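(* Let $\mathcal{H}$ be a Hopf algebra over $k$ with invertible antipode, let $\mathcal{L}$ be an $\mathcal{H}$-base algebra, let $\overline{\mathcal{M}}_{\mathcal{H},\mathcal{L}}$ be the dynamization over $\mathcal{L}$ of the category of left $\mathcal{H}$-modules, and let $\mathrm{Mod}_0\,\mathcal{L}\rtimes\mathcal{H}$ be the full subcategory of the monoidal category of left modules over the $\mathcal{L}$-bialgebroid $\mathcal{L}\rtimes\mathcal{H}$ consisting of the modules $X\otimes\mathcal{L}$, where $X$ is an $\mathcal{H}$-module. Then the functor $\Xi$ ($X\mapsto X\otimes\mathcal{L}$, $\psi\mapsto\tilde\psi_{\mathcal{L}}$) establishes an isomorphism of monoidal categories from $\overline{\mathcal{M}}_{\mathcal{H},\mathcal{L}}$ to $\mathrm{Mod}_0\,\mathcal{L}\rtimes\mathcal{H}$.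
   Context: $k$ is a field of characteristic zero (or a ring of formal power series over such a field); algebras are associative unital $k$-algebras, $\otimes=\otimes_k$, modules are left modules. Sweedler notation: $\Delta(h)=h^{(1)}\otimes h^{(2)}$; $\gamma$ is the antipode of $\mathcal{H}$, assumed invertible; $\triangleright$ denotes actions. **Base algebra.** An $\mathcal{H}$-base algebra is an algebra $\mathcal{L}$ that is a left $\mathcal{H}$-module algebra and a left $\mathcal{H}$-comodule algebra with coaction $\delta(\lambda)=\lambda^{(1)}\otimes\lambda^{[2]}\in\mathcal{H}\otimes\mathcal{L}$ such that for all $h\in\mathcal{H}$, $\lambda,\mu\in\mathcal{L}$: $\delta(h\triangleright\lambda)=h^{(1)}\lambda^{(1)}\gamma(h^{(3)})\otimes h^{(2)}\triangleright\lambda^{[2]}$ and $\lambda\mu=(\lambda^{(1)}\triangleright\mu)\lambda^{[2]}$. **Dynamization.** $\overline{\mathcal{M}}_{\mathcal{H},\mathcal{L}}$ is the strict monoidal category whose objects are the left $\mathcal{H}$-modules; $\mathrm{Hom}(X,Y)$ is the set of $\mathcal{H}$-equivariant linear maps $X\to Y\otimes\mathcal{L}$; the composition of $\phi\in\mathrm{Hom}(X,Y)$ and $\psi\in\mathrm{Hom}(Y,Z)$ is $X\xrightarrow{\phi}Y\otimes\mathcal{L}\xrightarrow{\psi\otimes\mathrm{id}}Z\otimes\mathcal{L}\otimes\mathcal{L}\xrightarrow{\mathrm{id}\otimes m_{\mathcal{L}}}Z\otimes\mathcal{L}$ ($m_{\mathcal{L}}$ the multiplication of $\mathcal{L}$);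 the tensor product of objects is that of $\mathcal{H}$-modules; the tensor product of $\phi\in\mathrm{Hom}(X,X')$ and $\psi\in\mathrm{Hom}(Y,Y')$ is $X\otimes Y\xrightarrow{\phi\otimes\psi}X'\otimes\mathcal{L}\otimes Y'\otimes\mathcal{L}\xrightarrow{\tau}X'\otimes Y'\otimes\mathcal{L}\otimes\mathcal{L}\xrightarrow{m_{\mathcal{L}}}X'\otimes Y'\otimes\mathcal{L}$, where $\tau:\mathcal{L}\otimes Y'\to Y'\otimes\mathcal{L}$, $\lambda\otimes y\mapsto\lambda^{(1)}\triangleright y\otimes\lambda^{[2]}$. **Bialgebroids.** An $\mathcal{L}$-bialgebroid is an algebra $B$ with an algebra homomorphism $s:\mathcal{L}\to B$ (source) and an algebra anti-homomorphism $t:\mathcal{L}\to B$ (target) with commuting images, so that $B$ is an $\mathcal{L}$-bimodule by $\lambda\cdot a=s(\lambda)a$, $a\cdot\lambda=t(\lambda)a$; a coassociative bimodule map $\Delta:B\to B\otimes_{\mathcal{L}}B$ which is an algebra homomorphism into $\{z\in B\otimes_{\mathcal{L}}B: z(t(\lambda)\otimes1)=z(1\otimes s(\lambda))\ \forall\lambda\}$; and a bimodule map $\varepsilon:B\to\mathcal{L}$ with $\varepsilon(1)=1$, $\varepsilon(a\,s(\varepsilon(b)))=\varepsilon(ab)=\varepsilon(a\,t(\varepsilon(b)))$ and $(\varepsilon\otimes_{\mathcal{L}}\mathrm{id})\Delta=\mathrm{id}=(\mathrm{id}\otimes_{\mathcal{L}}\varepsilon)\Delta$. Each left $B$-module is an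 $\mathcal{L}$-bimodule through $s$ and $t$, and left $B$-modules form a monoidal category under $\otimes_{\mathcal{L}}$ with $B$ acting via $\Delta$. **The bialgebroid $\mathcal{L}\rtimes\mathcal{H}$.** As an algebra it is the smash product, $(\lambda\otimes f)(\mu\otimes g)=\lambda(f^{(1)}\triangleright\mu)\otimes f^{(2)}g$. Its structure maps are $s(\lambda)=\lambda\otimes1$, $t(\lambda)=\lambda^{[2]}\otimes\gamma^{-1}(\lambda^{(1)})$, $\Delta(\lambda\otimes h)=(\lambda\otimes h^{(1)})\otimes_{\mathcal{L}}(1\otimes h^{(2)})$, $\varepsilon(\lambda\otimes h)=\lambda\varepsilon(h)$. **The functor $\Xi$.** For an $\mathcal{H}$-module $X$, $\Xi(X)=\tilde X_{\mathcal{L}}$ is $X\otimes\mathcal{L}$ with $\mathcal{L}$-bimodule structure $\lambda\cdot(x\otimes\mu)=\lambda^{(1)}\triangleright x\otimes\lambda^{[2]}\mu$, $(x\otimes\mu)\cdot\lambda=x\otimes\mu\lambda$; together with the tensor product action $h\triangleright(x\otimes\mu)=h^{(1)}\triangleright x\otimes h^{(2)}\triangleright\mu$ the left $\mathcal{L}$-action makes it an $\mathcal{L}\rtimes\mathcal{H}$-module; this is the module structure on $X\otimes\mathcal{L}$ used in the definition of $\mathrm{Mod}_0$. For an $\mathcal{H}$-equivariant $\psi:X\to Y\otimes\mathcal{L}$, $\tilde\psi_{\mathcal{L}}$ is the composition $X\otimes\mathcal{L}\xrightarrow{\psi\otimes\mathrm{id}}Y\otimes\mathcal{L}\otimes\mathcal{L}\xrightarrow{\mathrm{id}\otimes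 m_{\mathcal{L}}}Y\otimes\mathcal{L}$. The tensor products $\tilde X_{\mathcal{L}}\otimes_{\mathcal{L}}\tilde Y_{\mathcal{L}}$ and $(X\otimes Y)\otimes\mathcal{L}$ are identified canonically. *)

theory Defs
  imports "HOL-Algebra.Module" "HOL-Algebra.QuotRing"
begin

section \<open>A universe closed under tensor products\<close>

text \<open>
  Any set of structures, on whatever types, can be copied into \<open>'a univ\<close> for a suitable
  \<open>'a\<close> (via \<^term>\<open>Atom\<close>), and \<open>'a univ\<close> is closed under the tensor product constructed below.
  It plays the role of the universe of small sets: the objects of the categories below are
  the modules whose carriers are subsets of \<open>'a univ\<close>.
\<close>

datatype 'a univ = Atom 'a | Tens (tlist: "('a univ \<times> 'a univ) list")
  where "tlist (Atom _) = []"

section \<open>Ground ring, algebras, modules\<close>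

definition fps_ring :: "('k, 'm) ring_scheme \<Rightarrow> (nat \<Rightarrow> 'k) ring" where
  "fps_ring F =
    \<lparr> carrier = {f. \<forall>n. f n \<in> carrier F},
      mult = (\<lambda>f g n. \<Oplus>\<^bsub>F\<^esub> i \<in> {..n}. f i \<otimes>\<^bsub>F\<^esub> g (n - i)),
      one = (\<lambda>n. if n = 0 then \<one>\<^bsub>F\<^esub> else \<zero>\<^bsub>F\<^esub>),
      zero = (\<lambda>n. \<zero>\<^bsub>F\<^esub>),
      add = (\<lambda>f g n. f n \<oplus>\<^bsub>F\<^esub> g n) \<rparr>"

definition field_char_zero :: "('k, 'm) ring_scheme \<Rightarrow> bool" where
  "field_char_zero F \<longleftrightarrow> field F \<and> (\<forall>n::nat. n > 0 \<longrightarrow> [n] \<cdot>\<^bsub>F\<^esub> \<one>\<^bsub>F\<^esub> \<noteq> \<zero>\<^bsub>F\<^esub>)"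

text \<open>In the second case the coefficient field can always be found inside \<^term>\<open>K\<close>, so that
  letting \<^term>\<open>F\<close> range over the type of \<^term>\<open>K\<close> is no restriction.\<close>

definition ground_ring :: "'k ring \<Rightarrow> bool" where
  "ground_ring K \<longleftrightarrow>
     cring K \<and> (field_char_zero K \<or> (\<exists>F :: 'k ring. field_char_zero F \<and> K \<simeq> fps_ring F))"

text \<open>The locale \<open>algebra\<close> of HOL-Algebra is restricted to commutative algebras.\<close>

definition k_algebra :: "('k, 'n) ring_scheme \<Rightarrow> ('k, 'a, 'm) module_scheme \<Rightarrow> bool" where
  "k_algebra K A \<longleftrightarrow> module K A \<and> ring A \<and>
     (\<forall>k\<in>carrier K. \<forall>a\<in>carrier A. \<forall>b\<in>carrier A.
        k \<odot>\<^bsub>A\<^esub> (a \<otimes>\<^bsub>A\<^esub> b) = (k \<odot>\<^bsub>A\<^esub> a) \<otimes>\<^bsub>A\<^esub> b \<and>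
        k \<odot>\<^bsub>A\<^esub> (a \<otimes>\<^bsub>A\<^esub> b) = a \<otimes>\<^bsub>A\<^esub> (k \<odot>\<^bsub>A\<^esub> b))"

definition additive_on ::
  "('a, 'm) ring_scheme \<Rightarrow> ('b, 'n) ring_scheme \<Rightarrow> ('a \<Rightarrow> 'b) \<Rightarrow> bool" where
  "additive_on M N f \<longleftrightarrow> f \<in> carrier M \<rightarrow> carrier N \<and>
     (\<forall>x\<in>carrier M. \<forall>y\<in>carrier M. f (x \<oplus>\<^bsub>M\<^esub> y) = f x \<oplus>\<^bsub>N\<^esub> f y)"

definition k_linear ::
  "('k, 'l) ring_scheme \<Rightarrow> ('k, 'a, 'm) module_scheme \<Rightarrow> ('k, 'b, 'n) module_scheme \<Rightarrow>
   ('a \<Rightarrow> 'b) \<Rightarrow> bool" where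
  "k_linear K M N f \<longleftrightarrow> additive_on M N f \<and>
     (\<forall>k\<in>carrier K. \<forall>x\<in>carrier M. f (k \<odot>\<^bsub>M\<^esub> x) = k \<odot>\<^bsub>N\<^esub> f x)"

definition k_algebra_hom ::
  "('k, 'l) ring_scheme \<Rightarrow> ('k, 'a, 'm) module_scheme \<Rightarrow> ('k, 'b, 'n) module_scheme \<Rightarrow>
   ('a \<Rightarrow> 'b) \<Rightarrow> bool" where
  "k_algebra_hom K A B f \<longleftrightarrow> k_linear K A B f \<and> f \<one>\<^bsub>A\<^esub> = \<one>\<^bsub>B\<^esub> \<and>
     (\<forall>x\<in>carrier A. \<forall>y\<in>carrier A. f (x \<otimes>\<^bsub>A\<^esub> y) = f x \<otimes>\<^bsub>B\<^esub> f y)"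

definition k_algebra_antihom ::
  "('k, 'l) ring_scheme \<Rightarrow> ('k, 'a, 'm) module_scheme \<Rightarrow> ('k, 'b, 'n) module_scheme \<Rightarrow>
   ('a \<Rightarrow> 'b) \<Rightarrow> bool" where
  "k_algebra_antihom K A B f \<longleftrightarrow> k_linear K A B f \<and> f \<one>\<^bsub>A\<^esub> = \<one>\<^bsub>B\<^esub> \<and>
     (\<forall>x\<in>carrier A. \<forall>y\<in>carrier A. f (x \<otimes>\<^bsub>A\<^esub> y) = f y \<otimes>\<^bsub>B\<^esub> f x)"

text \<open>
  Left modules over a not necessarily commutative ring.  They are kept in the record type of
  HOL-Algebra, \<^const>\<open>smult\<close> being the action; the multiplicative fields of the record are
  without meaning for a module.
\<close>

definition left_module :: "('r, 'n) ring_scheme \<Rightarrow> ('r, 'a, 'm) module_scheme \<Rightarrow> bool" where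
  "left_module A M \<longleftrightarrow> ring A \<and> abelian_group M \<and>
     (\<forall>a\<in>carrier A. \<forall>x\<in>carrier M. a \<odot>\<^bsub>M\<^esub> x \<in> carrier M) \<and>
     (\<forall>a\<in>carrier A. \<forall>b\<in>carrier A. \<forall>x\<in>carrier M.
        (a \<oplus>\<^bsub>A\<^esub> b) \<odot>\<^bsub>M\<^esub> x = a \<odot>\<^bsub>M\<^esub> x \<oplus>\<^bsub>M\<^esub> b \<odot>\<^bsub>M\<^esub> x) \<and>
     (\<forall>a\<in>carrier A. \<forall>x\<in>carrier M. \<forall>y\<in>carrier M.
        a \<odot>\<^bsub>M\<^esub> (x \<oplus>\<^bsub>M\<^esub> y) = a \<odot>\<^bsub>M\<^esub> x \<oplus>\<^bsub>M\<^esub> a \<odot>\<^bsub>M\<^esub> y) \<and>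
     (\<forall>a\<in>carrier A. \<forall>b\<in>carrier A. \<forall>x\<in>carrier M.
        (a \<otimes>\<^bsub>A\<^esub> b) \<odot>\<^bsub>M\<^esub> x = a \<odot>\<^bsub>M\<^esub> (b \<odot>\<^bsub>M\<^esub> x)) \<and>
     (\<forall>x\<in>carrier M. \<one>\<^bsub>A\<^esub> \<odot>\<^bsub>M\<^esub> x = x)"

text \<open>Homomorphisms are extensional functions, so that they are equal as soon as they agree
  on the carrier.  When \<^term>\<open>A\<close> is a \<open>k\<close>-algebra they are automatically \<open>k\<close>-linear,
  because \<open>k\<close> acts through the multiples of the unit of \<^term>\<open>A\<close>.\<close>

definition left_module_hom ::
  "('r, 'l) ring_scheme \<Rightarrow> ('r, 'a, 'm) module_scheme \<Rightarrow> ('r, 'b, 'n) module_scheme \<Rightarrow>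
   ('a \<Rightarrow> 'b) set" where
  "left_module_hom A M N = {f \<in> carrier M \<rightarrow>\<^sub>E carrier N. additive_on M N f \<and>
     (\<forall>a\<in>carrier A. \<forall>x\<in>carrier M. f (a \<odot>\<^bsub>M\<^esub> x) = a \<odot>\<^bsub>N\<^esub> f x)}"

definition restrict_scalars ::
  "('k, 'r, 'm) module_scheme \<Rightarrow> ('r, 'a) module \<Rightarrow> ('k, 'a) module" where
  "restrict_scalars A M =
    \<lparr> carrier = carrier M, mult = mult M, one = one M, zero = zero M, add = add M,
      smult = (\<lambda>k x. (k \<odot>\<^bsub>A\<^esub> \<one>\<^bsub>A\<^esub>) \<odot>\<^bsub>M\<^esub> x) \<rparr>"

definition regular :: "('r, 'm) ring_scheme \<Rightarrow> ('r, 'r) module" where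
  "regular A =
    \<lparr> carrier = carrier A, mult = mult A, one = one A, zero = zero A, add = add A,
      smult = mult A \<rparr>"

definition lsum :: "('a, 'm) ring_scheme \<Rightarrow> 'a list \<Rightarrow> 'a" where
  "lsum M xs = foldr (add M) xs \<zero>\<^bsub>M\<^esub>"

section \<open>Tensor products\<close>

text \<open>
  A list \<open>[(m\<^sub>1, n\<^sub>1), \<dots>]\<close> stands for the formal sum of the \<open>m\<^sub>i \<otimes> n\<^sub>i\<close>.  Below,
  \<^term>\<open>tens_rel R M N\<close> is the congruence which defines \<open>M \<otimes>\<^sub>R N\<close>.  The ring \<^term>\<open>R\<close> need
  not be commutative: \<open>r \<odot>\<^bsub>M\<^esub> m\<close> is to be read as the right action \<open>m \<cdot> r\<close>
  and \<open>r \<odot>\<^bsub>N\<^esub> n\<close> as the left action \<open>r \<cdot> n\<close>.  No negatives are needed among the formal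
  sums, as the class of \<open>(-m) \<otimes> n\<close> is the inverse of that of \<open>m \<otimes> n\<close>.
\<close>

inductive tens_rel ::
  "('r, 'l) ring_scheme \<Rightarrow> ('r, 'u, 'm) module_scheme \<Rightarrow> ('r, 'u, 'n) module_scheme \<Rightarrow>
   ('u \<times> 'u) list \<Rightarrow> ('u \<times> 'u) list \<Rightarrow> bool"
  for R M N where
  refl: "set xs \<subseteq> carrier M \<times> carrier N \<Longrightarrow> tens_rel R M N xs xs"
| sym: "tens_rel R M N xs ys \<Longrightarrow> tens_rel R M N ys xs"
| trans: "tens_rel R M N xs ys \<Longrightarrow> tens_rel R M N ys zs \<Longrightarrow> tens_rel R M N xs zs"
| append: "tens_rel R M N xs xs' \<Longrightarrow> tens_rel R M N ys ys' \<Longrightarrow>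
    tens_rel R M N (xs @ ys) (xs' @ ys')"
| commute: "set xs \<subseteq> carrier M \<times> carrier N \<Longrightarrow> set ys \<subseteq> carrier M \<times> carrier N \<Longrightarrow>
    tens_rel R M N (xs @ ys) (ys @ xs)"
| zero_left: "n \<in> carrier N \<Longrightarrow> tens_rel R M N [(\<zero>\<^bsub>M\<^esub>, n)] []"
| zero_right: "m \<in> carrier M \<Longrightarrow> tens_rel R M N [(m, \<zero>\<^bsub>N\<^esub>)] []"
| add_left: "m \<in> carrier M \<Longrightarrow> m' \<in> carrier M \<Longrightarrow> n \<in> carrier N \<Longrightarrow>
    tens_rel R M N [(m \<oplus>\<^bsub>M\<^esub> m', n)] [(m, n), (m', n)]"
| add_right: "m \<in> carrier M \<Longrightarrow> n \<in> carrier N \<Longrightarrow> n' \<in> carrier N \<Longrightarrow>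
    tens_rel R M N [(m, n \<oplus>\<^bsub>N\<^esub> n')] [(m, n), (m, n')]"
| balanced: "r \<in> carrier R \<Longrightarrow> m \<in> carrier M \<Longrightarrow> n \<in> carrier N \<Longrightarrow>
    tens_rel R M N [(r \<odot>\<^bsub>M\<^esub> m, n)] [(m, r \<odot>\<^bsub>N\<^esub> n)]"

text \<open>
  The element of \<open>M \<otimes>\<^sub>R N\<close> given by a formal sum; an equivalence class is represented by a
  chosen one of its members, in order to stay within the universe.  Conversely, for an
  element \<open>t\<close> of a tensor product, \<^term>\<open>tlist t\<close> is a formal sum that represents it.
  Hence \<open>[\<dots>. (a, b) \<leftarrow> tlist t]\<close> is Sweedler notation \<open>t = a \<otimes> b\<close>.
\<close>

definition tcls ::
  "('r, 'l) ring_scheme \<Rightarrow> ('r, 'a univ, 'm) module_scheme \<Rightarrow> ('r, 'a univ, 'n) module_scheme \<Rightarrow>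
   ('a univ \<times> 'a univ) list \<Rightarrow> 'a univ" where
  "tcls R M N xs = Tens (SOME ys. tens_rel R M N xs ys)"

text \<open>
  The factorwise product is the product of the tensor product of two \<open>k\<close>-algebras, and it is
  also the product of elements of \<open>B \<otimes>\<^sub>L B\<close> that is used for bialgebroids.  The scalar
  multiplication is the \<open>k\<close>-module structure when \<^term>\<open>R\<close> is the ground ring.
\<close>

definition tensor ::
  "('r, 'l) ring_scheme \<Rightarrow> ('r, 'a univ, 'm) module_scheme \<Rightarrow> ('r, 'a univ, 'n) module_scheme \<Rightarrow>
   ('r, 'a univ) module" where
  "tensor R M N =
    \<lparr> carrier = tcls R M N ` {xs. set xs \<subseteq> carrier M \<times> carrier N},
      mult = (\<lambda>t u. tcls R M N
        [(m \<otimes>\<^bsub>M\<^esub> m', n \<otimes>\<^bsub>N\<^esub> n'). (m, n) \<leftarrow> tlist t, (m', n') \<leftarrow> tlist u]),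
      one = tcls R M N [(\<one>\<^bsub>M\<^esub>, \<one>\<^bsub>N\<^esub>)],
      zero = tcls R M N [],
      add = (\<lambda>t u. tcls R M N (tlist t @ tlist u)),
      smult = (\<lambda>r t. tcls R M N [(r \<odot>\<^bsub>M\<^esub> m, n). (m, n) \<leftarrow> tlist t]) \<rparr>"

section \<open>Hopf algebras and base algebras\<close>

record 'u hopf = "('u, 'u) module" +
  comul :: "'u \<Rightarrow> 'u"
  counit :: "'u \<Rightarrow> 'u"
  antipode :: "'u \<Rightarrow> 'u"

definition hopf_algebra :: "'a univ ring \<Rightarrow> 'a univ hopf \<Rightarrow> bool" where
  "hopf_algebra K H \<longleftrightarrow>
     k_algebra K H \<and>
     k_algebra_hom K H (tensor K H H) (comul H) \<and>
     k_algebra_hom K H (regular K) (counit H) \<and>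
     k_linear K H H (antipode H) \<and>
     (\<forall>h\<in>carrier H.
        tcls K H (tensor K H H) [(h1, comul H h2). (h1, h2) \<leftarrow> tlist (comul H h)] =
        tcls K H (tensor K H H) [(a, tcls K H H [(b, h2)]).
          (h1, h2) \<leftarrow> tlist (comul H h), (a, b) \<leftarrow> tlist (comul H h1)]) \<and>
     (\<forall>h\<in>carrier H.
        lsum H [counit H h1 \<odot>\<^bsub>H\<^esub> h2. (h1, h2) \<leftarrow> tlist (comul H h)] = h \<and>
        lsum H [counit H h2 \<odot>\<^bsub>H\<^esub> h1. (h1, h2) \<leftarrow> tlist (comul H h)] = h) \<and>
     (\<forall>h\<in>carrier H.
        lsum H [antipode H h1 \<otimes>\<^bsub>H\<^esub> h2. (h1, h2) \<leftarrow> tlist (comul H h)]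
          = counit H h \<odot>\<^bsub>H\<^esub> \<one>\<^bsub>H\<^esub> \<and>
        lsum H [h1 \<otimes>\<^bsub>H\<^esub> antipode H h2. (h1, h2) \<leftarrow> tlist (comul H h)]
          = counit H h \<odot>\<^bsub>H\<^esub> \<one>\<^bsub>H\<^esub>)"

definition invertible_antipode :: "'a univ hopf \<Rightarrow> bool" where
  "invertible_antipode H \<longleftrightarrow> bij_betw (antipode H) (carrier H) (carrier H)"

record 'u base_alg = "('u, 'u) module" +
  hact :: "'u \<Rightarrow> 'u \<Rightarrow> 'u"
  coact :: "'u \<Rightarrow> 'u"

definition base_hmod :: "'a univ base_alg \<Rightarrow> ('a univ, 'a univ) module" where
  "base_hmod L =
    \<lparr> carrier = carrier L, mult = mult L, one = one L, zero = zero L, add = add L,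
      smult = hact L \<rparr>"

text \<open>In the coaction axioms \<open>H \<otimes> (H \<otimes> L)\<close> serves as the triple tensor product.\<close>

definition base_algebra ::
  "'a univ ring \<Rightarrow> 'a univ hopf \<Rightarrow> 'a univ base_alg \<Rightarrow> bool" where
  "base_algebra K H L \<longleftrightarrow>
     k_algebra K L \<and>
     \<comment> \<open>module algebra, with the action compatible with the \<open>k\<close>-module structure\<close>
     left_module H (base_hmod L) \<and>
     (\<forall>k\<in>carrier K. \<forall>l\<in>carrier L. hact L (k \<odot>\<^bsub>H\<^esub> \<one>\<^bsub>H\<^esub>) l = k \<odot>\<^bsub>L\<^esub> l) \<and>
     (\<forall>h\<in>carrier H. \<forall>l\<in>carrier L. \<forall>m\<in>carrier L.
        hact L h (l \<otimes>\<^bsub>L\<^esub> m) =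
        lsum L [hact L h1 l \<otimes>\<^bsub>L\<^esub> hact L h2 m. (h1, h2) \<leftarrow> tlist (comul H h)]) \<and>
     (\<forall>h\<in>carrier H. hact L h \<one>\<^bsub>L\<^esub> = counit H h \<odot>\<^bsub>L\<^esub> \<one>\<^bsub>L\<^esub>) \<and>
     \<comment> \<open>comodule algebra\<close>
     k_algebra_hom K L (tensor K H L) (coact L) \<and>
     (\<forall>l\<in>carrier L.
        tcls K H (tensor K H L) [(l1, coact L l2). (l1, l2) \<leftarrow> tlist (coact L l)] =
        tcls K H (tensor K H L) [(a, tcls K H L [(b, l2)]).
          (l1, l2) \<leftarrow> tlist (coact L l), (a, b) \<leftarrow> tlist (comul H l1)]) \<and>
     (\<forall>l\<in>carrier L.
        lsum L [counit H l1 \<odot>\<^bsub>L\<^esub> l2. (l1, l2) \<leftarrow> tlist (coact L l)] = l) \<and>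
     \<comment> \<open>compatibility of action and coaction, and quasi-commutativity\<close>
     (\<forall>h\<in>carrier H. \<forall>l\<in>carrier L.
        coact L (hact L h l) =
        tcls K H L [(h1 \<otimes>\<^bsub>H\<^esub> l1 \<otimes>\<^bsub>H\<^esub> antipode H h3, hact L h2 l2).
          (h1, h') \<leftarrow> tlist (comul H h), (h2, h3) \<leftarrow> tlist (comul H h'),
          (l1, l2) \<leftarrow> tlist (coact L l)]) \<and>
     (\<forall>l\<in>carrier L. \<forall>m\<in>carrier L.
        l \<otimes>\<^bsub>L\<^esub> m = lsum L [hact L l1 m \<otimes>\<^bsub>L\<^esub> l2. (l1, l2) \<leftarrow> tlist (coact L l)])"

section \<open>Monoidal categories\<close>

text \<open>
  Hom sets of different pairs of objects need not be disjoint, hence operations on morphisms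
  take the objects as arguments.  Composition is in diagrammatic order: \<open>Comp C X Y Z f g\<close>
  is \<open>X \<rightarrow> Y \<rightarrow> Z\<close>, first \<open>f\<close>.  Similarly \<open>tmor C X X' Y Y' f g\<close> is the tensor product of
  \<open>f : X \<rightarrow> X'\<close> and \<open>g : Y \<rightarrow> Y'\<close>.
\<close>

record ('o, 'm) moncat =
  Obj :: "'o set"
  Hom :: "'o \<Rightarrow> 'o \<Rightarrow> 'm set"
  Ident :: "'o \<Rightarrow> 'm"
  Comp :: "'o \<Rightarrow> 'o \<Rightarrow> 'o \<Rightarrow> 'm \<Rightarrow> 'm \<Rightarrow> 'm"
  tobj :: "'o \<Rightarrow> 'o \<Rightarrow> 'o"
  tmor :: "'o \<Rightarrow> 'o \<Rightarrow> 'o \<Rightarrow> 'o \<Rightarrow> 'm \<Rightarrow> 'm \<Rightarrow> 'm"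
  tunit :: 'o
  assoc :: "'o \<Rightarrow> 'o \<Rightarrow> 'o \<Rightarrow> 'm"
  lunit :: "'o \<Rightarrow> 'm"
  runit :: "'o \<Rightarrow> 'm"

definition inverse_pair :: "('o, 'm, 'z) moncat_scheme \<Rightarrow> 'o \<Rightarrow> 'o \<Rightarrow> 'm \<Rightarrow> 'm \<Rightarrow> bool" where
  "inverse_pair C X Y f g \<longleftrightarrow> f \<in> Hom C X Y \<and> g \<in> Hom C Y X \<and>
     Comp C X Y X f g = Ident C X \<and> Comp C Y X Y g f = Ident C Y"

definition iso_mor :: "('o, 'm, 'z) moncat_scheme \<Rightarrow> 'o \<Rightarrow> 'o \<Rightarrow> 'm \<Rightarrow> bool" where
  "iso_mor C X Y f \<longleftrightarrow> (\<exists>g. inverse_pair C X Y f g)"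

definition inv_mor :: "('o, 'm, 'z) moncat_scheme \<Rightarrow> 'o \<Rightarrow> 'o \<Rightarrow> 'm \<Rightarrow> 'm" where
  "inv_mor C X Y f = (THE g. inverse_pair C X Y f g)"

locale category =
  fixes C :: "('o, 'm, 'z) moncat_scheme"
  assumes ident: "X \<in> Obj C \<Longrightarrow> Ident C X \<in> Hom C X X"
    and comp: "\<lbrakk> X \<in> Obj C; Y \<in> Obj C; Z \<in> Obj C; f \<in> Hom C X Y; g \<in> Hom C Y Z \<rbrakk> \<Longrightarrow>
      Comp C X Y Z f g \<in> Hom C X Z"
    and comp_ident_left: "\<lbrakk> X \<in> Obj C; Y \<in> Obj C; f \<in> Hom C X Y \<rbrakk> \<Longrightarrow>
      Comp C X X Y (Ident C X) f = f"
    and comp_ident_right: "\<lbrakk> X \<in> Obj C; Y \<in> Obj C; f \<in> Hom C X Y \<rbrakk> \<Longrightarrow>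
      Comp C X Y Y f (Ident C Y) = f"
    and comp_assoc: "\<lbrakk> W \<in> Obj C; X \<in> Obj C; Y \<in> Obj C; Z \<in> Obj C;
        f \<in> Hom C W X; g \<in> Hom C X Y; h \<in> Hom C Y Z \<rbrakk> \<Longrightarrow>
      Comp C W Y Z (Comp C W X Y f g) h = Comp C W X Z f (Comp C X Y Z g h)"

locale monoidal_category = category C for C :: "('o, 'm, 'z) moncat_scheme" +
  assumes tobj: "\<lbrakk> X \<in> Obj C; Y \<in> Obj C \<rbrakk> \<Longrightarrow> tobj C X Y \<in> Obj C"
    and tunit: "tunit C \<in> Obj C"
    and tmor: "\<lbrakk> X \<in> Obj C; X' \<in> Obj C; Y \<in> Obj C; Y' \<in> Obj C;
        f \<in> Hom C X X'; g \<in> Hom C Y Y' \<rbrakk> \<Longrightarrow>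
      tmor C X X' Y Y' f g \<in> Hom C (tobj C X Y) (tobj C X' Y')"
    and tmor_ident: "\<lbrakk> X \<in> Obj C; Y \<in> Obj C \<rbrakk> \<Longrightarrow>
      tmor C X X Y Y (Ident C X) (Ident C Y) = Ident C (tobj C X Y)"
    and tmor_comp: "\<lbrakk> X \<in> Obj C; X' \<in> Obj C; X'' \<in> Obj C; Y \<in> Obj C; Y' \<in> Obj C; Y'' \<in> Obj C;
        f \<in> Hom C X X'; f' \<in> Hom C X' X''; g \<in> Hom C Y Y'; g' \<in> Hom C Y' Y'' \<rbrakk> \<Longrightarrow>
      tmor C X X'' Y Y'' (Comp C X X' X'' f f') (Comp C Y Y' Y'' g g') =
      Comp C (tobj C X Y) (tobj C X' Y') (tobj C X'' Y'')
        (tmor C X X' Y Y' f g) (tmor C X' X'' Y' Y'' f' g')"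
    and assoc_iso: "\<lbrakk> X \<in> Obj C; Y \<in> Obj C; Z \<in> Obj C \<rbrakk> \<Longrightarrow>
      iso_mor C (tobj C (tobj C X Y) Z) (tobj C X (tobj C Y Z)) (assoc C X Y Z)"
    and assoc_natural: "\<lbrakk> X \<in> Obj C; X' \<in> Obj C; Y \<in> Obj C; Y' \<in> Obj C; Z \<in> Obj C; Z' \<in> Obj C;
        f \<in> Hom C X X'; g \<in> Hom C Y Y'; h \<in> Hom C Z Z' \<rbrakk> \<Longrightarrow>
      Comp C (tobj C (tobj C X Y) Z) (tobj C (tobj C X' Y') Z') (tobj C X' (tobj C Y' Z'))
        (tmor C (tobj C X Y) (tobj C X' Y') Z Z' (tmor C X X' Y Y' f g) h)
        (assoc C X' Y' Z') =
      Comp C (tobj C (tobj C X Y) Z) (tobj C X (tobj C Y Z)) (tobj C X' (tobj C Y' Z'))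
        (assoc C X Y Z)
        (tmor C X X' (tobj C Y Z) (tobj C Y' Z') f (tmor C Y Y' Z Z' g h))"
    and lunit_iso: "X \<in> Obj C \<Longrightarrow> iso_mor C (tobj C (tunit C) X) X (lunit C X)"
    and lunit_natural: "\<lbrakk> X \<in> Obj C; Y \<in> Obj C; f \<in> Hom C X Y \<rbrakk> \<Longrightarrow>
      Comp C (tobj C (tunit C) X) (tobj C (tunit C) Y) Y
        (tmor C (tunit C) (tunit C) X Y (Ident C (tunit C)) f) (lunit C Y) =
      Comp C (tobj C (tunit C) X) X Y (lunit C X) f"
    and runit_iso: "X \<in> Obj C \<Longrightarrow> iso_mor C (tobj C X (tunit C)) X (runit C X)"
    and runit_natural: "\<lbrakk> X \<in> Obj C; Y \<in> Obj C; f \<in> Hom C X Y \<rbrakk> \<Longrightarrow>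
      Comp C (tobj C X (tunit C)) (tobj C Y (tunit C)) Y
        (tmor C X Y (tunit C) (tunit C) f (Ident C (tunit C))) (runit C Y) =
      Comp C (tobj C X (tunit C)) X Y (runit C X) f"
    and pentagon: "\<lbrakk> W \<in> Obj C; X \<in> Obj C; Y \<in> Obj C; Z \<in> Obj C \<rbrakk> \<Longrightarrow>
      Comp C (tobj C (tobj C (tobj C W X) Y) Z) (tobj C (tobj C W X) (tobj C Y Z))
          (tobj C W (tobj C X (tobj C Y Z)))
        (assoc C (tobj C W X) Y Z) (assoc C W X (tobj C Y Z)) =
      Comp C (tobj C (tobj C (tobj C W X) Y) Z) (tobj C (tobj C W (tobj C X Y)) Z)
          (tobj C W (tobj C X (tobj C Y Z)))
        (tmor C (tobj C (tobj C W X) Y) (tobj C W (tobj C X Y)) Z Z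
          (assoc C W X Y) (Ident C Z))
        (Comp C (tobj C (tobj C W (tobj C X Y)) Z) (tobj C W (tobj C (tobj C X Y) Z))
            (tobj C W (tobj C X (tobj C Y Z)))
          (assoc C W (tobj C X Y) Z)
          (tmor C W W (tobj C (tobj C X Y) Z) (tobj C X (tobj C Y Z))
            (Ident C W) (assoc C X Y Z)))"
    and triangle: "\<lbrakk> X \<in> Obj C; Y \<in> Obj C \<rbrakk> \<Longrightarrow>
      Comp C (tobj C (tobj C X (tunit C)) Y) (tobj C X (tobj C (tunit C) Y)) (tobj C X Y)
        (assoc C X (tunit C) Y)
        (tmor C X X (tobj C (tunit C) Y) Y (Ident C X) (lunit C Y)) =
      tmor C (tobj C X (tunit C)) X Y Y (runit C X) (Ident C Y)"

text \<open>An isomorphism of monoidal categories: a functor that is bijective on objects and on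
  hom sets and respects the monoidal structures on the nose.\<close>

locale monoidal_isomorphism =
  C: monoidal_category C + D: monoidal_category D
  for C :: "('o, 'm, 'y) moncat_scheme" and D :: "('p, 'n, 'z) moncat_scheme" +
  fixes F0 :: "'o \<Rightarrow> 'p" and F1 :: "'o \<Rightarrow> 'o \<Rightarrow> 'm \<Rightarrow> 'n"
  assumes obj_bij: "bij_betw F0 (Obj C) (Obj D)"
    and hom_bij: "\<lbrakk> X \<in> Obj C; Y \<in> Obj C \<rbrakk> \<Longrightarrow>
      bij_betw (F1 X Y) (Hom C X Y) (Hom D (F0 X) (F0 Y))"
    and map_ident: "X \<in> Obj C \<Longrightarrow> F1 X X (Ident C X) = Ident D (F0 X)"
    and map_comp: "\<lbrakk> X \<in> Obj C; Y \<in> Obj C; Z \<in> Obj C; f \<in> Hom C X Y; g \<in> Hom C Y Z \<rbrakk> \<Longrightarrow>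
      F1 X Z (Comp C X Y Z f g) = Comp D (F0 X) (F0 Y) (F0 Z) (F1 X Y f) (F1 Y Z g)"
    and map_tobj: "\<lbrakk> X \<in> Obj C; Y \<in> Obj C \<rbrakk> \<Longrightarrow> F0 (tobj C X Y) = tobj D (F0 X) (F0 Y)"
    and map_tunit: "F0 (tunit C) = tunit D"
    and map_tmor: "\<lbrakk> X \<in> Obj C; X' \<in> Obj C; Y \<in> Obj C; Y' \<in> Obj C;
        f \<in> Hom C X X'; g \<in> Hom C Y Y' \<rbrakk> \<Longrightarrow>
      F1 (tobj C X Y) (tobj C X' Y') (tmor C X X' Y Y' f g) =
      tmor D (F0 X) (F0 X') (F0 Y) (F0 Y') (F1 X X' f) (F1 Y Y' g)"
    and map_assoc: "\<lbrakk> X \<in> Obj C; Y \<in> Obj C; Z \<in> Obj C \<rbrakk> \<Longrightarrow>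
      F1 (tobj C (tobj C X Y) Z) (tobj C X (tobj C Y Z)) (assoc C X Y Z) =
      assoc D (F0 X) (F0 Y) (F0 Z)"
    and map_lunit: "X \<in> Obj C \<Longrightarrow>
      F1 (tobj C (tunit C) X) X (lunit C X) = lunit D (F0 X)"
    and map_runit: "X \<in> Obj C \<Longrightarrow>
      F1 (tobj C X (tunit C)) X (runit C X) = runit D (F0 X)"

text \<open>
  The full subcategory of a monoidal category \<^term>\<open>D\<close> on a family of objects \<open>F i\<close>
  (\<open>i \<in> I\<close>) for which tensor products are identified with members of the family through
  isomorphisms \<open>J i j : F i \<otimes> F j \<rightarrow> F (ti i j)\<close>, and the unit object through
  \<open>J0 : 1 \<rightarrow> F ui\<close>.  An object is a pair \<open>(i, F i)\<close>, since the identification of the tensor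
  product depends on the indices and not only on the objects.
\<close>

definition identification ::
  "('p, 'n) moncat \<Rightarrow> 'i set \<Rightarrow> ('i \<Rightarrow> 'p) \<Rightarrow> ('i \<Rightarrow> 'i \<Rightarrow> 'i) \<Rightarrow> 'i \<Rightarrow> ('i \<Rightarrow> 'i \<Rightarrow> 'n) \<Rightarrow> 'n \<Rightarrow>
   bool" where
  "identification D I F ti ui J J0 \<longleftrightarrow>
     (\<forall>i\<in>I. F i \<in> Obj D) \<and>
     ui \<in> I \<and> iso_mor D (tunit D) (F ui) J0 \<and>
     (\<forall>i\<in>I. \<forall>j\<in>I. ti i j \<in> I \<and> iso_mor D (tobj D (F i) (F j)) (F (ti i j)) (J i j))"

definition full_subcategory_on ::
  "('p, 'n) moncat \<Rightarrow> 'i set \<Rightarrow> ('i \<Rightarrow> 'p) \<Rightarrow> ('i \<Rightarrow> 'i \<Rightarrow> 'i) \<Rightarrow> 'i \<Rightarrow> ('i \<Rightarrow> 'i \<Rightarrow> 'n) \<Rightarrow> 'n \<Rightarrow>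
   ('i \<times> 'p, 'n) moncat" where
  "full_subcategory_on D I F ti ui J J0 =
    \<lparr> Obj = (\<lambda>i. (i, F i)) ` I,
      Hom = (\<lambda>(i, M) (j, N). Hom D M N),
      Ident = (\<lambda>(i, M). Ident D M),
      Comp = (\<lambda>(i, M) (j, N) (l, P). Comp D M N P),
      tobj = (\<lambda>(i, M) (j, N). (ti i j, F (ti i j))),
      tmor = (\<lambda>(i, M) (i', M') (j, N) (j', N') f g.
        Comp D (F (ti i j)) (tobj D M N) (F (ti i' j'))
          (inv_mor D (tobj D M N) (F (ti i j)) (J i j))
          (Comp D (tobj D M N) (tobj D M' N') (F (ti i' j'))
            (tmor D M M' N N' f g) (J i' j'))),
      tunit = (ui, F ui),
      assoc = (\<lambda>(i, M) (j, N) (l, P).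
        Comp D (F (ti (ti i j) l)) (tobj D (F (ti i j)) P) (F (ti i (ti j l)))
          (inv_mor D (tobj D (F (ti i j)) P) (F (ti (ti i j) l)) (J (ti i j) l))
          (Comp D (tobj D (F (ti i j)) P) (tobj D (tobj D M N) P) (F (ti i (ti j l)))
            (tmor D (F (ti i j)) (tobj D M N) P P
              (inv_mor D (tobj D M N) (F (ti i j)) (J i j)) (Ident D P))
            (Comp D (tobj D (tobj D M N) P) (tobj D M (tobj D N P)) (F (ti i (ti j l)))
              (assoc D M N P)
              (Comp D (tobj D M (tobj D N P)) (tobj D M (F (ti j l))) (F (ti i (ti j l)))
                (tmor D M M (tobj D N P) (F (ti j l)) (Ident D M) (J j l))
                (J i (ti j l)))))),
      lunit = (\<lambda>(i, M).
        Comp D (F (ti ui i)) (tobj D (F ui) M) M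
          (inv_mor D (tobj D (F ui) M) (F (ti ui i)) (J ui i))
          (Comp D (tobj D (F ui) M) (tobj D (tunit D) M) M
            (tmor D (F ui) (tunit D) M M (inv_mor D (tunit D) (F ui) J0) (Ident D M))
            (lunit D M))),
      runit = (\<lambda>(i, M).
        Comp D (F (ti i ui)) (tobj D M (F ui)) M
          (inv_mor D (tobj D M (F ui)) (F (ti i ui)) (J i ui))
          (Comp D (tobj D M (F ui)) (tobj D M (tunit D)) M
            (tmor D M M (F ui) (tunit D) (Ident D M) (inv_mor D (tunit D) (F ui) J0))
            (runit D M))) \<rparr>"

section \<open>The dynamization of the category of modules over a Hopf algebra\<close>

definition hcls ::
  "'a univ ring \<Rightarrow> 'a univ hopf \<Rightarrow> ('a univ, 'a univ) module \<Rightarrow> ('a univ, 'a univ) module \<Rightarrow>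
   ('a univ \<times> 'a univ) list \<Rightarrow> 'a univ" where
  "hcls K H X Y = tcls K (restrict_scalars H X) (restrict_scalars H Y)"

definition htensor ::
  "'a univ ring \<Rightarrow> 'a univ hopf \<Rightarrow> ('a univ, 'a univ) module \<Rightarrow> ('a univ, 'a univ) module \<Rightarrow>
   ('a univ, 'a univ) module" where
  "htensor K H X Y = (tensor K (restrict_scalars H X) (restrict_scalars H Y))
    \<lparr> smult := (\<lambda>h t. hcls K H X Y [(h1 \<odot>\<^bsub>X\<^esub> x, h2 \<odot>\<^bsub>Y\<^esub> y).
        (h1, h2) \<leftarrow> tlist (comul H h), (x, y) \<leftarrow> tlist t]) \<rparr>"

definition hunit :: "'a univ ring \<Rightarrow> 'a univ hopf \<Rightarrow> ('a univ, 'a univ) module" where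
  "hunit K H = (regular K) \<lparr> smult := (\<lambda>h c. counit H h \<otimes>\<^bsub>K\<^esub> c) \<rparr>"

text \<open>
  \<open>ltens K H L X\<close> is \<open>X \<otimes> L\<close> as an \<open>H\<close>-module, and \<open>lcls\<close> its elements.  The canonical
  isomorphisms of \<open>H\<close>-modules (associativity and unit constraints) are morphisms of the
  dynamization after composition with \<open>y \<mapsto> y \<otimes> 1\<close>.
\<close>

abbreviation ltens ::
  "'a univ ring \<Rightarrow> 'a univ hopf \<Rightarrow> 'a univ base_alg \<Rightarrow> ('a univ, 'a univ) module \<Rightarrow>
   ('a univ, 'a univ) module" where
  "ltens K H L X \<equiv> htensor K H X (base_hmod L)"

abbreviation lcls ::
  "'a univ ring \<Rightarrow> 'a univ hopf \<Rightarrow> 'a univ base_alg \<Rightarrow> ('a univ, 'a univ) module \<Rightarrow>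
   ('a univ \<times> 'a univ) list \<Rightarrow> 'a univ" where
  "lcls K H L X \<equiv> hcls K H X (base_hmod L)"

definition dynamization ::
  "'a univ ring \<Rightarrow> 'a univ hopf \<Rightarrow> 'a univ base_alg \<Rightarrow>
   (('a univ, 'a univ) module, 'a univ \<Rightarrow> 'a univ) moncat" where
  "dynamization K H L =
    \<lparr> Obj = {X. left_module H X},
      Hom = (\<lambda>X Y. left_module_hom H X (ltens K H L Y)),
      Ident = (\<lambda>X. \<lambda>x\<in>carrier X. lcls K H L X [(x, \<one>\<^bsub>L\<^esub>)]),
      Comp = (\<lambda>X Y Z f g. \<lambda>x\<in>carrier X. lcls K H L Z
        [(z, m \<otimes>\<^bsub>L\<^esub> l). (y, l) \<leftarrow> tlist (f x), (z, m) \<leftarrow> tlist (g y)]),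
      tobj = htensor K H,
      tmor = (\<lambda>X X' Y Y' f g. \<lambda>t\<in>carrier (htensor K H X Y). lcls K H L (htensor K H X' Y')
        [(hcls K H X' Y' [(x', l1 \<odot>\<^bsub>Y'\<^esub> y')], l2 \<otimes>\<^bsub>L\<^esub> m).
          (x, y) \<leftarrow> tlist t, (x', l) \<leftarrow> tlist (f x), (y', m) \<leftarrow> tlist (g y),
          (l1, l2) \<leftarrow> tlist (coact L l)]),
      tunit = hunit K H,
      assoc = (\<lambda>X Y Z. \<lambda>t\<in>carrier (htensor K H (htensor K H X Y) Z).
        lcls K H L (htensor K H X (htensor K H Y Z))
          [(hcls K H X (htensor K H Y Z) [(x, hcls K H Y Z [(y, z)])], \<one>\<^bsub>L\<^esub>).
            (u, z) \<leftarrow> tlist t, (x, y) \<leftarrow> tlist u]),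
      lunit = (\<lambda>X. \<lambda>t\<in>carrier (htensor K H (hunit K H) X).
        lcls K H L X [((c \<odot>\<^bsub>H\<^esub> \<one>\<^bsub>H\<^esub>) \<odot>\<^bsub>X\<^esub> x, \<one>\<^bsub>L\<^esub>). (c, x) \<leftarrow> tlist t]),
      runit = (\<lambda>X. \<lambda>t\<in>carrier (htensor K H X (hunit K H)).
        lcls K H L X [((c \<odot>\<^bsub>H\<^esub> \<one>\<^bsub>H\<^esub>) \<odot>\<^bsub>X\<^esub> x, \<one>\<^bsub>L\<^esub>). (x, c) \<leftarrow> tlist t]) \<rparr>"

section \<open>Bialgebroids and their modules\<close>

record 'u bialgebroid_data = "('u, 'u) module" +
  src :: "'u \<Rightarrow> 'u"
  tgt :: "'u \<Rightarrow> 'u"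
  bcomul :: "'u \<Rightarrow> 'u"
  bcounit :: "'u \<Rightarrow> 'u"

text \<open>The right and the left \<open>L\<close>-module underlying a \<open>B\<close>-module, in the form in which they
  enter the tensor product over \<open>L\<close>.\<close>

definition via_tgt ::
  "'u bialgebroid_data \<Rightarrow> ('u, 'u) module \<Rightarrow> ('u, 'u) module" where
  "via_tgt B M = M \<lparr> smult := (\<lambda>l m. tgt B l \<odot>\<^bsub>M\<^esub> m) \<rparr>"

definition via_src ::
  "'u bialgebroid_data \<Rightarrow> ('u, 'u) module \<Rightarrow> ('u, 'u) module" where
  "via_src B M = M \<lparr> smult := (\<lambda>l m. src B l \<odot>\<^bsub>M\<^esub> m) \<rparr>"

definition bcls ::
  "'a univ base_alg \<Rightarrow> 'a univ bialgebroid_data \<Rightarrow>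
   ('a univ, 'a univ) module \<Rightarrow> ('a univ, 'a univ) module \<Rightarrow>
   ('a univ \<times> 'a univ) list \<Rightarrow> 'a univ" where
  "bcls L B M N = tcls L (via_tgt B M) (via_src B N)"

definition btensor ::
  "'a univ base_alg \<Rightarrow> 'a univ bialgebroid_data \<Rightarrow>
   ('a univ, 'a univ) module \<Rightarrow> ('a univ, 'a univ) module \<Rightarrow> ('a univ, 'a univ) module" where
  "btensor L B M N = (tensor L (via_tgt B M) (via_src B N))
    \<lparr> smult := (\<lambda>b t. bcls L B M N [(b1 \<odot>\<^bsub>M\<^esub> m, b2 \<odot>\<^bsub>N\<^esub> n).
        (b1, b2) \<leftarrow> tlist (bcomul B b), (m, n) \<leftarrow> tlist t]) \<rparr>"

text \<open>
  \<open>BB\<close> is \<open>B \<otimes>\<^sub>L B\<close> with its left \<open>L\<close>-action \<open>s(l) a \<otimes> b\<close>; the right action is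
  \<open>a \<otimes> t(l) b\<close>.  Coassociativity is stated in \<open>B \<otimes>\<^sub>L (B \<otimes>\<^sub>L B)\<close>, and the counit axioms
  use the canonical \<open>L \<otimes>\<^sub>L B = B = B \<otimes>\<^sub>L L\<close>.
\<close>

definition bialgebroid ::
  "'a univ ring \<Rightarrow> 'a univ base_alg \<Rightarrow> 'a univ bialgebroid_data \<Rightarrow> bool" where
  "bialgebroid K L B \<longleftrightarrow>
    (let c = bcls L B (regular B) (regular B);
         BB = (tensor L (via_tgt B (regular B)) (via_src B (regular B)))
           \<lparr> smult := (\<lambda>l z. c [(src B l \<otimes>\<^bsub>B\<^esub> a, b). (a, b) \<leftarrow> tlist z]) \<rparr>
     in
     k_algebra K L \<and> k_algebra K B \<and>
     k_algebra_hom K L B (src B) \<and>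
     k_algebra_antihom K L B (tgt B) \<and>
     (\<forall>l\<in>carrier L. \<forall>m\<in>carrier L. src B l \<otimes>\<^bsub>B\<^esub> tgt B m = tgt B m \<otimes>\<^bsub>B\<^esub> src B l) \<and>
     \<comment> \<open>comultiplication: bimodule map, algebra map into the Takeuchi product, coassociative\<close>
     additive_on B BB (bcomul B) \<and>
     (\<forall>l\<in>carrier L. \<forall>a\<in>carrier B.
        bcomul B (src B l \<otimes>\<^bsub>B\<^esub> a) =
          c [(src B l \<otimes>\<^bsub>B\<^esub> a1, a2). (a1, a2) \<leftarrow> tlist (bcomul B a)] \<and>
        bcomul B (tgt B l \<otimes>\<^bsub>B\<^esub> a) =
          c [(a1, tgt B l \<otimes>\<^bsub>B\<^esub> a2). (a1, a2) \<leftarrow> tlist (bcomul B a)]) \<and>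
     (\<forall>a\<in>carrier B. \<forall>l\<in>carrier L.
        c [(a1 \<otimes>\<^bsub>B\<^esub> tgt B l, a2). (a1, a2) \<leftarrow> tlist (bcomul B a)] =
        c [(a1, a2 \<otimes>\<^bsub>B\<^esub> src B l). (a1, a2) \<leftarrow> tlist (bcomul B a)]) \<and>
     bcomul B \<one>\<^bsub>B\<^esub> = \<one>\<^bsub>BB\<^esub> \<and>
     (\<forall>a\<in>carrier B. \<forall>b\<in>carrier B.
        bcomul B (a \<otimes>\<^bsub>B\<^esub> b) = bcomul B a \<otimes>\<^bsub>BB\<^esub> bcomul B b) \<and>
     (\<forall>a\<in>carrier B.
        tcls L (via_tgt B (regular B)) BB
          [(a1, bcomul B a2). (a1, a2) \<leftarrow> tlist (bcomul B a)] =
        tcls L (via_tgt B (regular B)) BB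
          [(p, c [(q, a2)]). (a1, a2) \<leftarrow> tlist (bcomul B a), (p, q) \<leftarrow> tlist (bcomul B a1)]) \<and>
     \<comment> \<open>counit\<close>
     additive_on B L (bcounit B) \<and>
     (\<forall>l\<in>carrier L. \<forall>a\<in>carrier B.
        bcounit B (src B l \<otimes>\<^bsub>B\<^esub> a) = l \<otimes>\<^bsub>L\<^esub> bcounit B a \<and>
        bcounit B (tgt B l \<otimes>\<^bsub>B\<^esub> a) = bcounit B a \<otimes>\<^bsub>L\<^esub> l) \<and>
     bcounit B \<one>\<^bsub>B\<^esub> = \<one>\<^bsub>L\<^esub> \<and>
     (\<forall>a\<in>carrier B. \<forall>b\<in>carrier B.
        bcounit B (a \<otimes>\<^bsub>B\<^esub> src B (bcounit B b)) = bcounit B (a \<otimes>\<^bsub>B\<^esub> b) \<and>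
        bcounit B (a \<otimes>\<^bsub>B\<^esub> tgt B (bcounit B b)) = bcounit B (a \<otimes>\<^bsub>B\<^esub> b)) \<and>
     (\<forall>a\<in>carrier B.
        lsum B [src B (bcounit B a1) \<otimes>\<^bsub>B\<^esub> a2. (a1, a2) \<leftarrow> tlist (bcomul B a)] = a \<and>
        lsum B [tgt B (bcounit B a2) \<otimes>\<^bsub>B\<^esub> a1. (a1, a2) \<leftarrow> tlist (bcomul B a)] = a))"

text \<open>The unit object is \<open>L\<close>, on which \<open>b\<close> acts by \<open>l \<mapsto> \<epsilon>(b s(l))\<close>.\<close>

definition bunit ::
  "'a univ base_alg \<Rightarrow> 'a univ bialgebroid_data \<Rightarrow> ('a univ, 'a univ) module" where
  "bunit L B = (regular L) \<lparr> smult := (\<lambda>b l. bcounit B (b \<otimes>\<^bsub>B\<^esub> src B l)) \<rparr>"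

definition BMod ::
  "'a univ base_alg \<Rightarrow> 'a univ bialgebroid_data \<Rightarrow>
   (('a univ, 'a univ) module, 'a univ \<Rightarrow> 'a univ) moncat" where
  "BMod L B =
    \<lparr> Obj = {M. left_module B M},
      Hom = left_module_hom B,
      Ident = (\<lambda>M. \<lambda>x\<in>carrier M. x),
      Comp = (\<lambda>M N P f g. compose (carrier M) g f),
      tobj = btensor L B,
      tmor = (\<lambda>M M' N N' f g. \<lambda>t\<in>carrier (btensor L B M N).
        bcls L B M' N' [(f m, g n). (m, n) \<leftarrow> tlist t]),
      tunit = bunit L B,
      assoc = (\<lambda>M N P. \<lambda>t\<in>carrier (btensor L B (btensor L B M N) P).
        bcls L B M (btensor L B N P)
          [(m, bcls L B N P [(n, p)]). (u, p) \<leftarrow> tlist t, (m, n) \<leftarrow> tlist u]),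
      lunit = (\<lambda>M. \<lambda>t\<in>carrier (btensor L B (bunit L B) M).
        lsum M [src B l \<odot>\<^bsub>M\<^esub> m. (l, m) \<leftarrow> tlist t]),
      runit = (\<lambda>M. \<lambda>t\<in>carrier (btensor L B M (bunit L B)).
        lsum M [tgt B l \<odot>\<^bsub>M\<^esub> m. (m, l) \<leftarrow> tlist t]) \<rparr>"

section \<open>The smash product bialgebroid and the functor Xi\<close>

definition smash ::
  "'a univ ring \<Rightarrow> 'a univ hopf \<Rightarrow> 'a univ base_alg \<Rightarrow> 'a univ bialgebroid_data" where
  "smash K H L =
    (let c = tcls K L H; T = tensor K L H;
         \<comment> \<open>everything but the comultiplication, which takes values in \<open>B0 \<otimes>\<^sub>L B0\<close>\<close>
         B0 = \<lparr> carrier = carrier T,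
           mult = (\<lambda>b b'. c [(l \<otimes>\<^bsub>L\<^esub> hact L f1 m, f2 \<otimes>\<^bsub>H\<^esub> g).
             (l, f) \<leftarrow> tlist b, (m, g) \<leftarrow> tlist b', (f1, f2) \<leftarrow> tlist (comul H f)]),
           one = c [(\<one>\<^bsub>L\<^esub>, \<one>\<^bsub>H\<^esub>)],
           zero = zero T, add = add T, smult = smult T,
           src = (\<lambda>l. c [(l, \<one>\<^bsub>H\<^esub>)]),
           tgt = (\<lambda>l. c [(l2, inv_into (carrier H) (antipode H) l1).
             (l1, l2) \<leftarrow> tlist (coact L l)]),
           bcomul = undefined,
           bcounit = (\<lambda>b. lsum L [counit H h \<odot>\<^bsub>L\<^esub> l. (l, h) \<leftarrow> tlist b]) \<rparr>
     in B0 \<lparr> bcomul := (\<lambda>b. bcls L B0 (regular B0) (regular B0)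
          [(c [(l, h1)], c [(\<one>\<^bsub>L\<^esub>, h2)]).
            (l, h) \<leftarrow> tlist b, (h1, h2) \<leftarrow> tlist (comul H h)]) \<rparr>)"

definition Xi_left_act ::
  "'a univ ring \<Rightarrow> 'a univ hopf \<Rightarrow> 'a univ base_alg \<Rightarrow> ('a univ, 'a univ) module \<Rightarrow>
   'a univ \<Rightarrow> 'a univ \<Rightarrow> 'a univ" where
  "Xi_left_act K H L X l v = lcls K H L X [(l1 \<odot>\<^bsub>X\<^esub> x, l2 \<otimes>\<^bsub>L\<^esub> m).
     (l1, l2) \<leftarrow> tlist (coact L l), (x, m) \<leftarrow> tlist v]"

text \<open>\<open>l \<otimes> h\<close> acts as \<open>h\<close> followed by \<open>l\<close>.  The right \<open>L\<close>-action on \<open>X \<otimes> L\<close> by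
  multiplication is the one obtained from the target map.\<close>

definition Xi_obj ::
  "'a univ ring \<Rightarrow> 'a univ hopf \<Rightarrow> 'a univ base_alg \<Rightarrow> ('a univ, 'a univ) module \<Rightarrow>
   ('a univ, 'a univ) module" where
  "Xi_obj K H L X = (ltens K H L X)
    \<lparr> smult := (\<lambda>b v. lsum (ltens K H L X)
        [Xi_left_act K H L X l (h \<odot>\<^bsub>ltens K H L X\<^esub> v). (l, h) \<leftarrow> tlist b]) \<rparr>"

definition Xi_mor ::
  "'a univ ring \<Rightarrow> 'a univ hopf \<Rightarrow> 'a univ base_alg \<Rightarrow>
   ('a univ, 'a univ) module \<Rightarrow> ('a univ, 'a univ) module \<Rightarrow>
   ('a univ \<Rightarrow> 'a univ) \<Rightarrow> 'a univ \<Rightarrow> 'a univ" where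
  "Xi_mor K H L X Y f = (\<lambda>v\<in>carrier (ltens K H L X).
     lcls K H L Y [(y, l \<otimes>\<^bsub>L\<^esub> m). (x, m) \<leftarrow> tlist v, (y, l) \<leftarrow> tlist (f x)])"

text \<open>The canonical maps
  \<open>(x \<otimes> l) \<otimes>\<^sub>L (y \<otimes> m) \<mapsto> x \<otimes> l\<^sup>(\<^sup>1\<^sup>) y \<otimes> l\<^sup>[\<^sup>2\<^sup>] m\<close> and \<open>l \<mapsto> 1 \<otimes> l\<close>.\<close>

definition Xi_ident ::
  "'a univ ring \<Rightarrow> 'a univ hopf \<Rightarrow> 'a univ base_alg \<Rightarrow>
   ('a univ, 'a univ) module \<Rightarrow> ('a univ, 'a univ) module \<Rightarrow> 'a univ \<Rightarrow> 'a univ" where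
  "Xi_ident K H L X Y =
     (\<lambda>t\<in>carrier (btensor L (smash K H L) (Xi_obj K H L X) (Xi_obj K H L Y)).
        lcls K H L (htensor K H X Y) [(hcls K H X Y [(x, l1 \<odot>\<^bsub>Y\<^esub> y)], l2 \<otimes>\<^bsub>L\<^esub> m).
          (u, v) \<leftarrow> tlist t, (x, l) \<leftarrow> tlist u, (y, m) \<leftarrow> tlist v,
          (l1, l2) \<leftarrow> tlist (coact L l)])"

definition Xi_ident_unit ::
  "'a univ ring \<Rightarrow> 'a univ hopf \<Rightarrow> 'a univ base_alg \<Rightarrow> 'a univ \<Rightarrow> 'a univ" where
  "Xi_ident_unit K H L = (\<lambda>l\<in>carrier L. lcls K H L (hunit K H) [(\<one>\<^bsub>K\<^esub>, l)])"

definition Mod_0 ::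
  "'a univ ring \<Rightarrow> 'a univ hopf \<Rightarrow> 'a univ base_alg \<Rightarrow>
   (('a univ, 'a univ) module \<times> ('a univ, 'a univ) module, 'a univ \<Rightarrow> 'a univ) moncat" where
  "Mod_0 K H L = full_subcategory_on (BMod L (smash K H L)) {X. left_module H X}
     (Xi_obj K H L) (htensor K H) (hunit K H) (Xi_ident K H L) (Xi_ident_unit K H L)"

end

theory Submission
  imports Defs
begin

text \<open>
  The module \<open>X \<otimes> L\<close> carries a right \<open>L\<close>-multiplication, which is the one that the target map of
  \<open>B = L \<rtimes> H\<close> induces.  Hence a \<open>B\<close>-linear map \<open>\<phi> : X \<otimes> L \<rightarrow> Y \<otimes> L\<close> is determined by its restriction to
  \<open>X \<otimes> 1\<close>, and as \<open>h (x \<otimes> 1) = h x \<otimes> 1\<close>, this restriction is \<open>H\<close>-equivariant.  Conversely, the right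
  \<open>L\<close>-linear extension of an equivariant \<open>f : X \<rightarrow> Y \<otimes> L\<close> commutes with \<open>H\<close>, and it commutes with the
  left \<open>L\<close>-action by quasi-commutativity \<open>\<lambda>\<mu> = (\<lambda>\<^sup>(\<^sup>1\<^sup>) \<mu>) \<lambda>\<^sup>[\<^sup>2\<^sup>]\<close>.  So \<open>\<Xi>\<close> is bijective on hom sets.

  The identification \<open>(x \<otimes> l) \<otimes>\<^sub>L (y \<otimes> m) \<mapsto> x \<otimes> l\<^sup>(\<^sup>1\<^sup>) y \<otimes> l\<^sup>[\<^sup>2\<^sup>] m\<close> has the inverse
  \<open>x \<otimes> y \<otimes> m \<mapsto> (x \<otimes> 1) \<otimes>\<^sub>L (y \<otimes> m)\<close>.  Through it, the coherence axioms for the full subcategory are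
  identities between images of pure tensors \<open>v \<otimes>\<^sub>L w\<close>, on which every structure map is given by an
  explicit formula.  Each structure map of the dynamization is the restriction of the corresponding
  one of the full subcategory, and its monoidal axioms follow by transport along \<open>\<Xi>\<close>.
\<close>

section \<open>Sums over lists\<close>

text \<open>An element of a tensor product is a chosen formal sum, so an expression that runs over
  \<open>tlist t\<close> has a usable value only once its summand is known to respect the defining
  relation. For this reason every list in the definitions is rewritten as a Sweedler sum
  \<open>tsum A F t\<close>, and the steps between such sums carry side conditions: \<open>F\<close>
  is balanced, or linear in each variable. The collections \<open>lin\<close>, \<open>linB\<close>,
  \<open>linC\<close>, \<open>linY\<close> and their relatives exist to discharge them.

  Two tensor products are in play, over \<open>K\<close> and over the noncommutative
  \<open>L\<close>. The Hopf algebra identities are stated for values in \<open>K\<close>-modules,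
  hence tensor products over \<open>L\<close> receive their \<open>K\<close>-structure separately
  (\<open>kt\<close>).

  That the smash product is a bialgebroid is itself part of the claim. Its target map is controlled
  by a form of quasi-commutativity that contains the inverse antipode (\<open>quasi_comm_T\<close>),
  and its Takeuchi condition rests on the compatibility of action and coaction
  (\<open>co_act\<close>).\<close>

lemma lsum_Nil [simp]: "lsum M [] = \<zero>\<^bsub>M\<^esub>"
  by (simp add: lsum_def)

lemma lsum_Cons [simp]: "lsum M (x # xs) = x \<oplus>\<^bsub>M\<^esub> lsum M xs"
  by (simp add: lsum_def)

context abelian_group
begin

lemma lsum_closed: "set xs \<subseteq> carrier G \<Longrightarrow> lsum G xs \<in> carrier G"
  by (induction xs) auto

lemma lsum_append:
  "set xs \<subseteq> carrier G \<Longrightarrow> set ys \<subseteq> carrier G \<Longrightarrow> lsum G (xs @ ys) = lsum G xs \<oplus> lsum G ys"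
  by (induction xs) (auto simp: lsum_closed a_assoc)

lemma lsum_zeros: "lsum G (map (\<lambda>x. \<zero>) xs) = \<zero>"
  by (induction xs) auto

lemma lsum_map_add:
  "(\<And>x. x \<in> set xs \<Longrightarrow> f x \<in> carrier G) \<Longrightarrow> (\<And>x. x \<in> set xs \<Longrightarrow> g x \<in> carrier G) \<Longrightarrow>
   lsum G (map (\<lambda>x. f x \<oplus> g x) xs) = lsum G (map f xs) \<oplus> lsum G (map g xs)"
proof (induction xs)
  case (Cons a xs)
  have "lsum G (map f xs) \<in> carrier G" "lsum G (map g xs) \<in> carrier G"
    using Cons.prems by (auto intro!: lsum_closed)
  with Cons show ?case by (simp add: a_ac)
qed auto

lemma lsum_swap:
  "(\<And>x y. x \<in> set xs \<Longrightarrow> y \<in> set ys \<Longrightarrow> f x y \<in> carrier G) \<Longrightarrow>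
   lsum G (map (\<lambda>x. lsum G (map (f x) ys)) xs) = lsum G (map (\<lambda>y. lsum G (map (\<lambda>x. f x y) xs)) ys)"
proof (induction xs)
  case (Cons a xs)
  have "lsum G (map (f a) ys) \<oplus> lsum G (map (\<lambda>y. lsum G (map (\<lambda>x. f x y) xs)) ys) =
    lsum G (map (\<lambda>y. f a y \<oplus> lsum G (map (\<lambda>x. f x y) xs)) ys)"
    using Cons.prems by (intro lsum_map_add[symmetric]) (auto intro!: lsum_closed)
  with Cons show ?case by simp
qed (simp add: lsum_zeros)

end

section \<open>Additive maps between abelian groups\<close>

lemma additive_onI:
  "(\<And>x. x \<in> carrier M \<Longrightarrow> f x \<in> carrier N) \<Longrightarrow>
   (\<And>x y. x \<in> carrier M \<Longrightarrow> y \<in> carrier M \<Longrightarrow> f (x \<oplus>\<^bsub>M\<^esub> y) = f x \<oplus>\<^bsub>N\<^esub> f y) \<Longrightarrow> additive_on M N f"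
  by (auto simp: additive_on_def)

lemma additive_on_closed: "additive_on M N f \<Longrightarrow> x \<in> carrier M \<Longrightarrow> f x \<in> carrier N"
  by (auto simp: additive_on_def)

lemma additive_on_add:
  "additive_on M N f \<Longrightarrow> x \<in> carrier M \<Longrightarrow> y \<in> carrier M \<Longrightarrow> f (x \<oplus>\<^bsub>M\<^esub> y) = f x \<oplus>\<^bsub>N\<^esub> f y"
  by (auto simp: additive_on_def)

lemma additive_on_zero:
  assumes "abelian_group M" "abelian_group N" "additive_on M N f"
  shows "f \<zero>\<^bsub>M\<^esub> = \<zero>\<^bsub>N\<^esub>"
proof -
  interpret M: abelian_group M by fact
  interpret N: abelian_group N by fact
  have "f \<zero>\<^bsub>M\<^esub> \<oplus>\<^bsub>N\<^esub> f \<zero>\<^bsub>M\<^esub> = f \<zero>\<^bsub>M\<^esub>"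
    using additive_on_add[OF assms(3), of "\<zero>\<^bsub>M\<^esub>" "\<zero>\<^bsub>M\<^esub>"] by simp
  thus ?thesis using additive_on_closed[OF assms(3) M.zero_closed]
    by (metis N.add.l_cancel_one' )
qed

lemma additive_on_lsum:
  assumes "abelian_group M" "abelian_group N" "additive_on M N f" "set xs \<subseteq> carrier M"
  shows "f (lsum M xs) = lsum N (map f xs)"
  using assms(4)
proof (induction xs)
  case Nil
  thus ?case using additive_on_zero[OF assms(1-3)] by simp
next
  case (Cons a xs)
  interpret M: abelian_group M by fact
  show ?case using Cons additive_on_add[OF assms(3), of a "lsum M xs"] M.lsum_closed[of xs] by simp
qed

lemma additive_on_id: "additive_on M M (\<lambda>x. x)"
  by (auto simp: additive_on_def)

lemma additive_on_comp:
  "additive_on P M g \<Longrightarrow> additive_on M N f \<Longrightarrow> additive_on P N (\<lambda>x. f (g x))"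
  by (auto simp: additive_on_def Pi_iff)

text \<open>Replacing \<open>f\<close> by \<open>g\<close> at a sum requires that the sum lie in the
  carrier, hence the assumption on \<open>M\<close>.\<close>

lemma additive_on_cong:
  assumes "additive_on M N f" "\<And>x. x \<in> carrier M \<Longrightarrow> f x = g x" "abelian_group M"
  shows "additive_on M N g"
proof -
  interpret M: abelian_group M by fact
  show ?thesis using assms(1,2) by (auto simp: additive_on_def Pi_iff)
qed

text \<open>Restriction of scalars, \<open>via_tgt\<close>, \<open>htensor\<close> and
  \<open>Xi_obj\<close> change the scalar action of a module and leave its abelian group as it is;
  the group laws are carried over by this rule.\<close>

lemma abelian_group_cong:
  assumes "abelian_group M" "carrier M' = carrier M" "add M' = add M" "zero M' = zero M"
  shows "abelian_group M'"
proof -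
  interpret abelian_group M by fact
  show ?thesis
    using assms(2-4)
    by (intro abelian_groupI) (auto simp: a_ac intro!: bexI[of _ "a_inv M _"] l_neg)
qed

section \<open>Tensor products\<close>

text \<open>Sweedler notation: \<open>tsum A F t\<close> is the sum of all \<open>F t\<^sup>(\<^sup>1\<^sup>) t\<^sup>(\<^sup>2\<^sup>)\<close>.\<close>

definition tsum :: "('b, 'm) ring_scheme \<Rightarrow> ('a univ \<Rightarrow> 'a univ \<Rightarrow> 'b) \<Rightarrow> 'a univ \<Rightarrow> 'b" where
  "tsum A F t = lsum A [F a b. (a, b) \<leftarrow> tlist t]"

text \<open>These are the demands that the generators of \<open>tens_rel\<close> make on a summand
  so that the value does not depend on the chosen formal sum (\<open>rel_lsum\<close>). The target
  enters only additively, because over a noncommutative ring a tensor product carries no scalar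
  action in general.\<close>

definition balanced ::
  "('r, 'l) ring_scheme \<Rightarrow> ('r, 'u, 'm) module_scheme \<Rightarrow> ('r, 'u, 'n) module_scheme \<Rightarrow>
   ('b, 'z) ring_scheme \<Rightarrow> ('u \<Rightarrow> 'u \<Rightarrow> 'b) \<Rightarrow> bool" where
  "balanced R M N A F \<longleftrightarrow>
     (\<forall>m\<in>carrier M. additive_on N A (\<lambda>n. F m n)) \<and>
     (\<forall>n\<in>carrier N. additive_on M A (\<lambda>m. F m n)) \<and>
     (\<forall>r\<in>carrier R. \<forall>m\<in>carrier M. \<forall>n\<in>carrier N. F (r \<odot>\<^bsub>M\<^esub> m) n = F m (r \<odot>\<^bsub>N\<^esub> n))"

lemma balancedI:
  "(\<And>m. m \<in> carrier M \<Longrightarrow> additive_on N A (\<lambda>n. F m n)) \<Longrightarrow>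
   (\<And>n. n \<in> carrier N \<Longrightarrow> additive_on M A (\<lambda>m. F m n)) \<Longrightarrow>
   (\<And>r m n. r \<in> carrier R \<Longrightarrow> m \<in> carrier M \<Longrightarrow> n \<in> carrier N \<Longrightarrow>
     F (r \<odot>\<^bsub>M\<^esub> m) n = F m (r \<odot>\<^bsub>N\<^esub> n)) \<Longrightarrow> balanced R M N A F"
  by (auto simp: balanced_def)

lemma balanced_closed:
  "balanced R M N A F \<Longrightarrow> m \<in> carrier M \<Longrightarrow> n \<in> carrier N \<Longrightarrow> F m n \<in> carrier A"
  by (auto simp: balanced_def dest: additive_on_closed)

text \<open>The closure assumptions on the scalars serve the generator \<open>balanced\<close>,
  whose two sides both have to be formal sums of carrier elements.\<close>

lemma tens_rel_valid:
  assumes "tens_rel R M N xs ys" "abelian_group M" "abelian_group N"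
    "\<And>r m. r \<in> carrier R \<Longrightarrow> m \<in> carrier M \<Longrightarrow> r \<odot>\<^bsub>M\<^esub> m \<in> carrier M"
    "\<And>r n. r \<in> carrier R \<Longrightarrow> n \<in> carrier N \<Longrightarrow> r \<odot>\<^bsub>N\<^esub> n \<in> carrier N"
  shows "set xs \<subseteq> carrier M \<times> carrier N \<and> set ys \<subseteq> carrier M \<times> carrier N"
proof -
  interpret M: abelian_group M by fact
  interpret N: abelian_group N by fact
  show ?thesis using assms(1) by (induction rule: tens_rel.induct) (auto simp: assms(4,5))
qed

lemma tens_rel_cong_record:
  assumes "tens_rel R M N xs ys"
    "carrier M' = carrier M" "add M' = add M" "zero M' = zero M"
    "carrier N' = carrier N" "add N' = add N" "zero N' = zero N"
    "\<And>r m. r \<in> carrier R \<Longrightarrow> m \<in> carrier M \<Longrightarrow> r \<odot>\<^bsub>M'\<^esub> m = r \<odot>\<^bsub>M\<^esub> m"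
    "\<And>r n. r \<in> carrier R \<Longrightarrow> n \<in> carrier N \<Longrightarrow> r \<odot>\<^bsub>N'\<^esub> n = r \<odot>\<^bsub>N\<^esub> n"
  shows "tens_rel R M' N' xs ys"
  using assms(1)
proof (induction rule: tens_rel.induct)
  case (sym xs ys) thus ?case by (blast intro: tens_rel.sym)
next
  case (trans xs ys zs) thus ?case by (blast intro: tens_rel.trans)
next
  case (append xs xs' ys ys') thus ?case by (blast intro: tens_rel.append)
next
  case (commute xs ys) thus ?case using tens_rel.commute[of xs M' N' ys R] assms by simp
next
  case (zero_left n) thus ?case using tens_rel.zero_left[of n N' R M'] assms by simp
next
  case (zero_right m) thus ?case using tens_rel.zero_right[of m M' R N'] assms by simp
next
  case (add_left m m' n) thus ?case using tens_rel.add_left[of m M' m' n N' R] assms by simp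
next
  case (add_right m n n') thus ?case using tens_rel.add_right[of m M' n N' n' R] assms by simp
next
  case (balanced r m n) thus ?case using tens_rel.balanced[of r R m M' n N'] assms(2-) by (simp )
qed (use assms in \<open>auto intro: tens_rel.intros\<close>)

text \<open>\<open>tcls\<close> picks its representative from the relation, so once the relations
  agree as predicates the chosen elements are equal, not just corresponding under an isomorphism.
  This allows one module to be exchanged for another description of it.\<close>

lemma tcls_cong_record:
  assumes "carrier M' = carrier M" "add M' = add M" "zero M' = zero M"
    "carrier N' = carrier N" "add N' = add N" "zero N' = zero N"
    "\<And>r m. r \<in> carrier R \<Longrightarrow> m \<in> carrier M \<Longrightarrow> r \<odot>\<^bsub>M'\<^esub> m = r \<odot>\<^bsub>M\<^esub> m"
    "\<And>r n. r \<in> carrier R \<Longrightarrow> n \<in> carrier N \<Longrightarrow> r \<odot>\<^bsub>N'\<^esub> n = r \<odot>\<^bsub>N\<^esub> n"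
  shows "tcls R M' N' = tcls R M N"
proof -
  have "tens_rel R M' N' xs ys = tens_rel R M N xs ys" for xs ys
    using tens_rel_cong_record[of R M N xs ys M' N'] tens_rel_cong_record[of R M' N' xs ys M N] assms
    by auto
  thus ?thesis by (intro ext) (simp add: tcls_def)
qed

text \<open>Only closure under the scalars is asked, no module laws. This is enough for the
  universal property and covers \<open>L\<close>-tensor products, where the scalars act on
  \<open>M\<close> from the right and on \<open>N\<close> from the left, so that \<open>M\<close> is
  not a left module over \<open>R\<close>.\<close>

locale tensor_pair =
  fixes R :: "('r, 'l) ring_scheme"
    and M :: "('r, 'a univ, 'm) module_scheme" and N :: "('r, 'a univ, 'n) module_scheme"
  assumes group_M: "abelian_group M" and group_N: "abelian_group N"
    and smult_M: "r \<in> carrier R \<Longrightarrow> m \<in> carrier M \<Longrightarrow> r \<odot>\<^bsub>M\<^esub> m \<in> carrier M"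
    and smult_N: "r \<in> carrier R \<Longrightarrow> n \<in> carrier N \<Longrightarrow> r \<odot>\<^bsub>N\<^esub> n \<in> carrier N"
begin

abbreviation "T \<equiv> tensor R M N"
abbreviation pure where "pure m n \<equiv> tcls R M N [(m, n)]"

lemma rel_valid:
  "tens_rel R M N xs ys \<Longrightarrow> set xs \<subseteq> carrier M \<times> carrier N \<and> set ys \<subseteq> carrier M \<times> carrier N"
  using tens_rel_valid[OF _ group_M group_N smult_M smult_N] by blast

lemma tlist_tcls:
  assumes "set xs \<subseteq> carrier M \<times> carrier N"
  shows "tens_rel R M N xs (tlist (tcls R M N xs))"
  using someI[of "tens_rel R M N xs", OF tens_rel.refl[OF assms]] by (simp add: tcls_def)

text \<open>Related formal sums are related to the same formal sums, so the choice operator receives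
  the same predicate for both.\<close>

lemma tcls_eqI: "tens_rel R M N xs ys \<Longrightarrow> tcls R M N xs = tcls R M N ys"
proof -
  assume "tens_rel R M N xs ys"
  hence "tens_rel R M N xs = tens_rel R M N ys"
    by (intro ext) (blast intro: tens_rel.sym tens_rel.trans)
  thus ?thesis by (simp add: tcls_def)
qed

lemma carrier_T: "carrier T = tcls R M N ` {xs. set xs \<subseteq> carrier M \<times> carrier N}"
  by (simp add: tensor_def)

lemma tcls_closed: "set xs \<subseteq> carrier M \<times> carrier N \<Longrightarrow> tcls R M N xs \<in> carrier T"
  by (auto simp: carrier_T)

lemma pure_closed: "m \<in> carrier M \<Longrightarrow> n \<in> carrier N \<Longrightarrow> pure m n \<in> carrier T"
  by (rule tcls_closed) auto

lemma tlist_valid: "t \<in> carrier T \<Longrightarrow> set (tlist t) \<subseteq> carrier M \<times> carrier N"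
  using rel_valid tlist_tcls by (fastforce simp: carrier_T)

lemma tlist_mem: "t \<in> carrier T \<Longrightarrow> p \<in> set (tlist t) \<Longrightarrow> fst p \<in> carrier M \<and> snd p \<in> carrier N"
  using tlist_valid by fastforce

lemma tcls_tlist: "t \<in> carrier T \<Longrightarrow> tcls R M N (tlist t) = t"
  using tcls_eqI tlist_tcls by (fastforce simp: carrier_T)

lemma tcls_append:
  assumes "set xs \<subseteq> carrier M \<times> carrier N" "set ys \<subseteq> carrier M \<times> carrier N"
  shows "tcls R M N (xs @ ys) = tcls R M N xs \<oplus>\<^bsub>T\<^esub> tcls R M N ys"
  using tcls_eqI[OF tens_rel.append[OF tlist_tcls[OF assms(1)] tlist_tcls[OF assms(2)]]]
  by (simp add: tensor_def)

lemma tcls_zero: "\<zero>\<^bsub>T\<^esub> = tcls R M N []"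
  by (simp add: tensor_def)

lemma pure_add_left:
  "m \<in> carrier M \<Longrightarrow> m' \<in> carrier M \<Longrightarrow> n \<in> carrier N \<Longrightarrow>
   pure (m \<oplus>\<^bsub>M\<^esub> m') n = pure m n \<oplus>\<^bsub>T\<^esub> pure m' n"
  using tcls_eqI[OF tens_rel.add_left, of m m' n] tcls_append[of "[(m, n)]" "[(m', n)]"] by simp

lemma pure_add_right:
  "m \<in> carrier M \<Longrightarrow> n \<in> carrier N \<Longrightarrow> n' \<in> carrier N \<Longrightarrow>
   pure m (n \<oplus>\<^bsub>N\<^esub> n') = pure m n \<oplus>\<^bsub>T\<^esub> pure m n'"
  using tcls_eqI[OF tens_rel.add_right, of m n n'] tcls_append[of "[(m, n)]" "[(m, n')]"] by simp

lemma pure_balanced: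
  "r \<in> carrier R \<Longrightarrow> m \<in> carrier M \<Longrightarrow> n \<in> carrier N \<Longrightarrow> pure (r \<odot>\<^bsub>M\<^esub> m) n = pure m (r \<odot>\<^bsub>N\<^esub> n)"
  using tcls_eqI[OF tens_rel.balanced] by blast

lemma tcls_inverse:
  assumes "set xs \<subseteq> carrier M \<times> carrier N"
  shows "\<exists>ys. set ys \<subseteq> carrier M \<times> carrier N \<and> tens_rel R M N (ys @ xs) []"
  using assms
proof (induction xs)
  case Nil
  show ?case by (rule exI[of _ "[]"]) (auto intro: tens_rel.refl)
next
  case (Cons p xs)
  interpret M: abelian_group M by (rule group_M)
  obtain m n where p: "p = (m, n)" "m \<in> carrier M" "n \<in> carrier N" using Cons.prems by auto
  obtain ys where ys: "set ys \<subseteq> carrier M \<times> carrier N" "tens_rel R M N (ys @ xs) []"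
    using Cons by auto
  \<comment> \<open>Additivity in the first argument merges this entry with \<open>(m, n)\<close>
    into a pair whose first entry is zero, and \<open>zero_left\<close> removes that pair.\<close>
  let ?q = "(\<ominus>\<^bsub>M\<^esub> m, n)"
  have q: "tens_rel R M N [?q, (m, n)] []"
    using tens_rel.add_left[of "\<ominus>\<^bsub>M\<^esub> m" M m n N R] tens_rel.zero_left[of n N R M] p
    by (auto simp: M.l_neg intro: tens_rel.sym tens_rel.trans)
  have "tens_rel R M N (ys @ [?q, p]) ys"
    using tens_rel.append[OF tens_rel.refl[OF ys(1)] q] p by simp
  hence "tens_rel R M N ((ys @ [?q, p]) @ xs) (ys @ xs)"
    by (rule tens_rel.append) (use Cons.prems in \<open>auto intro: tens_rel.refl\<close>)
  hence "tens_rel R M N ((ys @ [?q]) @ p # xs) []"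
    using ys(2) by (auto intro: tens_rel.trans)
  thus ?case using ys(1) p by (intro exI[of _ "ys @ [?q]"]) auto
qed

lemma group_T: "abelian_group T"
proof (rule abelian_groupI)
  fix x y z assume "x \<in> carrier T" "y \<in> carrier T" "z \<in> carrier T"
  then obtain xs ys zs where l: "set xs \<subseteq> carrier M \<times> carrier N" "set ys \<subseteq> carrier M \<times> carrier N"
    "set zs \<subseteq> carrier M \<times> carrier N" and
    eq: "x = tcls R M N xs" "y = tcls R M N ys" "z = tcls R M N zs"
    by (auto simp: carrier_T)
  show "x \<oplus>\<^bsub>T\<^esub> y \<oplus>\<^bsub>T\<^esub> z = x \<oplus>\<^bsub>T\<^esub> (y \<oplus>\<^bsub>T\<^esub> z)"
    using l by (simp add: eq tcls_append[symmetric])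
next
  fix x y assume "x \<in> carrier T" "y \<in> carrier T"
  then obtain xs ys where l: "set xs \<subseteq> carrier M \<times> carrier N" "set ys \<subseteq> carrier M \<times> carrier N" and
    eq: "x = tcls R M N xs" "y = tcls R M N ys"
    by (auto simp: carrier_T)
  show "x \<oplus>\<^bsub>T\<^esub> y \<in> carrier T"
    using l by (auto simp: eq tcls_append[symmetric] intro!: tcls_closed)
  show "x \<oplus>\<^bsub>T\<^esub> y = y \<oplus>\<^bsub>T\<^esub> x"
    using l by (auto simp: eq tcls_append[symmetric] intro!: tcls_eqI tens_rel.commute)
next
  fix x assume "x \<in> carrier T"
  then obtain xs where l: "set xs \<subseteq> carrier M \<times> carrier N" and eq: "x = tcls R M N xs"
    by (auto simp: carrier_T)
  show "\<zero>\<^bsub>T\<^esub> \<oplus>\<^bsub>T\<^esub> x = x"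
    using l by (simp add: eq tcls_zero tcls_append[symmetric])
  obtain ys where ys: "set ys \<subseteq> carrier M \<times> carrier N" "tens_rel R M N (ys @ xs) []"
    using tcls_inverse[OF l] by blast
  show "\<exists>y\<in>carrier T. y \<oplus>\<^bsub>T\<^esub> x = \<zero>\<^bsub>T\<^esub>"
    using ys l tcls_eqI[OF ys(2)]
    by (intro bexI[of _ "tcls R M N ys"]) (auto simp: eq tcls_zero tcls_append[symmetric] intro: tcls_closed)
qed (auto simp: tcls_zero intro: tcls_closed)

lemma tcls_lsum:
  assumes "set xs \<subseteq> carrier M \<times> carrier N"
  shows "tcls R M N xs = lsum T (map (\<lambda>(m, n). pure m n) xs)"
  using assms
proof (induction xs)
  case (Cons p xs)
  thus ?case using tcls_append[of "[p]" xs] by auto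
qed (simp add: tcls_zero)

lemma balanced_pure: "balanced R M N T pure"
  by (intro balancedI additive_onI) (auto simp: pure_add_left pure_add_right pure_balanced pure_closed)

text \<open>The existence half of the universal property, by induction on the relation: each clause
  of \<open>balanced\<close> answers to one kind of generator, and the structural rules follow from
  the laws of an abelian group.\<close>

lemma rel_lsum:
  assumes "tens_rel R M N xs ys" "abelian_group A" "balanced R M N A F"
  shows "lsum A (map (\<lambda>(m, n). F m n) xs) = lsum A (map (\<lambda>(m, n). F m n) ys)"
  using assms(1)
proof (induction rule: tens_rel.induct)
  interpret A: abelian_group A by fact
  note b = assms(3)[unfolded balanced_def]
  have c: "set (map (\<lambda>(m, n). F m n) xs) \<subseteq> carrier A" if "set xs \<subseteq> carrier M \<times> carrier N" for xs
    using that balanced_closed[OF assms(3)] by auto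
  {
    case (append xs xs' ys ys')
    thus ?case
      using rel_valid[of xs xs'] rel_valid[of ys ys'] c[of xs] c[of xs'] c[of ys] c[of ys']
      by (simp add: A.lsum_append)
  next
    case (commute xs ys)
    thus ?case using c[of xs] c[of ys] by (simp add: A.lsum_append A.a_comm A.lsum_closed)
  next
    case (zero_left n)
    thus ?case using additive_on_zero[OF group_M assms(2), of "\<lambda>m. F m n"] b by simp
  next
    case (zero_right n)
    thus ?case using additive_on_zero[OF group_N assms(2), of "F n"] b by simp
  next
    case (add_left m m' n)
    thus ?case using additive_on_add[of M A "\<lambda>m. F m n" m m'] b balanced_closed[OF assms(3)] by simp
  next
    case (add_right m n n')
    thus ?case using additive_on_add[of N A "F m" n n'] b balanced_closed[OF assms(3)] by simp
  next
    case (balanced r m n)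
    thus ?case using b balanced_closed[OF assms(3)] smult_M smult_N by simp
  }
qed auto

lemma tsum_tcls:
  assumes "abelian_group A" "balanced R M N A F" "set xs \<subseteq> carrier M \<times> carrier N"
  shows "tsum A F (tcls R M N xs) = lsum A (map (\<lambda>(m, n). F m n) xs)"
  using rel_lsum[OF tlist_tcls[OF assms(3)] assms(1,2)] by (simp add: tsum_def)

lemma tsum_pure:
  assumes "abelian_group A" "balanced R M N A F" "m \<in> carrier M" "n \<in> carrier N"
  shows "tsum A F (pure m n) = F m n"
proof -
  interpret A: abelian_group A by fact
  show ?thesis using tsum_tcls[of A F "[(m, n)]"] assms balanced_closed[OF assms(2)] by simp
qed

lemma tsum_closed:
  assumes "abelian_group A" "\<And>m n. m \<in> carrier M \<Longrightarrow> n \<in> carrier N \<Longrightarrow> F m n \<in> carrier A"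
    "t \<in> carrier T"
  shows "tsum A F t \<in> carrier A"
  using assms tlist_valid[OF assms(3)]
  unfolding tsum_def by (intro abelian_group.lsum_closed) auto

lemma tsum_cong:
  assumes "\<And>m n. m \<in> carrier M \<Longrightarrow> n \<in> carrier N \<Longrightarrow> F m n = G m n" "t \<in> carrier T"
  shows "tsum A F t = tsum A G t"
  using assms(1) tlist_valid[OF assms(2)]
  unfolding tsum_def by (intro arg_cong[of _ _ "lsum A"] map_cong) auto

lemma tsum_hom:
  assumes "abelian_group A" "abelian_group A'" "additive_on A A' f"
    "\<And>m n. m \<in> carrier M \<Longrightarrow> n \<in> carrier N \<Longrightarrow> F m n \<in> carrier A" "t \<in> carrier T"
  shows "f (tsum A F t) = tsum A' (\<lambda>m n. f (F m n)) t"
proof -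
  have "set (map (\<lambda>(m, n). F m n) (tlist t)) \<subseteq> carrier A"
    using tlist_valid[OF assms(5)] assms(4) by auto
  from additive_on_lsum[OF assms(1-3) this] show ?thesis
    by (simp add: tsum_def comp_def case_prod_unfold)
qed

lemma tsum_additive:
  assumes "abelian_group A" "balanced R M N A F"
  shows "additive_on T A (tsum A F)"
proof (rule additive_onI)
  fix x y assume "x \<in> carrier T" "y \<in> carrier T"
  then obtain xs ys where l: "set xs \<subseteq> carrier M \<times> carrier N" "set ys \<subseteq> carrier M \<times> carrier N" and
    eq: "x = tcls R M N xs" "y = tcls R M N ys"
    by (auto simp: carrier_T)
  have "set (map (\<lambda>(m, n). F m n) zs) \<subseteq> carrier A" if "set zs \<subseteq> carrier M \<times> carrier N" for zs
    using that balanced_closed[OF assms(2)] by auto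
  from this[OF l(1)] this[OF l(2)]
  show "tsum A F (x \<oplus>\<^bsub>T\<^esub> y) = tsum A F x \<oplus>\<^bsub>A\<^esub> tsum A F y"
    using l by (simp add: eq tcls_append[symmetric] tsum_tcls[OF assms] abelian_group.lsum_append[OF assms(1)])
qed (auto intro!: tsum_closed assms balanced_closed[OF assms(2)])

lemma tsum_self: "t \<in> carrier T \<Longrightarrow> tsum T pure t = t"
  using tcls_lsum[OF tlist_valid] tcls_tlist by (simp add: tsum_def)

lemma tsum_add:
  assumes "abelian_group A" "t \<in> carrier T"
    "\<And>m n. m \<in> carrier M \<Longrightarrow> n \<in> carrier N \<Longrightarrow> F m n \<in> carrier A"
    "\<And>m n. m \<in> carrier M \<Longrightarrow> n \<in> carrier N \<Longrightarrow> G m n \<in> carrier A"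
  shows "tsum A (\<lambda>m n. F m n \<oplus>\<^bsub>A\<^esub> G m n) t = tsum A F t \<oplus>\<^bsub>A\<^esub> tsum A G t"
  unfolding tsum_def case_prod_beta using assms(3,4) tlist_valid[OF assms(2)]
  by (intro abelian_group.lsum_map_add assms) auto

lemma additive_on_tsum_inner:
  assumes "abelian_group A" "t \<in> carrier T"
    "\<And>m n. m \<in> carrier M \<Longrightarrow> n \<in> carrier N \<Longrightarrow> additive_on P A (\<lambda>x. F x m n)"
  shows "additive_on P A (\<lambda>x. tsum A (F x) t)"
proof (rule additive_onI)
  fix x y assume xy: "x \<in> carrier P" "y \<in> carrier P"
  have "tsum A (F (x \<oplus>\<^bsub>P\<^esub> y)) t = tsum A (\<lambda>m n. F x m n \<oplus>\<^bsub>A\<^esub> F y m n) t"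
    using xy by (intro tsum_cong) (auto intro!: additive_on_add[OF assms(3)] assms(2))
  also have "\<dots> = tsum A (F x) t \<oplus>\<^bsub>A\<^esub> tsum A (F y) t"
    using xy by (intro tsum_add assms) (auto intro!: additive_on_closed[OF assms(3)])
  finally show "tsum A (F (x \<oplus>\<^bsub>P\<^esub> y)) t = tsum A (F x) t \<oplus>\<^bsub>A\<^esub> tsum A (F y) t" .
qed (auto intro!: tsum_closed assms additive_on_closed[OF assms(3)])

text \<open>The uniqueness half of the universal property: by \<open>tsum_self\<close> an element is
  the sum of the pure tensors in its representative, and an additive map can be applied to each of
  them.\<close>

lemma tensor_eqI:
  assumes "abelian_group A" "additive_on T A f" "additive_on T A g" "t \<in> carrier T"
    "\<And>m n. m \<in> carrier M \<Longrightarrow> n \<in> carrier N \<Longrightarrow> f (pure m n) = g (pure m n)"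
  shows "f t = g t"
proof -
  have "h t = tsum A (\<lambda>m n. h (pure m n)) t" if "additive_on T A h" for h
    using tsum_hom[OF group_T assms(1) that, of pure t] assms(4) tsum_self pure_closed by simp
  from this[OF assms(2)] this[OF assms(3)] show ?thesis
    using tsum_cong[OF assms(5,4)] by simp
qed

lemma tcls_concat_lsum:
  assumes "\<And>p. p \<in> set ps \<Longrightarrow> set (f p) \<subseteq> carrier M \<times> carrier N"
  shows "tcls R M N (concat (map f ps)) = lsum T (map (\<lambda>p. tcls R M N (f p)) ps)"
  using assms
  by (induction ps) (auto simp: tcls_zero tcls_append UN_subset_iff)

end

text \<open>Both sides are finite sums over two fixed lists, so the interchange asks of
  \<open>F\<close> nothing but values in the carrier. It is available also where the summand is
  balanced in only one order of summation.\<close>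

lemma tsum_swap:
  assumes "tensor_pair R M N" "tensor_pair S P Q" "abelian_group A"
    "t \<in> carrier (tensor R M N)" "u \<in> carrier (tensor S P Q)"
    "\<And>a b c d. a \<in> carrier M \<Longrightarrow> b \<in> carrier N \<Longrightarrow> c \<in> carrier P \<Longrightarrow> d \<in> carrier Q \<Longrightarrow>
      F a b c d \<in> carrier A"
  shows "tsum A (\<lambda>a b. tsum A (\<lambda>c d. F a b c d) u) t = tsum A (\<lambda>c d. tsum A (\<lambda>a b. F a b c d) t) u"
proof -
  have "fst p \<in> carrier M \<and> snd p \<in> carrier N" if "p \<in> set (tlist t)" for p
    using tensor_pair.tlist_valid[OF assms(1,4)] that by auto
  moreover have "fst q \<in> carrier P \<and> snd q \<in> carrier Q" if "q \<in> set (tlist u)" for q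
    using tensor_pair.tlist_valid[OF assms(2,5)] that by auto
  ultimately have "lsum A (map (\<lambda>p. lsum A (map (\<lambda>q. F (fst p) (snd p) (fst q) (snd q)) (tlist u))) (tlist t)) =
    lsum A (map (\<lambda>q. lsum A (map (\<lambda>p. F (fst p) (snd p) (fst q) (snd q)) (tlist t))) (tlist u))"
    by (intro abelian_group.lsum_swap assms(3)) (auto intro: assms(6))
  thus ?thesis by (simp add: tsum_def case_prod_unfold)
qed

context tensor_pair
begin

lemma tlist_map_valid:
  assumes "\<And>a b. a \<in> carrier M \<Longrightarrow> b \<in> carrier N \<Longrightarrow> f a b \<in> P"
    "\<And>a b. a \<in> carrier M \<Longrightarrow> b \<in> carrier N \<Longrightarrow> g a b \<in> Q" "t \<in> carrier T"
  shows "set (map (\<lambda>(a, b). (f a b, g a b)) (tlist t)) \<subseteq> P \<times> Q"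
  using assms(1,2) tlist_valid[OF assms(3)] by auto

lemma tlist_concat_valid:
  assumes "\<And>a b. a \<in> carrier M \<Longrightarrow> b \<in> carrier N \<Longrightarrow> set (h a b) \<subseteq> V" "t \<in> carrier T"
  shows "set (concat (map (\<lambda>(a, b). h a b) (tlist t))) \<subseteq> V"
  using assms(1) tlist_valid[OF assms(2)] by fastforce

text \<open>Structure maps are defined by comprehensions over a representative. This rewrites such a
  comprehension as a Sweedler sum of pure tensors; \<open>f\<close> and \<open>g\<close> need no
  compatibility with the relation.\<close>

lemma tcls_map:
  assumes "\<And>a b. a \<in> carrier M \<Longrightarrow> b \<in> carrier N \<Longrightarrow> f a b \<in> carrier P"
    "\<And>a b. a \<in> carrier M \<Longrightarrow> b \<in> carrier N \<Longrightarrow> g a b \<in> carrier Q"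
    "tensor_pair S P Q" "t \<in> carrier T"
  shows "tcls S P Q (map (\<lambda>(a, b). (f a b, g a b)) (tlist t)) =
    tsum (tensor S P Q) (\<lambda>a b. tcls S P Q [(f a b, g a b)]) t"
proof -
  from tensor_pair.tcls_lsum[OF assms(3) tlist_map_valid[OF assms(1,2,4)]] show ?thesis
    by (simp add: tsum_def comp_def case_prod_unfold)
qed

text \<open>For a comprehension with several generators: the outermost one becomes a Sweedler sum
  and the inner list is left for a further step.\<close>

lemma tcls_concat:
  assumes "\<And>a b. a \<in> carrier M \<Longrightarrow> b \<in> carrier N \<Longrightarrow> set (h a b) \<subseteq> carrier P \<times> carrier Q"
    "tensor_pair S P Q" "t \<in> carrier T"
  shows "tcls S P Q (concat (map (\<lambda>(a, b). h a b) (tlist t))) =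
    tsum (tensor S P Q) (\<lambda>a b. tcls S P Q (h a b)) t"
  unfolding tsum_def case_prod_unfold using assms(1) tlist_mem[OF assms(3)]
  by (intro tensor_pair.tcls_concat_lsum[OF assms(2)]) blast

end

text \<open>Only addition and zero of the target enter, so a sum may be read in a module or in any
  restriction of its scalars.\<close>

lemma tsum_cong_record: "add A = add A' \<Longrightarrow> zero A = zero A' \<Longrightarrow> tsum A = tsum A'"
  by (intro ext) (simp add: tsum_def lsum_def)

section \<open>Left modules\<close>

lemma left_module_group: "left_module A M \<Longrightarrow> abelian_group M"
  and left_module_closed:
    "left_module A M \<Longrightarrow> a \<in> carrier A \<Longrightarrow> x \<in> carrier M \<Longrightarrow> a \<odot>\<^bsub>M\<^esub> x \<in> carrier M"
  and left_module_mult: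
    "left_module A M \<Longrightarrow> a \<in> carrier A \<Longrightarrow> b \<in> carrier A \<Longrightarrow> x \<in> carrier M \<Longrightarrow>
     (a \<otimes>\<^bsub>A\<^esub> b) \<odot>\<^bsub>M\<^esub> x = a \<odot>\<^bsub>M\<^esub> (b \<odot>\<^bsub>M\<^esub> x)"
  and left_module_one: "left_module A M \<Longrightarrow> x \<in> carrier M \<Longrightarrow> \<one>\<^bsub>A\<^esub> \<odot>\<^bsub>M\<^esub> x = x"
  and left_module_add_left:
    "left_module A M \<Longrightarrow> a \<in> carrier A \<Longrightarrow> b \<in> carrier A \<Longrightarrow> x \<in> carrier M \<Longrightarrow>
     (a \<oplus>\<^bsub>A\<^esub> b) \<odot>\<^bsub>M\<^esub> x = a \<odot>\<^bsub>M\<^esub> x \<oplus>\<^bsub>M\<^esub> b \<odot>\<^bsub>M\<^esub> x"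
  and left_module_add_right:
    "left_module A M \<Longrightarrow> a \<in> carrier A \<Longrightarrow> x \<in> carrier M \<Longrightarrow> y \<in> carrier M \<Longrightarrow>
     a \<odot>\<^bsub>M\<^esub> (x \<oplus>\<^bsub>M\<^esub> y) = a \<odot>\<^bsub>M\<^esub> x \<oplus>\<^bsub>M\<^esub> a \<odot>\<^bsub>M\<^esub> y"
  by (simp_all add: left_module_def)

lemma additive_on_smult_left:
  "left_module A M \<Longrightarrow> additive_on P A f \<Longrightarrow> x \<in> carrier M \<Longrightarrow> additive_on P M (\<lambda>a. f a \<odot>\<^bsub>M\<^esub> x)"
  by (auto simp: additive_on_def left_module_def Pi_iff)

lemma additive_on_smult_right:
  "left_module A M \<Longrightarrow> additive_on P M f \<Longrightarrow> a \<in> carrier A \<Longrightarrow> additive_on P M (\<lambda>x. a \<odot>\<^bsub>M\<^esub> f x)"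
  by (auto simp: additive_on_def left_module_def Pi_iff)

lemma additive_on_mult_left:
  "ring A \<Longrightarrow> additive_on P A f \<Longrightarrow> x \<in> carrier A \<Longrightarrow> additive_on P A (\<lambda>a. f a \<otimes>\<^bsub>A\<^esub> x)"
  by (auto simp: additive_on_def Pi_iff ring.ring_simprules)

lemma additive_on_mult_right:
  "ring A \<Longrightarrow> additive_on P A f \<Longrightarrow> x \<in> carrier A \<Longrightarrow> additive_on P A (\<lambda>a. x \<otimes>\<^bsub>A\<^esub> f a)"
  by (auto simp: additive_on_def Pi_iff ring.ring_simprules)

lemma regular_simps [simp]:
  "carrier (regular A) = carrier A" "add (regular A) = add A" "zero (regular A) = zero A"
  "smult (regular A) = mult A" "mult (regular A) = mult A" "one (regular A) = one A"
  by (simp_all add: regular_def)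

lemma restrict_scalars_simps [simp]:
  "carrier (restrict_scalars A M) = carrier M" "add (restrict_scalars A M) = add M"
  "zero (restrict_scalars A M) = zero M"
  by (simp_all add: restrict_scalars_def)

lemma left_module_regular: "ring A \<Longrightarrow> left_module A (regular A)"
  unfolding left_module_def
  by (auto simp: ring.ring_simprules intro: abelian_group_cong[OF ring.is_abelian_group])

lemma left_module_hom_iff:
  "f \<in> left_module_hom A M N \<longleftrightarrow> f \<in> extensional (carrier M) \<and> additive_on M N f \<and>
     (\<forall>a\<in>carrier A. \<forall>x\<in>carrier M. f (a \<odot>\<^bsub>M\<^esub> x) = a \<odot>\<^bsub>N\<^esub> f x)"
  by (auto simp: left_module_hom_def additive_on_def PiE_iff)

lemma left_module_hom_additive: "f \<in> left_module_hom A M N \<Longrightarrow> additive_on M N f"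
  by (simp add: left_module_hom_iff)

lemma left_module_hom_closed:
  "f \<in> left_module_hom A M N \<Longrightarrow> x \<in> carrier M \<Longrightarrow> f x \<in> carrier N"
  by (auto simp: left_module_hom_def)

lemma left_module_hom_smult:
  "f \<in> left_module_hom A M N \<Longrightarrow> a \<in> carrier A \<Longrightarrow> x \<in> carrier M \<Longrightarrow> f (a \<odot>\<^bsub>M\<^esub> x) = a \<odot>\<^bsub>N\<^esub> f x"
  by (simp add: left_module_hom_iff)

lemma left_module_hom_eqI:
  "f \<in> left_module_hom A M N \<Longrightarrow> g \<in> left_module_hom A M N' \<Longrightarrow>
   (\<And>x. x \<in> carrier M \<Longrightarrow> f x = g x) \<Longrightarrow> f = g"
  by (auto simp: left_module_hom_iff intro: extensionalityI)

lemma left_module_hom_ident: "left_module A M \<Longrightarrow> (\<lambda>x\<in>carrier M. x) \<in> left_module_hom A M M"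
  by (auto simp: left_module_hom_def additive_on_def left_module_closed abelian_monoid.a_closed abelian_group.axioms(1) left_module_group)

lemma left_module_hom_compose:
  assumes "f \<in> left_module_hom A M N" "g \<in> left_module_hom A N P" "left_module A M"
  shows "compose (carrier M) g f \<in> left_module_hom A M P"
proof -
  interpret M: abelian_group M using assms(3) by (rule left_module_group)
  show ?thesis
    using assms by (auto simp: left_module_hom_def additive_on_def compose_def left_module_closed PiE_iff Pi_iff)
qed

lemma left_module_hom_inverse:
  assumes f: "f \<in> left_module_hom A M N" and M: "left_module A M" and N: "left_module A N"
    and g: "g \<in> extensional (carrier N)" "\<And>y. y \<in> carrier N \<Longrightarrow> g y \<in> carrier M"
    and gf: "\<And>x. x \<in> carrier M \<Longrightarrow> g (f x) = x" and fg: "\<And>y. y \<in> carrier N \<Longrightarrow> f (g y) = y"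
  shows "g \<in> left_module_hom A N M"
proof -
  interpret M: abelian_group M using M by (rule left_module_group)
  have "g (x \<oplus>\<^bsub>N\<^esub> y) = g x \<oplus>\<^bsub>M\<^esub> g y" if "x \<in> carrier N" "y \<in> carrier N" for x y
    using gf[of "g x \<oplus>\<^bsub>M\<^esub> g y"] that g fg additive_on_add[OF left_module_hom_additive[OF f]] by simp
  moreover have "g (a \<odot>\<^bsub>N\<^esub> y) = a \<odot>\<^bsub>M\<^esub> g y" if "a \<in> carrier A" "y \<in> carrier N" for a y
    using gf[of "a \<odot>\<^bsub>M\<^esub> g y"] that g fg left_module_hom_smult[OF f] left_module_closed[OF M] by simp
  ultimately show ?thesis using g by (auto simp: left_module_hom_iff intro: additive_onI)
qed

section \<open>Modules over a bialgebroid\<close>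

lemma via_simps [simp]:
  "carrier (via_tgt B M) = carrier M" "add (via_tgt B M) = add M" "zero (via_tgt B M) = zero M"
  "carrier (via_src B M) = carrier M" "add (via_src B M) = add M" "zero (via_src B M) = zero M"
  "smult (via_tgt B M) = (\<lambda>l m. tgt B l \<odot>\<^bsub>M\<^esub> m)" "smult (via_src B M) = (\<lambda>l m. src B l \<odot>\<^bsub>M\<^esub> m)"
  "mult (via_tgt B M) = mult M" "mult (via_src B M) = mult M"
  "one (via_tgt B M) = one M" "one (via_src B M) = one M"
  by (simp_all add: via_tgt_def via_src_def)

lemma additive_on_cong':
  "additive_on M N f \<Longrightarrow> carrier M' = carrier M \<Longrightarrow> add M' = add M \<Longrightarrow>
   carrier N' = carrier N \<Longrightarrow> add N' = add N \<Longrightarrow> additive_on M' N' f"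
  by (simp add: additive_on_def)

text \<open>The part of a bialgebroid that concerns source and target alone. It suffices to form
  tensor products over \<open>L\<close> as abelian groups, so that for the smash product the tensor
  square is at hand while the axioms of the comultiplication are still to be proved.\<close>

locale prebialg =
  fixes K :: "'a univ ring" and L :: "'a univ base_alg" and B :: "'a univ bialgebroid_data"
  assumes alg_L: "k_algebra K L" and alg_B: "k_algebra K B"
    and src_hom: "k_algebra_hom K L B (src B)" and tgt_antihom: "k_algebra_antihom K L B (tgt B)"
    and commute_bd: "\<forall>l\<in>carrier L. \<forall>m\<in>carrier L. src B l \<otimes>\<^bsub>B\<^esub> tgt B m = tgt B m \<otimes>\<^bsub>B\<^esub> src B l"
begin

abbreviation "RB \<equiv> regular B"
abbreviation "lmod M \<equiv> left_module B M"
abbreviation bal where "bal M N A F \<equiv> balanced L (via_tgt B M) (via_src B N) A F"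
abbreviation bp where "bp M N m n \<equiv> bcls L B M N [(m, n)]"
abbreviation bt where "bt M N \<equiv> btensor L B M N"
text \<open>Literally the record in which \<open>bialgebroid\<close> lets the comultiplication take
  its values. Its scalar action is a formula on lists and only later agrees with the action of
  \<open>src B l\<close> on a tensor product of modules.\<close>

abbreviation "BB \<equiv> (tensor L (via_tgt B (regular B)) (via_src B (regular B)))
           \<lparr> smult := (\<lambda>l z. bcls L B (regular B) (regular B) [(src B l \<otimes>\<^bsub>B\<^esub> a, b). (a, b) \<leftarrow> tlist z]) \<rparr>"

lemma ring_L: "ring L" and ring_B: "ring B"
  using alg_L alg_B by (simp_all add: k_algebra_def)

lemma lmod_RB: "lmod RB"
  by (rule left_module_regular[OF ring_B])

lemma src_additive: "additive_on L B (src B)" and tgt_additive: "additive_on L B (tgt B)"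
  and src_one: "src B \<one>\<^bsub>L\<^esub> = \<one>\<^bsub>B\<^esub>" and tgt_one: "tgt B \<one>\<^bsub>L\<^esub> = \<one>\<^bsub>B\<^esub>"
  and src_mult: "l \<in> carrier L \<Longrightarrow> m \<in> carrier L \<Longrightarrow> src B (l \<otimes>\<^bsub>L\<^esub> m) = src B l \<otimes>\<^bsub>B\<^esub> src B m"
  and tgt_mult: "l \<in> carrier L \<Longrightarrow> m \<in> carrier L \<Longrightarrow> tgt B (l \<otimes>\<^bsub>L\<^esub> m) = tgt B m \<otimes>\<^bsub>B\<^esub> tgt B l"
  and src_tgt_commute:
    "l \<in> carrier L \<Longrightarrow> m \<in> carrier L \<Longrightarrow> src B l \<otimes>\<^bsub>B\<^esub> tgt B m = tgt B m \<otimes>\<^bsub>B\<^esub> src B l"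
  using src_hom tgt_antihom commute_bd
  by (simp_all add: k_algebra_hom_def k_algebra_antihom_def k_linear_def)

lemma src_closed [simp]: "l \<in> carrier L \<Longrightarrow> src B l \<in> carrier B"
  and tgt_closed [simp]: "l \<in> carrier L \<Longrightarrow> tgt B l \<in> carrier B"
  using additive_on_closed[OF src_additive] additive_on_closed[OF tgt_additive] by auto

lemma B_mult_closed [simp]: "a \<in> carrier B \<Longrightarrow> b \<in> carrier B \<Longrightarrow> a \<otimes>\<^bsub>B\<^esub> b \<in> carrier B"
  by (simp add: ring.ring_simprules ring_B)

lemma B_one_closed [simp]: "\<one>\<^bsub>B\<^esub> \<in> carrier B"
  by (simp add: ring.ring_simprules ring_B)

lemma L_mult_closed [simp]: "a \<in> carrier L \<Longrightarrow> b \<in> carrier L \<Longrightarrow> a \<otimes>\<^bsub>L\<^esub> b \<in> carrier L"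
  by (simp add: ring.ring_simprules ring_L)

lemma L_one_closed [simp]: "\<one>\<^bsub>L\<^esub> \<in> carrier L"
  by (simp add: ring.ring_simprules ring_L)

lemma B_assoc: "a \<in> carrier B \<Longrightarrow> b \<in> carrier B \<Longrightarrow> c \<in> carrier B \<Longrightarrow>
    (a \<otimes>\<^bsub>B\<^esub> b) \<otimes>\<^bsub>B\<^esub> c = a \<otimes>\<^bsub>B\<^esub> (b \<otimes>\<^bsub>B\<^esub> c)"
  by (simp add: ring.ring_simprules ring_B)

lemma B_one [simp]: "b \<in> carrier B \<Longrightarrow> \<one>\<^bsub>B\<^esub> \<otimes>\<^bsub>B\<^esub> b = b" "b \<in> carrier B \<Longrightarrow> b \<otimes>\<^bsub>B\<^esub> \<one>\<^bsub>B\<^esub> = b"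
  using ring.is_monoid[OF ring_B] by (simp_all add: monoid.l_one monoid.r_one)

lemma L_one [simp]: "b \<in> carrier L \<Longrightarrow> \<one>\<^bsub>L\<^esub> \<otimes>\<^bsub>L\<^esub> b = b" "b \<in> carrier L \<Longrightarrow> b \<otimes>\<^bsub>L\<^esub> \<one>\<^bsub>L\<^esub> = b"
  using ring.is_monoid[OF ring_L] by (simp_all add: monoid.l_one monoid.r_one)

lemma pair: "lmod M \<Longrightarrow> lmod N \<Longrightarrow> tensor_pair L (via_tgt B M) (via_src B N)"
  by (rule tensor_pair.intro)
    (simp_all add: left_module_closed abelian_group_cong[OF left_module_group])

lemma pair_BB: "tensor_pair L (via_tgt B RB) (via_src B RB)"
  by (rule pair[OF lmod_RB lmod_RB])

subsection \<open>The tensor product of modules\<close>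

lemma btensor_simps:
  "carrier (bt M N) = carrier (tensor L (via_tgt B M) (via_src B N))"
  "add (bt M N) = add (tensor L (via_tgt B M) (via_src B N))"
  "zero (bt M N) = zero (tensor L (via_tgt B M) (via_src B N))"
  by (simp_all add: btensor_def)

lemma tsum_btensor: "tsum (bt M N) = tsum (tensor L (via_tgt B M) (via_src B N))"
  by (rule tsum_cong_record) (simp_all add: btensor_simps)

lemma group_bt: "lmod M \<Longrightarrow> lmod N \<Longrightarrow> abelian_group (bt M N)"
  by (rule abelian_group_cong[OF tensor_pair.group_T[OF pair]]) (simp_all add: btensor_simps)

lemma balI:
  "(\<And>m. m \<in> carrier M \<Longrightarrow> additive_on N A (\<lambda>n. F m n)) \<Longrightarrow>
   (\<And>n. n \<in> carrier N \<Longrightarrow> additive_on M A (\<lambda>m. F m n)) \<Longrightarrow>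
   (\<And>l m n. l \<in> carrier L \<Longrightarrow> m \<in> carrier M \<Longrightarrow> n \<in> carrier N \<Longrightarrow>
     F (tgt B l \<odot>\<^bsub>M\<^esub> m) n = F m (src B l \<odot>\<^bsub>N\<^esub> n)) \<Longrightarrow> bal M N A F"
  by (auto simp: balanced_def additive_on_def)

lemma bal_left: "bal M N A F \<Longrightarrow> n \<in> carrier N \<Longrightarrow> additive_on M A (\<lambda>m. F m n)"
  and bal_right: "bal M N A F \<Longrightarrow> m \<in> carrier M \<Longrightarrow> additive_on N A (\<lambda>n. F m n)"
  and bal_balance: "bal M N A F \<Longrightarrow> l \<in> carrier L \<Longrightarrow> m \<in> carrier M \<Longrightarrow> n \<in> carrier N \<Longrightarrow>
     F (tgt B l \<odot>\<^bsub>M\<^esub> m) n = F m (src B l \<odot>\<^bsub>N\<^esub> n)"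
  and bal_closed: "bal M N A F \<Longrightarrow> m \<in> carrier M \<Longrightarrow> n \<in> carrier N \<Longrightarrow> F m n \<in> carrier A"
  by (auto simp: balanced_def additive_on_def)

context
  fixes M N :: "('a univ, 'a univ) module" assumes M: "lmod M" and N: "lmod N"
begin

lemma bp_closed: "m \<in> carrier M \<Longrightarrow> n \<in> carrier N \<Longrightarrow> bp M N m n \<in> carrier (bt M N)"
  unfolding bcls_def btensor_simps by (rule tensor_pair.pure_closed[OF pair[OF M N]]) simp_all

lemma bal_bp: "bal M N (bt M N) (bp M N)"
  using tensor_pair.balanced_pure[OF pair[OF M N]]
  by (simp add: balanced_def additive_on_def bcls_def btensor_simps)

lemma bp_balance:
  "l \<in> carrier L \<Longrightarrow> m \<in> carrier M \<Longrightarrow> n \<in> carrier N \<Longrightarrow>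
   bp M N (tgt B l \<odot>\<^bsub>M\<^esub> m) n = bp M N m (src B l \<odot>\<^bsub>N\<^esub> n)"
  by (rule bal_balance[OF bal_bp])

lemma additive_on_bp_left:
  "additive_on P M f \<Longrightarrow> n \<in> carrier N \<Longrightarrow> additive_on P (bt M N) (\<lambda>x. bp M N (f x) n)"
  by (rule additive_on_comp[OF _ bal_left[OF bal_bp]])

lemma additive_on_bp_right:
  "additive_on P N f \<Longrightarrow> m \<in> carrier M \<Longrightarrow> additive_on P (bt M N) (\<lambda>x. bp M N m (f x))"
  by (rule additive_on_comp[OF _ bal_right[OF bal_bp]])

lemma btsum_pure:
  "abelian_group A \<Longrightarrow> bal M N A F \<Longrightarrow> m \<in> carrier M \<Longrightarrow> n \<in> carrier N \<Longrightarrow>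
   tsum A F (bp M N m n) = F m n"
  unfolding bcls_def by (rule tensor_pair.tsum_pure[OF pair[OF M N]]) simp_all

lemma btsum_additive:
  "abelian_group A \<Longrightarrow> bal M N A F \<Longrightarrow> additive_on (bt M N) A (tsum A F)"
  using tensor_pair.tsum_additive[OF pair[OF M N]] by (simp add: additive_on_def btensor_simps)

lemma btsum_additive_inner:
  "abelian_group A \<Longrightarrow> t \<in> carrier (bt M N) \<Longrightarrow>
   (\<And>m n. m \<in> carrier M \<Longrightarrow> n \<in> carrier N \<Longrightarrow> additive_on P A (\<lambda>x. F x m n)) \<Longrightarrow>
   additive_on P A (\<lambda>x. tsum A (F x) t)"
  by (rule tensor_pair.additive_on_tsum_inner[OF pair[OF M N]]) (simp_all add: btensor_simps)

lemma btsum_cong: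
  "(\<And>m n. m \<in> carrier M \<Longrightarrow> n \<in> carrier N \<Longrightarrow> F m n = G m n) \<Longrightarrow>
   t \<in> carrier (bt M N) \<Longrightarrow> tsum A F t = tsum A G t"
  by (rule tensor_pair.tsum_cong[OF pair[OF M N]]) (simp_all add: btensor_simps)

lemma bt_eqI:
  assumes "abelian_group A" "additive_on (bt M N) A f" "additive_on (bt M N) A g" "t \<in> carrier (bt M N)"
    "\<And>m n. m \<in> carrier M \<Longrightarrow> n \<in> carrier N \<Longrightarrow> f (bp M N m n) = g (bp M N m n)"
  shows "f t = g t"
  by (rule tensor_pair.tensor_eqI[OF pair[OF M N], of A])
    (use assms in \<open>simp_all add: additive_on_def btensor_simps bcls_def\<close>)

lemma bcls_map:
  assumes "\<And>m n. m \<in> carrier M \<Longrightarrow> n \<in> carrier N \<Longrightarrow> f m n \<in> carrier P"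
    "\<And>m n. m \<in> carrier M \<Longrightarrow> n \<in> carrier N \<Longrightarrow> g m n \<in> carrier Q"
    "lmod P" "lmod Q" "t \<in> carrier (bt M N)"
  shows "bcls L B P Q (map (\<lambda>(m, n). (f m n, g m n)) (tlist t)) =
    tsum (bt P Q) (\<lambda>m n. bp P Q (f m n) (g m n)) t"
  unfolding bcls_def tsum_btensor
  by (rule tensor_pair.tcls_map[OF pair[OF M N] _ _ pair]) (use assms in \<open>simp_all add: btensor_simps\<close>)

lemma bcls_concat:
  assumes "\<And>m n. m \<in> carrier M \<Longrightarrow> n \<in> carrier N \<Longrightarrow> set (h m n) \<subseteq> carrier P \<times> carrier Q"
    "lmod P" "lmod Q" "t \<in> carrier (bt M N)"
  shows "bcls L B P Q (concat (map (\<lambda>(m, n). h m n) (tlist t))) =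
    tsum (bt P Q) (\<lambda>m n. bcls L B P Q (h m n)) t"
  unfolding bcls_def tsum_btensor
  by (rule tensor_pair.tcls_concat[OF pair[OF M N] _ pair]) (use assms in \<open>simp_all add: btensor_simps\<close>)
end

end

section \<open>The single axioms of a bialgebroid\<close>

locale bialg = prebialg +
  assumes bialgebroid: "bialgebroid K L B"
begin

lemmas bd5 = bialgebroid[unfolded bialgebroid_def Let_def, THEN conjunct2, THEN conjunct2, THEN conjunct2,
  THEN conjunct2, THEN conjunct2]
lemmas comul_add_bd = bd5[THEN conjunct1] and bd6 = bd5[THEN conjunct2]
lemmas comul_bimod = bd6[THEN conjunct1] and bd7 = bd6[THEN conjunct2]
lemmas takeuchi_bd = bd7[THEN conjunct1] and bd8 = bd7[THEN conjunct2]
lemmas comul_one_bd = bd8[THEN conjunct1] and bd9 = bd8[THEN conjunct2]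
lemmas comul_mult_bd = bd9[THEN conjunct1] and bd10 = bd9[THEN conjunct2]
lemmas coassoc_bd = bd10[THEN conjunct1] and bd11 = bd10[THEN conjunct2]
lemmas counit_add_bd = bd11[THEN conjunct1] and bd12 = bd11[THEN conjunct2]
lemmas counit_bimod = bd12[THEN conjunct1] and bd13 = bd12[THEN conjunct2]
lemmas counit_one_bd = bd13[THEN conjunct1] and bd14 = bd13[THEN conjunct2]
lemmas counit_mult_bd = bd14[THEN conjunct1] and counit_bd = bd14[THEN conjunct2]

lemma counit_additive: "additive_on B L (bcounit B)"
  and counit_src: "l \<in> carrier L \<Longrightarrow> a \<in> carrier B \<Longrightarrow> bcounit B (src B l \<otimes>\<^bsub>B\<^esub> a) = l \<otimes>\<^bsub>L\<^esub> bcounit B a"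
  and counit_tgt: "l \<in> carrier L \<Longrightarrow> a \<in> carrier B \<Longrightarrow> bcounit B (tgt B l \<otimes>\<^bsub>B\<^esub> a) = bcounit B a \<otimes>\<^bsub>L\<^esub> l"
  and counit_one: "bcounit B \<one>\<^bsub>B\<^esub> = \<one>\<^bsub>L\<^esub>"
  and counit_mult_src: "a \<in> carrier B \<Longrightarrow> b \<in> carrier B \<Longrightarrow>
    bcounit B (a \<otimes>\<^bsub>B\<^esub> src B (bcounit B b)) = bcounit B (a \<otimes>\<^bsub>B\<^esub> b)"
  by (rule counit_add_bd) (use counit_bimod counit_one_bd counit_mult_bd in simp_all)

lemma counit_closed [simp]: "b \<in> carrier B \<Longrightarrow> bcounit B b \<in> carrier L"
  using additive_on_closed[OF counit_additive] .

subsection \<open>Comultiplication in Sweedler notation\<close>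

lemma comul_additive:
  "additive_on B (tensor L (via_tgt B RB) (via_src B RB)) (bcomul B)"
proof -
  have "additive_on B BB (bcomul B)" by (rule comul_add_bd)
  thus ?thesis by (rule additive_on_cong') simp_all
qed

lemma comul_closed [simp]:
  "a \<in> carrier B \<Longrightarrow> bcomul B a \<in> carrier (tensor L (via_tgt B RB) (via_src B RB))"
  using additive_on_closed[OF comul_additive] .

lemma bsum_closed:
  "abelian_group A \<Longrightarrow> (\<And>p q. p \<in> carrier B \<Longrightarrow> q \<in> carrier B \<Longrightarrow> F p q \<in> carrier A) \<Longrightarrow>
   b \<in> carrier B \<Longrightarrow> tsum A F (bcomul B b) \<in> carrier A"
  by (rule tensor_pair.tsum_closed[OF pair_BB]) auto

lemma bsum_cong:
  "(\<And>p q. p \<in> carrier B \<Longrightarrow> q \<in> carrier B \<Longrightarrow> F p q = G p q) \<Longrightarrow>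
   b \<in> carrier B \<Longrightarrow> tsum A F (bcomul B b) = tsum A G (bcomul B b)"
  by (rule tensor_pair.tsum_cong[OF pair_BB]) auto

lemma bsum_additive:
  "abelian_group A \<Longrightarrow> bal RB RB A F \<Longrightarrow> additive_on P B f \<Longrightarrow>
   additive_on P A (\<lambda>x. tsum A F (bcomul B (f x)))"
  using additive_on_comp[OF additive_on_comp[OF _ comul_additive] tensor_pair.tsum_additive[OF pair_BB], of P f A F]
  by simp

lemma bsum_additive_inner:
  "abelian_group A \<Longrightarrow> b \<in> carrier B \<Longrightarrow>
   (\<And>p q. p \<in> carrier B \<Longrightarrow> q \<in> carrier B \<Longrightarrow> additive_on P A (\<lambda>x. F x p q)) \<Longrightarrow>
   additive_on P A (\<lambda>x. tsum A (F x) (bcomul B b))"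
  by (rule tensor_pair.additive_on_tsum_inner[OF pair_BB]) auto

text \<open>The axioms equate classes of modified lists; applying the additive map induced by a
  balanced \<open>F\<close> turns them into equations between Sweedler sums.\<close>

lemma bsum_tcls:
  assumes A: "abelian_group A" and F: "bal RB RB A F" and b: "b \<in> carrier B"
    and "\<And>p q. p \<in> carrier B \<Longrightarrow> q \<in> carrier B \<Longrightarrow> f p q \<in> carrier B"
    and "\<And>p q. p \<in> carrier B \<Longrightarrow> q \<in> carrier B \<Longrightarrow> g p q \<in> carrier B"
  shows "tsum A F (bcls L B RB RB (map (\<lambda>(p, q). (f p q, g p q)) (tlist (bcomul B b)))) =
    tsum A (\<lambda>p q. F (f p q) (g p q)) (bcomul B b)"
proof -
  have l: "set (map (\<lambda>(p, q). (f p q, g p q)) (tlist (bcomul B b))) \<subseteq> carrier B \<times> carrier B"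
    by (rule tensor_pair.tlist_map_valid[OF pair_BB]) (use assms in auto)
  hence "tsum A F (bcls L B RB RB (map (\<lambda>(p, q). (f p q, g p q)) (tlist (bcomul B b)))) =
    lsum A (map (\<lambda>(m, n). F m n) (map (\<lambda>(p, q). (f p q, g p q)) (tlist (bcomul B b))))"
    unfolding bcls_def by (intro tensor_pair.tsum_tcls[OF pair_BB A F]) simp
  thus ?thesis by (simp add: tsum_def comp_def case_prod_unfold)
qed

lemma bsum_src:
  assumes A: "abelian_group A" and F: "bal RB RB A F" and l: "l \<in> carrier L" and b: "b \<in> carrier B"
  shows "tsum A F (bcomul B (src B l \<otimes>\<^bsub>B\<^esub> b)) = tsum A (\<lambda>p q. F (src B l \<otimes>\<^bsub>B\<^esub> p) q) (bcomul B b)"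
proof -
  have "bcomul B (src B l \<otimes>\<^bsub>B\<^esub> b) =
    bcls L B RB RB [(src B l \<otimes>\<^bsub>B\<^esub> a1, a2). (a1, a2) \<leftarrow> tlist (bcomul B b)]"
    using comul_bimod l b by simp
  thus ?thesis using bsum_tcls[OF A F b, of "\<lambda>p q. src B l \<otimes>\<^bsub>B\<^esub> p" "\<lambda>p q. q"] l by simp
qed

lemma bsum_tgt:
  assumes A: "abelian_group A" and F: "bal RB RB A F" and l: "l \<in> carrier L" and b: "b \<in> carrier B"
  shows "tsum A F (bcomul B (tgt B l \<otimes>\<^bsub>B\<^esub> b)) = tsum A (\<lambda>p q. F p (tgt B l \<otimes>\<^bsub>B\<^esub> q)) (bcomul B b)"
proof -
  have "bcomul B (tgt B l \<otimes>\<^bsub>B\<^esub> b) =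
    bcls L B RB RB [(a1, tgt B l \<otimes>\<^bsub>B\<^esub> a2). (a1, a2) \<leftarrow> tlist (bcomul B b)]"
    using comul_bimod l b by simp
  thus ?thesis using bsum_tcls[OF A F b, of "\<lambda>p q. p" "\<lambda>p q. tgt B l \<otimes>\<^bsub>B\<^esub> q"] l by simp
qed

lemma bsum_takeuchi:
  assumes A: "abelian_group A" and F: "bal RB RB A F" and l: "l \<in> carrier L" and b: "b \<in> carrier B"
  shows "tsum A (\<lambda>p q. F (p \<otimes>\<^bsub>B\<^esub> tgt B l) q) (bcomul B b) =
    tsum A (\<lambda>p q. F p (q \<otimes>\<^bsub>B\<^esub> src B l)) (bcomul B b)"
proof -
  have "bcls L B RB RB [(a1 \<otimes>\<^bsub>B\<^esub> tgt B l, a2). (a1, a2) \<leftarrow> tlist (bcomul B b)] =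
    bcls L B RB RB [(a1, a2 \<otimes>\<^bsub>B\<^esub> src B l). (a1, a2) \<leftarrow> tlist (bcomul B b)]"
    using takeuchi_bd l b by simp
  thus ?thesis using bsum_tcls[OF A F b, of "\<lambda>p q. p \<otimes>\<^bsub>B\<^esub> tgt B l" "\<lambda>p q. q"]
    bsum_tcls[OF A F b, of "\<lambda>p q. p" "\<lambda>p q. q \<otimes>\<^bsub>B\<^esub> src B l"] l by simp
qed

lemma bsum_one:
  assumes A: "abelian_group A" and F: "bal RB RB A F"
  shows "tsum A F (bcomul B \<one>\<^bsub>B\<^esub>) = F \<one>\<^bsub>B\<^esub> \<one>\<^bsub>B\<^esub>"
proof -
  have "bcomul B \<one>\<^bsub>B\<^esub> = \<one>\<^bsub>BB\<^esub>" by (rule comul_one_bd)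
  also have "\<dots> = tcls L (via_tgt B RB) (via_src B RB) [(\<one>\<^bsub>B\<^esub>, \<one>\<^bsub>B\<^esub>)]" by (simp add: tensor_def)
  finally show ?thesis using tensor_pair.tsum_pure[OF pair_BB A F, of "\<one>\<^bsub>B\<^esub>" "\<one>\<^bsub>B\<^esub>"] by simp
qed

lemma bsum_mult:
  assumes A: "abelian_group A" and F: "bal RB RB A F" and a: "a \<in> carrier B" and b: "b \<in> carrier B"
  shows "tsum A F (bcomul B (a \<otimes>\<^bsub>B\<^esub> b)) =
    tsum A (\<lambda>p q. tsum A (\<lambda>p' q'. F (p \<otimes>\<^bsub>B\<^esub> p') (q \<otimes>\<^bsub>B\<^esub> q')) (bcomul B b)) (bcomul B a)"
proof -
  let ?h = "\<lambda>p q. map (\<lambda>(p', q'). (p \<otimes>\<^bsub>B\<^esub> p', q \<otimes>\<^bsub>B\<^esub> q')) (tlist (bcomul B b))"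
  let ?T = "tensor L (via_tgt B RB) (via_src B RB)"
  have val: "set (?h p q) \<subseteq> carrier B \<times> carrier B" if "p \<in> carrier B" "q \<in> carrier B" for p q
    by (rule tensor_pair.tlist_map_valid[OF pair_BB]) (use that b in auto)
  have "bcomul B (a \<otimes>\<^bsub>B\<^esub> b) = bcomul B a \<otimes>\<^bsub>BB\<^esub> bcomul B b"
    using comul_mult_bd a b by simp
  also have "\<dots> = tcls L (via_tgt B RB) (via_src B RB) (concat (map (\<lambda>(p, q). ?h p q) (tlist (bcomul B a))))"
    by (simp add: tensor_def)
  also have "\<dots> = tsum ?T (\<lambda>p q. tcls L (via_tgt B RB) (via_src B RB) (?h p q)) (bcomul B a)"
    by (rule tensor_pair.tcls_concat[OF pair_BB]) (use val pair_BB a in \<open>auto simp del: set_map\<close>)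
  finally have "tsum A F (bcomul B (a \<otimes>\<^bsub>B\<^esub> b)) = tsum A F (\<dots>)" by simp
  also have "\<dots> = tsum A (\<lambda>p q. tsum A F (tcls L (via_tgt B RB) (via_src B RB) (?h p q))) (bcomul B a)"
    using val a
    by (intro tensor_pair.tsum_hom[OF pair_BB tensor_pair.group_T[OF pair_BB] A
          tensor_pair.tsum_additive[OF pair_BB A F]] tensor_pair.tcls_closed[OF pair_BB]) auto
  also have "\<dots> = tsum A (\<lambda>p q. tsum A (\<lambda>p' q'. F (p \<otimes>\<^bsub>B\<^esub> p') (q \<otimes>\<^bsub>B\<^esub> q')) (bcomul B b)) (bcomul B a)"
    using bsum_tcls[OF A F b] a by (intro bsum_cong) (auto simp: bcls_def)
  finally show ?thesis .
qed

lemma bsum_hom: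
  "abelian_group A \<Longrightarrow> abelian_group A' \<Longrightarrow> additive_on A A' f \<Longrightarrow>
   (\<And>p q. p \<in> carrier B \<Longrightarrow> q \<in> carrier B \<Longrightarrow> F p q \<in> carrier A) \<Longrightarrow> b \<in> carrier B \<Longrightarrow>
   f (tsum A F (bcomul B b)) = tsum A' (\<lambda>p q. f (F p q)) (bcomul B b)"
  by (rule tensor_pair.tsum_hom[OF pair_BB]) auto

section \<open>The diagonal action on a tensor product over \<open>L\<close>\<close>

context
  fixes M N :: "('a univ, 'a univ) module" assumes M: "lmod M" and N: "lmod N"
begin

lemmas mod_closed = left_module_closed[OF M] left_module_closed[OF N]

lemma bal_act:
  "m \<in> carrier M \<Longrightarrow> n \<in> carrier N \<Longrightarrow> bal RB RB (bt M N) (\<lambda>p q. bp M N (p \<odot>\<^bsub>M\<^esub> m) (q \<odot>\<^bsub>N\<^esub> n))"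
  using M N
  by (intro balI additive_on_bp_left[OF M N] additive_on_bp_right[OF M N] additive_on_smult_left)
    (auto simp: left_module_mult bp_balance[OF M N] left_module_closed additive_on_def)

definition bact where
  "bact b m n = tsum (bt M N) (\<lambda>p q. bp M N (p \<odot>\<^bsub>M\<^esub> m) (q \<odot>\<^bsub>N\<^esub> n)) (bcomul B b)"

text \<open>The diagonal action descends to the tensor product over \<open>L\<close> by the Takeuchi
  condition: t(l) on \<open>m\<close> is absorbed as p t(l) into the first leg of the coproduct,
  becomes q s(l) on the second leg, and is released as s(l) on \<open>n\<close>.\<close>

lemma bal_bact: "b \<in> carrier B \<Longrightarrow> bal M N (bt M N) (bact b)"
  unfolding bact_def
proof (intro balI bsum_additive_inner group_bt M N additive_on_bp_left[OF M N] additive_on_bp_right[OF M N]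
    additive_on_smult_right additive_on_id, simp_all add: M N mod_closed)
  fix l m n assume b: "b \<in> carrier B" and lmn: "l \<in> carrier L" "m \<in> carrier M" "n \<in> carrier N"
  have "tsum (bt M N) (\<lambda>p q. bp M N (p \<odot>\<^bsub>M\<^esub> (tgt B l \<odot>\<^bsub>M\<^esub> m)) (q \<odot>\<^bsub>N\<^esub> n)) (bcomul B b) =
    tsum (bt M N) (\<lambda>p q. bp M N ((p \<otimes>\<^bsub>B\<^esub> tgt B l) \<odot>\<^bsub>M\<^esub> m) (q \<odot>\<^bsub>N\<^esub> n)) (bcomul B b)"
    using b lmn by (intro bsum_cong) (simp_all add: left_module_mult[OF M])
  also have "\<dots> = tsum (bt M N) (\<lambda>p q. bp M N (p \<odot>\<^bsub>M\<^esub> m) ((q \<otimes>\<^bsub>B\<^esub> src B l) \<odot>\<^bsub>N\<^esub> n)) (bcomul B b)"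
    by (rule bsum_takeuchi[OF group_bt[OF M N] bal_act]) fact+
  also have "\<dots> = tsum (bt M N) (\<lambda>p q. bp M N (p \<odot>\<^bsub>M\<^esub> m) (q \<odot>\<^bsub>N\<^esub> (src B l \<odot>\<^bsub>N\<^esub> n))) (bcomul B b)"
    using b lmn by (intro bsum_cong) (simp_all add: left_module_mult[OF N])
  finally show "tsum (bt M N) (\<lambda>p q. bp M N (p \<odot>\<^bsub>M\<^esub> (tgt B l \<odot>\<^bsub>M\<^esub> m)) (q \<odot>\<^bsub>N\<^esub> n)) (bcomul B b) =
    tsum (bt M N) (\<lambda>p q. bp M N (p \<odot>\<^bsub>M\<^esub> m) (q \<odot>\<^bsub>N\<^esub> (src B l \<odot>\<^bsub>N\<^esub> n))) (bcomul B b)" .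
qed

text \<open>The defining list runs over the coproduct outside and over the tensor inside. The order
  is reversed, because for a single summand p \<otimes> q of the coproduct the map m \<otimes> n to
  pm \<otimes> qn need not be balanced, whereas the total \<open>bact b\<close> is.\<close>

lemma bt_smult:
  assumes b: "b \<in> carrier B" and t: "t \<in> carrier (bt M N)"
  shows "b \<odot>\<^bsub>bt M N\<^esub> t = tsum (bt M N) (bact b) t"
proof -
  let ?h = "\<lambda>p q. map (\<lambda>(m, n). (p \<odot>\<^bsub>M\<^esub> m, q \<odot>\<^bsub>N\<^esub> n)) (tlist t)"
  let ?T = "tensor L (via_tgt B M) (via_src B N)"
  have t': "t \<in> carrier ?T" using t by (simp add: btensor_simps)
  have val: "set (?h p q) \<subseteq> carrier M \<times> carrier N" if "p \<in> carrier B" "q \<in> carrier B" for p q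
    by (rule tensor_pair.tlist_map_valid[OF pair[OF M N] _ _ t'])
      (use that in \<open>auto intro: mod_closed\<close>)
  have "b \<odot>\<^bsub>bt M N\<^esub> t = tcls L (via_tgt B M) (via_src B N) (concat (map (\<lambda>(p, q). ?h p q) (tlist (bcomul B b))))"
    by (simp add: btensor_def bcls_def)
  also have "\<dots> = tsum ?T (\<lambda>p q. tcls L (via_tgt B M) (via_src B N) (?h p q)) (bcomul B b)"
    by (rule tensor_pair.tcls_concat[OF pair_BB]) (use val pair[OF M N] b in \<open>auto simp del: set_map\<close>)
  also have "\<dots> = tsum (bt M N) (\<lambda>p q. tsum (bt M N) (\<lambda>m n. bp M N (p \<odot>\<^bsub>M\<^esub> m) (q \<odot>\<^bsub>N\<^esub> n)) t) (bcomul B b)"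
    unfolding tsum_btensor using b t
    by (intro bsum_cong) (auto simp: bcls_map[OF M N _ _ M N t, unfolded bcls_def tsum_btensor] bcls_def mod_closed)
  also have "\<dots> = tsum (bt M N) (bact b) t"
    unfolding bact_def
    by (rule tsum_swap[OF pair_BB pair[OF M N] group_bt[OF M N]])
      (use b t' in \<open>auto intro!: bp_closed[OF M N] simp: mod_closed\<close>)
  finally show ?thesis .
qed

lemma bt_smult_pure:
  assumes "b \<in> carrier B" "m \<in> carrier M" "n \<in> carrier N"
  shows "b \<odot>\<^bsub>bt M N\<^esub> bp M N m n =
    tsum (bt M N) (\<lambda>p q. bp M N (p \<odot>\<^bsub>M\<^esub> m) (q \<odot>\<^bsub>N\<^esub> n)) (bcomul B b)"
  using assms
  by (simp add: bt_smult bp_closed[OF M N] btsum_pure[OF M N group_bt[OF M N] bal_bact[OF assms(1)]]) (simp add: bact_def)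

lemma bt_smult_additive: "b \<in> carrier B \<Longrightarrow> additive_on (bt M N) (bt M N) (\<lambda>t. b \<odot>\<^bsub>bt M N\<^esub> t)"
  by (rule additive_on_cong[OF btsum_additive[OF M N group_bt[OF M N] bal_bact] _ group_bt[OF M N]])
    (simp_all add: bt_smult)

text \<open>Unit law and associativity of the action are the unit law and the multiplicativity of
  the comultiplication, read on pure tensors.\<close>

lemma lmod_bt: "lmod (bt M N)"
proof -
  note G = group_bt[OF M N]
  have add: "additive_on B (bt M N) (\<lambda>b. b \<odot>\<^bsub>bt M N\<^esub> t)" if t: "t \<in> carrier (bt M N)" for t
  proof -
    have "additive_on B (bt M N) (\<lambda>b. tsum (bt M N) (bact b) t)"
      by (rule btsum_additive_inner[OF M N G t])
        (auto simp: bact_def intro!: bsum_additive[OF G bal_act additive_on_id])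
    thus ?thesis by (rule additive_on_cong) (use t ring.is_abelian_group[OF ring_B] in \<open>auto simp: bt_smult\<close>)
  qed
  have one: "\<one>\<^bsub>B\<^esub> \<odot>\<^bsub>bt M N\<^esub> t = t" if t: "t \<in> carrier (bt M N)" for t
    by (rule bt_eqI[OF M N G bt_smult_additive additive_on_id t])
      (simp_all add: bt_smult_pure bsum_one[OF G bal_act] left_module_one[OF M] left_module_one[OF N])
  have mult: "(a \<otimes>\<^bsub>B\<^esub> b) \<odot>\<^bsub>bt M N\<^esub> t = a \<odot>\<^bsub>bt M N\<^esub> (b \<odot>\<^bsub>bt M N\<^esub> t)"
    if ab: "a \<in> carrier B" "b \<in> carrier B" and t: "t \<in> carrier (bt M N)" for a b t
  proof (rule bt_eqI[OF M N G bt_smult_additive additive_on_comp[OF bt_smult_additive bt_smult_additive] t])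
    fix m n assume mn: "m \<in> carrier M" "n \<in> carrier N"
    have "(a \<otimes>\<^bsub>B\<^esub> b) \<odot>\<^bsub>bt M N\<^esub> bp M N m n = tsum (bt M N) (\<lambda>p q. tsum (bt M N) (\<lambda>p' q'.
        bp M N ((p \<otimes>\<^bsub>B\<^esub> p') \<odot>\<^bsub>M\<^esub> m) ((q \<otimes>\<^bsub>B\<^esub> q') \<odot>\<^bsub>N\<^esub> n)) (bcomul B b)) (bcomul B a)"
      using ab mn by (simp add: bt_smult_pure bsum_mult[OF G bal_act])
    also have "\<dots> = tsum (bt M N) (\<lambda>p' q'. tsum (bt M N) (\<lambda>p q.
        bp M N ((p \<otimes>\<^bsub>B\<^esub> p') \<odot>\<^bsub>M\<^esub> m) ((q \<otimes>\<^bsub>B\<^esub> q') \<odot>\<^bsub>N\<^esub> n)) (bcomul B a)) (bcomul B b)"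
      by (rule tsum_swap[OF pair_BB pair_BB G])
        (use ab mn in \<open>auto intro!: bp_closed[OF M N] simp: mod_closed\<close>)
    also have "\<dots> = tsum (bt M N) (\<lambda>p' q'. a \<odot>\<^bsub>bt M N\<^esub> bp M N (p' \<odot>\<^bsub>M\<^esub> m) (q' \<odot>\<^bsub>N\<^esub> n)) (bcomul B b)"
      by (rule bsum_cong) (use ab mn in \<open>auto intro!: bsum_cong simp: bt_smult_pure mod_closed left_module_mult[OF M] left_module_mult[OF N]\<close>)
    also have "\<dots> = a \<odot>\<^bsub>bt M N\<^esub> (b \<odot>\<^bsub>bt M N\<^esub> bp M N m n)"
      using ab mn bsum_hom[OF G G bt_smult_additive[OF ab(1)], of "\<lambda>p' q'. bp M N (p' \<odot>\<^bsub>M\<^esub> m) (q' \<odot>\<^bsub>N\<^esub> n)" b]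
      by (simp add: bt_smult_pure bp_closed[OF M N] mod_closed)
    finally show "(a \<otimes>\<^bsub>B\<^esub> b) \<odot>\<^bsub>bt M N\<^esub> bp M N m n = a \<odot>\<^bsub>bt M N\<^esub> (b \<odot>\<^bsub>bt M N\<^esub> bp M N m n)" .
  qed (use ab in simp_all)
  show ?thesis
    unfolding left_module_def
    using add bt_smult_additive one mult ring_B G by (auto simp: additive_on_def)
qed

text \<open>Linearity over \<open>B\<close> is tested on pure tensors, where the action is a sum
  over the coproduct. The tensor product of morphisms and the constraints of the module category are
  obtained in this way.\<close>

lemma bt_homI:
  assumes P: "lmod P" and F: "bal M N P F"
    and eq: "\<And>b m n. b \<in> carrier B \<Longrightarrow> m \<in> carrier M \<Longrightarrow> n \<in> carrier N \<Longrightarrow>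
      tsum P (\<lambda>p q. F (p \<odot>\<^bsub>M\<^esub> m) (q \<odot>\<^bsub>N\<^esub> n)) (bcomul B b) = b \<odot>\<^bsub>P\<^esub> F m n"
  shows "(\<lambda>t\<in>carrier (bt M N). tsum P F t) \<in> left_module_hom B (bt M N) P"
proof -
  note G = group_bt[OF M N] and GP = left_module_group[OF P]
  note add = btsum_additive[OF M N GP F]
  have "tsum P F (b \<odot>\<^bsub>bt M N\<^esub> t) = b \<odot>\<^bsub>P\<^esub> tsum P F t"
    if b: "b \<in> carrier B" and t: "t \<in> carrier (bt M N)" for b t
  proof (rule bt_eqI[OF M N GP additive_on_comp[OF bt_smult_additive add] additive_on_smult_right[OF P add] t])
    fix m n assume mn: "m \<in> carrier M" "n \<in> carrier N"
    show "tsum P F (b \<odot>\<^bsub>bt M N\<^esub> bp M N m n) = b \<odot>\<^bsub>P\<^esub> tsum P F (bp M N m n)"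
      using b mn bsum_hom[OF G GP add, of "\<lambda>p q. bp M N (p \<odot>\<^bsub>M\<^esub> m) (q \<odot>\<^bsub>N\<^esub> n)" b]
      by (simp add: bt_smult_pure btsum_pure[OF M N GP F] bp_closed[OF M N] mod_closed eq
          cong: bsum_cong)
  qed (use b in simp_all)
  thus ?thesis
    using add left_module_closed[OF lmod_bt] abelian_monoid.a_closed[OF abelian_group.axioms(1)[OF G]]
    by (auto simp: left_module_hom_iff additive_on_def)
qed

lemma bt_hom_eqI:
  assumes "f \<in> left_module_hom B (bt M N) P" "g \<in> left_module_hom B (bt M N) P" "lmod P"
    "\<And>m n. m \<in> carrier M \<Longrightarrow> n \<in> carrier N \<Longrightarrow> f (bp M N m n) = g (bp M N m n)"
  shows "f = g"
  by (rule left_module_hom_eqI[OF assms(1,2)], rule bt_eqI[OF M N])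
    (use assms left_module_hom_additive left_module_group in auto)

end

end

section \<open>The category of modules over a bialgebroid\<close>

context bialg
begin

abbreviation "BM \<equiv> BMod L B"
abbreviation "bhom M N \<equiv> left_module_hom B M N"

lemma BMod_simps:
  "Obj BM = {M. lmod M}" "Hom BM = left_module_hom B" "Ident BM M = (\<lambda>x\<in>carrier M. x)"
  "Comp BM M N P f g = compose (carrier M) g f" "tobj BM = btensor L B" "tunit BM = bunit L B"
  by (simp_all add: BMod_def)

lemma comp_apply: "x \<in> carrier M \<Longrightarrow> Comp BM M N P f g x = g (f x)"
  by (simp add: BMod_simps compose_def)

lemma category_BM: "category BM"
  by unfold_locales
    (auto simp: BMod_simps left_module_hom_ident left_module_hom_compose,
      auto simp: compose_def left_module_hom_iff fun_eq_iff restrict_def extensional_def dest: additive_on_closed)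

lemma BMod_inverse_pair:
  assumes f: "f \<in> bhom M N" and M: "lmod M" and N: "lmod N"
    and g: "\<And>y. y \<in> carrier N \<Longrightarrow> g y \<in> carrier M"
    and gf: "\<And>x. x \<in> carrier M \<Longrightarrow> g (f x) = x" and fg: "\<And>y. y \<in> carrier N \<Longrightarrow> f (g y) = y"
  shows "inverse_pair BM M N f (restrict g (carrier N))"
proof -
  have "restrict g (carrier N) \<in> bhom N M"
    by (rule left_module_hom_inverse[OF f M N]) (use g gf fg left_module_hom_closed[OF f] in auto)
  thus ?thesis
    using f g gf fg left_module_hom_closed[OF f]
    by (auto simp: inverse_pair_def BMod_simps compose_def fun_eq_iff restrict_def)
qed

subsection \<open>Tensor product of morphisms\<close>

lemma bal_tmor:
  assumes "lmod M'" "lmod N'" "f \<in> bhom M M'" "g \<in> bhom N N'"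
  shows "bal M N (bt M' N') (\<lambda>m n. bp M' N' (f m) (g n))"
  using assms left_module_hom_additive[OF assms(3)] left_module_hom_additive[OF assms(4)]
  by (intro balI additive_on_bp_left additive_on_bp_right)
    (auto simp: left_module_hom_smult bp_balance additive_on_closed)

context
  fixes M M' N N' :: "('a univ, 'a univ) module" and f g
  assumes M: "lmod M" and M': "lmod M'" and N: "lmod N" and N': "lmod N'"
    and f: "f \<in> bhom M M'" and g: "g \<in> bhom N N'"
begin

lemma tmor_eq:
  "tmor BM M M' N N' f g = (\<lambda>t\<in>carrier (bt M N). tsum (bt M' N') (\<lambda>m n. bp M' N' (f m) (g n)) t)"
  by (simp add: BMod_def)
    (auto intro!: restrict_ext bcls_map[OF M N] M' N' left_module_hom_closed[OF f] left_module_hom_closed[OF g])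

lemma tmor_pure:
  "m \<in> carrier M \<Longrightarrow> n \<in> carrier N \<Longrightarrow> tmor BM M M' N N' f g (bp M N m n) = bp M' N' (f m) (g n)"
  using btsum_pure[OF M N group_bt[OF M' N'] bal_tmor[OF M' N' f g]] bp_closed[OF M N]
  by (simp add: tmor_eq)

lemma tmor_hom: "tmor BM M M' N N' f g \<in> bhom (bt M N) (bt M' N')"
  unfolding tmor_eq
  by (rule bt_homI[OF M N lmod_bt[OF M' N'] bal_tmor[OF M' N' f g]])
    (auto simp: bt_smult_pure[OF M' N'] left_module_hom_closed[OF f] left_module_hom_closed[OF g]
      left_module_hom_smult[OF f] left_module_hom_smult[OF g] intro!: bsum_cong)

end

context
  fixes M N :: "('a univ, 'a univ) module" assumes M: "lmod M" and N: "lmod N"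
begin

text \<open>Write s(l) as s(l) 1. The comultiplication is a bimodule map and sends 1 to 1 \<otimes>
  1, so only the first factor is touched. The summand with s(l) inserted stays balanced because
  source and target images commute.\<close>

lemma bt_src:
  assumes l: "l \<in> carrier L" and m: "m \<in> carrier M" and n: "n \<in> carrier N"
  shows "src B l \<odot>\<^bsub>bt M N\<^esub> bp M N m n = bp M N (src B l \<odot>\<^bsub>M\<^esub> m) n"
proof -
  note G = group_bt[OF M N]
  let ?F = "\<lambda>p q. bp M N (p \<odot>\<^bsub>M\<^esub> m) (q \<odot>\<^bsub>N\<^esub> n)"
  have "bal RB RB (bt M N) (\<lambda>p q. bp M N ((src B l \<otimes>\<^bsub>B\<^esub> p) \<odot>\<^bsub>M\<^esub> m) (q \<odot>\<^bsub>N\<^esub> n))"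
  proof (intro balI additive_on_bp_left additive_on_bp_right additive_on_smult_left[OF M]
        additive_on_smult_left[OF N] additive_on_mult_right M N ring_B additive_on_id)
    fix k p q assume "k \<in> carrier L" "p \<in> carrier RB" "q \<in> carrier RB"
    thus "bp M N ((src B l \<otimes>\<^bsub>B\<^esub> (tgt B k \<odot>\<^bsub>RB\<^esub> p)) \<odot>\<^bsub>M\<^esub> m) (q \<odot>\<^bsub>N\<^esub> n) =
      bp M N ((src B l \<otimes>\<^bsub>B\<^esub> p) \<odot>\<^bsub>M\<^esub> m) ((src B k \<odot>\<^bsub>RB\<^esub> q) \<odot>\<^bsub>N\<^esub> n)"
      using l m n bp_balance[OF M N, of k "(src B l \<otimes>\<^bsub>B\<^esub> p) \<odot>\<^bsub>M\<^esub> m" "q \<odot>\<^bsub>N\<^esub> n"]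
      by (simp add: B_assoc[symmetric] src_tgt_commute mod_closed[OF M N]
          left_module_mult[OF M, symmetric] left_module_mult[OF N, symmetric])
  qed (use l m n in \<open>auto simp: additive_on_def ring.ring_simprules[OF ring_B] mod_closed[OF M N]\<close>)
  from bsum_one[OF G this] show ?thesis
    using l m n bsum_src[OF G bal_act[OF M N m n] l, of "\<one>\<^bsub>B\<^esub>"]
    by (simp add: bt_smult_pure[OF M N] left_module_one[OF N])
qed

lemma bt_tgt:
  assumes l: "l \<in> carrier L" and m: "m \<in> carrier M" and n: "n \<in> carrier N"
  shows "tgt B l \<odot>\<^bsub>bt M N\<^esub> bp M N m n = bp M N m (tgt B l \<odot>\<^bsub>N\<^esub> n)"
proof -
  note G = group_bt[OF M N]
  have "bal RB RB (bt M N) (\<lambda>p q. bp M N (p \<odot>\<^bsub>M\<^esub> m) ((tgt B l \<otimes>\<^bsub>B\<^esub> q) \<odot>\<^bsub>N\<^esub> n))"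
  proof (intro balI additive_on_bp_left additive_on_bp_right additive_on_smult_left[OF M]
        additive_on_smult_left[OF N] additive_on_mult_right M N ring_B additive_on_id)
    fix k p q assume "k \<in> carrier L" "p \<in> carrier RB" "q \<in> carrier RB"
    thus "bp M N ((tgt B k \<odot>\<^bsub>RB\<^esub> p) \<odot>\<^bsub>M\<^esub> m) ((tgt B l \<otimes>\<^bsub>B\<^esub> q) \<odot>\<^bsub>N\<^esub> n) =
      bp M N (p \<odot>\<^bsub>M\<^esub> m) ((tgt B l \<otimes>\<^bsub>B\<^esub> (src B k \<odot>\<^bsub>RB\<^esub> q)) \<odot>\<^bsub>N\<^esub> n)"
      using l m n bp_balance[OF M N, of k "p \<odot>\<^bsub>M\<^esub> m" "(tgt B l \<otimes>\<^bsub>B\<^esub> q) \<odot>\<^bsub>N\<^esub> n"]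
      by (simp add: B_assoc[symmetric] src_tgt_commute[symmetric] mod_closed[OF M N]
          left_module_mult[OF M, symmetric] left_module_mult[OF N, symmetric])
  qed (use l m n in \<open>auto simp: additive_on_def ring.ring_simprules[OF ring_B] mod_closed[OF M N]\<close>)
  from bsum_one[OF G this] show ?thesis
    using l m n bsum_tgt[OF G bal_act[OF M N m n] l, of "\<one>\<^bsub>B\<^esub>"]
    by (simp add: bt_smult_pure[OF M N] left_module_one[OF M])
qed

end

text \<open>The axiom is an equation in a triple tensor product over \<open>L\<close>. It is tested
  against the additive map induced by \<open>G\<close>; \<open>bal12\<close> and
  \<open>bal23\<close> say that \<open>G\<close> is balanced across the first and across the second
  tensor sign.\<close>

lemma bsum_coassoc:
  assumes A: "abelian_group A" and a: "a \<in> carrier B"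
    and G1: "\<And>q r. q \<in> carrier B \<Longrightarrow> r \<in> carrier B \<Longrightarrow> additive_on B A (\<lambda>p. G p q r)"
    and G2: "\<And>p r. p \<in> carrier B \<Longrightarrow> r \<in> carrier B \<Longrightarrow> additive_on B A (\<lambda>q. G p q r)"
    and G3: "\<And>p q. p \<in> carrier B \<Longrightarrow> q \<in> carrier B \<Longrightarrow> additive_on B A (\<lambda>r. G p q r)"
    and bal12: "\<And>l p q r. l \<in> carrier L \<Longrightarrow> p \<in> carrier B \<Longrightarrow> q \<in> carrier B \<Longrightarrow> r \<in> carrier B \<Longrightarrow>
      G (tgt B l \<otimes>\<^bsub>B\<^esub> p) q r = G p (src B l \<otimes>\<^bsub>B\<^esub> q) r"
    and bal23: "\<And>l p q r. l \<in> carrier L \<Longrightarrow> p \<in> carrier B \<Longrightarrow> q \<in> carrier B \<Longrightarrow> r \<in> carrier B \<Longrightarrow>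
      G p (tgt B l \<otimes>\<^bsub>B\<^esub> q) r = G p q (src B l \<otimes>\<^bsub>B\<^esub> r)"
  shows "tsum A (\<lambda>p x. tsum A (\<lambda>q r. G p q r) (bcomul B x)) (bcomul B a) =
    tsum A (\<lambda>x r. tsum A (\<lambda>p q. G p q r) (bcomul B x)) (bcomul B a)"
proof -
  let ?T = "bt RB RB"
  let ?F = "\<lambda>p w. tsum A (G p) w"
  note RB = lmod_RB and T = lmod_bt[OF lmod_RB lmod_RB]
  note GT = group_bt[OF RB RB] and GTT = group_bt[OF RB T]
  have cT: "bcomul B x \<in> carrier ?T" if "x \<in> carrier B" for x
    using that by (simp add: btensor_simps)
  have balG: "bal RB RB A (\<lambda>q r. G p q r)" if "p \<in> carrier B" for p
    by (rule balI) (use that G2 G3 bal23 in \<open>auto simp: additive_on_def\<close>)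
  \<comment> \<open>The action by formula in the axiom is the diagonal action of s(l), by
    \<open>bt_src\<close>.\<close>
  have src: "bcls L B RB RB [(src B l \<otimes>\<^bsub>B\<^esub> q, r). (q, r) \<leftarrow> tlist w] = src B l \<odot>\<^bsub>?T\<^esub> w"
    if l: "l \<in> carrier L" and w: "w \<in> carrier ?T" for l w
  proof -
    have b: "bal RB RB ?T (\<lambda>q r. bp RB RB (src B l \<otimes>\<^bsub>B\<^esub> q) r)"
    proof (intro balI additive_on_bp_left additive_on_bp_right additive_on_mult_right additive_on_id RB ring_B)
      fix k q r assume "k \<in> carrier L" "q \<in> carrier RB" "r \<in> carrier RB"
      thus "bp RB RB (src B l \<otimes>\<^bsub>B\<^esub> (tgt B k \<odot>\<^bsub>RB\<^esub> q)) r = bp RB RB (src B l \<otimes>\<^bsub>B\<^esub> q) (src B k \<odot>\<^bsub>RB\<^esub> r)"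
        using l bp_balance[OF RB RB, of k "src B l \<otimes>\<^bsub>B\<^esub> q" r] by (simp add: B_assoc[symmetric] src_tgt_commute)
    qed (use l in \<open>auto simp: additive_on_def ring.ring_simprules[OF ring_B]\<close>)
    have "bcls L B RB RB [(src B l \<otimes>\<^bsub>B\<^esub> q, r). (q, r) \<leftarrow> tlist w] =
      tsum ?T (\<lambda>q r. bp RB RB (src B l \<otimes>\<^bsub>B\<^esub> q) r) w"
      by (rule bcls_map[OF RB RB _ _ RB RB w]) (use l in auto)
    also have "\<dots> = src B l \<odot>\<^bsub>?T\<^esub> w"
      by (rule bt_eqI[OF RB RB GT btsum_additive[OF RB RB GT b] bt_smult_additive[OF RB RB] w])
        (use l in \<open>auto simp: btsum_pure[OF RB RB GT b] bt_src[OF RB RB]\<close>)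
    finally show ?thesis .
  qed
  \<comment> \<open>Hence the triple tensor product of the axiom has the same classes as the tensor
    product of the modules \<open>RB\<close> and \<open>?T\<close>, to which the general results
    apply.\<close>
  have rec: "tcls L (via_tgt B RB) BB = bcls L B RB ?T"
    unfolding bcls_def
    by (rule tcls_cong_record) (simp_all add: btensor_simps src[unfolded btensor_simps bcls_def] bcls_def)
  have balF: "bal RB ?T A ?F"
  proof (rule balI)
    fix p assume "p \<in> carrier RB"
    thus "additive_on ?T A (tsum A (G p))" using btsum_additive[OF RB RB A balG] by simp
  next
    fix w assume "w \<in> carrier ?T"
    thus "additive_on RB A (\<lambda>p. tsum A (G p) w)"
      by (intro btsum_additive_inner[OF RB RB A]) (auto simp: additive_on_def dest: G1[unfolded additive_on_def])
  next
    fix l p w assume l: "l \<in> carrier L" and p: "p \<in> carrier RB" and w: "w \<in> carrier ?T"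
    have "tsum A (G (tgt B l \<otimes>\<^bsub>B\<^esub> p)) w = tsum A (G p) (src B l \<odot>\<^bsub>?T\<^esub> w)"
      by (rule bt_eqI[OF RB RB A btsum_additive[OF RB RB A balG]
            additive_on_comp[OF bt_smult_additive[OF RB RB] btsum_additive[OF RB RB A balG]] w])
        (use l p in \<open>auto simp: btsum_pure[OF RB RB A balG] bt_src[OF RB RB] bal12\<close>)
    thus "tsum A (G (tgt B l \<odot>\<^bsub>RB\<^esub> p)) w = tsum A (G p) (src B l \<odot>\<^bsub>?T\<^esub> w)" by simp
  qed
  note addF = btsum_additive[OF RB T A balF]
  have pT: "bp RB RB q r \<in> carrier ?T" if "q \<in> carrier B" "r \<in> carrier B" for q r
    using bp_closed[OF RB RB] that by simp
  have pTT: "bp RB ?T p w \<in> carrier (bt RB ?T)" if "p \<in> carrier B" "w \<in> carrier ?T" for p w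
    using bp_closed[OF RB T] that by simp
  have 1: "bcls L B RB ?T (map (\<lambda>(p, x). (p, bcomul B x)) (tlist (bcomul B a))) =
    tsum (bt RB ?T) (\<lambda>p x. bp RB ?T p (bcomul B x)) (bcomul B a)"
    by (rule bcls_map[OF RB RB _ _ RB T]) (use a cT in auto)
  let ?h = "\<lambda>x r. map (\<lambda>(p, q). (p, bp RB RB q r)) (tlist (bcomul B x))"
  have 2: "bcls L B RB ?T (concat (map (\<lambda>(x, r). ?h x r) (tlist (bcomul B a)))) =
    tsum (bt RB ?T) (\<lambda>x r. bcls L B RB ?T (?h x r)) (bcomul B a)"
    by (rule bcls_concat[OF RB RB _ RB T]; (rule tensor_pair.tlist_map_valid[OF pair_BB])?) (use a cT pT in auto)
  have 3: "bcls L B RB ?T (?h x r) = tsum (bt RB ?T) (\<lambda>p q. bp RB ?T p (bp RB RB q r)) (bcomul B x)"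
    if "x \<in> carrier B" "r \<in> carrier B" for x r
    by (rule bcls_map[OF RB RB _ _ RB T]) (use that cT pT in auto)
  have eq: "tsum (bt RB ?T) (\<lambda>p x. bp RB ?T p (bcomul B x)) (bcomul B a) =
    tsum (bt RB ?T) (\<lambda>x r. tsum (bt RB ?T) (\<lambda>p q. bp RB ?T p (bp RB RB q r)) (bcomul B x)) (bcomul B a)"
    (is "?l = ?r")
    using bspec[OF coassoc_bd a] 1 2 3 a unfolding rec by (simp cong: bsum_cong)
  have "tsum A ?F ?l = tsum A (\<lambda>p x. tsum A ?F (bp RB ?T p (bcomul B x))) (bcomul B a)"
    by (rule bsum_hom[OF GTT A addF]) (use a cT pTT in auto)
  also have "\<dots> = tsum A (\<lambda>p x. tsum A (\<lambda>q r. G p q r) (bcomul B x)) (bcomul B a)"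
    by (rule bsum_cong) (use a cT in \<open>auto simp: btsum_pure[OF RB T A balF]\<close>)
  finally have l: "tsum A ?F ?l = \<dots>" .
  have "tsum A ?F ?r = tsum A (\<lambda>x r. tsum A ?F (tsum (bt RB ?T) (\<lambda>p q. bp RB ?T p (bp RB RB q r)) (bcomul B x))) (bcomul B a)"
    by (rule bsum_hom[OF GTT A addF]) (use a cT pTT pT in \<open>auto intro!: bsum_closed GTT\<close>)
  also have "\<dots> = tsum A (\<lambda>x r. tsum A (\<lambda>p q. tsum A ?F (bp RB ?T p (bp RB RB q r))) (bcomul B x)) (bcomul B a)"
    by (rule bsum_cong, rule bsum_hom[OF GTT A addF]) (use a pTT pT in auto)
  also have "\<dots> = tsum A (\<lambda>x r. tsum A (\<lambda>p q. G p q r) (bcomul B x)) (bcomul B a)"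
    using a pT by (auto intro!: bsum_cong simp: btsum_pure[OF RB T A balF] btsum_pure[OF RB RB A balG])
  finally show ?thesis using l eq by simp
qed

subsection \<open>Associativity constraint\<close>

context
  fixes M N P :: "('a univ, 'a univ) module" assumes M: "lmod M" and N: "lmod N" and P: "lmod P"
begin

lemmas lMN = lmod_bt[OF M N] and lNP = lmod_bt[OF N P]
lemmas lMN_P = lmod_bt[OF lMN P] and lM_NP = lmod_bt[OF M lNP]
lemmas gMN_P = left_module_group[OF lMN_P] and gM_NP = left_module_group[OF lM_NP]
lemmas cl = left_module_closed[OF M] left_module_closed[OF N] left_module_closed[OF P]
  bp_closed[OF M N] bp_closed[OF N P] bp_closed[OF lMN P] bp_closed[OF M lNP]
lemmas ad = additive_on_bp_left[OF M N] additive_on_bp_left[OF N P]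
  additive_on_bp_left[OF lMN P] additive_on_bp_left[OF M lNP]
  additive_on_bp_right[OF M N] additive_on_bp_right[OF N P]
  additive_on_bp_right[OF lMN P] additive_on_bp_right[OF M lNP] additive_on_id
  additive_on_smult_left[OF M] additive_on_smult_left[OF N] additive_on_smult_left[OF P]

text \<open>A map out of (M \<otimes> N) \<otimes> P is built in two stages: for fixed
  \<open>p\<close> the universal property of M \<otimes> N gives \<open>assocF\<close>, which is
  then balanced against P. \<open>assocG\<close> does the same for the opposite bracketing.\<close>

definition assocF where
  "assocF u p = tsum (bt M (bt N P)) (\<lambda>m n. bp M (bt N P) m (bp N P n p)) u"

definition assocG where
  "assocG m w = tsum (bt (bt M N) P) (\<lambda>n p. bp (bt M N) P (bp M N m n) p) w"

text \<open>Balancedness holds because the source acts on N \<otimes> P through N. In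
  \<open>bal_G1\<close> the corresponding fact is that the target acts on M \<otimes> N through
  N.\<close>

lemma bal_F1: "p \<in> carrier P \<Longrightarrow> bal M N (bt M (bt N P)) (\<lambda>m n. bp M (bt N P) m (bp N P n p))"
  by (intro balI ad) (auto simp: cl bp_balance[OF M lNP] bt_src[OF N P])

lemma bal_G1: "m \<in> carrier M \<Longrightarrow> bal N P (bt (bt M N) P) (\<lambda>n p. bp (bt M N) P (bp M N m n) p)"
  by (intro balI ad) (auto simp: cl bp_balance[OF lMN P, symmetric] bt_tgt[OF M N])

lemma assocF_pure: "m \<in> carrier M \<Longrightarrow> n \<in> carrier N \<Longrightarrow> p \<in> carrier P \<Longrightarrow>
    assocF (bp M N m n) p = bp M (bt N P) m (bp N P n p)"
  unfolding assocF_def by (rule btsum_pure[OF M N gM_NP bal_F1])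

lemma assocG_pure: "m \<in> carrier M \<Longrightarrow> n \<in> carrier N \<Longrightarrow> p \<in> carrier P \<Longrightarrow>
    assocG m (bp N P n p) = bp (bt M N) P (bp M N m n) p"
  unfolding assocG_def by (rule btsum_pure[OF N P gMN_P bal_G1])

lemma assocF_additive: "p \<in> carrier P \<Longrightarrow> additive_on (bt M N) (bt M (bt N P)) (\<lambda>u. assocF u p)"
  unfolding assocF_def by (rule btsum_additive[OF M N gM_NP bal_F1])

lemma assocG_additive: "m \<in> carrier M \<Longrightarrow> additive_on (bt N P) (bt (bt M N) P) (\<lambda>w. assocG m w)"
  unfolding assocG_def by (rule btsum_additive[OF N P gMN_P bal_G1])

lemma bal_F: "bal (bt M N) P (bt M (bt N P)) assocF"
proof (rule balI)
  fix u assume "u \<in> carrier (bt M N)"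
  thus "additive_on P (bt M (bt N P)) (\<lambda>p. assocF u p)"
    unfolding assocF_def by (intro btsum_additive_inner[OF M N gM_NP] ad)
next
  fix l u p assume l: "l \<in> carrier L" and u: "u \<in> carrier (bt M N)" and p: "p \<in> carrier P"
  show "assocF (tgt B l \<odot>\<^bsub>bt M N\<^esub> u) p = assocF u (src B l \<odot>\<^bsub>P\<^esub> p)"
    by (rule bt_eqI[OF M N gM_NP additive_on_comp[OF bt_smult_additive[OF M N] assocF_additive] assocF_additive u])
      (use l p in \<open>auto simp: cl bt_tgt[OF M N] assocF_pure bp_balance[OF N P]\<close>)
qed (rule assocF_additive)

lemma bal_G: "bal M (bt N P) (bt (bt M N) P) assocG"
proof (rule balI)
  fix w assume "w \<in> carrier (bt N P)"
  thus "additive_on M (bt (bt M N) P) (\<lambda>m. assocG m w)"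
    unfolding assocG_def by (intro btsum_additive_inner[OF N P gMN_P] ad)
next
  fix l m w assume l: "l \<in> carrier L" and m: "m \<in> carrier M" and w: "w \<in> carrier (bt N P)"
  show "assocG (tgt B l \<odot>\<^bsub>M\<^esub> m) w = assocG m (src B l \<odot>\<^bsub>bt N P\<^esub> w)"
    by (rule bt_eqI[OF N P gMN_P assocG_additive additive_on_comp[OF bt_smult_additive[OF N P] assocG_additive] w])
      (use l m in \<open>auto simp: cl bt_src[OF N P] assocG_pure bp_balance[OF M N]\<close>)
qed (rule assocG_additive)

lemma assoc_eq: "assoc BM M N P = (\<lambda>t\<in>carrier (bt (bt M N) P). tsum (bt M (bt N P)) assocF t)"
proof -
  have 1: "set (map (\<lambda>(m, n). (m, bp N P n p)) (tlist u)) \<subseteq> carrier M \<times> carrier (bt N P)"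
    if "u \<in> carrier (bt M N)" "p \<in> carrier P" for u p
    by (rule tensor_pair.tlist_map_valid[OF pair[OF M N]]) (use that in \<open>auto simp: cl btensor_simps[of M N]\<close>)
  have "bcls L B M (bt N P) (concat (map (\<lambda>(u, p). map (\<lambda>(m, n). (m, bp N P n p)) (tlist u)) (tlist t))) =
    tsum (bt M (bt N P)) assocF t" if t: "t \<in> carrier (bt (bt M N) P)" for t
    by (rule HOL.trans[OF bcls_concat[OF lMN P 1 M lNP t]], assumption, assumption,
        rule btsum_cong[OF lMN P _ t], unfold assocF_def, rule bcls_map[OF M N _ _ M lNP]) (auto simp: cl)
  thus ?thesis by (simp add: BMod_def cong: restrict_cong)
qed

lemma assoc_pure: "m \<in> carrier M \<Longrightarrow> n \<in> carrier N \<Longrightarrow> p \<in> carrier P \<Longrightarrow>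
    assoc BM M N P (bp (bt M N) P (bp M N m n) p) = bp M (bt N P) m (bp N P n p)"
  by (simp add: assoc_eq cl btsum_pure[OF lMN P gM_NP bal_F] assocF_pure)

text \<open>On pure tensors the two sides differ by the bracketing of the iterated coproduct, so
  \<open>bsum_coassoc\<close> for the summand \<open>?G\<close> gives equivariance.\<close>

lemma assoc_hom: "assoc BM M N P \<in> bhom (bt (bt M N) P) (bt M (bt N P))"
  unfolding assoc_eq
proof (rule bt_homI[OF lMN P lM_NP bal_F])
  fix b u p assume b: "b \<in> carrier B" and u: "u \<in> carrier (bt M N)" and p: "p \<in> carrier P"
  note lin = additive_on_comp[OF bt_smult_additive[OF M N] assocF_additive]
  show "tsum (bt M (bt N P)) (\<lambda>x y. assocF (x \<odot>\<^bsub>bt M N\<^esub> u) (y \<odot>\<^bsub>P\<^esub> p)) (bcomul B b) =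
    b \<odot>\<^bsub>bt M (bt N P)\<^esub> assocF u p" (is "?l u = ?r u")
  proof (rule bt_eqI[OF M N gM_NP _ additive_on_smult_right[OF lM_NP assocF_additive] u])
    show "additive_on (bt M N) (bt M (bt N P)) ?l"
      by (rule bsum_additive_inner[OF gM_NP b lin]) (use p in \<open>auto simp: cl\<close>)
    fix m n assume mn: "m \<in> carrier M" "n \<in> carrier N"
    let ?G = "\<lambda>x y z. bp M (bt N P) (x \<odot>\<^bsub>M\<^esub> m) (bp N P (y \<odot>\<^bsub>N\<^esub> n) (z \<odot>\<^bsub>P\<^esub> p))"
    have "?l (bp M N m n) = tsum (bt M (bt N P)) (\<lambda>x z. tsum (bt M (bt N P)) (\<lambda>x y. ?G x y z) (bcomul B x)) (bcomul B b)"
    proof (rule bsum_cong[OF _ b])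
      fix x z assume xz: "x \<in> carrier B" "z \<in> carrier B"
      show "assocF (x \<odot>\<^bsub>bt M N\<^esub> bp M N m n) (z \<odot>\<^bsub>P\<^esub> p) = tsum (bt M (bt N P)) (\<lambda>x y. ?G x y z) (bcomul B x)"
        using xz mn p bsum_hom[OF group_bt[OF M N] gM_NP assocF_additive, of "z \<odot>\<^bsub>P\<^esub> p" "\<lambda>x y. bp M N (x \<odot>\<^bsub>M\<^esub> m) (y \<odot>\<^bsub>N\<^esub> n)" x]
        by (simp add: bt_smult_pure[OF M N] cl assocF_pure cong: bsum_cong)
    qed
    also have "\<dots> = tsum (bt M (bt N P)) (\<lambda>x w. tsum (bt M (bt N P)) (\<lambda>y z. ?G x y z) (bcomul B w)) (bcomul B b)"
    proof (rule bsum_coassoc[OF gM_NP b, symmetric])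
      fix l x y z assume "l \<in> carrier L" "x \<in> carrier B" "y \<in> carrier B" "z \<in> carrier B"
      thus "?G (tgt B l \<otimes>\<^bsub>B\<^esub> x) y z = ?G x (src B l \<otimes>\<^bsub>B\<^esub> y) z"
        "?G x (tgt B l \<otimes>\<^bsub>B\<^esub> y) z = ?G x y (src B l \<otimes>\<^bsub>B\<^esub> z)"
        using mn p by (simp_all add: left_module_mult[OF M] left_module_mult[OF N] left_module_mult[OF P]
            bp_balance[OF M lNP] bp_balance[OF N P] bt_src[OF N P] cl)
    qed (use mn p in \<open>auto simp: cl intro!: ad\<close>)
    also have "\<dots> = ?r (bp M N m n)"
      using b mn p bsum_hom[OF left_module_group[OF lNP] gM_NP additive_on_bp_right[OF M lNP additive_on_id]]
      by (simp add: bt_smult_pure[OF M lNP] bt_smult_pure[OF N P] cl assocF_pure cong: bsum_cong)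
    finally show "?l (bp M N m n) = ?r (bp M N m n)" .
  qed (use b p in auto)
qed

lemma assoc_inverse:
  "inverse_pair BM (bt (bt M N) P) (bt M (bt N P)) (assoc BM M N P)
     (\<lambda>w\<in>carrier (bt M (bt N P)). tsum (bt (bt M N) P) assocG w)"
proof (rule BMod_inverse_pair[OF assoc_hom lMN_P lM_NP])
  note aF = left_module_hom_additive[OF assoc_hom] and aG = btsum_additive[OF M lNP gMN_P bal_G]
  show "y \<in> carrier (bt M (bt N P)) \<Longrightarrow> tsum (bt (bt M N) P) assocG y \<in> carrier (bt (bt M N) P)" for y
    using additive_on_closed[OF aG] .
  show "tsum (bt (bt M N) P) assocG (assoc BM M N P x) = x" if x: "x \<in> carrier (bt (bt M N) P)" for x
  proof (rule bt_eqI[OF lMN P gMN_P additive_on_comp[OF aF aG] additive_on_id x])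
    fix u p assume u: "u \<in> carrier (bt M N)" and p: "p \<in> carrier P"
    show "tsum (bt (bt M N) P) assocG (assoc BM M N P (bp (bt M N) P u p)) = bp (bt M N) P u p"
      by (rule bt_eqI[OF M N gMN_P additive_on_comp[OF additive_on_comp[OF _ aF] aG] _ u])
        (use p in \<open>auto intro!: ad simp: cl assoc_pure btsum_pure[OF M lNP gMN_P bal_G] assocG_pure\<close>)
  qed
  show "assoc BM M N P (tsum (bt (bt M N) P) assocG y) = y" if y: "y \<in> carrier (bt M (bt N P))" for y
  proof (rule bt_eqI[OF M lNP gM_NP additive_on_comp[OF aG aF] additive_on_id y])
    fix m w assume m: "m \<in> carrier M" and w: "w \<in> carrier (bt N P)"
    show "assoc BM M N P (tsum (bt (bt M N) P) assocG (bp M (bt N P) m w)) = bp M (bt N P) m w"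
      by (rule bt_eqI[OF N P gM_NP additive_on_comp[OF additive_on_comp[OF _ aG] aF] _ w])
        (use m in \<open>auto intro!: ad simp: cl assoc_pure btsum_pure[OF M lNP gMN_P bal_G] assocG_pure\<close>)
  qed
qed

lemma bt_hom_eqI3:
  assumes "f \<in> bhom (bt (bt M N) P) Q" "g \<in> bhom (bt (bt M N) P) Q" "lmod Q"
    "\<And>m n p. m \<in> carrier M \<Longrightarrow> n \<in> carrier N \<Longrightarrow> p \<in> carrier P \<Longrightarrow>
       f (bp (bt M N) P (bp M N m n) p) = g (bp (bt M N) P (bp M N m n) p)"
  shows "f = g"
proof (rule bt_hom_eqI[OF lMN P assms(1-3)])
  fix u p assume u: "u \<in> carrier (bt M N)" and p: "p \<in> carrier P"
  show "f (bp (bt M N) P u p) = g (bp (bt M N) P u p)"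
    by (rule bt_eqI[OF M N left_module_group[OF assms(3)] _ _ u];
        (rule additive_on_comp[OF _ left_module_hom_additive[OF assms(1)]]
           additive_on_comp[OF _ left_module_hom_additive[OF assms(2)]])?)
      (use p assms(4) in \<open>auto intro!: ad\<close>)
qed

end

subsection \<open>Unit constraints\<close>

text \<open>The comultiplication sends s(l) to s(l) \<otimes> 1: the action of s(l) on 1 \<otimes> 1
  is computed once through the coproduct and once through \<open>bt_src\<close>.\<close>

lemma bsum_of_src:
  assumes A: "abelian_group A" and F: "bal RB RB A F" and l: "l \<in> carrier L"
  shows "tsum A F (bcomul B (src B l)) = F (src B l) \<one>\<^bsub>B\<^esub>"
proof -
  note RB = lmod_RB and G = group_bt[OF lmod_RB lmod_RB]
  have "tsum A F (src B l \<odot>\<^bsub>bt RB RB\<^esub> bp RB RB \<one>\<^bsub>B\<^esub> \<one>\<^bsub>B\<^esub>) = tsum A F (bcomul B (src B l))"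
    using l bsum_hom[OF G A btsum_additive[OF RB RB A F], of "bp RB RB" "src B l"]
    by (simp add: bt_smult_pure[OF RB RB] bp_closed[OF RB RB, simplified] btsum_pure[OF RB RB A F] cong: bsum_cong)
  thus ?thesis using l by (simp add: bt_src[OF RB RB] btsum_pure[OF RB RB A F])
qed

text \<open>Right multiplication by a source is not covered by the bimodule axiom. Multiplicativity
  of the comultiplication reduces it to the coproduct of s(l), which is s(l) \<otimes> 1.\<close>

lemma bsum_mult_src:
  assumes A: "abelian_group A" and F: "bal RB RB A F" and l: "l \<in> carrier L" and a: "a \<in> carrier B"
  shows "tsum A F (bcomul B (a \<otimes>\<^bsub>B\<^esub> src B l)) = tsum A (\<lambda>p q. F (p \<otimes>\<^bsub>B\<^esub> src B l) q) (bcomul B a)"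
proof -
  let ?G = "\<lambda>p' q'. tsum A (\<lambda>p q. F (p \<otimes>\<^bsub>B\<^esub> p') (q \<otimes>\<^bsub>B\<^esub> q')) (bcomul B a)"
  have F1: "additive_on P A (\<lambda>x. F (f x) q)" if "q \<in> carrier B" "additive_on P B f" for P :: "('a univ, 'a univ) module" and f q
    by (rule additive_on_comp[OF that(2)]) (use bal_left[OF F, of q] that(1) in \<open>simp add: additive_on_def\<close>)
  have F2: "additive_on P A (\<lambda>x. F q (f x))" if "q \<in> carrier B" "additive_on P B f" for P :: "('a univ, 'a univ) module" and f q
    by (rule additive_on_comp[OF that(2)]) (use bal_right[OF F, of q] that(1) in \<open>simp add: additive_on_def\<close>)
  have id: "additive_on RB B (\<lambda>x. x)" by (simp add: additive_on_def)
  have bal': "bal RB RB A (\<lambda>x y. F (x \<otimes>\<^bsub>B\<^esub> p) (y \<otimes>\<^bsub>B\<^esub> q))" if "p \<in> carrier B" "q \<in> carrier B" for p q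
    using that bal_balance[OF F]
    by (intro balI F1 F2 additive_on_mult_left[OF ring_B id]) (auto simp: B_assoc)
  \<comment> \<open>The factors p' and q' stand to the right of the legs of \<open>a\<close>, so a
    target in front of p' reaches q' as a source only by the Takeuchi condition for
    \<open>a\<close>.\<close>
  have "bal RB RB A ?G"
  proof (intro balI bsum_additive_inner[OF A a] F1 F2 additive_on_mult_right[OF ring_B id])
    fix k p q assume k: "k \<in> carrier L" and "p \<in> carrier RB" "q \<in> carrier RB"
    thus "?G (tgt B k \<odot>\<^bsub>RB\<^esub> p) q = ?G p (src B k \<odot>\<^bsub>RB\<^esub> q)"
      using bsum_takeuchi[OF A bal'[of p q] k a] a by (simp add: B_assoc cong: bsum_cong)
  qed auto
  from bsum_of_src[OF A this l]
  have "?G (src B l) \<one>\<^bsub>B\<^esub> = tsum A ?G (bcomul B (src B l))" by simp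
  also have "\<dots> = tsum A F (bcomul B (a \<otimes>\<^bsub>B\<^esub> src B l))"
    unfolding bsum_mult[OF A F a src_closed[OF l]]
    by (rule tsum_swap[OF pair_BB pair_BB A]) (use l a bal_closed[OF F] in auto)
  finally show ?thesis using l a by (simp cong: bsum_cong)
qed

abbreviation "BU \<equiv> bunit L B"

lemma bunit_simps [simp]:
  "carrier BU = carrier L" "add BU = add L" "zero BU = zero L"
  "smult BU = (\<lambda>b l. bcounit B (b \<otimes>\<^bsub>B\<^esub> src B l))"
  by (simp_all add: bunit_def)

lemma counit_src' [simp]: "l \<in> carrier L \<Longrightarrow> bcounit B (src B l) = l"
  using counit_src[of l "\<one>\<^bsub>B\<^esub>"] by (simp add: counit_one)

text \<open>Associativity of the action is the axiom that \<epsilon>(a s(\<epsilon>(b))) equals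
  \<epsilon>(ab); the unit law comes from \<epsilon>(s(l)) = l.\<close>

lemma lmod_BU: "lmod BU"
proof -
  have "additive_on B L (\<lambda>b. bcounit B (b \<otimes>\<^bsub>B\<^esub> src B l))" if "l \<in> carrier L" for l
    by (rule additive_on_comp[OF additive_on_mult_left[OF ring_B additive_on_id] counit_additive]) (use that in auto)
  moreover have "additive_on L L (\<lambda>l. bcounit B (b \<otimes>\<^bsub>B\<^esub> src B l))" if "b \<in> carrier B" for b
    by (rule additive_on_comp[OF additive_on_mult_right[OF ring_B src_additive] counit_additive]) (use that in auto)
  moreover have "abelian_group BU" by (rule abelian_group_cong[OF ring.is_abelian_group[OF ring_L]]) simp_all
  ultimately show ?thesis
    by (auto simp: left_module_def ring_B additive_on_def B_assoc counit_mult_src)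
qed

context
  fixes M :: "('a univ, 'a univ) module" assumes M: "lmod M"
begin

lemma bal_lunit: "bal BU M M (\<lambda>l m. src B l \<odot>\<^bsub>M\<^esub> m)"
  using src_additive
  by (intro balI additive_on_smult_left[OF M] additive_on_smult_right[OF M] additive_on_id)
    (auto simp: additive_on_def counit_tgt src_mult left_module_mult[OF M])

lemma bal_runit: "bal M BU M (\<lambda>m l. tgt B l \<odot>\<^bsub>M\<^esub> m)"
  using tgt_additive
  by (intro balI additive_on_smult_left[OF M] additive_on_smult_right[OF M] additive_on_id)
    (auto simp: additive_on_def counit_src tgt_mult left_module_mult[OF M])

lemma lunit_eq: "lunit BM M = (\<lambda>t\<in>carrier (bt BU M). tsum M (\<lambda>l m. src B l \<odot>\<^bsub>M\<^esub> m) t)"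
  by (simp add: BMod_def tsum_def)

lemma runit_eq: "runit BM M = (\<lambda>t\<in>carrier (bt M BU). tsum M (\<lambda>m l. tgt B l \<odot>\<^bsub>M\<^esub> m) t)"
  by (simp add: BMod_def tsum_def)

lemma lunit_pure: "l \<in> carrier L \<Longrightarrow> m \<in> carrier M \<Longrightarrow> lunit BM M (bp BU M l m) = src B l \<odot>\<^bsub>M\<^esub> m"
  using btsum_pure[OF lmod_BU M left_module_group[OF M] bal_lunit] bp_closed[OF lmod_BU M]
  by (simp add: lunit_eq)

lemma runit_pure: "l \<in> carrier L \<Longrightarrow> m \<in> carrier M \<Longrightarrow> runit BM M (bp M BU m l) = tgt B l \<odot>\<^bsub>M\<^esub> m"
  using btsum_pure[OF M lmod_BU left_module_group[OF M] bal_runit] bp_closed[OF M lmod_BU]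
  by (simp add: runit_eq)

lemma bal_counit1: "m \<in> carrier M \<Longrightarrow> bal RB RB M (\<lambda>p q. (src B (bcounit B p) \<otimes>\<^bsub>B\<^esub> q) \<odot>\<^bsub>M\<^esub> m)"
  by (intro balI additive_on_smult_left[OF M] additive_on_mult_left additive_on_mult_right ring_B
      additive_on_comp[OF counit_additive src_additive] additive_on_id)
    (auto simp: additive_on_def ring.ring_simprules[OF ring_B] counit_tgt src_mult B_assoc
      additive_on_add[OF counit_additive] additive_on_add[OF src_additive])

lemma bal_counit2: "m \<in> carrier M \<Longrightarrow> bal RB RB M (\<lambda>p q. (tgt B (bcounit B q) \<otimes>\<^bsub>B\<^esub> p) \<odot>\<^bsub>M\<^esub> m)"
  by (intro balI additive_on_smult_left[OF M] additive_on_mult_left additive_on_mult_right ring_B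
      additive_on_comp[OF counit_additive tgt_additive] additive_on_id)
    (auto simp: additive_on_def ring.ring_simprules[OF ring_B] counit_src tgt_mult B_assoc
      additive_on_add[OF counit_additive] additive_on_add[OF tgt_additive])

lemma counit1:
  assumes "b \<in> carrier B" "m \<in> carrier M"
  shows "tsum M (\<lambda>p q. (src B (bcounit B p) \<otimes>\<^bsub>B\<^esub> q) \<odot>\<^bsub>M\<^esub> m) (bcomul B b) = b \<odot>\<^bsub>M\<^esub> m"
proof -
  have "tsum B (\<lambda>p q. src B (bcounit B p) \<otimes>\<^bsub>B\<^esub> q) (bcomul B b) = b"
    using counit_bd assms(1) by (simp add: tsum_def)
  thus ?thesis
    using assms bsum_hom[OF ring.is_abelian_group[OF ring_B] left_module_group[OF M]
        additive_on_smult_left[OF M additive_on_id assms(2)], of "\<lambda>p q. src B (bcounit B p) \<otimes>\<^bsub>B\<^esub> q" b] by simp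
qed

lemma counit2:
  assumes "b \<in> carrier B" "m \<in> carrier M"
  shows "tsum M (\<lambda>p q. (tgt B (bcounit B q) \<otimes>\<^bsub>B\<^esub> p) \<odot>\<^bsub>M\<^esub> m) (bcomul B b) = b \<odot>\<^bsub>M\<^esub> m"
proof -
  have "tsum B (\<lambda>p q. tgt B (bcounit B q) \<otimes>\<^bsub>B\<^esub> p) (bcomul B b) = b"
    using counit_bd assms(1) by (simp add: tsum_def)
  thus ?thesis
    using assms bsum_hom[OF ring.is_abelian_group[OF ring_B] left_module_group[OF M]
        additive_on_smult_left[OF M additive_on_id assms(2)], of "\<lambda>p q. tgt B (bcounit B q) \<otimes>\<^bsub>B\<^esub> p" b] by simp
qed

text \<open>The first leg enters through \<epsilon>(p s(l)). By \<open>bsum_mult_src\<close> the sum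
  is the one for the coproduct of b s(l), and the counit axiom for that element finishes.\<close>

lemma lunit_hom: "lunit BM M \<in> bhom (bt BU M) M"
  unfolding lunit_eq
proof (rule bt_homI[OF lmod_BU M M bal_lunit])
  fix b l m assume b: "b \<in> carrier B" and l: "l \<in> carrier BU" and m: "m \<in> carrier M"
  note G = left_module_group[OF M]
  let ?F = "\<lambda>p q. (src B (bcounit B p) \<otimes>\<^bsub>B\<^esub> q) \<odot>\<^bsub>M\<^esub> m"
  have l': "l \<in> carrier L" using l by simp
  have "tsum M (\<lambda>p q. src B (p \<odot>\<^bsub>BU\<^esub> l) \<odot>\<^bsub>M\<^esub> (q \<odot>\<^bsub>M\<^esub> m)) (bcomul B b) =
    tsum M (\<lambda>p q. ?F (p \<otimes>\<^bsub>B\<^esub> src B l) q) (bcomul B b)"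
    using l' m b by (intro bsum_cong) (auto simp: left_module_mult[OF M])
  also have "\<dots> = tsum M ?F (bcomul B (b \<otimes>\<^bsub>B\<^esub> src B l))"
    using b l' m by (simp add: bsum_mult_src[OF G bal_counit1])
  also have "\<dots> = b \<odot>\<^bsub>M\<^esub> (src B l \<odot>\<^bsub>M\<^esub> m)"
    using b l' m by (simp add: counit1 left_module_mult[OF M])
  finally show "tsum M (\<lambda>p q. src B (p \<odot>\<^bsub>BU\<^esub> l) \<odot>\<^bsub>M\<^esub> (q \<odot>\<^bsub>M\<^esub> m)) (bcomul B b) = b \<odot>\<^bsub>M\<^esub> (src B l \<odot>\<^bsub>M\<^esub> m)" .
qed

text \<open>Here s(l) stands behind the second leg. The Takeuchi condition moves it to the first leg
  as t(l), where it acts on \<open>m\<close>, and the counit axiom for \<open>b\<close>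
  remains.\<close>

lemma runit_hom: "runit BM M \<in> bhom (bt M BU) M"
  unfolding runit_eq
proof (rule bt_homI[OF M lmod_BU M bal_runit])
  fix b l m assume b: "b \<in> carrier B" and l: "l \<in> carrier BU" and m: "m \<in> carrier M"
  note G = left_module_group[OF M]
  let ?F = "\<lambda>p q. (tgt B (bcounit B q) \<otimes>\<^bsub>B\<^esub> p) \<odot>\<^bsub>M\<^esub> m"
  have l': "l \<in> carrier L" using l by simp
  have "tsum M (\<lambda>p q. tgt B (q \<odot>\<^bsub>BU\<^esub> l) \<odot>\<^bsub>M\<^esub> (p \<odot>\<^bsub>M\<^esub> m)) (bcomul B b) =
    tsum M (\<lambda>p q. ?F p (q \<otimes>\<^bsub>B\<^esub> src B l)) (bcomul B b)"
    using l' m b by (intro bsum_cong) (auto simp: left_module_mult[OF M])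
  also have "\<dots> = tsum M (\<lambda>p q. ?F (p \<otimes>\<^bsub>B\<^esub> tgt B l) q) (bcomul B b)"
    by (rule bsum_takeuchi[symmetric, OF G bal_counit2[OF m] l' b])
  also have "\<dots> = tsum M (\<lambda>p q. (tgt B (bcounit B q) \<otimes>\<^bsub>B\<^esub> p) \<odot>\<^bsub>M\<^esub> (tgt B l \<odot>\<^bsub>M\<^esub> m)) (bcomul B b)"
    using l' m b by (intro bsum_cong) (auto simp: left_module_mult[OF M] B_assoc left_module_closed[OF M])
  also have "\<dots> = b \<odot>\<^bsub>M\<^esub> (tgt B l \<odot>\<^bsub>M\<^esub> m)"
    using b l' m by (simp add: counit2 left_module_closed[OF M])
  finally show "tsum M (\<lambda>p q. tgt B (q \<odot>\<^bsub>BU\<^esub> l) \<odot>\<^bsub>M\<^esub> (p \<odot>\<^bsub>M\<^esub> m)) (bcomul B b) = b \<odot>\<^bsub>M\<^esub> (tgt B l \<odot>\<^bsub>M\<^esub> m)" .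
qed

text \<open>The inverse relies on l being t(l) applied to the unit of \<open>L\<close>: balancedness
  turns l \<otimes> m into 1 \<otimes> s(l) m.\<close>

lemma lunit_inverse:
  "inverse_pair BM (bt BU M) M (lunit BM M) (\<lambda>m\<in>carrier M. bp BU M \<one>\<^bsub>L\<^esub> m)"
proof (rule BMod_inverse_pair[OF lunit_hom lmod_bt[OF lmod_BU M] M])
  note aF = left_module_hom_additive[OF lunit_hom]
    and aG = additive_on_bp_right[OF lmod_BU M]
  show "bp BU M \<one>\<^bsub>L\<^esub> (lunit BM M x) = x" if x: "x \<in> carrier (bt BU M)" for x
    by (rule bt_eqI[OF lmod_BU M group_bt[OF lmod_BU M] aG[OF aF] additive_on_id x])
      (auto simp: lunit_pure bp_balance[OF lmod_BU M, symmetric] counit_tgt)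
qed (auto simp: lunit_pure src_one left_module_one[OF M] intro!: bp_closed[OF lmod_BU M])

lemma runit_inverse:
  "inverse_pair BM (bt M BU) M (runit BM M) (\<lambda>m\<in>carrier M. bp M BU m \<one>\<^bsub>L\<^esub>)"
proof (rule BMod_inverse_pair[OF runit_hom lmod_bt[OF M lmod_BU] M])
  note aF = left_module_hom_additive[OF runit_hom]
    and aG = additive_on_bp_left[OF M lmod_BU]
  show "bp M BU (runit BM M x) \<one>\<^bsub>L\<^esub> = x" if x: "x \<in> carrier (bt M BU)" for x
    by (rule bt_eqI[OF M lmod_BU group_bt[OF M lmod_BU] aG[OF aF] additive_on_id x])
      (auto simp: runit_pure bp_balance[OF M lmod_BU] src_one)
qed (auto simp: runit_pure tgt_one left_module_one[OF M] intro!: bp_closed[OF M lmod_BU])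

end

subsection \<open>The monoidal category of modules\<close>

context
  fixes M N P Q :: "('a univ, 'a univ) module"
  assumes M: "lmod M" and N: "lmod N" and P: "lmod P" and Q: "lmod Q"
begin

lemma bt_hom_eqI4:
  assumes "f \<in> bhom (bt (bt (bt M N) P) Q) V" "g \<in> bhom (bt (bt (bt M N) P) Q) V" "lmod V"
    "\<And>m n p q. m \<in> carrier M \<Longrightarrow> n \<in> carrier N \<Longrightarrow> p \<in> carrier P \<Longrightarrow> q \<in> carrier Q \<Longrightarrow>
       f (bp (bt (bt M N) P) Q (bp (bt M N) P (bp M N m n) p) q) =
       g (bp (bt (bt M N) P) Q (bp (bt M N) P (bp M N m n) p) q)"
  shows "f = g"
proof (rule bt_hom_eqI3[OF lmod_bt[OF M N] P Q assms(1-3)])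
  fix u p q assume u: "u \<in> carrier (bt M N)" and p: "p \<in> carrier P" and q: "q \<in> carrier Q"
  note ad = additive_on_bp_left[OF lmod_bt[OF lmod_bt[OF M N] P] Q] additive_on_bp_left[OF lmod_bt[OF M N] P]
    additive_on_id bp_closed
  show "f (bp (bt (bt M N) P) Q (bp (bt M N) P u p) q) = g (bp (bt (bt M N) P) Q (bp (bt M N) P u p) q)"
    by (rule bt_eqI[OF M N left_module_group[OF assms(3)] _ _ u];
        (rule additive_on_comp[OF _ left_module_hom_additive[OF assms(1)]]
           additive_on_comp[OF _ left_module_hom_additive[OF assms(2)]])?)
      (use p q assms(4) in \<open>auto intro!: ad\<close>)
qed

end

lemmas bs = left_module_hom_compose left_module_hom_ident tmor_hom assoc_hom lunit_hom runit_hom lmod_bt lmod_BU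
  compose_eq tmor_pure assoc_pure lunit_pure runit_pure bp_closed left_module_closed left_module_hom_closed left_module_hom_smult

text \<open>The invertibility clauses come from the explicit inverses above. The equations compare
  linear maps on iterated tensor products and hold because both sides have the same value on pure
  tensors.\<close>

theorem monoidal_category_BMod: "monoidal_category BM"
proof (intro monoidal_category.intro category_BM monoidal_category_axioms.intro, goal_cases)
  case (4 X Y)
  hence l: "lmod X" "lmod Y" by (simp_all add: BMod_simps)
  show ?case unfolding BMod_simps by (rule bt_hom_eqI[OF l _ _ lmod_bt[OF l]]) (simp_all add: l bs)
next
  case (5 X X' X'' Y Y' Y'' f f' g g')
  hence l: "lmod X" "lmod X'" "lmod X''" "lmod Y" "lmod Y'" "lmod Y''"
    and f: "f \<in> bhom X X'" "f' \<in> bhom X' X''" and g: "g \<in> bhom Y Y'" "g' \<in> bhom Y' Y''"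
    by (simp_all add: BMod_simps)
  show ?case unfolding BMod_simps
    by (rule bt_hom_eqI[OF l(1,4) _ _ lmod_bt[OF l(3,6)]])
      (simp_all add: l f g bs left_module_hom_closed[OF f(1)] left_module_hom_closed[OF g(1)]
        left_module_hom_compose[OF f] left_module_hom_compose[OF g]
        left_module_hom_compose[OF tmor_hom[OF l(1,2,4,5) f(1) g(1)] tmor_hom[OF l(2,3,5,6) f(2) g(2)]])
next
  case (6 X Y Z)
  thus ?case using assoc_inverse by (auto simp: iso_mor_def BMod_simps)
next
  case (7 X X' Y Y' Z Z' f g h)
  hence l: "lmod X" "lmod X'" "lmod Y" "lmod Y'" "lmod Z" "lmod Z'"
    and f: "f \<in> bhom X X'" and g: "g \<in> bhom Y Y'" and h: "h \<in> bhom Z Z'"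
    by (simp_all add: BMod_simps)
  note fg = tmor_hom[OF l(1-4) f g] and gh = tmor_hom[OF l(3-6) g h]
  note ll = lmod_bt[OF l(1,3)] lmod_bt[OF l(2,4)] lmod_bt[OF l(3,5)] lmod_bt[OF l(4,6)]
  show ?case unfolding BMod_simps
    by (rule bt_hom_eqI3[OF l(1,3,5) left_module_hom_compose[OF tmor_hom[OF ll(1,2) l(5,6) fg h] assoc_hom[OF l(2,4,6)]]
          left_module_hom_compose[OF assoc_hom[OF l(1,3,5)] tmor_hom[OF l(1,2) ll(3,4) f gh]]])
      (simp_all add: l f g h bs left_module_hom_closed[OF f] left_module_hom_closed[OF g] left_module_hom_closed[OF h])
next
  case (8 X)
  thus ?case using lunit_inverse by (auto simp: iso_mor_def BMod_simps)
next
  case (9 X Y f)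
  hence l: "lmod X" "lmod Y" and f: "f \<in> bhom X Y" by (simp_all add: BMod_simps)
  note i = left_module_hom_ident[OF lmod_BU]
  show ?case unfolding BMod_simps
    by (rule bt_hom_eqI[OF lmod_BU l(1) left_module_hom_compose[OF tmor_hom[OF lmod_BU lmod_BU l i f] lunit_hom[OF l(2)]]
          left_module_hom_compose[OF lunit_hom[OF l(1)] f]])
      (simp_all add: l bs left_module_hom_closed[OF f] left_module_hom_smult[OF f] tmor_pure[OF lmod_BU lmod_BU l i f, simplified])
next
  case (10 X)
  thus ?case using runit_inverse by (auto simp: iso_mor_def BMod_simps)
next
  case (11 X Y f)
  hence l: "lmod X" "lmod Y" and f: "f \<in> bhom X Y" by (simp_all add: BMod_simps)
  note i = left_module_hom_ident[OF lmod_BU]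
  show ?case unfolding BMod_simps
    by (rule bt_hom_eqI[OF l(1) lmod_BU left_module_hom_compose[OF tmor_hom[OF l lmod_BU lmod_BU f i] runit_hom[OF l(2)]]
          left_module_hom_compose[OF runit_hom[OF l(1)] f]])
      (simp_all add: l bs left_module_hom_closed[OF f] left_module_hom_smult[OF f] tmor_pure[OF l lmod_BU lmod_BU f i, simplified])
next
  case (12 W X Y Z)
  hence l: "lmod W" "lmod X" "lmod Y" "lmod Z" by (simp_all add: BMod_simps)
  note b = lmod_bt[OF l(1,2)] lmod_bt[OF l(2,3)] lmod_bt[OF l(3,4)]
  note bb = lmod_bt[OF b(1) l(3)] lmod_bt[OF l(1) b(2)] lmod_bt[OF b(2) l(4)] lmod_bt[OF l(2) b(3)]
  note t = tmor_hom[OF bb(1,2) l(4,4) assoc_hom[OF l(1-3)] left_module_hom_ident[OF l(4)]]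
    tmor_hom[OF l(1,1) bb(3,4) left_module_hom_ident[OF l(1)] assoc_hom[OF l(2-4)]]
  show ?case unfolding BMod_simps
    by (rule bt_hom_eqI4[OF l left_module_hom_compose[OF assoc_hom[OF b(1) l(3,4)] assoc_hom[OF l(1,2) b(3)]]
        left_module_hom_compose[OF t(1) left_module_hom_compose[OF assoc_hom[OF l(1) b(2) l(4)] t(2)]]])
      (simp_all add: l bs)
next
  case (13 X Y)
  hence l: "lmod X" "lmod Y" by (simp_all add: BMod_simps)
  note t = tmor_hom[OF l(1,1) lmod_bt[OF lmod_BU l(2)] l(2) left_module_hom_ident[OF l(1)] lunit_hom[OF l(2)]]
  show ?case unfolding BMod_simps
    by (rule bt_hom_eqI3[OF l(1) lmod_BU l(2) left_module_hom_compose[OF assoc_hom[OF l(1) lmod_BU l(2)] t] _ lmod_bt[OF l]])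
      (simp_all add: l bs bp_balance[OF l])
qed (simp_all add: BMod_simps bs)

end

section \<open>Linear maps over the ground ring\<close>

lemma k_linearI:
  "(\<And>x. x \<in> carrier M \<Longrightarrow> f x \<in> carrier N) \<Longrightarrow>
   (\<And>x y. x \<in> carrier M \<Longrightarrow> y \<in> carrier M \<Longrightarrow> f (x \<oplus>\<^bsub>M\<^esub> y) = f x \<oplus>\<^bsub>N\<^esub> f y) \<Longrightarrow>
   (\<And>k x. k \<in> carrier K \<Longrightarrow> x \<in> carrier M \<Longrightarrow> f (k \<odot>\<^bsub>M\<^esub> x) = k \<odot>\<^bsub>N\<^esub> f x) \<Longrightarrow> k_linear K M N f"
  by (simp add: k_linear_def additive_on_def)

lemma k_linear_closed: "k_linear K M N f \<Longrightarrow> x \<in> carrier M \<Longrightarrow> f x \<in> carrier N"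
  by (auto simp: k_linear_def additive_on_def)

lemma k_linear_additive: "k_linear K M N f \<Longrightarrow> additive_on M N f"
  by (simp add: k_linear_def)

lemma k_linear_smult:
  "k_linear K M N f \<Longrightarrow> k \<in> carrier K \<Longrightarrow> x \<in> carrier M \<Longrightarrow> f (k \<odot>\<^bsub>M\<^esub> x) = k \<odot>\<^bsub>N\<^esub> f x"
  by (simp add: k_linear_def)

lemma k_linear_id: "k_linear K M M (\<lambda>x. x)"
  by (simp add: k_linear_def additive_on_id)

lemma k_linear_comp: "k_linear K P M g \<Longrightarrow> k_linear K M N f \<Longrightarrow> k_linear K P N (\<lambda>x. f (g x))"
  by (auto simp: k_linear_def intro: additive_on_comp dest: additive_on_closed)

lemma k_linear_cong:
  assumes "k_linear K M N f" "\<And>x. x \<in> carrier M \<Longrightarrow> f x = g x" "module K M"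
  shows "k_linear K M N g"
proof -
  interpret module K M by fact
  show ?thesis using assms(1,2)
    by (auto simp: k_linear_def intro: additive_on_cong[OF _ _ M.abelian_group_axioms])
qed

lemma module_group: "module K M \<Longrightarrow> abelian_group M"
  by (simp add: module_def)

lemma module_smult_additive:
  "module K M \<Longrightarrow> k \<in> carrier K \<Longrightarrow> additive_on M M (\<lambda>x. k \<odot>\<^bsub>M\<^esub> x)"
  by (auto intro: additive_onI simp: module.smult_r_distr module.smult_closed)

lemma module_cong_record:
  assumes "module K M" "carrier M' = carrier M" "add M' = add M" "zero M' = zero M"
    "\<And>k x. k \<in> carrier K \<Longrightarrow> x \<in> carrier M \<Longrightarrow> k \<odot>\<^bsub>M'\<^esub> x = k \<odot>\<^bsub>M\<^esub> x"
  shows "module K M'"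
proof -
  interpret module K M by fact
  show ?thesis
    using assms(2-) abelian_group_cong[OF M.abelian_group_axioms assms(2-4)] R.cring_axioms
    by (intro moduleI) (auto simp: smult_l_distr smult_r_distr smult_assoc1)
qed

lemma k_algebra_module: "k_algebra K A \<Longrightarrow> module K A"
  and k_algebra_ring: "k_algebra K A \<Longrightarrow> ring A"
  and k_algebra_smult_left:
    "k_algebra K A \<Longrightarrow> k \<in> carrier K \<Longrightarrow> a \<in> carrier A \<Longrightarrow> b \<in> carrier A \<Longrightarrow>
     (k \<odot>\<^bsub>A\<^esub> a) \<otimes>\<^bsub>A\<^esub> b = k \<odot>\<^bsub>A\<^esub> (a \<otimes>\<^bsub>A\<^esub> b)"
  and k_algebra_smult_right:
    "k_algebra K A \<Longrightarrow> k \<in> carrier K \<Longrightarrow> a \<in> carrier A \<Longrightarrow> b \<in> carrier A \<Longrightarrow>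
     a \<otimes>\<^bsub>A\<^esub> (k \<odot>\<^bsub>A\<^esub> b) = k \<odot>\<^bsub>A\<^esub> (a \<otimes>\<^bsub>A\<^esub> b)"
  unfolding k_algebra_def by metis+

lemma module_restrict_scalars:
  assumes A: "k_algebra K A" and M: "left_module A M"
  shows "module K (restrict_scalars A M)"
proof -
  interpret A: module K A using A by (rule k_algebra_module)
  interpret R: ring A using A by (rule k_algebra_ring)
  have 1: "((a \<otimes>\<^bsub>K\<^esub> b) \<odot>\<^bsub>A\<^esub> \<one>\<^bsub>A\<^esub>) = (a \<odot>\<^bsub>A\<^esub> \<one>\<^bsub>A\<^esub>) \<otimes>\<^bsub>A\<^esub> (b \<odot>\<^bsub>A\<^esub> \<one>\<^bsub>A\<^esub>)"
    if "a \<in> carrier K" "b \<in> carrier K" for a b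
    using that by (simp add: k_algebra_smult_left[OF A] A.smult_assoc1)
  show ?thesis
    using abelian_group_cong[OF left_module_group[OF M], of "restrict_scalars A M"] A.R.cring_axioms
    by (intro moduleI)
      (auto simp: restrict_scalars_def left_module_closed[OF M] A.smult_l_distr left_module_add_left[OF M]
        left_module_add_right[OF M] 1 left_module_mult[OF M] left_module_one[OF M])
qed

text \<open>Over \<open>K\<close>, linearity in each variable is tracked and not only balancedness:
  a sum over one tensor must again be linear in the variables that remain, so that the next identity
  can be applied inside it.\<close>

definition bilinear ::
  "('k, 'l) ring_scheme \<Rightarrow> ('k, 'u, 'm) module_scheme \<Rightarrow> ('k, 'v, 'n) module_scheme \<Rightarrow>
   ('k, 'b, 'z) module_scheme \<Rightarrow> ('u \<Rightarrow> 'v \<Rightarrow> 'b) \<Rightarrow> bool" where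
  "bilinear K M N A F \<longleftrightarrow>
     (\<forall>m\<in>carrier M. k_linear K N A (\<lambda>n. F m n)) \<and> (\<forall>n\<in>carrier N. k_linear K M A (\<lambda>m. F m n))"

lemma bilinearI:
  "(\<And>m. m \<in> carrier M \<Longrightarrow> k_linear K N A (\<lambda>n. F m n)) \<Longrightarrow>
   (\<And>n. n \<in> carrier N \<Longrightarrow> k_linear K M A (\<lambda>m. F m n)) \<Longrightarrow> bilinear K M N A F"
  by (simp add: bilinear_def)

lemma bilinear_left: "bilinear K M N A F \<Longrightarrow> n \<in> carrier N \<Longrightarrow> k_linear K M A (\<lambda>m. F m n)"
  and bilinear_right: "bilinear K M N A F \<Longrightarrow> m \<in> carrier M \<Longrightarrow> k_linear K N A (\<lambda>n. F m n)"
  by (simp_all add: bilinear_def)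

lemma bilinear_closed: "bilinear K M N A F \<Longrightarrow> m \<in> carrier M \<Longrightarrow> n \<in> carrier N \<Longrightarrow> F m n \<in> carrier A"
  by (auto simp: bilinear_def dest: k_linear_closed)

lemma bilinear_balanced: "bilinear K M N A F \<Longrightarrow> balanced K M N A F"
  by (auto simp: bilinear_def balanced_def k_linear_def)

definition trilinear ::
  "('k, 'l) ring_scheme \<Rightarrow> ('k, 'u, 'm) module_scheme \<Rightarrow> ('k, 'v, 'n) module_scheme \<Rightarrow>
   ('k, 'w, 'p) module_scheme \<Rightarrow> ('k, 'b, 'z) module_scheme \<Rightarrow> ('u \<Rightarrow> 'v \<Rightarrow> 'w \<Rightarrow> 'b) \<Rightarrow> bool" where
  "trilinear K M N P A F \<longleftrightarrow>
     (\<forall>n\<in>carrier N. \<forall>p\<in>carrier P. k_linear K M A (\<lambda>m. F m n p)) \<and>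
     (\<forall>m\<in>carrier M. \<forall>p\<in>carrier P. k_linear K N A (\<lambda>n. F m n p)) \<and>
     (\<forall>m\<in>carrier M. \<forall>n\<in>carrier N. k_linear K P A (\<lambda>p. F m n p))"

lemma trilinearI:
  "(\<And>n p. n \<in> carrier N \<Longrightarrow> p \<in> carrier P \<Longrightarrow> k_linear K M A (\<lambda>m. F m n p)) \<Longrightarrow>
   (\<And>m p. m \<in> carrier M \<Longrightarrow> p \<in> carrier P \<Longrightarrow> k_linear K N A (\<lambda>n. F m n p)) \<Longrightarrow>
   (\<And>m n. m \<in> carrier M \<Longrightarrow> n \<in> carrier N \<Longrightarrow> k_linear K P A (\<lambda>p. F m n p)) \<Longrightarrow>
   trilinear K M N P A F"
  by (simp add: trilinear_def)

lemma module_pair: "module K M \<Longrightarrow> module K N \<Longrightarrow> tensor_pair K M N"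
  by (rule tensor_pair.intro) (auto simp: module_group module.smult_closed)

text \<open>\<open>M \<otimes>\<^sub>R N\<close> as a \<open>k\<close>-module through an action of \<open>k\<close> on \<open>M\<close> that commutes with \<open>R\<close>.\<close>

definition tensor_act ::
  "('r, 'l) ring_scheme \<Rightarrow> ('r, 'a univ, 'm) module_scheme \<Rightarrow> ('r, 'a univ, 'n) module_scheme \<Rightarrow>
   ('r \<Rightarrow> 'a univ \<Rightarrow> 'a univ) \<Rightarrow> ('r, 'a univ) module" where
  "tensor_act R M N c = (tensor R M N) \<lparr> smult := (\<lambda>k t. tcls R M N [(c k m, n). (m, n) \<leftarrow> tlist t]) \<rparr>"

lemma tensor_act_simps:
  "carrier (tensor_act R M N c) = carrier (tensor R M N)" "add (tensor_act R M N c) = add (tensor R M N)"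
  "zero (tensor_act R M N c) = zero (tensor R M N)"
  by (simp_all add: tensor_act_def)

lemma tensor_act_smult: "tensor_act K M N (smult M) = tensor K M N"
  by (simp add: tensor_act_def tensor_def)

context
  fixes K :: "('r, 'k) ring_scheme" and R :: "('r, 'l) ring_scheme"
    and M :: "('r, 'a univ, 'm) module_scheme" and N :: "('r, 'a univ, 'n) module_scheme"
    and c :: "'r \<Rightarrow> 'a univ \<Rightarrow> 'a univ"
  assumes tp: "tensor_pair R M N" and Mc: "module K (M \<lparr> smult := c \<rparr>)"
    and comm: "\<forall>k\<in>carrier K. \<forall>x\<in>carrier R. \<forall>m\<in>carrier M. c k (x \<odot>\<^bsub>M\<^esub> m) = x \<odot>\<^bsub>M\<^esub> c k m"
begin

interpretation tensor_pair R M N by (rule tp)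
interpretation Mc: module K "M \<lparr> smult := c \<rparr>" by (rule Mc)

abbreviation (input) "Tc \<equiv> tensor_act R M N c"

lemmas Mc' = Mc.smult_closed[simplified] Mc.smult_r_distr[simplified] Mc.smult_l_distr[simplified] Mc.smult_assoc1[simplified]

lemma balanced_act: "k \<in> carrier K \<Longrightarrow> balanced R M N T (\<lambda>m n. pure (c k m) n)"
  by (intro balancedI additive_onI)
    (auto simp: Mc' pure_add_left pure_add_right pure_closed comm pure_balanced)

lemma tensor_act_tsum: "k \<in> carrier K \<Longrightarrow> t \<in> carrier T \<Longrightarrow> k \<odot>\<^bsub>Tc\<^esub> t = tsum T (\<lambda>m n. pure (c k m) n) t"
  using tcls_map[OF _ _ tp, of "\<lambda>m n. c k m" "\<lambda>m n. n" t] by (simp add: tensor_act_def Mc')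

lemma tensor_act_pure: "k \<in> carrier K \<Longrightarrow> m \<in> carrier M \<Longrightarrow> n \<in> carrier N \<Longrightarrow> k \<odot>\<^bsub>Tc\<^esub> pure m n = pure (c k m) n"
  by (simp add: tensor_act_tsum pure_closed tsum_pure[OF group_T balanced_act])

lemma tensor_act_additive: "k \<in> carrier K \<Longrightarrow> additive_on T T (\<lambda>t. k \<odot>\<^bsub>Tc\<^esub> t)"
  by (rule additive_on_cong[OF tsum_additive[OF group_T balanced_act]]) (auto simp: tensor_act_tsum group_T)

lemma module_tensor_act: "module K Tc"
proof (rule moduleI)
  note add = tensor_act_additive
  show "cring K" by (rule Mc.R.cring_axioms)
  show "abelian_group Tc" by (rule abelian_group_cong[OF group_T]) (simp_all add: tensor_act_simps)
  show "k \<odot>\<^bsub>Tc\<^esub> t \<in> carrier Tc" if "k \<in> carrier K" "t \<in> carrier Tc" for k t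
    using additive_on_closed[OF add] that by (simp add: tensor_act_simps)
  show "k \<odot>\<^bsub>Tc\<^esub> (t \<oplus>\<^bsub>Tc\<^esub> u) = k \<odot>\<^bsub>Tc\<^esub> t \<oplus>\<^bsub>Tc\<^esub> k \<odot>\<^bsub>Tc\<^esub> u"
    if "k \<in> carrier K" "t \<in> carrier Tc" "u \<in> carrier Tc" for k t u
    using additive_on_add[OF add] that by (simp add: tensor_act_simps)
  show "\<one>\<^bsub>K\<^esub> \<odot>\<^bsub>Tc\<^esub> t = t" if "t \<in> carrier Tc" for t
    by (rule tensor_eqI[OF group_T add additive_on_id])
      (use that Mc.smult_one in \<open>auto simp: tensor_act_simps tensor_act_pure\<close>)
  show "(k \<otimes>\<^bsub>K\<^esub> k') \<odot>\<^bsub>Tc\<^esub> t = k \<odot>\<^bsub>Tc\<^esub> (k' \<odot>\<^bsub>Tc\<^esub> t)"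
    if "k \<in> carrier K" "k' \<in> carrier K" "t \<in> carrier Tc" for k k' t
    by (rule tensor_eqI[OF group_T add additive_on_comp[OF add add]])
      (use that in \<open>auto simp: tensor_act_simps tensor_act_pure Mc'\<close>)
  show "(k \<oplus>\<^bsub>K\<^esub> k') \<odot>\<^bsub>Tc\<^esub> t = k \<odot>\<^bsub>Tc\<^esub> t \<oplus>\<^bsub>Tc\<^esub> k' \<odot>\<^bsub>Tc\<^esub> t"
    if "k \<in> carrier K" "k' \<in> carrier K" "t \<in> carrier Tc" for k k' t
  proof -
    interpret G: abelian_group T by (rule group_T)
    have "additive_on T T (\<lambda>t. k \<odot>\<^bsub>Tc\<^esub> t \<oplus>\<^bsub>T\<^esub> k' \<odot>\<^bsub>Tc\<^esub> t)"
      using add[OF that(1)] add[OF that(2)] by (auto simp: additive_on_def Pi_iff G.a_ac)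
    from tensor_eqI[OF group_T add this, of "k \<oplus>\<^bsub>K\<^esub> k'" t] show ?thesis
      using that by (simp add: tensor_act_simps tensor_act_pure Mc' pure_add_left)
  qed
qed

lemma k_linear_tensor_act_left: "k_linear K P (M \<lparr> smult := c \<rparr>) f \<Longrightarrow> n \<in> carrier N \<Longrightarrow> k_linear K P Tc (\<lambda>x. pure (f x) n)"
  by (auto simp: k_linear_def additive_on_def Pi_iff tensor_act_simps pure_closed pure_add_left tensor_act_pure)

lemma k_linear_tsum_act:
  assumes A: "module K A" and F: "balanced R M N A F"
    and lin: "\<And>n. n \<in> carrier N \<Longrightarrow> k_linear K (M \<lparr> smult := c \<rparr>) A (\<lambda>m. F m n)"
  shows "k_linear K Tc A (tsum A F)"
proof -
  note G = module_group[OF A]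
  have "tsum A F (k \<odot>\<^bsub>Tc\<^esub> t) = k \<odot>\<^bsub>A\<^esub> tsum A F t" if k: "k \<in> carrier K" and t: "t \<in> carrier T" for k t
    by (rule tensor_eqI[OF G additive_on_comp[OF tensor_act_additive tsum_additive[OF G F]]
          additive_on_comp[OF tsum_additive[OF G F] module_smult_additive[OF A k]] t])
      (use k k_linear_smult[OF lin] in \<open>auto simp: tensor_act_pure tsum_pure[OF G F] Mc'\<close>)
  thus ?thesis using tsum_additive[OF G F] by (simp add: k_linear_def additive_on_def tensor_act_simps)
qed

end

section \<open>Linear maps out of tensor products of \<open>K\<close>-modules\<close>

context
  fixes K :: "('k, 'l) ring_scheme" and M :: "('k, 'a univ, 'm) module_scheme" and N :: "('k, 'a univ, 'n) module_scheme"
  assumes M: "module K M" and N: "module K N"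
begin

interpretation M: module K M by (rule M)
interpretation N: module K N by (rule N)
interpretation tensor_pair K M N by (rule module_pair[OF M N])

lemma smult_comm: "\<forall>k\<in>carrier K. \<forall>x\<in>carrier K. \<forall>m\<in>carrier M. k \<odot>\<^bsub>M\<^esub> (x \<odot>\<^bsub>M\<^esub> m) = x \<odot>\<^bsub>M\<^esub> (k \<odot>\<^bsub>M\<^esub> m)"
  by (simp add: M.smult_assoc1[symmetric] M.R.m_comm)

lemma self_act: "module K (M \<lparr> smult := smult M \<rparr>)"
  using M by simp

lemmas module_tensor = module_tensor_act[OF tensor_pair_axioms self_act smult_comm, unfolded tensor_act_smult]
  and smult_pure = tensor_act_pure[OF tensor_pair_axioms self_act smult_comm, unfolded tensor_act_smult]

lemma k_linear_pure_left: "k_linear K P M f \<Longrightarrow> n \<in> carrier N \<Longrightarrow> k_linear K P T (\<lambda>x. pure (f x) n)"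
  by (auto simp: k_linear_def additive_on_def Pi_iff pure_closed pure_add_left smult_pure)

lemma k_linear_pure_right: "k_linear K P N f \<Longrightarrow> m \<in> carrier M \<Longrightarrow> k_linear K P T (\<lambda>x. pure m (f x))"
  by (auto simp: k_linear_def additive_on_def Pi_iff pure_closed pure_add_right smult_pure pure_balanced)

context
  fixes A :: "('k, 'b, 'z) module_scheme" assumes A: "module K A"
begin

lemma k_linear_tsum:
  assumes "bilinear K M N A F" "k_linear K P T f"
  shows "k_linear K P A (\<lambda>x. tsum A F (f x))"
  by (rule k_linear_comp[OF assms(2)
        k_linear_tsum_act[OF tensor_pair_axioms self_act smult_comm A bilinear_balanced[OF assms(1)], unfolded tensor_act_smult]])
    (use bilinear_left[OF assms(1)] in simp_all)

lemma k_linear_tsum_inner: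
  assumes "t \<in> carrier T"
    "\<And>m n. m \<in> carrier M \<Longrightarrow> n \<in> carrier N \<Longrightarrow> k_linear K P A (\<lambda>x. F x m n)"
    "\<And>k x. k \<in> carrier K \<Longrightarrow> x \<in> carrier P \<Longrightarrow> k \<odot>\<^bsub>P\<^esub> x \<in> carrier P"
  shows "k_linear K P A (\<lambda>x. tsum A (F x) t)"
proof -
  note G = module_group[OF A]
  have "tsum A (F (k \<odot>\<^bsub>P\<^esub> x)) t = k \<odot>\<^bsub>A\<^esub> tsum A (F x) t" if "k \<in> carrier K" "x \<in> carrier P" for k x
  proof -
    have "tsum A (F (k \<odot>\<^bsub>P\<^esub> x)) t = tsum A (\<lambda>m n. k \<odot>\<^bsub>A\<^esub> F x m n) t"
      using that by (intro tsum_cong assms(1)) (auto simp: k_linear_smult[OF assms(2)])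
    also have "\<dots> = k \<odot>\<^bsub>A\<^esub> tsum A (F x) t"
      using that by (intro tsum_hom[symmetric] G assms(1) module_smult_additive[OF A]) (auto simp: k_linear_closed[OF assms(2)])
    finally show ?thesis .
  qed
  moreover have "additive_on P A (\<lambda>x. tsum A (F x) t)"
    by (intro additive_on_tsum_inner G assms(1) k_linear_additive[OF assms(2)])
  ultimately show ?thesis by (simp add: k_linear_def)
qed

end

end

section \<open>Linearity of products and actions\<close>

lemma k_linear_mult_left:
  "k_algebra K A \<Longrightarrow> k_linear K P A f \<Longrightarrow> a \<in> carrier A \<Longrightarrow> k_linear K P A (\<lambda>x. f x \<otimes>\<^bsub>A\<^esub> a)"
  by (simp add: k_linear_def additive_on_mult_left[OF k_algebra_ring])
    (auto simp: additive_on_def k_algebra_smult_left Pi_iff)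

lemma k_linear_mult_right:
  "k_algebra K A \<Longrightarrow> k_linear K P A f \<Longrightarrow> a \<in> carrier A \<Longrightarrow> k_linear K P A (\<lambda>x. a \<otimes>\<^bsub>A\<^esub> f x)"
  by (simp add: k_linear_def additive_on_mult_right[OF k_algebra_ring])
    (auto simp: additive_on_def k_algebra_smult_right Pi_iff)

lemma k_linear_smult_right:
  assumes "module K A" "k_linear K P A f" "k \<in> carrier K" shows "k_linear K P A (\<lambda>x. k \<odot>\<^bsub>A\<^esub> f x)"
proof -
  interpret module K A by fact
  show ?thesis using assms(2,3)
    by (auto simp: k_linear_def additive_on_def Pi_iff smult_r_distr smult_assoc1[symmetric] R.m_comm)
qed

lemma k_linear_smult_left:
  assumes "module K A" "k_linear K P (regular K) f" "a \<in> carrier A" shows "k_linear K P A (\<lambda>x. f x \<odot>\<^bsub>A\<^esub> a)"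
proof -
  interpret module K A by fact
  show ?thesis using assms(2,3)
    by (auto simp: k_linear_def additive_on_def Pi_iff smult_l_distr smult_assoc1)
qed

lemma k_linear_act_left:
  assumes A: "k_algebra K A" and M: "left_module A M" and f: "k_linear K P A f" and m: "m \<in> carrier M"
  shows "k_linear K P (restrict_scalars A M) (\<lambda>x. f x \<odot>\<^bsub>M\<^esub> m)"
proof -
  interpret A: module K A using A by (rule k_algebra_module)
  interpret R: ring A using A by (rule k_algebra_ring)
  have "(k \<odot>\<^bsub>A\<^esub> a) \<odot>\<^bsub>M\<^esub> m = (k \<odot>\<^bsub>A\<^esub> \<one>\<^bsub>A\<^esub>) \<odot>\<^bsub>M\<^esub> (a \<odot>\<^bsub>M\<^esub> m)" if "k \<in> carrier K" "a \<in> carrier A" for k a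
    using that m by (simp add: left_module_mult[OF M, symmetric] k_algebra_smult_left[OF A])
  thus ?thesis
    using f m by (auto simp: k_linear_def additive_on_def Pi_iff left_module_closed[OF M] left_module_add_left[OF M]
        restrict_scalars_def)
qed

text \<open>Multiples of the unit are central in a \<open>K\<close>-algebra, so every element acts
  \<open>K\<close>-linearly.\<close>

lemma k_linear_act_right:
  assumes A: "k_algebra K A" and M: "left_module A M" and f: "k_linear K P (restrict_scalars A M) f" and a: "a \<in> carrier A"
  shows "k_linear K P (restrict_scalars A M) (\<lambda>x. a \<odot>\<^bsub>M\<^esub> f x)"
proof -
  interpret A: module K A using A by (rule k_algebra_module)
  interpret R: ring A using A by (rule k_algebra_ring)
  have "a \<odot>\<^bsub>M\<^esub> ((k \<odot>\<^bsub>A\<^esub> \<one>\<^bsub>A\<^esub>) \<odot>\<^bsub>M\<^esub> m) = (k \<odot>\<^bsub>A\<^esub> \<one>\<^bsub>A\<^esub>) \<odot>\<^bsub>M\<^esub> (a \<odot>\<^bsub>M\<^esub> m)"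
    if "k \<in> carrier K" "m \<in> carrier M" for k m
    using that a by (simp add: left_module_mult[OF M, symmetric] k_algebra_smult_left[OF A] k_algebra_smult_right[OF A])
  thus ?thesis
    using f a by (auto simp: k_linear_def additive_on_def Pi_iff left_module_closed[OF M] left_module_add_right[OF M]
        restrict_scalars_def)
qed

lemma tsum_tensor_mult:
  fixes M :: "('k, 'a univ, 'm) module_scheme" and N :: "('k, 'a univ, 'n) module_scheme"
  assumes M: "k_algebra K M" and N: "k_algebra K N" and A: "module K A" and F: "bilinear K M N A F"
    and t: "t \<in> carrier (tensor K M N)" and u: "u \<in> carrier (tensor K M N)"
  shows "tsum A F (t \<otimes>\<^bsub>tensor K M N\<^esub> u) =
    tsum A (\<lambda>m n. tsum A (\<lambda>m' n'. F (m \<otimes>\<^bsub>M\<^esub> m') (n \<otimes>\<^bsub>N\<^esub> n')) u) t"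
proof -
  note p = module_pair[OF k_algebra_module[OF M] k_algebra_module[OF N]]
  note bal = bilinear_balanced[OF F] and G = module_group[OF A] and GT = tensor_pair.group_T[OF p]
  have c: "m \<otimes>\<^bsub>M\<^esub> m' \<in> carrier M" if "m \<in> carrier M" "m' \<in> carrier M" for m m'
    using that k_algebra_ring[OF M] by (simp add: ring.ring_simprules)
  have d: "m \<otimes>\<^bsub>N\<^esub> m' \<in> carrier N" if "m \<in> carrier N" "m' \<in> carrier N" for m m'
    using that k_algebra_ring[OF N] by (simp add: ring.ring_simprules)
  let ?T = "tensor K M N"
  let ?h = "\<lambda>m n. [(m \<otimes>\<^bsub>M\<^esub> m', n \<otimes>\<^bsub>N\<^esub> n'). (m', n') \<leftarrow> tlist u]"
  have val: "set (?h m n) \<subseteq> carrier M \<times> carrier N" if "m \<in> carrier M" "n \<in> carrier N" for m n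
    by (rule tensor_pair.tlist_map_valid[OF p _ _ u]) (use that c d in auto)
  have 1: "t \<otimes>\<^bsub>?T\<^esub> u = tsum ?T (\<lambda>m n. tcls K M N (?h m n)) t"
    using tensor_pair.tcls_concat[OF p val p t] by (simp add: tensor_def)
  have "tsum A F (t \<otimes>\<^bsub>?T\<^esub> u) = tsum A (\<lambda>m n. tsum A F (tcls K M N (?h m n))) t"
    unfolding 1 by (rule tensor_pair.tsum_hom[OF p GT G tensor_pair.tsum_additive[OF p G bal] _ t])
      (use val in \<open>auto intro!: tensor_pair.tcls_closed[OF p] simp del: set_map\<close>)
  also have "\<dots> = tsum A (\<lambda>m n. tsum A (\<lambda>m' n'. F (m \<otimes>\<^bsub>M\<^esub> m') (n \<otimes>\<^bsub>N\<^esub> n')) u) t"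
    by (rule tensor_pair.tsum_cong[OF p _ t], subst tensor_pair.tsum_tcls[OF p G bal val])
      (simp_all add: tsum_def comp_def case_prod_unfold)
  finally show ?thesis .
qed

section \<open>Hopf algebras and base algebras in Sweedler notation\<close>

text \<open>One proof for two axioms: N = H with \<open>d\<close> the comultiplication, and N = L
  with \<open>d\<close> the coaction. The equation \<open>eq\<close> in H \<otimes> (H \<otimes> N)
  is tested against the map that the trilinear \<open>F\<close> induces.\<close>

lemma tsum_coassoc:
  fixes H :: "('k, 'a univ, 'h) module_scheme" and N :: "('k, 'a univ, 'n) module_scheme"
  assumes H: "module K H" and N: "module K N" and A: "module K A"
    and t: "t \<in> carrier (tensor K H N)"
    and d: "\<And>y. y \<in> carrier N \<Longrightarrow> d y \<in> carrier (tensor K H N)"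
    and D: "\<And>x. x \<in> carrier H \<Longrightarrow> D x \<in> carrier (tensor K H H)"
    and eq: "tcls K H (tensor K H N) [(a, d y). (a, y) \<leftarrow> tlist t] =
      tcls K H (tensor K H N) [(a, tcls K H N [(b, m)]). (x, m) \<leftarrow> tlist t, (a, b) \<leftarrow> tlist (D x)]"
    and F: "trilinear K H H N A F"
  shows "tsum A (\<lambda>x m. tsum A (\<lambda>a b. F a b m) (D x)) t = tsum A (\<lambda>a y. tsum A (\<lambda>b m. F a b m) (d y)) t"
proof -
  let ?T = "tensor K H N" let ?TT = "tensor K H ?T"
  note pHN = module_pair[OF H N] and T = module_tensor[OF H N]
  note pHT = module_pair[OF H T] and pHH = module_pair[OF H H]
  note GT = tensor_pair.group_T[OF pHN] and GTT = tensor_pair.group_T[OF pHT] and GA = module_group[OF A]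
  let ?G = "\<lambda>a w. tsum A (F a) w"
  have Fb: "bilinear K H N A (F a)" if "a \<in> carrier H" for a
    using that F by (auto simp: trilinear_def bilinear_def)
  have G: "bilinear K H ?T A ?G"
  proof (rule bilinearI)
    show "k_linear K ?T A (?G a)" if "a \<in> carrier H" for a
      by (rule k_linear_tsum[OF H N A Fb k_linear_id]) fact
    show "k_linear K H A (\<lambda>a. ?G a w)" if "w \<in> carrier ?T" for w
      by (rule k_linear_tsum_inner[OF H N A that]) (use F in \<open>auto simp: trilinear_def module.smult_closed[OF H]\<close>)
  qed
  note add = tensor_pair.tsum_additive[OF pHT GA bilinear_balanced[OF G]]
  note pureG = tensor_pair.tsum_pure[OF pHT GA bilinear_balanced[OF G]]
  have pT: "tcls K H N [(a, b)] \<in> carrier ?T" if "a \<in> carrier H" "b \<in> carrier N" for a b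
    using tensor_pair.pure_closed[OF pHN that] .
  have pTT: "tcls K H ?T [(a, b)] \<in> carrier ?TT" if "a \<in> carrier H" "b \<in> carrier ?T" for a b
    using tensor_pair.pure_closed[OF pHT that] .
  let ?l = "tsum ?TT (\<lambda>a y. tcls K H ?T [(a, d y)]) t"
  let ?r = "tsum ?TT (\<lambda>x m. tsum ?TT (\<lambda>a b. tcls K H ?T [(a, tcls K H N [(b, m)])]) (D x)) t"
  let ?h = "\<lambda>x m. [(a, tcls K H N [(b, m)]). (a, b) \<leftarrow> tlist (D x)]"
  have 1: "tcls K H ?T [(a, d y). (a, y) \<leftarrow> tlist t] = ?l"
    by (rule tensor_pair.tcls_map[OF pHN _ _ pHT t]) (use d in auto)
  have val: "set (?h x m) \<subseteq> carrier H \<times> carrier ?T" if "x \<in> carrier H" "m \<in> carrier N" for x m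
    by (rule tensor_pair.tlist_map_valid[OF pHH]) (use that D pT in auto)
  have 2: "tcls K H ?T (concat (map (\<lambda>(x, m). ?h x m) (tlist t))) = tsum ?TT (\<lambda>x m. tcls K H ?T (?h x m)) t"
    by (rule tensor_pair.tcls_concat[OF pHN val pHT t])
  also have "\<dots> = ?r"
    by (rule tensor_pair.tsum_cong[OF pHN _ t], rule tensor_pair.tcls_map[OF pHH _ _ pHT]) (use D pT in auto)
  finally have lr: "?l = ?r" using eq 1 by simp
  have l: "tsum A ?G ?l = tsum A (\<lambda>a y. tsum A ?G (tcls K H ?T [(a, d y)])) t"
    by (rule tensor_pair.tsum_hom[OF pHN GTT GA add _ t]) (use d pTT in auto)
  also have "\<dots> = tsum A (\<lambda>a y. tsum A (\<lambda>b m. F a b m) (d y)) t"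
    by (rule tensor_pair.tsum_cong[OF pHN _ t]) (use pureG d in auto)
  finally have l: "tsum A ?G ?l = \<dots>" .
  have r: "tsum A ?G ?r = tsum A (\<lambda>x m. tsum A ?G (tsum ?TT (\<lambda>a b. tcls K H ?T [(a, tcls K H N [(b, m)])]) (D x))) t"
    by (rule tensor_pair.tsum_hom[OF pHN GTT GA add _ t], rule tensor_pair.tsum_closed[OF pHH GTT])
      (use D pT pTT in auto)
  also have "\<dots> = tsum A (\<lambda>x m. tsum A (\<lambda>a b. tsum A ?G (tcls K H ?T [(a, tcls K H N [(b, m)])])) (D x)) t"
    by (rule tensor_pair.tsum_cong[OF pHN _ t], rule tensor_pair.tsum_hom[OF pHH GTT GA add]) (use D pT pTT in auto)
  also have "\<dots> = tsum A (\<lambda>x m. tsum A (\<lambda>a b. F a b m) (D x)) t"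
    by (rule tensor_pair.tsum_cong[OF pHN _ t], rule tensor_pair.tsum_cong[OF pHH])
      (use D pT in \<open>auto simp: pureG tensor_pair.tsum_pure[OF pHN GA bilinear_balanced[OF Fb]]\<close>)
  finally show ?thesis using l lr by simp
qed

locale hopf_base =
  fixes K :: "'a univ ring" and H :: "'a univ hopf" and L :: "'a univ base_alg"
  assumes cring_K: "cring K" and hopf: "hopf_algebra K H"
    and inv_antipode: "invertible_antipode H" and base: "base_algebra K H L"
begin

abbreviation "lin \<equiv> k_linear K"
abbreviation "hmod X \<equiv> left_module H X"
abbreviation r where "r X \<equiv> restrict_scalars H X"
abbreviation "LL \<equiv> base_hmod L"
abbreviation ht (infixr \<open>\<bullet>\<close> 70) where "X \<bullet> Y \<equiv> htensor K H X Y"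
abbreviation hp where "hp X Y x y \<equiv> hcls K H X Y [(x, y)]"
abbreviation "S \<equiv> antipode H"
abbreviation "T \<equiv> inv_into (carrier H) (antipode H)"
abbreviation act (infixr \<open>\<rhd>\<close> 75) where "h \<rhd> l \<equiv> hact L h l"
abbreviation "\<epsilon> \<equiv> counit H"
abbreviation hmult (infixl \<open>\<cdot>\<close> 72) where "g \<cdot> h \<equiv> g \<otimes>\<^bsub>H\<^esub> h"
abbreviation lmult (infixl \<open>*\<^sub>L\<close> 72) where "l *\<^sub>L m \<equiv> l \<otimes>\<^bsub>L\<^esub> m"
abbreviation sw where "sw A h F \<equiv> tsum A F (comul H h)"
abbreviation co where "co A l F \<equiv> tsum A F (coact L l)"

lemma alg_H: "k_algebra K H" and alg_L: "k_algebra K L"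
  using hopf base by (simp_all add: hopf_algebra_def base_algebra_def)

lemma mod_H: "module K H" and mod_L: "module K L" and ring_H: "ring H" and ring_L: "ring L"
  using alg_H alg_L by (simp_all add: k_algebra_def)

lemma hmod_LL: "hmod LL"
  using base by (simp add: base_algebra_def)

lemma mod_r: "hmod X \<Longrightarrow> module K (r X)"
  by (rule module_restrict_scalars[OF alg_H])

lemma mod_K: "module K (regular K)"
  using cring_K cring.axioms(1)[OF cring_K]
  by (intro moduleI) (auto simp: ring.ring_simprules intro: abelian_group_cong[OF ring.is_abelian_group]
      monoid.l_one[OF ring.is_monoid] cring.cring_simprules)

lemma LL_simps [simp]:
  "carrier LL = carrier L" "add LL = add L" "zero LL = zero L" "smult LL = hact L"
  by (simp_all add: base_hmod_def)

lemma hact_scalar: "k \<in> carrier K \<Longrightarrow> l \<in> carrier L \<Longrightarrow> (k \<odot>\<^bsub>H\<^esub> \<one>\<^bsub>H\<^esub>) \<rhd> l = k \<odot>\<^bsub>L\<^esub> l"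
  using base by (simp add: base_algebra_def)

lemma r_smult: "k \<odot>\<^bsub>r X\<^esub> x = (k \<odot>\<^bsub>H\<^esub> \<one>\<^bsub>H\<^esub>) \<odot>\<^bsub>X\<^esub> x"
  by (simp add: restrict_scalars_def)

text \<open>\<open>L\<close> has its own \<open>K\<close>-structure and one through
  \<open>H\<close>; the base algebra axiom \<open>hact_scalar\<close> says that they coincide, so
  linearity may be read in either.\<close>

lemma lin_from_LL: "lin (r LL) A f = lin L A f"
  by (auto simp: k_linear_def additive_on_def r_smult hact_scalar)

lemma lin_to_LL: "lin P (r LL) f = lin P L f"
  by (auto simp: k_linear_def additive_on_def r_smult hact_scalar Pi_iff)

lemmas hopf1 = hopf[unfolded hopf_algebra_def, THEN conjunct2] and base1 = base[unfolded base_algebra_def, THEN conjunct2]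
lemmas hopf2 = hopf1[THEN conjunct2]
lemmas hopf3 = hopf2[THEN conjunct2]
lemmas hopf4 = hopf3[THEN conjunct2]
lemmas hopf5 = hopf4[THEN conjunct2]
lemmas hopf6 = hopf5[THEN conjunct2]
lemmas base2 = base1[THEN conjunct2]
lemmas base3 = base2[THEN conjunct2]
lemmas base4 = base3[THEN conjunct2]
lemmas base5 = base4[THEN conjunct2]
lemmas base6 = base5[THEN conjunct2]
lemmas base7 = base6[THEN conjunct2]
lemmas base8 = base7[THEN conjunct2]
lemmas base9 = base8[THEN conjunct2]

lemma lin_comul: "lin H (tensor K H H) (comul H)"
  using hopf1[THEN conjunct1] by (simp add: k_algebra_hom_def)

lemma lin_counit: "lin H (regular K) \<epsilon>" and counit_one: "\<epsilon> \<one>\<^bsub>H\<^esub> = \<one>\<^bsub>K\<^esub>"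
  and counit_mult: "g \<in> carrier H \<Longrightarrow> h \<in> carrier H \<Longrightarrow> \<epsilon> (g \<cdot> h) = \<epsilon> g \<otimes>\<^bsub>K\<^esub> \<epsilon> h"
  using hopf2[THEN conjunct1] by (simp_all add: k_algebra_hom_def)

lemma lin_antipode: "lin H H S"
  using hopf3[THEN conjunct1] .

lemma lin_coact: "lin L (tensor K H L) (coact L)"
  using base5[THEN conjunct1] by (simp add: k_algebra_hom_def)

lemma pair_HH: "tensor_pair K H H" and pair_HL: "tensor_pair K H L"
  by (intro module_pair mod_H mod_L)+

lemma comul_closed: "h \<in> carrier H \<Longrightarrow> comul H h \<in> carrier (tensor K H H)"
  and coact_closed: "l \<in> carrier L \<Longrightarrow> coact L l \<in> carrier (tensor K H L)"
  by (rule k_linear_closed[OF lin_comul] k_linear_closed[OF lin_coact]; assumption)+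

lemma H_closed [simp]: "g \<in> carrier H \<Longrightarrow> h \<in> carrier H \<Longrightarrow> g \<cdot> h \<in> carrier H"
  "l \<in> carrier L \<Longrightarrow> m \<in> carrier L \<Longrightarrow> l *\<^sub>L m \<in> carrier L" "\<one>\<^bsub>H\<^esub> \<in> carrier H" "\<one>\<^bsub>L\<^esub> \<in> carrier L"
  by (simp_all add: ring.ring_simprules ring_H ring_L)

lemma H_one [simp]: "h \<in> carrier H \<Longrightarrow> \<one>\<^bsub>H\<^esub> \<cdot> h = h" "h \<in> carrier H \<Longrightarrow> h \<cdot> \<one>\<^bsub>H\<^esub> = h"
  "l \<in> carrier L \<Longrightarrow> \<one>\<^bsub>L\<^esub> *\<^sub>L l = l" "l \<in> carrier L \<Longrightarrow> l *\<^sub>L \<one>\<^bsub>L\<^esub> = l"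
  using ring.is_monoid[OF ring_H] ring.is_monoid[OF ring_L] by (simp_all add: monoid.l_one monoid.r_one)

lemma H_assoc: "f \<in> carrier H \<Longrightarrow> g \<in> carrier H \<Longrightarrow> h \<in> carrier H \<Longrightarrow> f \<cdot> g \<cdot> h = f \<cdot> (g \<cdot> h)"
  and L_assoc: "l \<in> carrier L \<Longrightarrow> m \<in> carrier L \<Longrightarrow> n \<in> carrier L \<Longrightarrow> l *\<^sub>L m *\<^sub>L n = l *\<^sub>L (m *\<^sub>L n)"
  by (simp_all add: ring.ring_simprules ring_H ring_L)

lemma K_closed [simp]: "\<one>\<^bsub>K\<^esub> \<in> carrier K" "h \<in> carrier H \<Longrightarrow> \<epsilon> h \<in> carrier K"
  using k_linear_closed[OF lin_counit] cring.axioms(1)[OF cring_K] by (auto simp: ring.ring_simprules)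

lemma act_closed [simp]: "h \<in> carrier H \<Longrightarrow> l \<in> carrier L \<Longrightarrow> h \<rhd> l \<in> carrier L"
  using left_module_closed[OF hmod_LL] by simp

lemma act_act: "g \<in> carrier H \<Longrightarrow> h \<in> carrier H \<Longrightarrow> l \<in> carrier L \<Longrightarrow> (g \<cdot> h) \<rhd> l = g \<rhd> h \<rhd> l"
  using left_module_mult[OF hmod_LL] by simp

lemma act_one [simp]: "l \<in> carrier L \<Longrightarrow> \<one>\<^bsub>H\<^esub> \<rhd> l = l"
  using left_module_one[OF hmod_LL] by simp

lemma S_closed [simp]: "h \<in> carrier H \<Longrightarrow> S h \<in> carrier H"
  by (rule k_linear_closed[OF lin_antipode])

lemma T_closed [simp]: "h \<in> carrier H \<Longrightarrow> T h \<in> carrier H"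
  and S_T [simp]: "h \<in> carrier H \<Longrightarrow> S (T h) = h" and T_S [simp]: "h \<in> carrier H \<Longrightarrow> T (S h) = h"
  using inv_antipode unfolding invertible_antipode_def bij_betw_def
  by (auto intro: inv_into_into f_inv_into_f inv_into_f_f)

lemma lin_T: "lin H H T"
proof -
  interpret H: module K H by (rule mod_H)
  have "T (x \<oplus>\<^bsub>H\<^esub> y) = T x \<oplus>\<^bsub>H\<^esub> T y" if "x \<in> carrier H" "y \<in> carrier H" for x y
    using T_S[of "T x \<oplus>\<^bsub>H\<^esub> T y"] that additive_on_add[OF k_linear_additive[OF lin_antipode]] by simp
  moreover have "T (k \<odot>\<^bsub>H\<^esub> y) = k \<odot>\<^bsub>H\<^esub> T y" if "k \<in> carrier K" "y \<in> carrier H" for k y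
    using T_S[of "k \<odot>\<^bsub>H\<^esub> T y"] that k_linear_smult[OF lin_antipode] by simp
  ultimately show ?thesis by (intro k_linearI) auto
qed

subsection \<open>The tensor product of modules over the Hopf algebra\<close>

lemma pair_r: "hmod X \<Longrightarrow> hmod Y \<Longrightarrow> tensor_pair K (r X) (r Y)"
  by (intro module_pair mod_r)

lemma ht_simps:
  "carrier (X \<bullet> Y) = carrier (tensor K (r X) (r Y))" "add (X \<bullet> Y) = add (tensor K (r X) (r Y))"
  "zero (X \<bullet> Y) = zero (tensor K (r X) (r Y))"
  by (simp_all add: htensor_def)

lemma tsum_ht: "tsum (r (X \<bullet> Y)) = tsum (tensor K (r X) (r Y))"
  by (rule tsum_cong_record) (simp_all add: ht_simps)

lemma tsum_r: "tsum X = tsum (r X)"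
  by (rule tsum_cong_record) simp_all

lemma sw_cong:
  "(\<And>a b. a \<in> carrier H \<Longrightarrow> b \<in> carrier H \<Longrightarrow> F a b = G a b) \<Longrightarrow> h \<in> carrier H \<Longrightarrow> sw A h F = sw A h G"
  by (rule tensor_pair.tsum_cong[OF pair_HH _ comul_closed])

lemma co_cong:
  "(\<And>a b. a \<in> carrier H \<Longrightarrow> b \<in> carrier L \<Longrightarrow> F a b = G a b) \<Longrightarrow> l \<in> carrier L \<Longrightarrow> co A l F = co A l G"
  by (rule tensor_pair.tsum_cong[OF pair_HL _ coact_closed])

lemma sw_closed:
  "module K A \<Longrightarrow> h \<in> carrier H \<Longrightarrow> (\<And>a b. a \<in> carrier H \<Longrightarrow> b \<in> carrier H \<Longrightarrow> F a b \<in> carrier A) \<Longrightarrow>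
   sw A h F \<in> carrier A"
  by (rule tensor_pair.tsum_closed[OF pair_HH module_group _ comul_closed])

lemma co_closed:
  "module K A \<Longrightarrow> l \<in> carrier L \<Longrightarrow> (\<And>a b. a \<in> carrier H \<Longrightarrow> b \<in> carrier L \<Longrightarrow> F a b \<in> carrier A) \<Longrightarrow>
   co A l F \<in> carrier A"
  by (rule tensor_pair.tsum_closed[OF pair_HL module_group _ coact_closed])

lemma sw_closed_r:
  "hmod X \<Longrightarrow> h \<in> carrier H \<Longrightarrow> (\<And>a b. a \<in> carrier H \<Longrightarrow> b \<in> carrier H \<Longrightarrow> F a b \<in> carrier X) \<Longrightarrow>
   sw (r X) h F \<in> carrier X"
  by (rule sw_closed[OF mod_r, simplified])

lemma co_closed_r:
  "hmod X \<Longrightarrow> l \<in> carrier L \<Longrightarrow> (\<And>a b. a \<in> carrier H \<Longrightarrow> b \<in> carrier L \<Longrightarrow> F a b \<in> carrier X) \<Longrightarrow>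
   co (r X) l F \<in> carrier X"
  by (rule co_closed[OF mod_r, simplified])

text \<open>For a parameter that enters through the element being comultiplied; linearity then needs
  a bilinear summand. \<open>lin_sw_inner\<close> treats a parameter that enters only through the
  summand.\<close>

lemma lin_sw:
  assumes "module K A" "\<And>a. a \<in> carrier H \<Longrightarrow> lin H A (\<lambda>b. F a b)"
    "\<And>b. b \<in> carrier H \<Longrightarrow> lin H A (\<lambda>a. F a b)" "lin P H f"
  shows "lin P A (\<lambda>x. sw A (f x) F)"
  by (rule k_linear_comp[OF assms(4) k_linear_tsum[OF mod_H mod_H assms(1) _ lin_comul]])
    (rule bilinearI; fact)

lemma lin_co:
  assumes "module K A" "\<And>a. a \<in> carrier H \<Longrightarrow> lin L A (\<lambda>b. F a b)"
    "\<And>b. b \<in> carrier L \<Longrightarrow> lin H A (\<lambda>a. F a b)" "lin P L f"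
  shows "lin P A (\<lambda>x. co A (f x) F)"
  by (rule k_linear_comp[OF assms(4) k_linear_tsum[OF mod_H mod_L assms(1) _ lin_coact]])
    (rule bilinearI; fact)

lemma lin_sw_inner:
  assumes "module K A" "module K P" "h \<in> carrier H"
    "\<And>a b. a \<in> carrier H \<Longrightarrow> b \<in> carrier H \<Longrightarrow> lin P A (\<lambda>x. F x a b)"
  shows "lin P A (\<lambda>x. sw A h (F x))"
  by (rule k_linear_tsum_inner[OF mod_H mod_H assms(1) comul_closed[OF assms(3)] assms(4) module.smult_closed[OF assms(2)]])

lemma lin_co_inner:
  assumes "module K A" "module K P" "l \<in> carrier L"
    "\<And>a b. a \<in> carrier H \<Longrightarrow> b \<in> carrier L \<Longrightarrow> lin P A (\<lambda>x. F x a b)"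
  shows "lin P A (\<lambda>x. co A l (F x))"
  by (rule k_linear_tsum_inner[OF mod_H mod_L assms(1) coact_closed[OF assms(3)] assms(4) module.smult_closed[OF assms(2)]])

lemma lin_act_left: "lin P H f \<Longrightarrow> l \<in> carrier L \<Longrightarrow> lin P L (\<lambda>x. f x \<rhd> l)"
  using k_linear_act_left[OF alg_H hmod_LL] by (simp add: lin_to_LL)

lemma lin_act_right: "lin P L f \<Longrightarrow> h \<in> carrier H \<Longrightarrow> lin P L (\<lambda>x. h \<rhd> f x)"
  using k_linear_act_right[OF alg_H hmod_LL] by (simp add: lin_to_LL)

lemmas lin_S = k_linear_comp[OF _ lin_antipode]
lemmas lin_T' = k_linear_comp[OF _ lin_T]
lemmas lin_eps = k_linear_comp[OF _ lin_counit]

text \<open>Introduction rules that take a nested Sweedler expression apart, so that its linearity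
  in one variable, and the membership conditions which arise on the way, are found by proof
  search.\<close>

lemmas lin = k_linear_id lin_sw lin_co lin_sw_inner lin_co_inner lin_act_left lin_act_right
  k_linear_mult_left[OF alg_H] k_linear_mult_right[OF alg_H] k_linear_mult_left[OF alg_L] k_linear_mult_right[OF alg_L]
  lin_S lin_T' lin_eps k_linear_smult_left k_linear_smult_right
  k_linear_act_left[OF alg_H] k_linear_act_right[OF alg_H]
  mod_H mod_L mod_K mod_r sw_closed co_closed sw_closed_r co_closed_r bilinearI trilinearI
  lin_to_LL[THEN iffD2] lin_from_LL[THEN iffD2] left_module_closed

lemma sw_hom:
  assumes "module K A" "module K A'" "lin A A' f"
    "\<And>a b. a \<in> carrier H \<Longrightarrow> b \<in> carrier H \<Longrightarrow> F a b \<in> carrier A" "h \<in> carrier H"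
  shows "f (sw A h F) = sw A' h (\<lambda>a b. f (F a b))"
  by (rule tensor_pair.tsum_hom[OF pair_HH module_group[OF assms(1)] module_group[OF assms(2)]
        k_linear_additive[OF assms(3)] assms(4) comul_closed[OF assms(5)]])

lemma co_hom:
  assumes "module K A" "module K A'" "lin A A' f"
    "\<And>a b. a \<in> carrier H \<Longrightarrow> b \<in> carrier L \<Longrightarrow> F a b \<in> carrier A" "l \<in> carrier L"
  shows "f (co A l F) = co A' l (\<lambda>a b. f (F a b))"
  by (rule tensor_pair.tsum_hom[OF pair_HL module_group[OF assms(1)] module_group[OF assms(2)]
        k_linear_additive[OF assms(3)] assms(4) coact_closed[OF assms(5)]])

lemma sw_sw:
  assumes "module K A" "g \<in> carrier H" "h \<in> carrier H"
    "\<And>a b c d. a \<in> carrier H \<Longrightarrow> b \<in> carrier H \<Longrightarrow> c \<in> carrier H \<Longrightarrow> d \<in> carrier H \<Longrightarrow> F a b c d \<in> carrier A"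
  shows "sw A g (\<lambda>a b. sw A h (\<lambda>c d. F a b c d)) = sw A h (\<lambda>c d. sw A g (\<lambda>a b. F a b c d))"
  by (rule tsum_swap[OF pair_HH pair_HH module_group[OF assms(1)] comul_closed comul_closed]) fact+

lemma sw_co:
  assumes "module K A" "g \<in> carrier H" "l \<in> carrier L"
    "\<And>a b c d. a \<in> carrier H \<Longrightarrow> b \<in> carrier H \<Longrightarrow> c \<in> carrier H \<Longrightarrow> d \<in> carrier L \<Longrightarrow> F a b c d \<in> carrier A"
  shows "sw A g (\<lambda>a b. co A l (\<lambda>c d. F a b c d)) = co A l (\<lambda>c d. sw A g (\<lambda>a b. F a b c d))"
  by (rule tsum_swap[OF pair_HH pair_HL module_group[OF assms(1)] comul_closed coact_closed]) fact+

lemma co_co: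
  assumes "module K A" "g \<in> carrier L" "l \<in> carrier L"
    "\<And>a b c d. a \<in> carrier H \<Longrightarrow> b \<in> carrier L \<Longrightarrow> c \<in> carrier H \<Longrightarrow> d \<in> carrier L \<Longrightarrow> F a b c d \<in> carrier A"
  shows "co A g (\<lambda>a b. co A l (\<lambda>c d. F a b c d)) = co A l (\<lambda>c d. co A g (\<lambda>a b. F a b c d))"
  by (rule tsum_swap[OF pair_HL pair_HL module_group[OF assms(1)] coact_closed coact_closed]) fact+

subsection \<open>The axioms\<close>

lemma sw_coassoc:
  assumes "module K A" "trilinear K H H H A F" "h \<in> carrier H"
  shows "sw A h (\<lambda>x c. sw A x (\<lambda>a b. F a b c)) = sw A h (\<lambda>a x. sw A x (\<lambda>b c. F a b c))"
  using tsum_coassoc[OF mod_H mod_H assms(1) comul_closed[OF assms(3)] comul_closed comul_closed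
      bspec[OF hopf4[THEN conjunct1] assms(3)] assms(2)] .

lemma co_coassoc:
  assumes "module K A" "trilinear K H H L A F" "l \<in> carrier L"
  shows "co A l (\<lambda>x m. sw A x (\<lambda>a b. F a b m)) = co A l (\<lambda>a y. co A y (\<lambda>b m. F a b m))"
  using tsum_coassoc[OF mod_H mod_L assms(1) coact_closed[OF assms(3)] coact_closed comul_closed
      bspec[OF base6[THEN conjunct1] assms(3)] assms(2)] .

text \<open>The linear map \<open>f\<close> allows the counit to be cancelled inside a larger
  expression.\<close>

lemma sw_counit_left:
  assumes A: "module K A" and f: "lin H A f" and h: "h \<in> carrier H"
  shows "sw A h (\<lambda>a b. \<epsilon> a \<odot>\<^bsub>A\<^esub> f b) = f h"
proof -
  have "sw H h (\<lambda>a b. \<epsilon> a \<odot>\<^bsub>H\<^esub> b) = h"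
    using hopf5[THEN conjunct1] h by (simp add: tsum_def)
  hence "f h = f (sw H h (\<lambda>a b. \<epsilon> a \<odot>\<^bsub>H\<^esub> b))" by simp
  also have "\<dots> = sw A h (\<lambda>a b. f (\<epsilon> a \<odot>\<^bsub>H\<^esub> b))"
    by (rule sw_hom[OF mod_H A f _ h]) (simp add: module.smult_closed[OF mod_H])
  finally show ?thesis using h by (simp add: k_linear_smult[OF f] cong: sw_cong)
qed

lemma sw_counit_right:
  assumes A: "module K A" and f: "lin H A f" and h: "h \<in> carrier H"
  shows "sw A h (\<lambda>a b. \<epsilon> b \<odot>\<^bsub>A\<^esub> f a) = f h"
proof -
  have "sw H h (\<lambda>a b. \<epsilon> b \<odot>\<^bsub>H\<^esub> a) = h"
    using hopf5[THEN conjunct1] h by (simp add: tsum_def)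
  hence "f h = f (sw H h (\<lambda>a b. \<epsilon> b \<odot>\<^bsub>H\<^esub> a))" by simp
  also have "\<dots> = sw A h (\<lambda>a b. f (\<epsilon> b \<odot>\<^bsub>H\<^esub> a))"
    by (rule sw_hom[OF mod_H A f _ h]) (simp add: module.smult_closed[OF mod_H])
  finally show ?thesis using h by (simp add: k_linear_smult[OF f] cong: sw_cong)
qed

lemma co_counit:
  assumes A: "module K A" and f: "lin L A f" and l: "l \<in> carrier L"
  shows "co A l (\<lambda>a m. \<epsilon> a \<odot>\<^bsub>A\<^esub> f m) = f l"
proof -
  have "co L l (\<lambda>a b. \<epsilon> a \<odot>\<^bsub>L\<^esub> b) = l"
    using base7[THEN conjunct1] l by (simp add: tsum_def)
  hence "f l = f (co L l (\<lambda>a b. \<epsilon> a \<odot>\<^bsub>L\<^esub> b))" by simp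
  also have "\<dots> = co A l (\<lambda>a b. f (\<epsilon> a \<odot>\<^bsub>L\<^esub> b))"
    by (rule co_hom[OF mod_L A f _ l]) (simp add: module.smult_closed[OF mod_L])
  finally show ?thesis using l by (simp add: k_linear_smult[OF f] cong: co_cong)
qed

lemma antipode_left: "h \<in> carrier H \<Longrightarrow> sw H h (\<lambda>a b. S a \<cdot> b) = \<epsilon> h \<odot>\<^bsub>H\<^esub> \<one>\<^bsub>H\<^esub>"
  and antipode_right: "h \<in> carrier H \<Longrightarrow> sw H h (\<lambda>a b. a \<cdot> S b) = \<epsilon> h \<odot>\<^bsub>H\<^esub> \<one>\<^bsub>H\<^esub>"
  using hopf6 by (simp_all add: tsum_def)

lemma quasi_comm: "l \<in> carrier L \<Longrightarrow> m \<in> carrier L \<Longrightarrow> co L l (\<lambda>a n. (a \<rhd> m) *\<^sub>L n) = l *\<^sub>L m"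
  using base9 by (simp add: tsum_def)

lemma act_mult:
  "h \<in> carrier H \<Longrightarrow> l \<in> carrier L \<Longrightarrow> m \<in> carrier L \<Longrightarrow>
   h \<rhd> (l *\<^sub>L m) = sw L h (\<lambda>a b. (a \<rhd> l) *\<^sub>L (b \<rhd> m))"
  using base3[THEN conjunct1] by (simp add: tsum_def)

lemma act_unit: "h \<in> carrier H \<Longrightarrow> h \<rhd> \<one>\<^bsub>L\<^esub> = \<epsilon> h \<odot>\<^bsub>L\<^esub> \<one>\<^bsub>L\<^esub>"
  using base4[THEN conjunct1] by simp

end

section \<open>Coproducts and coactions of products and of h \<rhd> l\<close>

context hopf_base
begin

lemma sw_mult:
  assumes A: "module K A" and F: "bilinear K H H A F" and "g \<in> carrier H" "h \<in> carrier H"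
  shows "sw A (g \<cdot> h) F = sw A g (\<lambda>a b. sw A h (\<lambda>c d. F (a \<cdot> c) (b \<cdot> d)))"
proof -
  have "comul H (g \<cdot> h) = comul H g \<otimes>\<^bsub>tensor K H H\<^esub> comul H h"
    using hopf1[THEN conjunct1] assms(3,4) by (simp add: k_algebra_hom_def)
  thus ?thesis using tsum_tensor_mult[OF alg_H alg_H A F comul_closed comul_closed] assms(3,4) by simp
qed

lemma sw_one:
  assumes A: "module K A" and F: "bilinear K H H A F"
  shows "sw A \<one>\<^bsub>H\<^esub> F = F \<one>\<^bsub>H\<^esub> \<one>\<^bsub>H\<^esub>"
proof -
  have "comul H \<one>\<^bsub>H\<^esub> = tcls K H H [(\<one>\<^bsub>H\<^esub>, \<one>\<^bsub>H\<^esub>)]"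
    using hopf1[THEN conjunct1] by (simp add: k_algebra_hom_def tensor_def)
  thus ?thesis using tensor_pair.tsum_pure[OF pair_HH module_group[OF A] bilinear_balanced[OF F]] by simp
qed

lemma co_mult:
  assumes A: "module K A" and F: "bilinear K H L A F" and "l \<in> carrier L" "m \<in> carrier L"
  shows "co A (l *\<^sub>L m) F = co A l (\<lambda>a b. co A m (\<lambda>c d. F (a \<cdot> c) (b *\<^sub>L d)))"
proof -
  have "coact L (l *\<^sub>L m) = coact L l \<otimes>\<^bsub>tensor K H L\<^esub> coact L m"
    using base5[THEN conjunct1] assms(3,4) by (simp add: k_algebra_hom_def)
  thus ?thesis using tsum_tensor_mult[OF alg_H alg_L A F coact_closed coact_closed] assms(3,4) by simp
qed

lemma co_one:
  assumes A: "module K A" and F: "bilinear K H L A F"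
  shows "co A \<one>\<^bsub>L\<^esub> F = F \<one>\<^bsub>H\<^esub> \<one>\<^bsub>L\<^esub>"
proof -
  have "coact L \<one>\<^bsub>L\<^esub> = tcls K H L [(\<one>\<^bsub>H\<^esub>, \<one>\<^bsub>L\<^esub>)]"
    using base5[THEN conjunct1] by (simp add: k_algebra_hom_def tensor_def)
  thus ?thesis using tensor_pair.tsum_pure[OF pair_HL module_group[OF A] bilinear_balanced[OF F]] by simp
qed

text \<open>A condition of Yetter-Drinfeld type, evaluated on a bilinear map: the three legs of
  \<open>h\<close> appear as \<open>a\<close>, \<open>b\<close>, \<open>c\<close>, the coaction of
  \<open>l\<close> is conjugated by the outer two, and the middle one acts on
  \<open>L\<close>.\<close>

lemma co_act:
  assumes A: "module K A" and F: "bilinear K H L A F" and h: "h \<in> carrier H" and l: "l \<in> carrier L"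
  shows "co A (h \<rhd> l) F =
    sw A h (\<lambda>a x. sw A x (\<lambda>b c. co A l (\<lambda>p m. F (a \<cdot> p \<cdot> S c) (b \<rhd> m))))"
proof -
  note G = module_group[OF A] and bal = bilinear_balanced[OF F]
  let ?T = "tensor K H L"
  note GT = tensor_pair.group_T[OF pair_HL]
  note add = tensor_pair.tsum_additive[OF pair_HL G bal]
  let ?g = "\<lambda>a b c. [(a \<cdot> p \<cdot> S c, b \<rhd> m). (p, m) \<leftarrow> tlist (coact L l)]"
  let ?f = "\<lambda>a x. concat (map (\<lambda>(b, c). ?g a b c) (tlist (comul H x)))"
  have valg: "set (?g a b c) \<subseteq> carrier H \<times> carrier L" if "a \<in> carrier H" "b \<in> carrier H" "c \<in> carrier H" for a b c
    by (rule tensor_pair.tlist_map_valid[OF pair_HL _ _ coact_closed[OF l]]) (use that in auto)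
  have valf: "set (?f a x) \<subseteq> carrier H \<times> carrier L" if "a \<in> carrier H" "x \<in> carrier H" for a x
    by (rule tensor_pair.tlist_concat_valid[OF pair_HH valg[OF that(1)] comul_closed[OF that(2)]])
  have 0: "coact L (h \<rhd> l) = tcls K H L (concat (map (\<lambda>(a, x). ?f a x) (tlist (comul H h))))"
    using bspec[OF bspec[OF base8[THEN conjunct1] h] l] .
  have 1: "\<dots> = sw ?T h (\<lambda>a x. tcls K H L (?f a x))"
    by (rule tensor_pair.tcls_concat[OF pair_HH valf pair_HL comul_closed[OF h]])
  have 2: "tcls K H L (?f a x) = sw ?T x (\<lambda>b c. tcls K H L (?g a b c))" if "a \<in> carrier H" "x \<in> carrier H" for a x
    by (rule tensor_pair.tcls_concat[OF pair_HH valg pair_HL comul_closed]) (use that in auto)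
  have 3: "tsum A F (tcls K H L (?g a b c)) = co A l (\<lambda>p m. F (a \<cdot> p \<cdot> S c) (b \<rhd> m))"
    if "a \<in> carrier H" "b \<in> carrier H" "c \<in> carrier H" for a b c
    by (subst tensor_pair.tsum_tcls[OF pair_HL G bal valg[OF that]])
      (simp add: tsum_def comp_def case_prod_unfold)
  have "co A (h \<rhd> l) F = sw A h (\<lambda>a x. tsum A F (tcls K H L (?f a x)))"
    unfolding 0 1 by (rule tensor_pair.tsum_hom[OF pair_HH GT G add _ comul_closed[OF h]])
      (rule tensor_pair.tcls_closed[OF pair_HL valf])
  also have "\<dots> = sw A h (\<lambda>a x. sw A x (\<lambda>b c. tsum A F (tcls K H L (?g a b c))))"
  proof (rule sw_cong[OF _ h])
    fix a x assume ax: "a \<in> carrier H" "x \<in> carrier H"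
    show "tsum A F (tcls K H L (?f a x)) = sw A x (\<lambda>b c. tsum A F (tcls K H L (?g a b c)))"
      unfolding 2[OF ax] by (rule tensor_pair.tsum_hom[OF pair_HH GT G add _ comul_closed[OF ax(2)]])
        (rule tensor_pair.tcls_closed[OF pair_HL valg[OF ax(1)]])
  qed
  also have "\<dots> = sw A h (\<lambda>a x. sw A x (\<lambda>b c. co A l (\<lambda>p m. F (a \<cdot> p \<cdot> S c) (b \<rhd> m))))"
    by (intro sw_cong 3 h)
  finally show ?thesis .
qed

subsection \<open>The antipode\<close>

text \<open>The pairs \<open>S a \<cdot> b\<close>, \<open>a \<cdot> S b\<close>,
  \<open>T b \<cdot> a\<close> and \<open>b \<cdot> T a\<close> all sum to \<epsilon>(h) 1 over the
  coproduct of \<open>h\<close>. With the property isolated, the cancellation rules below are proved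
  once for all four.\<close>

definition conv_unit :: "('a univ \<Rightarrow> 'a univ \<Rightarrow> 'a univ) \<Rightarrow> bool" where
  "conv_unit u \<longleftrightarrow> bilinear K H H H u \<and> (\<forall>h\<in>carrier H. sw H h u = \<epsilon> h \<odot>\<^bsub>H\<^esub> \<one>\<^bsub>H\<^esub>)"

text \<open>Coassociativity makes the two arguments of \<open>u\<close> the legs of one coproduct;
  their sum is a counit times 1, and the counit is absorbed by the leg or the element of
  \<open>L\<close> that is left over.\<close>

lemma
  assumes u: "conv_unit u" and A: "module K A"
  shows collapse_right: "bilinear K H H A F \<Longrightarrow> h \<in> carrier H \<Longrightarrow>
      sw A h (\<lambda>a x. sw A x (\<lambda>b c. F a (u b c))) = F h \<one>\<^bsub>H\<^esub>"
    and collapse_left: "bilinear K H H A F \<Longrightarrow> h \<in> carrier H \<Longrightarrow>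
      sw A h (\<lambda>a x. sw A x (\<lambda>b c. F (u a b) c)) = F \<one>\<^bsub>H\<^esub> h"
    and collapse_co: "bilinear K H L A G \<Longrightarrow> l \<in> carrier L \<Longrightarrow>
      co A l (\<lambda>a y. co A y (\<lambda>b m. G (u a b) m)) = G \<one>\<^bsub>H\<^esub> l"
proof -
  have ub: "bilinear K H H H u" and ue: "\<And>h. h \<in> carrier H \<Longrightarrow> sw H h u = \<epsilon> h \<odot>\<^bsub>H\<^esub> \<one>\<^bsub>H\<^esub>"
    using u by (auto simp: conv_unit_def)
  note uc = bilinear_closed[OF ub]
  have in_u: "sw A x (\<lambda>b c. f (u b c)) = \<epsilon> x \<odot>\<^bsub>A\<^esub> f \<one>\<^bsub>H\<^esub>" if "lin H A f" "x \<in> carrier H" for f x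
    using sw_hom[OF mod_H A that(1), of u x] ue[OF that(2)] k_linear_smult[OF that(1), of "\<epsilon> x" "\<one>\<^bsub>H\<^esub>"] uc that
    by simp
  show "sw A h (\<lambda>a x. sw A x (\<lambda>b c. F a (u b c))) = F h \<one>\<^bsub>H\<^esub>"
    if F: "bilinear K H H A F" and h: "h \<in> carrier H"
    using sw_counit_right[OF A bilinear_left[OF F, of "\<one>\<^bsub>H\<^esub>"] h] h
    by (simp add: in_u[OF bilinear_right[OF F]] cong: sw_cong)
  show "sw A h (\<lambda>a x. sw A x (\<lambda>b c. F (u a b) c)) = F \<one>\<^bsub>H\<^esub> h"
    if F: "bilinear K H H A F" and h: "h \<in> carrier H"
  proof -
    have "trilinear K H H H A (\<lambda>a b c. F (u a b) c)"
      by (intro trilinearI k_linear_comp[OF bilinear_left[OF ub] bilinear_left[OF F]]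
          k_linear_comp[OF bilinear_right[OF ub] bilinear_left[OF F]] bilinear_right[OF F] uc)
    from sw_coassoc[OF A this h] show ?thesis
      using sw_counit_left[OF A bilinear_right[OF F, of "\<one>\<^bsub>H\<^esub>"] h] h
      by (simp add: in_u[OF bilinear_left[OF F]] cong: sw_cong)
  qed
  show "co A l (\<lambda>a y. co A y (\<lambda>b m. G (u a b) m)) = G \<one>\<^bsub>H\<^esub> l"
    if G: "bilinear K H L A G" and l: "l \<in> carrier L"
  proof -
    have "trilinear K H H L A (\<lambda>a b c. G (u a b) c)"
      by (intro trilinearI k_linear_comp[OF bilinear_left[OF ub] bilinear_left[OF G]]
          k_linear_comp[OF bilinear_right[OF ub] bilinear_left[OF G]] bilinear_right[OF G] uc)
    from co_coassoc[OF A this l] show ?thesis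
      using co_counit[OF A bilinear_right[OF G, of "\<one>\<^bsub>H\<^esub>"] l] l
      by (simp add: in_u[OF bilinear_left[OF G]] cong: co_cong)
  qed
qed

lemma conv_S: "conv_unit (\<lambda>a b. S a \<cdot> b)" "conv_unit (\<lambda>a b. a \<cdot> S b)"
  by (auto simp: conv_unit_def antipode_left antipode_right intro!: lin)

lemma S_one: "S \<one>\<^bsub>H\<^esub> = \<one>\<^bsub>H\<^esub>"
proof -
  interpret H: module K H by (rule mod_H)
  have "bilinear K H H H (\<lambda>a b. S a \<cdot> b)" by (auto intro!: lin)
  from sw_one[OF mod_H this] antipode_left[of "\<one>\<^bsub>H\<^esub>"] show ?thesis by (simp add: counit_one)
qed

text \<open>Expand \<epsilon>(S h) as a sum of \<epsilon>(a) \<epsilon>(S b), collect it into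
  \<epsilon>(a S(b)), and apply the antipode axiom.\<close>

lemma counit_S: assumes "h \<in> carrier H" shows "\<epsilon> (S h) = \<epsilon> h"
proof -
  interpret H: module K H by (rule mod_H)
  have "\<epsilon> (S h) = sw (regular K) h (\<lambda>a b. \<epsilon> a \<odot>\<^bsub>regular K\<^esub> \<epsilon> (S b))"
    by (rule sw_counit_left[symmetric]) (use assms in \<open>auto intro!: lin\<close>)
  also have "\<dots> = sw (regular K) h (\<lambda>a b. \<epsilon> (a \<cdot> S b))"
    using assms by (simp add: counit_mult cong: sw_cong)
  also have "\<dots> = \<epsilon> (sw H h (\<lambda>a b. a \<cdot> S b))"
    by (rule sw_hom[symmetric]) (use assms in \<open>auto intro!: lin\<close>)
  also have "\<dots> = \<epsilon> h"
    using assms k_linear_smult[OF lin_counit, of "\<epsilon> h" "\<one>\<^bsub>H\<^esub>"] by (simp add: antipode_right counit_one)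
  finally show ?thesis .
qed

text \<open>Uniqueness of convolution inverses of the multiplication, carried out by hand. Three
  legs of each factor are created by inserting g2 (h2 S(h3)) S(g3); rebracketing gives S(g1 h1) g2
  h2 times S(h3) S(g3), and the first product collapses.\<close>

lemma S_mult:
  assumes g: "g \<in> carrier H" and h: "h \<in> carrier H"
  shows "S (g \<cdot> h) = S h \<cdot> S g"
proof -
  let ?F = "\<lambda>a b c p q r. S (a \<cdot> p) \<cdot> (b \<cdot> (q \<cdot> S r) \<cdot> S c)"
  have "S (g \<cdot> h) = sw H g (\<lambda>a x. sw H x (\<lambda>b c. S (a \<cdot> h) \<cdot> (b \<cdot> S c)))"
    by (subst collapse_right[OF conv_S(2) mod_H, where F="\<lambda>a z. S (a \<cdot> h) \<cdot> z"]) (use g h in \<open>auto intro!: lin\<close>)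
  also have "\<dots> = sw H g (\<lambda>a x. sw H x (\<lambda>b c. sw H h (\<lambda>p y. sw H y (\<lambda>q r. ?F a b c p q r))))"
    by (intro sw_cong g, subst collapse_right[OF conv_S(2) mod_H, where F="\<lambda>p z. S (_ \<cdot> p) \<cdot> (_ \<cdot> z \<cdot> S _)"])
      (use g h in \<open>auto intro!: lin\<close>)
  also have "\<dots> = sw H g (\<lambda>x c. sw H x (\<lambda>a b. sw H h (\<lambda>p y. sw H y (\<lambda>q r. ?F a b c p q r))))"
    by (rule sw_coassoc[symmetric]) (use g h in \<open>auto intro!: lin\<close>)
  also have "\<dots> = sw H g (\<lambda>x c. sw H x (\<lambda>a b. sw H h (\<lambda>y r. sw H y (\<lambda>p q. ?F a b c p q r))))"
    by (intro sw_cong g sw_coassoc[symmetric]) (use g h in \<open>auto intro!: lin\<close>)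
  also have "\<dots> = sw H g (\<lambda>x c. sw H h (\<lambda>y r. sw H x (\<lambda>a b. sw H y (\<lambda>p q. ?F a b c p q r))))"
    by (intro sw_cong g sw_sw) (use g h in \<open>auto intro!: lin\<close>)
  also have "\<dots> = sw H g (\<lambda>x c. sw H h (\<lambda>y r. sw H x (\<lambda>a b. sw H y (\<lambda>p q. S (a \<cdot> p) \<cdot> (b \<cdot> q) \<cdot> (S r \<cdot> S c)))))"
    by (intro sw_cong g h) (auto simp: H_assoc)
  \<comment> \<open>Multiplicativity of the coproduct, read from right to left, makes
    \<open>a\<close> and \<open>b\<close> the legs of \<open>x \<cdot> y\<close>, to which the
    antipode axiom applies.\<close>
  also have "\<dots> = sw H g (\<lambda>x c. sw H h (\<lambda>y r. sw H (x \<cdot> y) (\<lambda>a b. S a \<cdot> b \<cdot> (S r \<cdot> S c))))"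
    by (intro sw_cong g h sw_mult[symmetric]) (auto intro!: lin)
  also have "\<dots> = sw H g (\<lambda>x c. sw H h (\<lambda>y r. \<epsilon> y \<odot>\<^bsub>H\<^esub> (\<epsilon> x \<odot>\<^bsub>H\<^esub> (S r \<cdot> S c))))"
  proof (intro sw_cong g h)
    interpret H: module K H by (rule mod_H)
    fix x c y r assume c: "x \<in> carrier H" "c \<in> carrier H" "y \<in> carrier H" "r \<in> carrier H"
    have "sw H (x \<cdot> y) (\<lambda>a b. S a \<cdot> b \<cdot> (S r \<cdot> S c)) = sw H (x \<cdot> y) (\<lambda>a b. S a \<cdot> b) \<cdot> (S r \<cdot> S c)"
      by (rule sw_hom[symmetric]) (use c in \<open>auto intro!: lin\<close>)
    thus "sw H (x \<cdot> y) (\<lambda>a b. S a \<cdot> b \<cdot> (S r \<cdot> S c)) = \<epsilon> y \<odot>\<^bsub>H\<^esub> (\<epsilon> x \<odot>\<^bsub>H\<^esub> (S r \<cdot> S c))"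
      using c by (simp add: antipode_left counit_mult k_algebra_smult_left[OF alg_H] H.smult_assoc1[symmetric] cring.cring_simprules(14)[OF cring_K])
  qed
  also have "\<dots> = sw H g (\<lambda>x c. \<epsilon> x \<odot>\<^bsub>H\<^esub> (S h \<cdot> S c))"
    by (intro sw_cong g sw_counit_left) (use h in \<open>auto intro!: lin\<close>)
  also have "\<dots> = S h \<cdot> S g"
    by (rule sw_counit_left) (use g h in \<open>auto intro!: lin\<close>)
  finally show ?thesis .
qed

text \<open>The same uniqueness argument with values in H \<otimes> H. With five legs of
  \<open>h\<close>, the factors h2 S(h5) and h3 S(h4) are inserted behind the two legs of the
  coproduct of S(h1). The coproducts of S(h1) and of the inserted h2 \<otimes> h3 combine into one,
  which collapses, and S(h5) \<otimes> S(h4) is left.\<close>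

lemma sw_S:
  assumes A: "module K A" and F: "bilinear K H H A F" and h: "h \<in> carrier H"
  shows "sw A (S h) F = sw A h (\<lambda>a b. F (S b) (S a))"
proof -
  note FL = k_linear_comp[OF _ bilinear_left[OF F]] and FR = k_linear_comp[OF _ bilinear_right[OF F]]
    and Fc = bilinear_closed[OF F]
  have "sw A (S h) F = sw A h (\<lambda>a x. sw A x (\<lambda>b y. sw A (S a) (\<lambda>p q. F (p \<cdot> (b \<cdot> S y)) q)))"
    by (subst collapse_right[OF conv_S(2) A, where F="\<lambda>a z. sw A (S a) (\<lambda>p q. F (p \<cdot> z) q)"])
      (use A h Fc in \<open>auto intro!: lin FL FR cong: sw_cong\<close>)
  also have "\<dots> = sw A h (\<lambda>a x. sw A x (\<lambda>b y. sw A y (\<lambda>c z. sw A z (\<lambda>d e.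
      sw A (S a) (\<lambda>p q. F (p \<cdot> (b \<cdot> S e)) (q \<cdot> (c \<cdot> S d)))))))"
    by (intro sw_cong h, subst collapse_left[OF conv_S(2) A, where F="\<lambda>z e. sw A (S _) (\<lambda>p q. F (p \<cdot> (_ \<cdot> S e)) (q \<cdot> z))"])
      (use A h Fc in \<open>auto intro!: lin FL FR cong: sw_cong\<close>)
  also have "\<dots> = sw A h (\<lambda>a x. sw A x (\<lambda>w z. sw A w (\<lambda>b c. sw A z (\<lambda>d e.
      sw A (S a) (\<lambda>p q. F (p \<cdot> (b \<cdot> S e)) (q \<cdot> (c \<cdot> S d)))))))"
    by (intro sw_cong h sw_coassoc[symmetric]) (use A Fc in \<open>auto intro!: lin FL FR\<close>)
  also have "\<dots> = sw A h (\<lambda>a x. sw A x (\<lambda>w z. sw A z (\<lambda>d e. sw A w (\<lambda>b c.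
      sw A (S a) (\<lambda>p q. F (p \<cdot> (b \<cdot> S e)) (q \<cdot> (c \<cdot> S d)))))))"
    by (intro sw_cong h sw_sw) (use A Fc in \<open>auto intro!: lin FL FR\<close>)
  also have "\<dots> = sw A h (\<lambda>a x. sw A x (\<lambda>w z. sw A z (\<lambda>d e. sw A (S a) (\<lambda>p q. sw A w (\<lambda>b c.
      F (p \<cdot> b \<cdot> S e) (q \<cdot> c \<cdot> S d))))))"
    by (intro sw_cong h HOL.trans[OF sw_sw]) (use A Fc in \<open>auto simp: H_assoc intro!: lin FL FR sw_cong\<close>)
  also have "\<dots> = sw A h (\<lambda>a x. sw A x (\<lambda>w z. sw A z (\<lambda>d e. sw A (S a \<cdot> w) (\<lambda>p q. F (p \<cdot> S e) (q \<cdot> S d)))))"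
    by (intro sw_cong h sw_mult[symmetric]) (use A Fc in \<open>auto intro!: lin FL FR\<close>)
  also have "\<dots> = sw A h (\<lambda>d e. sw A \<one>\<^bsub>H\<^esub> (\<lambda>p q. F (p \<cdot> S e) (q \<cdot> S d)))"
    by (subst collapse_left[OF conv_S(1) A, where F="\<lambda>v z. sw A z (\<lambda>d e. sw A v (\<lambda>p q. F (p \<cdot> S e) (q \<cdot> S d)))"])
      (use A h Fc in \<open>auto intro!: lin FL FR\<close>)
  also have "\<dots> = sw A h (\<lambda>a b. F (S b) (S a))"
    by (rule sw_cong[OF _ h], subst sw_one) (use A Fc in \<open>auto intro!: lin FL FR\<close>)
  finally show ?thesis .
qed

lemma T_one: "T \<one>\<^bsub>H\<^esub> = \<one>\<^bsub>H\<^esub>"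
  using T_S[of "\<one>\<^bsub>H\<^esub>"] by (simp add: S_one)

lemma counit_T: "h \<in> carrier H \<Longrightarrow> \<epsilon> (T h) = \<epsilon> h"
  using counit_S[of "T h"] by simp

lemma T_mult: "g \<in> carrier H \<Longrightarrow> h \<in> carrier H \<Longrightarrow> T (g \<cdot> h) = T h \<cdot> T g"
  using T_S[of "T h \<cdot> T g"] by (simp add: S_mult)

text \<open>The rule for \<open>S\<close> at the element \<open>T h\<close>, with \<open>T\<close>
  composed into the summand.\<close>

lemma sw_T:
  assumes A: "module K A" and F: "bilinear K H H A F" and h: "h \<in> carrier H"
  shows "sw A (T h) F = sw A h (\<lambda>a b. F (T b) (T a))"
proof -
  note FL = k_linear_comp[OF _ bilinear_left[OF F]] and FR = k_linear_comp[OF _ bilinear_right[OF F]]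
  have "sw A (S (T h)) (\<lambda>a b. F (T b) (T a)) = sw A (T h) (\<lambda>a b. F (T (S a)) (T (S b)))"
    by (rule sw_S[OF A]) (use h in \<open>auto intro!: lin FL FR\<close>)
  thus ?thesis unfolding S_T[OF h] using h by (simp cong: sw_cong)
qed

text \<open>\<open>S\<close> is injective and reverses products, so it carries T(b) a to S(a) b and
  b T(a) to a S(b). The inverse antipode thus satisfies the antipode axioms with the legs in
  opposite order.\<close>

lemma conv_T: "conv_unit (\<lambda>a b. T b \<cdot> a)" "conv_unit (\<lambda>a b. b \<cdot> T a)"
proof -
  interpret H: module K H by (rule mod_H)
  have *: "sw H h u = \<epsilon> h \<odot>\<^bsub>H\<^esub> \<one>\<^bsub>H\<^esub>"
    if h: "h \<in> carrier H" and u: "\<And>a b. a \<in> carrier H \<Longrightarrow> b \<in> carrier H \<Longrightarrow> u a b \<in> carrier H"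
      and v: "sw H h (\<lambda>a b. S (u a b)) = \<epsilon> h \<odot>\<^bsub>H\<^esub> \<one>\<^bsub>H\<^esub>" for u h
  proof -
    have "S (sw H h u) = \<epsilon> h \<odot>\<^bsub>H\<^esub> \<one>\<^bsub>H\<^esub>"
      using sw_hom[OF mod_H mod_H lin_antipode, of u h] u h v by simp
    hence "sw H h u = T (\<epsilon> h \<odot>\<^bsub>H\<^esub> \<one>\<^bsub>H\<^esub>)"
      using T_S[of "sw H h u"] sw_closed[OF mod_H h, of u] u by simp
    thus ?thesis using h by (simp add: k_linear_smult[OF lin_T] T_one)
  qed
  have b: "bilinear K H H H (\<lambda>a b. T b \<cdot> a)" "bilinear K H H H (\<lambda>a b. b \<cdot> T a)"
    by (auto intro!: lin)
  show "conv_unit (\<lambda>a b. T b \<cdot> a)"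
    unfolding conv_unit_def
    by (intro conjI ballI b, rule *)
      (simp_all add: S_mult antipode_left cong: sw_cong)
  show "conv_unit (\<lambda>a b. b \<cdot> T a)"
    unfolding conv_unit_def
    by (intro conjI ballI b, rule *)
      (simp_all add: S_mult antipode_right cong: sw_cong)
qed

text \<open>Applied to n (T(a) \<rhd> l), quasi-commutativity produces the action of b T(a) on
  \<open>l\<close> with \<open>a\<close>, \<open>b\<close> neighbouring legs of the coaction of
  \<open>m\<close>; these collapse by \<open>conv_T\<close>. The outcome writes left multiplication
  by \<open>l\<close> as a sum of right multiplications.\<close>

lemma quasi_comm_T:
  assumes l: "l \<in> carrier L" and m: "m \<in> carrier L"
  shows "co L m (\<lambda>a n. n *\<^sub>L (T a \<rhd> l)) = l *\<^sub>L m"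
proof -
  have "co L m (\<lambda>a n. n *\<^sub>L (T a \<rhd> l)) = co L m (\<lambda>a n. co L n (\<lambda>b p. ((b \<cdot> T a) \<rhd> l) *\<^sub>L p))"
    by (rule co_cong[OF _ m]) (use l in \<open>simp add: quasi_comm[symmetric] act_act cong: co_cong\<close>)
  also have "\<dots> = l *\<^sub>L m"
    by (subst collapse_co[OF conv_T(2) mod_L, where G="\<lambda>z p. (z \<rhd> l) *\<^sub>L p"]) (use l m in \<open>auto intro!: lin\<close>)
  finally show ?thesis .
qed

end

section \<open>The smash product algebra\<close>

context hopf_base
begin

abbreviation "B \<equiv> smash K H L"
abbreviation e where "e l h \<equiv> tcls K L H [(l, h)]"
abbreviation bmult (infixl \<open>\<star>\<close> 72) where "a \<star> b \<equiv> a \<otimes>\<^bsub>B\<^esub> b"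

lemma smash_simps:
  "carrier B = carrier (tensor K L H)" "add B = add (tensor K L H)" "zero B = zero (tensor K L H)"
  "smult B = smult (tensor K L H)" "\<one>\<^bsub>B\<^esub> = e \<one>\<^bsub>L\<^esub> \<one>\<^bsub>H\<^esub>" "src B l = e l \<one>\<^bsub>H\<^esub>"
  by (simp_all add: smash_def Let_def)

lemma pair_LH: "tensor_pair K L H"
  by (intro module_pair mod_H mod_L)

lemma mod_B: "module K B"
  by (rule module_cong_record[OF module_tensor[OF mod_L mod_H]]) (simp_all add: smash_simps)

lemma tsum_B: "tsum (tensor K L H) = tsum B"
  by (rule tsum_cong_record) (simp_all add: smash_simps)

lemma lin_to_B: "lin P B f = lin P (tensor K L H) f"
  by (simp add: k_linear_def additive_on_def smash_simps)

lemma e_closed [simp]: "l \<in> carrier L \<Longrightarrow> h \<in> carrier H \<Longrightarrow> e l h \<in> carrier B"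
  using tensor_pair.pure_closed[OF pair_LH] by (simp add: smash_simps)

lemma lin_e_left: "lin P L f \<Longrightarrow> h \<in> carrier H \<Longrightarrow> lin P B (\<lambda>x. e (f x) h)"
  unfolding lin_to_B by (rule k_linear_pure_left[OF mod_L mod_H])

lemma lin_e_right: "lin P H f \<Longrightarrow> l \<in> carrier L \<Longrightarrow> lin P B (\<lambda>x. e l (f x))"
  unfolding lin_to_B by (rule k_linear_pure_right[OF mod_L mod_H])

lemma lin_Bsum:
  assumes "module K A" "\<And>l. l \<in> carrier L \<Longrightarrow> lin H A (\<lambda>h. F l h)"
    "\<And>h. h \<in> carrier H \<Longrightarrow> lin L A (\<lambda>l. F l h)" "lin P B f"
  shows "lin P A (\<lambda>x. tsum A F (f x))"
  by (rule k_linear_comp[OF assms(4)[unfolded lin_to_B] k_linear_tsum[OF mod_L mod_H assms(1) _ k_linear_id]])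
    (rule bilinearI; fact)

lemma lin_Bsum_inner:
  assumes "module K A" "module K P" "b \<in> carrier B"
    "\<And>l h. l \<in> carrier L \<Longrightarrow> h \<in> carrier H \<Longrightarrow> lin P A (\<lambda>x. F x l h)"
  shows "lin P A (\<lambda>x. tsum A (F x) b)"
  using assms(3)
  by (intro k_linear_tsum_inner[OF mod_L mod_H assms(1) _ assms(4) module.smult_closed[OF assms(2)]])
    (simp_all add: smash_simps)

lemma Bsum_pure:
  assumes "module K A" "\<And>l. l \<in> carrier L \<Longrightarrow> lin H A (\<lambda>h. F l h)"
    "\<And>h. h \<in> carrier H \<Longrightarrow> lin L A (\<lambda>l. F l h)" "l \<in> carrier L" "h \<in> carrier H"
  shows "tsum A F (e l h) = F l h"
  by (rule tensor_pair.tsum_pure[OF pair_LH module_group[OF assms(1)] bilinear_balanced assms(4,5)])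
    (rule bilinearI; fact)

lemma B_eqI:
  assumes "module K A" "lin B A f" "lin B A g" "b \<in> carrier B"
    "\<And>l h. l \<in> carrier L \<Longrightarrow> h \<in> carrier H \<Longrightarrow> f (e l h) = g (e l h)"
  shows "f b = g b"
  by (rule tensor_pair.tensor_eqI[OF pair_LH module_group[OF assms(1)]])
    (use assms in \<open>simp_all add: k_linear_def additive_on_def smash_simps\<close>)

lemmas lin_B_intros = lin mod_B e_closed lin_e_left lin_e_right

definition multF where
  "multF l f m g = sw B f (\<lambda>a b. e (l *\<^sub>L (a \<rhd> m)) (b \<cdot> g))"

lemma smash_mult:
  assumes b: "b \<in> carrier B" and b': "b' \<in> carrier B"
  shows "b \<star> b' = tsum B (\<lambda>l f. tsum B (\<lambda>m g. multF l f m g) b') b"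
proof -
  have bb: "b \<in> carrier (tensor K L H)" "b' \<in> carrier (tensor K L H)" using b b' by (simp_all add: smash_simps)
  let ?g = "\<lambda>l f m g. [(l *\<^sub>L (f1 \<rhd> m), f2 \<cdot> g). (f1, f2) \<leftarrow> tlist (comul H f)]"
  let ?f = "\<lambda>l f. concat (map (\<lambda>(m, g). ?g l f m g) (tlist b'))"
  have valg: "set (?g l f m g) \<subseteq> carrier L \<times> carrier H"
    if "l \<in> carrier L" "f \<in> carrier H" "m \<in> carrier L" "g \<in> carrier H" for l f m g
    by (rule tensor_pair.tlist_map_valid[OF pair_HH]) (use that in \<open>auto simp: comul_closed\<close>)
  have valf: "set (?f l f) \<subseteq> carrier L \<times> carrier H" if "l \<in> carrier L" "f \<in> carrier H" for l f
    by (rule tensor_pair.tlist_concat_valid[OF pair_LH valg[OF that] bb(2)])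
  have "b \<star> b' = tcls K L H (concat (map (\<lambda>(l, f). ?f l f) (tlist b)))"
    by (simp add: smash_def Let_def)
  also have "\<dots> = tsum B (\<lambda>l f. tcls K L H (?f l f)) b"
    unfolding tsum_B[symmetric] by (rule tensor_pair.tcls_concat[OF pair_LH valf pair_LH bb(1)])
  also have "\<dots> = tsum B (\<lambda>l f. tsum B (\<lambda>m g. tcls K L H (?g l f m g)) b') b"
    unfolding tsum_B[symmetric]
    by (rule tensor_pair.tsum_cong[OF pair_LH _ bb(1)], rule tensor_pair.tcls_concat[OF pair_LH valg pair_LH bb(2)])
  also have "\<dots> = tsum B (\<lambda>l f. tsum B (\<lambda>m g. multF l f m g) b') b"
    unfolding tsum_B[symmetric] multF_def
    by (rule tensor_pair.tsum_cong[OF pair_LH _ bb(1)], rule tensor_pair.tsum_cong[OF pair_LH _ bb(2)],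
        rule tensor_pair.tcls_map[OF pair_HH _ _ pair_LH comul_closed]) auto
  finally show ?thesis .
qed

lemma lin_smash_left: assumes "b' \<in> carrier B" shows "lin B B (\<lambda>b. b \<star> b')"
proof (rule k_linear_cong[OF _ _ mod_B])
  show "lin B B (\<lambda>b. tsum B (\<lambda>l f. tsum B (\<lambda>m g. multF l f m g) b') b)"
    unfolding multF_def
    by (rule lin_Bsum; (rule lin_Bsum_inner)?) (use assms in \<open>auto intro!: lin_B_intros\<close>)
qed (use assms in \<open>simp add: smash_mult\<close>)

lemma lin_smash_right: assumes "b \<in> carrier B" shows "lin B B (\<lambda>b'. b \<star> b')"
proof (rule k_linear_cong[OF _ _ mod_B])
  show "lin B B (\<lambda>b'. tsum B (\<lambda>l f. tsum B (\<lambda>m g. multF l f m g) b') b)"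
    unfolding multF_def
    by (rule lin_Bsum_inner; (rule lin_Bsum)?) (use assms in \<open>auto intro!: lin_B_intros\<close>)
qed (use assms in \<open>simp add: smash_mult\<close>)

lemma smash_pure:
  assumes "l \<in> carrier L" "f \<in> carrier H" "m \<in> carrier L" "g \<in> carrier H"
  shows "e l f \<star> e m g = sw B f (\<lambda>a b. e (l *\<^sub>L (a \<rhd> m)) (b \<cdot> g))"
proof -
  have 1: "tsum B (\<lambda>m g. multF l f m g) (e m g) = multF l f m g" if "l \<in> carrier L" "f \<in> carrier H" for l f
    by (rule Bsum_pure) (use that assms in \<open>auto simp: multF_def intro!: lin_B_intros\<close>)
  have "tsum B (\<lambda>l f. tsum B (\<lambda>m g. multF l f m g) (e m g)) (e l f) = tsum B (\<lambda>m g. multF l f m g) (e m g)"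
    unfolding multF_def
    by (rule Bsum_pure; (rule lin_Bsum_inner)?) (use assms in \<open>auto intro!: lin_B_intros\<close>)
  thus ?thesis using 1[of l f] assms by (simp add: smash_mult multF_def)
qed

lemma B_closed [simp]: "a \<in> carrier B \<Longrightarrow> b \<in> carrier B \<Longrightarrow> a \<star> b \<in> carrier B"
  using k_linear_closed[OF lin_smash_left] .

lemma lin_star_left: "lin P B f \<Longrightarrow> b \<in> carrier B \<Longrightarrow> lin P B (\<lambda>x. f x \<star> b)"
  by (rule k_linear_comp[OF _ lin_smash_left])

lemma lin_star_right: "lin P B f \<Longrightarrow> b \<in> carrier B \<Longrightarrow> lin P B (\<lambda>x. b \<star> f x)"
  by (rule k_linear_comp[OF _ lin_smash_right])

lemmas linB = lin_B_intros B_closed lin_star_left lin_star_right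

text \<open>Both sides are brought to the sum of l (f1 \<rhd> m) (f2 g1 \<rhd> n) \<otimes> f3 g2 k.
  One side gets there by multiplicativity of the coproduct, the other because \<open>H\<close> acts
  on products in \<open>L\<close> through the coproduct.\<close>

lemma smash_assoc_pure:
  assumes l: "l \<in> carrier L" and f: "f \<in> carrier H" and m: "m \<in> carrier L" and g: "g \<in> carrier H"
    and n: "n \<in> carrier L" and k: "k \<in> carrier H"
  shows "e l f \<star> e m g \<star> e n k = e l f \<star> (e m g \<star> e n k)"
proof -
  have "e l f \<star> e m g \<star> e n k = sw B f (\<lambda>a x. e (l *\<^sub>L (a \<rhd> m)) (x \<cdot> g) \<star> e n k)"
    unfolding smash_pure[OF l f m g]
    by (rule sw_hom[OF mod_B mod_B, where f="\<lambda>b. b \<star> e n k"]) (use assms in \<open>auto intro!: linB\<close>)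
  also have "\<dots> = sw B f (\<lambda>a x. sw B (x \<cdot> g) (\<lambda>p q. e (l *\<^sub>L (a \<rhd> m) *\<^sub>L (p \<rhd> n)) (q \<cdot> k)))"
    using assms by (intro sw_cong smash_pure) auto
  also have "\<dots> = sw B f (\<lambda>a x. sw B x (\<lambda>p q. sw B g (\<lambda>c d.
      e (l *\<^sub>L (a \<rhd> m) *\<^sub>L ((p \<cdot> c) \<rhd> n)) (q \<cdot> d \<cdot> k))))"
    by (intro sw_cong f sw_mult) (use assms in \<open>auto intro!: linB\<close>)
  also have "\<dots> = sw B f (\<lambda>x q. sw B x (\<lambda>a p. sw B g (\<lambda>c d.
      e (l *\<^sub>L (a \<rhd> m) *\<^sub>L ((p \<cdot> c) \<rhd> n)) (q \<cdot> d \<cdot> k))))"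
    by (rule sw_coassoc[symmetric]) (use assms in \<open>auto intro!: linB\<close>)
  also have "\<dots> = sw B f (\<lambda>x q. sw B g (\<lambda>c d. sw B x (\<lambda>a p.
      e (l *\<^sub>L (a \<rhd> m) *\<^sub>L ((p \<cdot> c) \<rhd> n)) (q \<cdot> d \<cdot> k))))"
    by (intro sw_cong f sw_sw) (use assms in \<open>auto intro!: linB\<close>)
  also have "\<dots> = sw B f (\<lambda>x q. sw B g (\<lambda>c d. e (l *\<^sub>L (x \<rhd> (m *\<^sub>L (c \<rhd> n)))) (q \<cdot> (d \<cdot> k))))"
  proof (intro sw_cong f g)
    fix x q c d assume h: "x \<in> carrier H" "q \<in> carrier H" "c \<in> carrier H" "d \<in> carrier H"
    have "e (l *\<^sub>L sw L x (\<lambda>a p. (a \<rhd> m) *\<^sub>L (p \<rhd> c \<rhd> n))) (q \<cdot> d \<cdot> k) =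
      sw B x (\<lambda>a p. e (l *\<^sub>L ((a \<rhd> m) *\<^sub>L (p \<rhd> c \<rhd> n))) (q \<cdot> d \<cdot> k))"
      by (rule sw_hom[OF mod_L mod_B, where f="\<lambda>y. e (l *\<^sub>L y) (q \<cdot> d \<cdot> k)"]) (use h assms in \<open>auto intro!: linB\<close>)
    thus "sw B x (\<lambda>a p. e (l *\<^sub>L (a \<rhd> m) *\<^sub>L ((p \<cdot> c) \<rhd> n)) (q \<cdot> d \<cdot> k)) =
      e (l *\<^sub>L (x \<rhd> (m *\<^sub>L (c \<rhd> n)))) (q \<cdot> (d \<cdot> k))"
      using h assms by (simp add: act_mult act_act H_assoc L_assoc cong: sw_cong)
  qed
  also have "\<dots> = sw B g (\<lambda>c d. sw B f (\<lambda>x q. e (l *\<^sub>L (x \<rhd> (m *\<^sub>L (c \<rhd> n)))) (q \<cdot> (d \<cdot> k))))"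
    by (rule sw_sw) (use assms in \<open>auto intro!: linB\<close>)
  also have "\<dots> = sw B g (\<lambda>c d. e l f \<star> e (m *\<^sub>L (c \<rhd> n)) (d \<cdot> k))"
    using assms by (intro sw_cong smash_pure[symmetric]) auto
  also have "\<dots> = e l f \<star> (e m g \<star> e n k)"
    unfolding smash_pure[OF m g n k]
    by (rule sw_hom[OF mod_B mod_B, where f="\<lambda>b. e l f \<star> b", symmetric]) (use assms in \<open>auto intro!: linB\<close>)
  finally show ?thesis .
qed

lemma smash_unit_left: "m \<in> carrier L \<Longrightarrow> g \<in> carrier H \<Longrightarrow> l \<in> carrier L \<Longrightarrow> e l \<one>\<^bsub>H\<^esub> \<star> e m g = e (l *\<^sub>L m) g"
  unfolding smash_pure[OF _ H_closed(3)]
  by (subst sw_one) (auto intro!: linB)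

text \<open>\<open>H\<close> acts on the unit of \<open>L\<close> through the counit, which removes
  the first leg of \<open>f\<close>.\<close>

lemma smash_unit_right: assumes "l \<in> carrier L" "f \<in> carrier H" "g \<in> carrier H"
  shows "e l f \<star> e \<one>\<^bsub>L\<^esub> g = e l (f \<cdot> g)"
proof -
  have "e l f \<star> e \<one>\<^bsub>L\<^esub> g = sw B f (\<lambda>a b. \<epsilon> a \<odot>\<^bsub>B\<^esub> e l (b \<cdot> g))"
    unfolding smash_pure[OF assms(1,2) H_closed(4) assms(3)]
  proof (rule sw_cong)
    fix a b assume "a \<in> carrier H" "b \<in> carrier H"
    thus "e (l *\<^sub>L (a \<rhd> \<one>\<^bsub>L\<^esub>)) (b \<cdot> g) = \<epsilon> a \<odot>\<^bsub>B\<^esub> e l (b \<cdot> g)"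
      using k_linear_smult[OF lin_e_left[OF k_linear_id, of "b \<cdot> g"], of "\<epsilon> a" l] assms
      by (simp add: act_unit k_algebra_smult_right[OF alg_L])
  qed (rule assms)
  also have "\<dots> = e l (f \<cdot> g)"
    by (rule sw_counit_left) (use assms in \<open>auto intro!: linB\<close>)
  finally show ?thesis .
qed

lemma alg_B: "k_algebra K B"
proof -
  interpret B: module K B by (rule mod_B)
  have assoc: "a \<star> b \<star> c = a \<star> (b \<star> c)" if a: "a \<in> carrier B" and b: "b \<in> carrier B" and c: "c \<in> carrier B" for a b c
  proof (rule B_eqI[OF mod_B _ _ a, of "\<lambda>a. a \<star> b \<star> c"])
    fix l f assume lf: "l \<in> carrier L" "f \<in> carrier H"
    show "e l f \<star> b \<star> c = e l f \<star> (b \<star> c)"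
    proof (rule B_eqI[OF mod_B _ _ b, of "\<lambda>b. e l f \<star> b \<star> c"])
      fix m g assume mg: "m \<in> carrier L" "g \<in> carrier H"
      show "e l f \<star> e m g \<star> c = e l f \<star> (e m g \<star> c)"
        by (rule B_eqI[OF mod_B _ _ c]) (use lf mg smash_assoc_pure in \<open>auto intro!: linB\<close>)
    qed (use lf c in \<open>auto intro!: linB\<close>)
  qed (use b c in \<open>auto intro!: linB\<close>)
  have one: "\<one>\<^bsub>B\<^esub> \<star> b = b" "b \<star> \<one>\<^bsub>B\<^esub> = b" if b: "b \<in> carrier B" for b
    by (rule B_eqI[OF mod_B _ _ b]; use b in \<open>auto simp: smash_simps(5) smash_unit_left smash_unit_right intro!: linB\<close>)+
  note dl = k_linear_additive[OF lin_smash_left, THEN additive_on_add]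
    and dr = k_linear_additive[OF lin_smash_right, THEN additive_on_add]
  have "ring B"
    by (rule ringI[OF B.M.abelian_group_axioms]) (auto intro!: monoidI simp: assoc one dl dr, auto simp: smash_simps(5))
  thus ?thesis
    using k_linear_smult[OF lin_smash_left] k_linear_smult[OF lin_smash_right]
    by (auto simp: k_algebra_def mod_B)
qed

lemma ring_B: "ring B"
  by (rule k_algebra_ring[OF alg_B])

lemma B_assoc: "a \<in> carrier B \<Longrightarrow> b \<in> carrier B \<Longrightarrow> c \<in> carrier B \<Longrightarrow> a \<star> b \<star> c = a \<star> (b \<star> c)"
  using ring_B by (simp add: ring.ring_simprules)

subsection \<open>Source and target\<close>

lemma src_eq: "src B l = e l \<one>\<^bsub>H\<^esub>"
  by (rule smash_simps)

lemma tgt_eq: assumes l: "l \<in> carrier L" shows "tgt B l = co B l (\<lambda>a n. e n (T a))"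
proof -
  have "tgt B l = tcls K L H [(l2, T l1). (l1, l2) \<leftarrow> tlist (coact L l)]"
    by (simp add: smash_def Let_def)
  also have "\<dots> = co B l (\<lambda>a n. e n (T a))"
    unfolding tsum_B[symmetric]
    by (rule tensor_pair.tcls_map[OF pair_HL _ _ pair_LH coact_closed[OF l]]) auto
  finally show ?thesis .
qed

lemma lin_src: "lin L B (src B)"
  unfolding src_eq by (auto intro!: linB)

lemma lin_tgt: "lin L B (tgt B)"
  by (rule k_linear_cong[of _ _ _ "\<lambda>l. co B l (\<lambda>a n. e n (T a))"]) (auto simp: tgt_eq intro!: linB)

lemma src_closed [simp]: "l \<in> carrier L \<Longrightarrow> src B l \<in> carrier B"
  and tgt_closed [simp]: "l \<in> carrier L \<Longrightarrow> tgt B l \<in> carrier B"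
  using k_linear_closed[OF lin_src] k_linear_closed[OF lin_tgt] by auto

lemma src_mult_e: "l \<in> carrier L \<Longrightarrow> m \<in> carrier L \<Longrightarrow> g \<in> carrier H \<Longrightarrow> src B l \<star> e m g = e (l *\<^sub>L m) g"
  by (simp add: src_eq smash_unit_left)

text \<open>The target multiplies the \<open>L\<close>-leg from the right. In the smash product T(x)
  splits with its legs reversed; coassociativity pairs the leg that acts on \<open>m\<close> with
  \<open>n\<close>, and \<open>quasi_comm_T\<close> turns n (T(q) \<rhd> m) into m times the element
  of \<open>L\<close>.\<close>

lemma tgt_mult_e:
  assumes l: "l \<in> carrier L" and m: "m \<in> carrier L" and g: "g \<in> carrier H"
  shows "tgt B l \<star> e m g = co B l (\<lambda>p y. e (m *\<^sub>L y) (T p \<cdot> g))"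
proof -
  have "tgt B l \<star> e m g = co B l (\<lambda>x n. e n (T x) \<star> e m g)"
    unfolding tgt_eq[OF l]
    by (rule co_hom[OF mod_B mod_B, where f="\<lambda>b. b \<star> e m g"]) (use assms in \<open>auto intro!: linB\<close>)
  also have "\<dots> = co B l (\<lambda>x n. sw B x (\<lambda>p q. e (n *\<^sub>L (T q \<rhd> m)) (T p \<cdot> g)))"
  proof (rule co_cong[OF _ l])
    fix x n assume h: "x \<in> carrier H" "n \<in> carrier L"
    have "e n (T x) \<star> e m g = sw B (T x) (\<lambda>a b. e (n *\<^sub>L (a \<rhd> m)) (b \<cdot> g))"
      using h assms by (intro smash_pure) auto
    also have "\<dots> = sw B x (\<lambda>p q. e (n *\<^sub>L (T q \<rhd> m)) (T p \<cdot> g))"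
      by (rule sw_T) (use h assms in \<open>auto intro!: linB\<close>)
    finally show "e n (T x) \<star> e m g = \<dots>" .
  qed
  also have "\<dots> = co B l (\<lambda>p y. co B y (\<lambda>q n. e (n *\<^sub>L (T q \<rhd> m)) (T p \<cdot> g)))"
    by (rule co_coassoc) (use assms in \<open>auto intro!: linB\<close>)
  also have "\<dots> = co B l (\<lambda>p y. e (m *\<^sub>L y) (T p \<cdot> g))"
  proof (rule co_cong[OF _ l])
    fix p y assume h: "p \<in> carrier H" "y \<in> carrier L"
    have "e (co L y (\<lambda>q n. n *\<^sub>L (T q \<rhd> m))) (T p \<cdot> g) = co B y (\<lambda>q n. e (n *\<^sub>L (T q \<rhd> m)) (T p \<cdot> g))"
      by (rule co_hom[OF mod_L mod_B, where f="\<lambda>z. e z (T p \<cdot> g)"]) (use h assms in \<open>auto intro!: linB\<close>)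
    thus "co B y (\<lambda>q n. e (n *\<^sub>L (T q \<rhd> m)) (T p \<cdot> g)) = e (m *\<^sub>L y) (T p \<cdot> g)"
      using h assms by (simp add: quasi_comm_T)
  qed
  finally show ?thesis .
qed

lemma src_hom: "k_algebra_hom K L B (src B)"
  unfolding k_algebra_hom_def using lin_src
  by (auto simp: src_eq smash_unit_left smash_simps(5))

text \<open>Right multiplication in the \<open>L\<close>-leg and the order reversal of
  \<open>T\<close> in the \<open>H\<close>-leg fit the multiplicativity of the coaction.\<close>

lemma tgt_antihom: "k_algebra_antihom K L B (tgt B)"
proof -
  have "tgt B (l *\<^sub>L m) = tgt B m \<star> tgt B l" if l: "l \<in> carrier L" and m: "m \<in> carrier L" for l m
  proof -
    have "tgt B m \<star> tgt B l = co B l (\<lambda>a n. tgt B m \<star> e n (T a))"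
      unfolding tgt_eq[OF l]
      by (rule co_hom[OF mod_B mod_B, where f="\<lambda>b. tgt B m \<star> b"]) (use l m in \<open>auto intro!: linB\<close>)
    also have "\<dots> = co B l (\<lambda>a n. co B m (\<lambda>p y. e (n *\<^sub>L y) (T (a \<cdot> p))))"
      using l m by (intro co_cong) (simp_all add: tgt_mult_e T_mult cong: co_cong)
    also have "\<dots> = tgt B (l *\<^sub>L m)"
      unfolding tgt_eq[OF H_closed(2)[OF l m]]
      by (rule co_mult[symmetric]) (use l m in \<open>auto intro!: linB\<close>)
    finally show ?thesis by simp
  qed
  moreover have "tgt B \<one>\<^bsub>L\<^esub> = \<one>\<^bsub>B\<^esub>"
    unfolding tgt_eq[OF H_closed(4)] by (subst co_one) (auto simp: smash_simps(5) T_one intro!: linB)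
  ultimately show ?thesis using lin_tgt by (simp add: k_algebra_antihom_def)
qed

text \<open>By \<open>src_mult_e\<close> and \<open>tgt_mult_e\<close> the source multiplies the
  \<open>L\<close>-leg from the left and the target from the right.\<close>

lemma src_tgt: assumes "l \<in> carrier L" "m \<in> carrier L" shows "src B l \<star> tgt B m = tgt B m \<star> src B l"
proof -
  have "src B l \<star> tgt B m = co B m (\<lambda>a n. src B l \<star> e n (T a))"
    unfolding tgt_eq[OF assms(2)]
    by (rule co_hom[OF mod_B mod_B, where f="\<lambda>b. src B l \<star> b"]) (use assms in \<open>auto intro!: linB\<close>)
  also have "\<dots> = tgt B m \<star> src B l"
    using assms unfolding src_eq[of l]
    by (simp add: tgt_mult_e smash_unit_left cong: co_cong)
  finally show ?thesis .
qed

lemma prebialg: "prebialg K L B"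
  by unfold_locales (simp_all add: alg_L alg_B src_hom tgt_antihom src_tgt)

end

section \<open>The action of the ground ring on tensor products over \<open>L\<close>\<close>

context prebialg
begin

text \<open>The Sweedler calculus for \<open>H\<close> and \<open>L\<close> asks for
  \<open>K\<close>-modules as targets, whereas a tensor product over \<open>L\<close> is built with
  \<open>L\<close> as its scalars. The right factor is left general so that the tensor cube of
  \<open>B\<close> is covered as well.\<close>

definition kt ::
  "('a univ, 'a univ) module \<Rightarrow> ('a univ, 'a univ) module \<Rightarrow> ('a univ, 'a univ) module" where
  "kt M Q = tensor_act L (via_tgt B M) Q (\<lambda>k m. (k \<odot>\<^bsub>B\<^esub> \<one>\<^bsub>B\<^esub>) \<odot>\<^bsub>M\<^esub> m)"

lemma kt_simps:
  "carrier (kt M Q) = carrier (tensor L (via_tgt B M) Q)" "add (kt M Q) = add (tensor L (via_tgt B M) Q)"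
  "zero (kt M Q) = zero (tensor L (via_tgt B M) Q)"
  by (simp_all add: kt_def tensor_act_simps)

lemma tsum_kt: "tsum (tensor L (via_tgt B M) Q) = tsum (kt M Q)"
  by (rule tsum_cong_record) (simp_all add: kt_simps)

lemma mod_B: "module K B" and mod_L: "module K L"
  using alg_B alg_L by (simp_all add: k_algebra_def)

lemma scalar_closed: "k \<in> carrier K \<Longrightarrow> k \<odot>\<^bsub>B\<^esub> \<one>\<^bsub>B\<^esub> \<in> carrier B"
  "k \<in> carrier K \<Longrightarrow> k \<odot>\<^bsub>L\<^esub> \<one>\<^bsub>L\<^esub> \<in> carrier L"
  by (simp_all add: module.smult_closed[OF mod_B] module.smult_closed[OF mod_L])

lemma scalar_src: "k \<in> carrier K \<Longrightarrow> src B (k \<odot>\<^bsub>L\<^esub> \<one>\<^bsub>L\<^esub>) = k \<odot>\<^bsub>B\<^esub> \<one>\<^bsub>B\<^esub>"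
  and scalar_tgt: "k \<in> carrier K \<Longrightarrow> tgt B (k \<odot>\<^bsub>L\<^esub> \<one>\<^bsub>L\<^esub>) = k \<odot>\<^bsub>B\<^esub> \<one>\<^bsub>B\<^esub>"
  using src_hom tgt_antihom
  by (simp_all add: k_algebra_hom_def k_algebra_antihom_def k_linear_def)

lemma scalar_commute: "k \<in> carrier K \<Longrightarrow> b \<in> carrier B \<Longrightarrow>
    (k \<odot>\<^bsub>B\<^esub> \<one>\<^bsub>B\<^esub>) \<otimes>\<^bsub>B\<^esub> b = b \<otimes>\<^bsub>B\<^esub> (k \<odot>\<^bsub>B\<^esub> \<one>\<^bsub>B\<^esub>)"
  by (simp add: k_algebra_smult_left[OF alg_B] k_algebra_smult_right[OF alg_B])

lemma k_linear_RB: "k_linear K P (restrict_scalars B RB) f = k_linear K P B f"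
  by (auto simp: k_linear_def additive_on_def restrict_scalars_def k_algebra_smult_left[OF alg_B] Pi_iff)

lemma k_linear_via_src: "k_linear K P (restrict_scalars L (via_src B N)) f = k_linear K P (restrict_scalars B N) f"
  by (auto simp: k_linear_def additive_on_def restrict_scalars_def scalar_src)

context
  fixes M Q :: "('a univ, 'a univ) module"
  assumes M: "lmod M" and tp: "tensor_pair L (via_tgt B M) Q"
begin

interpretation tensor_pair L "via_tgt B M" Q by (rule tp)

abbreviation (input) "Mk \<equiv> via_tgt B M \<lparr> smult := \<lambda>k m. (k \<odot>\<^bsub>B\<^esub> \<one>\<^bsub>B\<^esub>) \<odot>\<^bsub>M\<^esub> m \<rparr>"

lemma module_Mk: "module K Mk"
  by (rule module_cong_record[OF module_restrict_scalars[OF alg_B M]]) (simp_all add: restrict_scalars_def)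

lemma scalar_tgt_comm: "\<forall>k\<in>carrier K. \<forall>l\<in>carrier L. \<forall>m\<in>carrier (via_tgt B M).
    (k \<odot>\<^bsub>B\<^esub> \<one>\<^bsub>B\<^esub>) \<odot>\<^bsub>M\<^esub> (l \<odot>\<^bsub>via_tgt B M\<^esub> m) = l \<odot>\<^bsub>via_tgt B M\<^esub> ((k \<odot>\<^bsub>B\<^esub> \<one>\<^bsub>B\<^esub>) \<odot>\<^bsub>M\<^esub> m)"
  by (simp add: left_module_mult[OF M, symmetric] scalar_closed scalar_commute)

lemmas module_kt = module_tensor_act[OF tp module_Mk scalar_tgt_comm, folded kt_def]
  and kt_smult_pure = tensor_act_pure[OF tp module_Mk scalar_tgt_comm, folded kt_def, simplified]

lemma k_linear_Mk: "k_linear K P Mk f = k_linear K P (restrict_scalars B M) f" "k_linear K Mk A g = k_linear K (restrict_scalars B M) A g"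
  by (simp_all add: k_linear_def additive_on_def restrict_scalars_def)

lemmas kt_lin_left = k_linear_tensor_act_left[OF tp module_Mk scalar_tgt_comm, folded kt_def, unfolded k_linear_Mk]
  and kt_lin_tsum = k_linear_tsum_act[OF tp module_Mk scalar_tgt_comm, folded kt_def, unfolded k_linear_Mk]

text \<open>Scalars act on the left factor. Over \<open>L\<close>, the multiple of the unit by
  \<open>k\<close> crosses the tensor sign, since its target is the multiple of the unit of
  \<open>B\<close> by \<open>k\<close>.\<close>

lemma kt_lin_right:
  assumes "k_linear K P (restrict_scalars L Q) f" "m \<in> carrier M"
  shows "k_linear K P (kt M Q) (\<lambda>x. tcls L (via_tgt B M) Q [(m, f x)])"
proof -
  have "pure m ((k \<odot>\<^bsub>L\<^esub> \<one>\<^bsub>L\<^esub>) \<odot>\<^bsub>Q\<^esub> n) = pure ((k \<odot>\<^bsub>B\<^esub> \<one>\<^bsub>B\<^esub>) \<odot>\<^bsub>M\<^esub> m) n" if "k \<in> carrier K" "n \<in> carrier Q" for k n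
    using that assms(2) pure_balanced[of "k \<odot>\<^bsub>L\<^esub> \<one>\<^bsub>L\<^esub>" m n] by (simp add: scalar_closed scalar_tgt)
  with assms show ?thesis
    by (auto simp: k_linear_def additive_on_def Pi_iff kt_simps pure_closed kt_smult_pure restrict_scalars_def
        pure_add_right)
qed

end

end

sublocale hopf_base \<subseteq> pb: prebialg K L "smash K H L"
  by (rule prebialg)

section \<open>The smash product bialgebroid\<close>

context hopf_base
begin

abbreviation "RB \<equiv> regular B"
abbreviation "KT \<equiv> pb.kt RB (via_src B RB)"
abbreviation cc where "cc p q \<equiv> bcls L B RB RB [(p, q)]"
abbreviation u where "u h \<equiv> e \<one>\<^bsub>L\<^esub> h"

lemmas tpB = pb.pair_BB
lemmas lmodRB = pb.lmod_RB

lemma mod_KT: "module K KT"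
  by (rule pb.module_kt[OF lmodRB tpB])

lemma cc_closed: "p \<in> carrier B \<Longrightarrow> q \<in> carrier B \<Longrightarrow> cc p q \<in> carrier KT"
  using tensor_pair.pure_closed[OF tpB] by (simp add: pb.kt_simps bcls_def)

lemma lin_cc_left: "lin P B f \<Longrightarrow> q \<in> carrier B \<Longrightarrow> lin P KT (\<lambda>x. cc (f x) q)"
  unfolding bcls_def by (rule pb.kt_lin_left[OF lmodRB tpB]) (simp_all add: pb.k_linear_RB)

lemma lin_cc_right: "lin P B f \<Longrightarrow> q \<in> carrier B \<Longrightarrow> lin P KT (\<lambda>x. cc q (f x))"
  unfolding bcls_def by (rule pb.kt_lin_right[OF lmodRB tpB]) (simp_all add: pb.k_linear_RB pb.k_linear_via_src)

lemma cc_balance: "l \<in> carrier L \<Longrightarrow> p \<in> carrier B \<Longrightarrow> q \<in> carrier B \<Longrightarrow> cc (tgt B l \<star> p) q = cc p (src B l \<star> q)"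
  using pb.bp_balance[OF lmodRB lmodRB] by simp

lemmas linC = linB mod_KT cc_closed lin_cc_left lin_cc_right
  k_linear_comp[OF _ lin_src] k_linear_comp[OF _ lin_tgt]

lemma comul_eq:
  assumes b: "b \<in> carrier B"
  shows "bcomul B b = tsum KT (\<lambda>l h. sw KT h (\<lambda>x y. cc (e l x) (u y))) b"
proof -
  have b': "b \<in> carrier (tensor K L H)" using b by (simp add: smash_simps)
  let ?c = "bcls L B RB RB"
  let ?h = "\<lambda>l h. map (\<lambda>(h1, h2). (e l h1, u h2)) (tlist (comul H h))"
  have val: "set (?h l h) \<subseteq> carrier (via_tgt B RB) \<times> carrier (via_src B RB)" if "l \<in> carrier L" "h \<in> carrier H" for l h
    by (rule tensor_pair.tlist_map_valid[OF pair_HH]) (use that in \<open>auto simp: comul_closed\<close>)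
  have "bcomul B b = ?c (concat (map (\<lambda>(l, h). ?h l h) (tlist b)))"
    by (simp add: smash_def Let_def bcls_def via_tgt_def via_src_def regular_def)
  also have "\<dots> = tsum KT (\<lambda>l h. ?c (?h l h)) b"
    unfolding bcls_def pb.tsum_kt[symmetric]
    by (rule tensor_pair.tcls_concat[OF pair_LH val tpB b'])
  also have "\<dots> = tsum KT (\<lambda>l h. sw KT h (\<lambda>x y. cc (e l x) (u y))) b"
    unfolding bcls_def pb.tsum_kt[symmetric]
    by (rule tensor_pair.tsum_cong[OF pair_LH _ b'], rule tensor_pair.tcls_map[OF pair_HH _ _ tpB comul_closed]) auto
  finally show ?thesis .
qed

lemma comul_e:
  assumes "l \<in> carrier L" "h \<in> carrier H"
  shows "bcomul B (e l h) = sw KT h (\<lambda>x y. cc (e l x) (u y))"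
  unfolding comul_eq[OF e_closed[OF assms]]
  by (rule Bsum_pure) (use assms in \<open>auto intro!: linC\<close>)

lemma lin_bcomul: "lin B KT (bcomul B)"
proof (rule k_linear_cong[OF _ _ mod_B])
  show "lin B KT (\<lambda>b. tsum KT (\<lambda>l h. sw KT h (\<lambda>x y. cc (e l x) (u y))) b)"
    by (rule lin_Bsum) (auto intro!: linC)
qed (simp add: comul_eq)

lemma bcomul_closed [simp]: "b \<in> carrier B \<Longrightarrow> bcomul B b \<in> carrier KT"
  by (rule k_linear_closed[OF lin_bcomul])

text \<open>The maps out of the tensor square of \<open>B\<close> over \<open>L\<close> that fit the
  Sweedler calculus: \<open>K\<close>-linear in each variable and balanced over \<open>L\<close>,
  with values in a \<open>K\<close>-module.\<close>

definition bal2 where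
  "bal2 A F \<longleftrightarrow> module K A \<and> (\<forall>p\<in>carrier B. lin B A (\<lambda>q. F p q)) \<and> (\<forall>q\<in>carrier B. lin B A (\<lambda>p. F p q)) \<and>
     (\<forall>l\<in>carrier L. \<forall>p\<in>carrier B. \<forall>q\<in>carrier B. F (tgt B l \<star> p) q = F p (src B l \<star> q))"

lemma bal2I:
  "module K A \<Longrightarrow> (\<And>p. p \<in> carrier B \<Longrightarrow> lin B A (\<lambda>q. F p q)) \<Longrightarrow> (\<And>q. q \<in> carrier B \<Longrightarrow> lin B A (\<lambda>p. F p q)) \<Longrightarrow>
   (\<And>l p q. l \<in> carrier L \<Longrightarrow> p \<in> carrier B \<Longrightarrow> q \<in> carrier B \<Longrightarrow> F (tgt B l \<star> p) q = F p (src B l \<star> q)) \<Longrightarrow>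
   bal2 A F"
  by (simp add: bal2_def)

lemma bal2_balanced: "bal2 A F \<Longrightarrow> balanced L (via_tgt B RB) (via_src B RB) A F"
  by (auto simp: bal2_def balanced_def k_linear_def additive_on_def)

lemma lin_tsumKT:
  assumes "bal2 A F" "lin P KT f"
  shows "lin P A (\<lambda>x. tsum A F (f x))"
proof (rule k_linear_comp[OF assms(2) pb.kt_lin_tsum[OF lmodRB tpB _ bal2_balanced[OF assms(1)]]])
  show "module K A" using assms(1) by (simp add: bal2_def)
  fix n assume "n \<in> carrier (via_src B RB)"
  thus "lin (restrict_scalars B RB) A (\<lambda>m. F m n)"
    using assms(1)
    by (auto simp: bal2_def k_linear_def additive_on_def restrict_scalars_def k_algebra_smult_left[OF alg_B])
qed

lemma tsum_cc: "bal2 A F \<Longrightarrow> p \<in> carrier B \<Longrightarrow> q \<in> carrier B \<Longrightarrow> tsum A F (cc p q) = F p q"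
  unfolding bcls_def
  by (rule tensor_pair.tsum_pure[OF tpB _ bal2_balanced]) (auto simp: bal2_def module_group)

lemma lin_bsum: "bal2 A F \<Longrightarrow> lin P B f \<Longrightarrow> lin P A (\<lambda>x. tsum A F (bcomul B (f x)))"
  by (rule lin_tsumKT[OF _ k_linear_comp[OF _ lin_bcomul]])

lemma bsum_e:
  assumes F: "bal2 A F" and l: "l \<in> carrier L" and h: "h \<in> carrier H"
  shows "tsum A F (bcomul B (e l h)) = sw A h (\<lambda>x y. F (e l x) (u y))"
proof -
  have "tsum A F (bcomul B (e l h)) = sw A h (\<lambda>x y. tsum A F (cc (e l x) (u y)))"
    unfolding comul_e[OF l h]
    by (rule sw_hom[OF mod_KT _ lin_tsumKT[OF F k_linear_id]]) (use l h F in \<open>auto simp: bal2_def intro!: linC\<close>)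
  also have "\<dots> = sw A h (\<lambda>x y. F (e l x) (u y))"
    using l h by (simp add: tsum_cc[OF F] cong: sw_cong)
  finally show ?thesis .
qed

lemma bsum_cong:
  "(\<And>p q. p \<in> carrier B \<Longrightarrow> q \<in> carrier B \<Longrightarrow> F p q = G p q) \<Longrightarrow> z \<in> carrier KT \<Longrightarrow> tsum A F z = tsum A G z"
  by (rule tensor_pair.tsum_cong[OF tpB]) (simp_all add: pb.kt_simps)

lemma bcls_list:
  assumes "\<And>p q. p \<in> carrier B \<Longrightarrow> q \<in> carrier B \<Longrightarrow> f p q \<in> carrier B"
    "\<And>p q. p \<in> carrier B \<Longrightarrow> q \<in> carrier B \<Longrightarrow> g p q \<in> carrier B" "z \<in> carrier KT"
  shows "bcls L B RB RB (map (\<lambda>(p, q). (f p q, g p q)) (tlist z)) = tsum KT (\<lambda>p q. cc (f p q) (g p q)) z"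
  unfolding bcls_def pb.tsum_kt[symmetric]
  by (rule tensor_pair.tcls_map[OF tpB _ _ tpB]) (use assms in \<open>auto simp: pb.kt_simps\<close>)

lemma e_split: "l \<in> carrier L \<Longrightarrow> h \<in> carrier H \<Longrightarrow> e l h = src B l \<star> u h"
  by (simp add: src_mult_e)

lemma u_mult_e: "h \<in> carrier H \<Longrightarrow> m \<in> carrier L \<Longrightarrow> g \<in> carrier H \<Longrightarrow>
    u h \<star> e m g = sw B h (\<lambda>a b. e (a \<rhd> m) (b \<cdot> g))"
  by (simp add: smash_pure cong: sw_cong)

text \<open>The rule for moving an element of \<open>H\<close> past a target. The coaction of q
  \<rhd> m has the form c a S(f), and \<open>T\<close> turns it into f T(a) T(c). The leg
  \<open>p\<close> of \<open>h\<close> stands immediately before \<open>c\<close>, so T(c) p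
  collapses, and what remains is the product of \<open>h\<close> with t(m).\<close>

lemma u_tgt:
  assumes h: "h \<in> carrier H" and m: "m \<in> carrier L"
  shows "u h \<star> tgt B m = sw B h (\<lambda>p q. tgt B (q \<rhd> m) \<star> u p)"
proof -
  have "sw B h (\<lambda>p q. tgt B (q \<rhd> m) \<star> u p) = sw B h (\<lambda>p q. co B (q \<rhd> m) (\<lambda>x y. e y (T x \<cdot> p)))"
    using h m by (intro sw_cong) (simp_all add: tgt_mult_e cong: co_cong)
  also have "\<dots> = sw B h (\<lambda>p q. sw B q (\<lambda>c x. sw B x (\<lambda>d f. co B m (\<lambda>a y. e (d \<rhd> y) (T (c \<cdot> a \<cdot> S f) \<cdot> p)))))"
    by (intro sw_cong h co_act) (use m in \<open>auto intro!: linC\<close>)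
  also have "\<dots> = sw B h (\<lambda>p q. sw B q (\<lambda>c x. sw B x (\<lambda>d f. co B m (\<lambda>a y. e (d \<rhd> y) (f \<cdot> T a \<cdot> (T c \<cdot> p))))))"
    by (intro sw_cong h co_cong m) (auto simp: T_mult H_assoc)
  also have "\<dots> = sw B h (\<lambda>d f. co B m (\<lambda>a y. e (d \<rhd> y) (f \<cdot> T a \<cdot> \<one>\<^bsub>H\<^esub>)))"
    by (rule collapse_left[OF conv_T(1) mod_B, where F="\<lambda>z x. sw B x (\<lambda>d f. co B m (\<lambda>a y. e (d \<rhd> y) (f \<cdot> T a \<cdot> z)))"])
      (use m h in \<open>auto intro!: linC\<close>)
  also have "\<dots> = co B m (\<lambda>a y. sw B h (\<lambda>d f. e (d \<rhd> y) (f \<cdot> T a \<cdot> \<one>\<^bsub>H\<^esub>)))"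
    by (rule sw_co) (use m h in \<open>auto intro!: linC\<close>)
  also have "\<dots> = co B m (\<lambda>a y. u h \<star> e y (T a))"
    using h by (intro co_cong m) (simp add: u_mult_e cong: sw_cong)
  also have "\<dots> = u h \<star> tgt B m"
    unfolding tgt_eq[OF m]
    by (rule co_hom[OF mod_B mod_B, where f="\<lambda>b. u h \<star> b", symmetric]) (use h m in \<open>auto intro!: linC\<close>)
  finally show ?thesis by simp
qed

section \<open>The Takeuchi condition\<close>

lemma bal2_lin:
  assumes "bal2 A F"
  shows "q \<in> carrier B \<Longrightarrow> lin P B f \<Longrightarrow> lin P A (\<lambda>x. F (f x) q)"
    "q \<in> carrier B \<Longrightarrow> lin P B f \<Longrightarrow> lin P A (\<lambda>x. F q (f x))"
  using assms by (auto simp: bal2_def intro: k_linear_comp)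

text \<open>On l \<otimes> h, \<open>u_tgt\<close> moves t(m) in front of the first leg of
  \<open>h\<close>, where it becomes the target of q \<rhd> m. Balancedness carries it over as a
  source, and in front of the second leg this is the rule for moving \<open>H\<close> past s(m),
  read backwards.\<close>

lemma takeuchi:
  assumes F: "bal2 A F" and m: "m \<in> carrier L" and b: "b \<in> carrier B"
  shows "tsum A (\<lambda>p q. F (p \<star> tgt B m) q) (bcomul B b) = tsum A (\<lambda>p q. F p (q \<star> src B m)) (bcomul B b)"
proof -
  note FL = bal2_lin(1)[OF F] and FR = bal2_lin(2)[OF F]
  have A: "module K A" and Fb: "\<And>l p q. l \<in> carrier L \<Longrightarrow> p \<in> carrier B \<Longrightarrow> q \<in> carrier B \<Longrightarrow>
      F (tgt B l \<star> p) q = F p (src B l \<star> q)" using F by (auto simp: bal2_def)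
  have 1: "bal2 A (\<lambda>p q. F (p \<star> tgt B m) q)" "bal2 A (\<lambda>p q. F p (q \<star> src B m))"
    by (rule bal2I; use m A in \<open>auto simp: B_assoc Fb intro!: linC FL FR\<close>)+
  show ?thesis
  proof (rule B_eqI[OF A lin_bsum[OF 1(1) k_linear_id] lin_bsum[OF 1(2) k_linear_id] b])
    fix l h assume l: "l \<in> carrier L" and h: "h \<in> carrier H"
    have "tsum A (\<lambda>p q. F (p \<star> tgt B m) q) (bcomul B (e l h)) = sw A h (\<lambda>x y. F (e l x \<star> tgt B m) (u y))"
      by (rule bsum_e[OF 1(1) l h])
    also have "\<dots> = sw A h (\<lambda>x y. sw A x (\<lambda>p q. F (e l p) (src B (q \<rhd> m) \<star> u y)))"
    proof (rule sw_cong[OF _ h])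
      fix x y assume xy: "x \<in> carrier H" "y \<in> carrier H"
      have "e l x \<star> tgt B m = src B l \<star> (u x \<star> tgt B m)"
        using xy l m by (simp add: e_split[of l x] B_assoc)
      also have "\<dots> = src B l \<star> sw B x (\<lambda>p q. tgt B (q \<rhd> m) \<star> u p)" using xy m by (simp add: u_tgt)
      finally have 2: "e l x \<star> tgt B m = src B l \<star> sw B x (\<lambda>p q. tgt B (q \<rhd> m) \<star> u p)" .
      have "F (e l x \<star> tgt B m) (u y) = sw A x (\<lambda>p q. F (src B l \<star> (tgt B (q \<rhd> m) \<star> u p)) (u y))"
        unfolding 2
        by (rule sw_hom[OF mod_B A, where f="\<lambda>z. F (src B l \<star> z) (u y)"]) (use xy l m in \<open>auto intro!: linC FL\<close>)
      also have "\<dots> = sw A x (\<lambda>p q. F (e l p) (src B (q \<rhd> m) \<star> u y))"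
      proof (rule sw_cong[OF _ xy(1)])
        fix p q assume pq: "p \<in> carrier H" "q \<in> carrier H"
        have "src B l \<star> (tgt B (q \<rhd> m) \<star> u p) = tgt B (q \<rhd> m) \<star> e l p"
          using pq l m by (simp add: e_split[of l p] B_assoc[symmetric] src_tgt)
        thus "F (src B l \<star> (tgt B (q \<rhd> m) \<star> u p)) (u y) = F (e l p) (src B (q \<rhd> m) \<star> u y)"
          using pq l m xy by (simp add: Fb)
      qed
      finally show "F (e l x \<star> tgt B m) (u y) = \<dots>" .
    qed
    also have "\<dots> = sw A h (\<lambda>p x. sw A x (\<lambda>q y. F (e l p) (src B (q \<rhd> m) \<star> u y)))"
      by (rule sw_coassoc[OF A _ h]) (use l m A in \<open>auto intro!: linC FL FR\<close>)
    also have "\<dots> = sw A h (\<lambda>p x. F (e l p) (u x \<star> src B m))"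
    proof (rule sw_cong[OF _ h])
      fix p x assume px: "p \<in> carrier H" "x \<in> carrier H"
      have "u x \<star> src B m = sw B x (\<lambda>q y. src B (q \<rhd> m) \<star> u y)"
        using px m unfolding src_eq by (simp add: u_mult_e smash_unit_left cong: sw_cong)
      hence "F (e l p) (u x \<star> src B m) = F (e l p) (sw B x (\<lambda>q y. src B (q \<rhd> m) \<star> u y))" by simp
      also have "\<dots> = sw A x (\<lambda>q y. F (e l p) (src B (q \<rhd> m) \<star> u y))"
        by (rule sw_hom[OF mod_B A, where f="\<lambda>z. F (e l p) z"]) (use px l m in \<open>auto intro!: linC FR\<close>)
      finally show "sw A x (\<lambda>q y. F (e l p) (src B (q \<rhd> m) \<star> u y)) = F (e l p) (u x \<star> src B m)" by simp
    qed
    also have "\<dots> = tsum A (\<lambda>p q. F p (q \<star> src B m)) (bcomul B (e l h))"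
      by (rule bsum_e[OF 1(2) l h, symmetric])
    finally show "tsum A (\<lambda>p q. F (p \<star> tgt B m) q) (bcomul B (e l h)) =
      tsum A (\<lambda>p q. F p (q \<star> src B m)) (bcomul B (e l h))" .
  qed
qed

lemma bsum_hom:
  assumes "module K A" "module K A'" "lin A A' f"
    "\<And>p q. p \<in> carrier B \<Longrightarrow> q \<in> carrier B \<Longrightarrow> F p q \<in> carrier A" "b \<in> carrier B"
  shows "f (tsum A F (bcomul B b)) = tsum A' (\<lambda>p q. f (F p q)) (bcomul B b)"
  by (rule tensor_pair.tsum_hom[OF tpB module_group[OF assms(1)] module_group[OF assms(2)] k_linear_additive[OF assms(3)]])
    (use assms(4,5) bcomul_closed in \<open>auto simp: pb.kt_simps\<close>)

lemma lin_bsum_inner: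
  assumes A: "module K A" and b: "b \<in> carrier B"
    "\<And>p q. p \<in> carrier B \<Longrightarrow> q \<in> carrier B \<Longrightarrow> lin B A (\<lambda>x. F x p q)"
  shows "lin B A (\<lambda>x. tsum A (F x) (bcomul B b))"
proof -
  interpret B: module K B by (rule mod_B)
  have c: "bcomul B b \<in> carrier (tensor L (via_tgt B RB) (via_src B RB))" using bcomul_closed[OF b(1)] by (simp add: pb.kt_simps)
  have "tsum A (F (k \<odot>\<^bsub>B\<^esub> x)) (bcomul B b) = k \<odot>\<^bsub>A\<^esub> tsum A (F x) (bcomul B b)" if "k \<in> carrier K" "x \<in> carrier B" for k x
  proof -
    have "tsum A (F (k \<odot>\<^bsub>B\<^esub> x)) (bcomul B b) = tsum A (\<lambda>p q. k \<odot>\<^bsub>A\<^esub> F x p q) (bcomul B b)"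
      using that by (intro tensor_pair.tsum_cong[OF tpB _ c]) (simp add: k_linear_smult[OF b(2)])
    also have "\<dots> = k \<odot>\<^bsub>A\<^esub> tsum A (F x) (bcomul B b)"
      using that k_linear_closed[OF b(2)]
      by (intro tensor_pair.tsum_hom[OF tpB module_group[OF A] module_group[OF A] module_smult_additive[OF A] _ c, symmetric]) auto
    finally show ?thesis .
  qed
  moreover have "additive_on B A (\<lambda>x. tsum A (F x) (bcomul B b))"
    by (rule tensor_pair.additive_on_tsum_inner[OF tpB module_group[OF A] c]) (use k_linear_additive[OF b(2)] in auto)
  ultimately show ?thesis by (simp add: k_linear_def)
qed

section \<open>The comultiplication as a bimodule map\<close>

lemma comul_src:
  assumes l: "l \<in> carrier L" and b: "b \<in> carrier B"
  shows "bcomul B (src B l \<star> b) = tsum KT (\<lambda>p q. cc (src B l \<star> p) q) (bcomul B b)"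
proof -
  have F: "bal2 KT (\<lambda>p q. cc (src B l \<star> p) q)"
    by (rule bal2I) (use l in \<open>auto simp: B_assoc[symmetric] src_tgt cc_balance[symmetric] intro!: linC\<close>)
  show ?thesis
  proof (rule B_eqI[OF mod_KT k_linear_comp[OF lin_smash_right lin_bcomul] lin_bsum[OF F k_linear_id] b])
    fix m h assume mh: "m \<in> carrier L" "h \<in> carrier H"
    show "bcomul B (src B l \<star> e m h) = tsum KT (\<lambda>p q. cc (src B l \<star> p) q) (bcomul B (e m h))"
      unfolding bsum_e[OF F mh] using l mh by (simp add: src_mult_e comul_e cong: sw_cong)
  qed (use l in simp)
qed

text \<open>\<open>T\<close> reverses the coproduct, so the inner leg of the coaction of
  \<open>l\<close> lands on the first factor. Together with the \<open>L\<close>-part it forms a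
  target there, by \<open>tgt_mult_e\<close>. It crosses the tensor sign as a source, and with the
  outer leg it recombines to t(l) on the second factor.\<close>

lemma comul_tgt:
  assumes l: "l \<in> carrier L" and b: "b \<in> carrier B"
  shows "bcomul B (tgt B l \<star> b) = tsum KT (\<lambda>p q. cc p (tgt B l \<star> q)) (bcomul B b)"
proof -
  have F: "bal2 KT (\<lambda>p q. cc p (tgt B l \<star> q))"
    by (rule bal2I) (use l in \<open>auto simp: B_assoc[symmetric] src_tgt[symmetric] cc_balance intro!: linC\<close>)
  show ?thesis
  proof (rule B_eqI[OF mod_KT k_linear_comp[OF lin_smash_right lin_bcomul] lin_bsum[OF F k_linear_id] b])
    fix m h assume m: "m \<in> carrier L" and h: "h \<in> carrier H"
    have "bcomul B (tgt B l \<star> e m h) = co KT l (\<lambda>p y. bcomul B (e (m *\<^sub>L y) (T p \<cdot> h)))"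
      unfolding tgt_mult_e[OF l m h]
      by (rule co_hom[OF mod_B mod_KT lin_bcomul]) (use l m h in \<open>auto intro!: linC\<close>)
    also have "\<dots> = co KT l (\<lambda>p y. sw KT (T p) (\<lambda>a b. sw KT h (\<lambda>c d. cc (e (m *\<^sub>L y) (a \<cdot> c)) (u (b \<cdot> d)))))"
    proof (rule co_cong[OF _ l])
      fix p y assume py: "p \<in> carrier H" "y \<in> carrier L"
      have "bcomul B (e (m *\<^sub>L y) (T p \<cdot> h)) = sw KT (T p \<cdot> h) (\<lambda>a b. cc (e (m *\<^sub>L y) a) (u b))"
        using py m h by (intro comul_e) auto
      also have "\<dots> = sw KT (T p) (\<lambda>a b. sw KT h (\<lambda>c d. cc (e (m *\<^sub>L y) (a \<cdot> c)) (u (b \<cdot> d))))"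
        by (rule sw_mult[OF mod_KT]) (use py m h in \<open>auto intro!: linC\<close>)
      finally show "bcomul B (e (m *\<^sub>L y) (T p \<cdot> h)) = \<dots>" .
    qed
    also have "\<dots> = co KT l (\<lambda>p y. sw KT p (\<lambda>a b. sw KT h (\<lambda>c d. cc (e (m *\<^sub>L y) (T b \<cdot> c)) (u (T a \<cdot> d)))))"
      by (intro co_cong l sw_T) (use m h in \<open>auto intro!: linC\<close>)
    also have "\<dots> = co KT l (\<lambda>a z. co KT z (\<lambda>b y. sw KT h (\<lambda>c d. cc (e (m *\<^sub>L y) (T b \<cdot> c)) (u (T a \<cdot> d)))))"
      by (rule co_coassoc) (use l m h in \<open>auto intro!: linC\<close>)
    also have "\<dots> = co KT l (\<lambda>a z. sw KT h (\<lambda>c d. co KT z (\<lambda>b y. cc (e (m *\<^sub>L y) (T b \<cdot> c)) (u (T a \<cdot> d)))))"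
      by (intro co_cong l sw_co[symmetric]) (use m h in \<open>auto intro!: linC\<close>)
    also have "\<dots> = co KT l (\<lambda>a z. sw KT h (\<lambda>c d. cc (e m c) (e z (T a \<cdot> d))))"
    proof (intro co_cong l sw_cong h)
      fix a z c d assume hh: "a \<in> carrier H" "z \<in> carrier L" "c \<in> carrier H" "d \<in> carrier H"
      have "cc (tgt B z \<star> e m c) (u (T a \<cdot> d)) = co KT z (\<lambda>b y. cc (e (m *\<^sub>L y) (T b \<cdot> c)) (u (T a \<cdot> d)))"
        unfolding tgt_mult_e[OF hh(2) m hh(3)]
        by (rule co_hom[OF mod_B mod_KT, where f="\<lambda>x. cc x (u (T a \<cdot> d))"]) (use hh m in \<open>auto intro!: linC\<close>)
      thus "co KT z (\<lambda>b y. cc (e (m *\<^sub>L y) (T b \<cdot> c)) (u (T a \<cdot> d))) = cc (e m c) (e z (T a \<cdot> d))"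
        using hh m by (simp add: cc_balance src_mult_e)
    qed
    also have "\<dots> = sw KT h (\<lambda>c d. co KT l (\<lambda>a z. cc (e m c) (e z (T a \<cdot> d))))"
      by (rule sw_co[symmetric]) (use l m h in \<open>auto intro!: linC\<close>)
    also have "\<dots> = sw KT h (\<lambda>c d. cc (e m c) (tgt B l \<star> u d))"
    proof (rule sw_cong[OF _ h])
      fix c d assume cd: "c \<in> carrier H" "d \<in> carrier H"
      have "cc (e m c) (co B l (\<lambda>a z. e (\<one>\<^bsub>L\<^esub> *\<^sub>L z) (T a \<cdot> d))) = co KT l (\<lambda>a z. cc (e m c) (e (\<one>\<^bsub>L\<^esub> *\<^sub>L z) (T a \<cdot> d)))"
        by (rule co_hom[OF mod_B mod_KT, where f="\<lambda>x. cc (e m c) x"]) (use cd l m in \<open>auto intro!: linC\<close>)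
      thus "co KT l (\<lambda>a z. cc (e m c) (e z (T a \<cdot> d))) = cc (e m c) (tgt B l \<star> u d)"
        using cd l by (simp add: tgt_mult_e cong: co_cong)
    qed
    also have "\<dots> = tsum KT (\<lambda>p q. cc p (tgt B l \<star> q)) (bcomul B (e m h))"
      by (rule bsum_e[OF F m h, symmetric])
    finally show "bcomul B (tgt B l \<star> e m h) = tsum KT (\<lambda>p q. cc p (tgt B l \<star> q)) (bcomul B (e m h))" .
  qed (use l in simp)
qed

section \<open>Multiplicativity of the comultiplication\<close>

lemma bal2_cc: "bal2 KT cc"
  by (rule bal2I) (auto simp: cc_balance intro!: linC)

text \<open>The inner sum \<open>?N a\<close> is balanced in p' and q' by the Takeuchi condition for
  \<open>a\<close>. Hence both factors can be reduced to pure elements one after the other, and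
  there the claim follows from coassociativity and multiplicativity of the coproduct of
  \<open>H\<close>.\<close>

lemma comul_mult:
  assumes a: "a \<in> carrier B" and b: "b \<in> carrier B"
  shows "bcomul B (a \<star> b) = tsum KT (\<lambda>p q. tsum KT (\<lambda>p' q'. cc (p \<star> p') (q \<star> q')) (bcomul B b)) (bcomul B a)"
proof -
  let ?N = "\<lambda>a p' q'. tsum KT (\<lambda>p q. cc (p \<star> p') (q \<star> q')) (bcomul B a)"
  have F: "bal2 KT (\<lambda>p q. cc (p \<star> p') (q \<star> q'))" if "p' \<in> carrier B" "q' \<in> carrier B" for p' q'
    by (rule bal2I) (use that in \<open>auto simp: B_assoc cc_balance intro!: linC\<close>)
  have N: "bal2 KT (?N a)" if a: "a \<in> carrier B" for a
  proof (rule bal2I[OF mod_KT])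
    fix l p q assume h: "l \<in> carrier L" "p \<in> carrier B" "q \<in> carrier B"
    show "?N a (tgt B l \<star> p) q = ?N a p (src B l \<star> q)"
      using takeuchi[OF F[OF h(2,3)] h(1) a] h bcomul_closed[OF a] by (simp add: B_assoc cong: bsum_cong)
  qed (use a in \<open>auto intro!: lin_bsum_inner linC\<close>)
  have N': "lin B KT (\<lambda>a. ?N a p q)" if "p \<in> carrier B" "q \<in> carrier B" for p q
    by (rule lin_bsum[OF F[OF that] k_linear_id])
  have "bcomul B (a \<star> b) = tsum KT (?N a) (bcomul B b)"
  proof (rule B_eqI[OF mod_KT k_linear_comp[OF lin_smash_right[OF a] lin_bcomul] lin_bsum[OF N[OF a] k_linear_id] b])
    fix m g assume m: "m \<in> carrier L" and g: "g \<in> carrier H"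
    show "bcomul B (a \<star> e m g) = tsum KT (?N a) (bcomul B (e m g))"
    proof (rule B_eqI[OF mod_KT _ _ a])
      show "lin B KT (\<lambda>a. bcomul B (a \<star> e m g))"
        by (rule k_linear_comp[OF lin_smash_left lin_bcomul]) (use m g in simp)
      have "lin B KT (\<lambda>a. sw KT g (\<lambda>c d. ?N a (e m c) (u d)))"
        by (rule lin_sw_inner[OF mod_KT mod_B g N']) (use m in auto)
      thus "lin B KT (\<lambda>a. tsum KT (?N a) (bcomul B (e m g)))"
        by (rule k_linear_cong[OF _ _ mod_B]) (simp add: bsum_e[OF N m g])
      fix l f assume l: "l \<in> carrier L" and f: "f \<in> carrier H"
      have "tsum KT (?N (e l f)) (bcomul B (e m g)) = sw KT g (\<lambda>c d. ?N (e l f) (e m c) (u d))"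
        by (rule bsum_e[OF N m g]) (use l f in simp)
      also have "\<dots> = sw KT g (\<lambda>c d. sw KT f (\<lambda>x b. cc (e l x \<star> e m c) (u b \<star> u d)))"
        by (intro sw_cong g bsum_e[OF F l f]) (use m in auto)
      also have "\<dots> = sw KT g (\<lambda>c d. sw KT f (\<lambda>x b. sw KT x (\<lambda>p q. cc (e (l *\<^sub>L (p \<rhd> m)) (q \<cdot> c)) (u (b \<cdot> d)))))"
      proof (intro sw_cong f g)
        fix c d x b assume h: "c \<in> carrier H" "d \<in> carrier H" "x \<in> carrier H" "b \<in> carrier H"
        have "cc (sw B x (\<lambda>p q. e (l *\<^sub>L (p \<rhd> m)) (q \<cdot> c))) (u (b \<cdot> d)) =
          sw KT x (\<lambda>p q. cc (e (l *\<^sub>L (p \<rhd> m)) (q \<cdot> c)) (u (b \<cdot> d)))"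
          by (rule sw_hom[OF mod_B mod_KT, where f="\<lambda>z. cc z (u (b \<cdot> d))"]) (use h l m in \<open>auto intro!: linC\<close>)
        thus "cc (e l x \<star> e m c) (u b \<star> u d) = sw KT x (\<lambda>p q. cc (e (l *\<^sub>L (p \<rhd> m)) (q \<cdot> c)) (u (b \<cdot> d)))"
          using h l m by (simp add: smash_pure[of l x m c] smash_unit_right)
      qed
      also have "\<dots> = sw KT f (\<lambda>x b. sw KT g (\<lambda>c d. sw KT x (\<lambda>p q. cc (e (l *\<^sub>L (p \<rhd> m)) (q \<cdot> c)) (u (b \<cdot> d)))))"
        by (rule sw_sw) (use l m f g in \<open>auto intro!: linC\<close>)
      also have "\<dots> = sw KT f (\<lambda>x b. sw KT x (\<lambda>p q. sw KT g (\<lambda>c d. cc (e (l *\<^sub>L (p \<rhd> m)) (q \<cdot> c)) (u (b \<cdot> d)))))"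
        by (intro sw_cong f sw_sw) (use l m g in \<open>auto intro!: linC\<close>)
      also have "\<dots> = sw KT f (\<lambda>p x. sw KT x (\<lambda>q b. sw KT g (\<lambda>c d. cc (e (l *\<^sub>L (p \<rhd> m)) (q \<cdot> c)) (u (b \<cdot> d)))))"
        by (rule sw_coassoc) (use l m f g in \<open>auto intro!: linC\<close>)
      also have "\<dots> = sw KT f (\<lambda>p x. sw KT (x \<cdot> g) (\<lambda>q b. cc (e (l *\<^sub>L (p \<rhd> m)) q) (u b)))"
        by (intro sw_cong f sw_mult[symmetric]) (use l m g in \<open>auto intro!: linC\<close>)
      also have "\<dots> = sw KT f (\<lambda>p x. bcomul B (e (l *\<^sub>L (p \<rhd> m)) (x \<cdot> g)))"
        by (intro sw_cong f comul_e[symmetric]) (use l m g in auto)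
      also have "\<dots> = bcomul B (e l f \<star> e m g)"
        unfolding smash_pure[OF l f m g]
        by (rule sw_hom[OF mod_B mod_KT lin_bcomul, symmetric]) (use l f m g in \<open>auto intro!: linC\<close>)
      finally show "bcomul B (e l f \<star> e m g) = tsum KT (?N (e l f)) (bcomul B (e m g))" by simp
    qed
  qed
  \<comment> \<open>The computation needed the sum over \<open>b\<close> outside, where balancedness
    is known; the product in the tensor square is defined with the sum over \<open>a\<close>
    outside.\<close>
  also have "\<dots> = tsum KT (\<lambda>p q. tsum KT (\<lambda>p' q'. cc (p \<star> p') (q \<star> q')) (bcomul B b)) (bcomul B a)"
    by (rule tsum_swap[OF tpB tpB module_group[OF mod_KT]])
      (use bcomul_closed[OF a] bcomul_closed[OF b] cc_closed in \<open>auto simp: pb.kt_simps\<close>)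
  finally show ?thesis .
qed

subsection \<open>The counit\<close>

abbreviation "\<epsilon>\<^sub>B \<equiv> bcounit B"

lemma counit_eq: "\<epsilon>\<^sub>B b = tsum L (\<lambda>l h. \<epsilon> h \<odot>\<^bsub>L\<^esub> l) b"
  by (simp add: smash_def Let_def tsum_def)

lemma lin_bcounit: "lin B L \<epsilon>\<^sub>B"
  unfolding counit_eq by (rule lin_Bsum) (auto intro!: linC)

lemma bcounit_closed [simp]: "b \<in> carrier B \<Longrightarrow> \<epsilon>\<^sub>B b \<in> carrier L"
  by (rule k_linear_closed[OF lin_bcounit])

lemma counit_e: "l \<in> carrier L \<Longrightarrow> h \<in> carrier H \<Longrightarrow> \<epsilon>\<^sub>B (e l h) = \<epsilon> h \<odot>\<^bsub>L\<^esub> l"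
  unfolding counit_eq by (rule Bsum_pure) (auto intro!: linC)

text \<open>The leg in \<open>H\<close> of the second factor enters only through its counit. Both
  forms of the axiom on \<epsilon>(ab) follow from this, as they replace \<open>b\<close> by an
  element with the same counit.\<close>

lemma counit_mult_e:
  assumes a: "a \<in> carrier B" and m: "m \<in> carrier L" and g: "g \<in> carrier H"
  shows "\<epsilon>\<^sub>B (a \<star> e m g) = \<epsilon> g \<odot>\<^bsub>L\<^esub> \<epsilon>\<^sub>B (a \<star> src B m)"
proof -
  interpret L: module K L by (rule mod_L)
  have 1: "\<epsilon>\<^sub>B (e l f \<star> e m g) = \<epsilon> g \<odot>\<^bsub>L\<^esub> (l *\<^sub>L (f \<rhd> m))"
    if l: "l \<in> carrier L" and f: "f \<in> carrier H" and g: "g \<in> carrier H" for l f g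
  proof -
    have "\<epsilon>\<^sub>B (e l f \<star> e m g) = sw L f (\<lambda>x b. \<epsilon>\<^sub>B (e (l *\<^sub>L (x \<rhd> m)) (b \<cdot> g)))"
      unfolding smash_pure[OF l f m g]
      by (rule sw_hom[OF mod_B mod_L lin_bcounit]) (use l f g m in \<open>auto intro!: linC\<close>)
    also have "\<dots> = sw L f (\<lambda>x b. \<epsilon> b \<odot>\<^bsub>L\<^esub> (\<epsilon> g \<odot>\<^bsub>L\<^esub> (l *\<^sub>L (x \<rhd> m))))"
      using l f g m by (intro sw_cong) (simp_all add: counit_e counit_mult L.smult_assoc1)
    also have "\<dots> = \<epsilon> g \<odot>\<^bsub>L\<^esub> (l *\<^sub>L (f \<rhd> m))"
      by (rule sw_counit_right) (use l f g m in \<open>auto intro!: linC\<close>)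
    finally show ?thesis .
  qed
  show ?thesis
    by (rule B_eqI[OF mod_L _ _ a]; (rule k_linear_smult_right[OF mod_L])?;
        (rule k_linear_comp[OF lin_smash_left lin_bcounit])?)
      (use m g in \<open>auto simp: 1 src_eq counit_one\<close>)
qed

lemma counit_mult_src':
  assumes a: "a \<in> carrier B" and b: "b \<in> carrier B"
  shows "\<epsilon>\<^sub>B (a \<star> src B (\<epsilon>\<^sub>B b)) = \<epsilon>\<^sub>B (a \<star> b)"
  by (rule B_eqI[OF mod_L _ _ b]; (rule k_linear_comp[OF k_linear_comp[OF k_linear_comp[OF lin_bcounit lin_src] lin_smash_right] lin_bcounit]
      k_linear_comp[OF lin_smash_right lin_bcounit])?)
    (use a in \<open>auto simp: counit_e counit_mult_e k_linear_smult[OF lin_src] k_linear_smult[OF lin_smash_right] k_linear_smult[OF lin_bcounit]\<close>)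

text \<open>The inverse antipode disappears under the counit, and the counit axiom of the coaction
  removes the remaining leg.\<close>

lemma counit_mult_tgt':
  assumes a: "a \<in> carrier B" and m: "m \<in> carrier L"
  shows "\<epsilon>\<^sub>B (a \<star> tgt B m) = \<epsilon>\<^sub>B (a \<star> src B m)"
proof -
  have "\<epsilon>\<^sub>B (a \<star> tgt B m) = co L m (\<lambda>p y. \<epsilon>\<^sub>B (a \<star> e y (T p)))"
    unfolding tgt_eq[OF m]
    by (rule co_hom[OF mod_B mod_L, where f="\<lambda>z. \<epsilon>\<^sub>B (a \<star> z)"])
      (use a m in \<open>auto intro!: linC k_linear_comp[OF lin_smash_right lin_bcounit]\<close>)
  also have "\<dots> = co L m (\<lambda>p y. \<epsilon> p \<odot>\<^bsub>L\<^esub> \<epsilon>\<^sub>B (a \<star> src B y))"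
    using a by (intro co_cong m) (simp add: counit_mult_e counit_T)
  also have "\<dots> = \<epsilon>\<^sub>B (a \<star> src B m)"
    by (rule co_counit[OF mod_L k_linear_comp[OF k_linear_comp[OF lin_src lin_smash_right] lin_bcounit]]) (use a m in auto)
  finally show ?thesis .
qed

lemma counit_tgt_mult:
  assumes l: "l \<in> carrier L" and b: "b \<in> carrier B"
  shows "\<epsilon>\<^sub>B (tgt B l \<star> b) = \<epsilon>\<^sub>B b *\<^sub>L l"
proof (rule B_eqI[OF mod_L k_linear_comp[OF lin_smash_right lin_bcounit] k_linear_mult_left[OF alg_L lin_bcounit] b])
  interpret L: module K L by (rule mod_L)
  fix m h assume m: "m \<in> carrier L" and h: "h \<in> carrier H"
  have "\<epsilon>\<^sub>B (tgt B l \<star> e m h) = co L l (\<lambda>p y. \<epsilon>\<^sub>B (e (m *\<^sub>L y) (T p \<cdot> h)))"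
    unfolding tgt_mult_e[OF l m h]
    by (rule co_hom[OF mod_B mod_L lin_bcounit]) (use l m h in \<open>auto intro!: linC\<close>)
  also have "\<dots> = co L l (\<lambda>p y. \<epsilon> p \<odot>\<^bsub>L\<^esub> (\<epsilon> h \<odot>\<^bsub>L\<^esub> (m *\<^sub>L y)))"
    using m h by (intro co_cong l) (simp add: counit_e counit_mult counit_T L.smult_assoc1)
  also have "\<dots> = \<epsilon> h \<odot>\<^bsub>L\<^esub> (m *\<^sub>L l)"
    by (rule co_counit) (use l m h in \<open>auto intro!: linC\<close>)
  finally show "\<epsilon>\<^sub>B (tgt B l \<star> e m h) = \<epsilon>\<^sub>B (e m h) *\<^sub>L l"
    using l m h by (simp add: counit_e k_algebra_smult_left[OF alg_L])
qed (use l in auto)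

lemma counit_src_mult:
  assumes l: "l \<in> carrier L" and b: "b \<in> carrier B"
  shows "\<epsilon>\<^sub>B (src B l \<star> b) = l *\<^sub>L \<epsilon>\<^sub>B b"
  by (rule B_eqI[OF mod_L k_linear_comp[OF lin_smash_right lin_bcounit] k_linear_mult_right[OF alg_L lin_bcounit] b])
    (use l in \<open>auto simp: src_mult_e counit_e k_algebra_smult_right[OF alg_L]\<close>)

lemma counit_axioms:
  assumes b: "b \<in> carrier B"
  shows "tsum B (\<lambda>p q. src B (\<epsilon>\<^sub>B p) \<star> q) (bcomul B b) = b"
    "tsum B (\<lambda>p q. tgt B (\<epsilon>\<^sub>B q) \<star> p) (bcomul B b) = b"
proof -
  have l: "\<And>P f. lin P B f \<Longrightarrow> lin P L (\<lambda>x. \<epsilon>\<^sub>B (f x))" by (rule k_linear_comp[OF _ lin_bcounit])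
  have 1: "bal2 B (\<lambda>p q. src B (\<epsilon>\<^sub>B p) \<star> q)"
    by (rule bal2I) (auto simp: counit_tgt_mult pb.src_mult B_assoc intro!: linC l)
  have 2: "bal2 B (\<lambda>p q. tgt B (\<epsilon>\<^sub>B q) \<star> p)"
    by (rule bal2I) (auto simp: counit_src_mult pb.tgt_mult B_assoc intro!: linC l)
  note cm = k_linear_smult[OF lin_src] k_linear_smult[OF lin_tgt] k_linear_smult[OF lin_smash_left]
  show "tsum B (\<lambda>p q. src B (\<epsilon>\<^sub>B p) \<star> q) (bcomul B b) = b"
  proof (rule B_eqI[OF mod_B lin_bsum[OF 1 k_linear_id] k_linear_id b])
    fix l h assume lh: "l \<in> carrier L" "h \<in> carrier H"
    have "tsum B (\<lambda>p q. src B (\<epsilon>\<^sub>B p) \<star> q) (bcomul B (e l h)) = sw B h (\<lambda>x y. \<epsilon> x \<odot>\<^bsub>B\<^esub> e l y)"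
      unfolding bsum_e[OF 1 lh] using lh by (intro sw_cong) (simp_all add: counit_e cm src_mult_e)
    also have "\<dots> = e l h" by (rule sw_counit_left) (use lh in \<open>auto intro!: linC\<close>)
    finally show "tsum B (\<lambda>p q. src B (\<epsilon>\<^sub>B p) \<star> q) (bcomul B (e l h)) = e l h" .
  qed
  show "tsum B (\<lambda>p q. tgt B (\<epsilon>\<^sub>B q) \<star> p) (bcomul B b) = b"
  proof (rule B_eqI[OF mod_B lin_bsum[OF 2 k_linear_id] k_linear_id b])
    fix l h assume lh: "l \<in> carrier L" "h \<in> carrier H"
    have "tsum B (\<lambda>p q. tgt B (\<epsilon>\<^sub>B q) \<star> p) (bcomul B (e l h)) = sw B h (\<lambda>x y. \<epsilon> y \<odot>\<^bsub>B\<^esub> e l x)"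
      unfolding bsum_e[OF 2 lh] using lh
      by (intro sw_cong) (simp_all add: counit_e cm pb.tgt_one pb.B_one)
    also have "\<dots> = e l h" by (rule sw_counit_right) (use lh in \<open>auto intro!: linC\<close>)
    finally show "tsum B (\<lambda>p q. tgt B (\<epsilon>\<^sub>B q) \<star> p) (bcomul B (e l h)) = e l h" .
  qed
qed

section \<open>Coassociativity of the comultiplication\<close>

abbreviation "BB \<equiv> pb.BB"
abbreviation "KT2 \<equiv> pb.kt RB BB"
abbreviation pr where "pr p z \<equiv> tcls L (via_tgt B RB) BB [(p, z)]"

lemma bal2_src: "l \<in> carrier L \<Longrightarrow> bal2 KT (\<lambda>p q. cc (src B l \<star> p) q)"
  by (rule bal2I) (auto simp: B_assoc[symmetric] src_tgt cc_balance[symmetric] intro!: linC)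

lemma BB_simps: "carrier BB = carrier KT" "add BB = add KT" "zero BB = zero KT"
  by (simp_all add: pb.kt_simps)

lemma BB_smult: "l \<in> carrier L \<Longrightarrow> z \<in> carrier KT \<Longrightarrow> l \<odot>\<^bsub>BB\<^esub> z = tsum KT (\<lambda>p q. cc (src B l \<star> p) q) z"
  using bcls_list[of "\<lambda>p q. src B l \<star> p" "\<lambda>p q. q" z] by simp

lemma BB_smult_closed: "l \<in> carrier L \<Longrightarrow> z \<in> carrier KT \<Longrightarrow> l \<odot>\<^bsub>BB\<^esub> z \<in> carrier KT"
  unfolding BB_smult by (rule k_linear_closed[OF lin_tsumKT[OF bal2_src k_linear_id]])

lemma tp2: "tensor_pair L (via_tgt B RB) BB"
proof (rule tensor_pair.intro)
  show "abelian_group BB"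
    by (rule abelian_group_cong[OF module_group[OF mod_KT]]) (simp_all only: BB_simps)
  show "r \<odot>\<^bsub>BB\<^esub> n \<in> carrier BB" if "r \<in> carrier L" "n \<in> carrier BB" for r n
    using BB_smult_closed that by (simp only: BB_simps)
qed (use tensor_pair.group_M[OF tpB] in \<open>simp_all\<close>)

lemma mod_KT2: "module K KT2"
  by (rule pb.module_kt[OF lmodRB tp2])

lemma pr_closed: "p \<in> carrier B \<Longrightarrow> z \<in> carrier KT \<Longrightarrow> pr p z \<in> carrier KT2"
  using tensor_pair.pure_closed[OF tp2, of p z] by (simp add: pb.kt_simps)

lemma lin_pr_left: "lin P B f \<Longrightarrow> z \<in> carrier KT \<Longrightarrow> lin P KT2 (\<lambda>x. pr (f x) z)"
  by (rule pb.kt_lin_left[OF lmodRB tp2]) (simp_all add: pb.k_linear_RB pb.kt_simps)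

lemma lin_BB: "lin P (restrict_scalars L BB) f = lin P KT f"
  by (auto simp: k_linear_def additive_on_def restrict_scalars_def pb.kt_def tensor_act_def pb.scalar_src bcls_def)

lemma lin_pr_right: "lin P KT f \<Longrightarrow> p \<in> carrier B \<Longrightarrow> lin P KT2 (\<lambda>x. pr p (f x))"
  by (rule pb.kt_lin_right[OF lmodRB tp2]) (simp_all add: lin_BB)

lemma pr_balance: "l \<in> carrier L \<Longrightarrow> p \<in> carrier B \<Longrightarrow> z \<in> carrier KT \<Longrightarrow>
    pr (tgt B l \<star> p) z = pr p (tsum KT (\<lambda>p q. cc (src B l \<star> p) q) z)"
  using tensor_pair.pure_balanced[OF tp2, of l p z] BB_smult[of l z] by (simp add: pb.kt_simps)

lemmas linD = linC mod_KT2 pr_closed lin_pr_left lin_pr_right k_linear_comp[OF _ lin_bcomul]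

text \<open>On pure elements this is coassociativity of \<open>H\<close>. Before the reduction both
  sides have to be balanced maps on the tensor square: for the left side this is
  \<open>comul_src\<close>, for the right side \<open>comul_tgt\<close>.\<close>

lemma comul_coassoc:
  assumes b: "b \<in> carrier B"
  shows "tcls L (via_tgt B RB) BB [(a1, bcomul B a2). (a1, a2) \<leftarrow> tlist (bcomul B b)] =
    tcls L (via_tgt B RB) BB [(p, cc q a2). (a1, a2) \<leftarrow> tlist (bcomul B b), (p, q) \<leftarrow> tlist (bcomul B a1)]"
proof -
  have cT: "x \<in> carrier B \<Longrightarrow> bcomul B x \<in> carrier (tensor L (via_tgt B RB) (via_src B RB))" for x
    using bcomul_closed[of x] by (simp add: pb.kt_simps)
  let ?G = "\<lambda>r p q. pr p (cc q r)"
  have F1: "bal2 KT2 (\<lambda>p q. pr p (bcomul B q))"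
    by (rule bal2I) (auto simp: pr_balance comul_src intro!: linD)
  have G: "bal2 KT2 (?G r)" if "r \<in> carrier B" for r
    by (rule bal2I) (use that in \<open>auto simp: pr_balance cc_closed tsum_cc[OF bal2_src] intro!: linD\<close>)
  have F2: "bal2 KT2 (\<lambda>x r. tsum KT2 (?G r) (bcomul B x))"
  proof (rule bal2I[OF mod_KT2])
    show "lin B KT2 (\<lambda>r. tsum KT2 (?G r) (bcomul B p))" if "p \<in> carrier B" for p
      by (rule lin_bsum_inner[OF mod_KT2 that]) (auto intro!: linD)
    show "lin B KT2 (\<lambda>p. tsum KT2 (?G q) (bcomul B p))" if "q \<in> carrier B" for q
      by (rule lin_bsum[OF G[OF that] k_linear_id])
    fix l x r assume h: "l \<in> carrier L" "x \<in> carrier B" "r \<in> carrier B"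
    have "tsum KT2 (?G r) (bcomul B (tgt B l \<star> x)) = tsum KT2 (\<lambda>p q. tsum KT2 (?G r) (cc p (tgt B l \<star> q))) (bcomul B x)"
      unfolding comul_tgt[OF h(1,2)]
      by (rule bsum_hom[OF mod_KT mod_KT2 lin_tsumKT[OF G k_linear_id]]) (use h in \<open>auto intro!: linD\<close>)
    also have "\<dots> = tsum KT2 (?G (src B l \<star> r)) (bcomul B x)"
      using h by (intro bsum_cong) (auto simp: tsum_cc[OF G] cc_balance)
    finally show "tsum KT2 (?G r) (bcomul B (tgt B l \<star> x)) = tsum KT2 (?G (src B l \<star> r)) (bcomul B x)" .
  qed
  have "tcls L (via_tgt B RB) BB (map (\<lambda>(a1, a2). (a1, bcomul B a2)) (tlist (bcomul B b))) =
    tsum KT2 (\<lambda>p q. pr p (bcomul B q)) (bcomul B b)"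
    unfolding pb.tsum_kt[symmetric]
    by (rule tensor_pair.tcls_map[OF tpB _ _ tp2 cT[OF b]]) (auto simp: cT)
  also have "\<dots> = tsum KT2 (\<lambda>x r. tsum KT2 (?G r) (bcomul B x)) (bcomul B b)"
  proof (rule B_eqI[OF mod_KT2 lin_bsum[OF F1 k_linear_id] lin_bsum[OF F2 k_linear_id] b])
    fix l h assume l: "l \<in> carrier L" and h: "h \<in> carrier H"
    have "tsum KT2 (\<lambda>p q. pr p (bcomul B q)) (bcomul B (e l h)) = sw KT2 h (\<lambda>x y. pr (e l x) (bcomul B (u y)))"
      by (rule bsum_e[OF F1 l h])
    also have "\<dots> = sw KT2 h (\<lambda>x y. sw KT2 y (\<lambda>c d. pr (e l x) (cc (u c) (u d))))"
    proof (rule sw_cong[OF _ h])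
      fix x y assume xy: "x \<in> carrier H" "y \<in> carrier H"
      show "pr (e l x) (bcomul B (u y)) = sw KT2 y (\<lambda>c d. pr (e l x) (cc (u c) (u d)))"
        unfolding comul_e[OF H_closed(4) xy(2)]
        by (rule sw_hom[OF mod_KT mod_KT2, where f="\<lambda>z. pr (e l x) z"]) (use xy l in \<open>auto intro!: linD\<close>)
    qed
    also have "\<dots> = sw KT2 h (\<lambda>x d. sw KT2 x (\<lambda>a c. pr (e l a) (cc (u c) (u d))))"
      by (rule sw_coassoc[symmetric]) (use l h in \<open>auto intro!: linD\<close>)
    also have "\<dots> = sw KT2 h (\<lambda>x d. tsum KT2 (?G (u d)) (bcomul B (e l x)))"
      by (intro sw_cong h bsum_e[OF G l, symmetric]) auto
    also have "\<dots> = tsum KT2 (\<lambda>x r. tsum KT2 (?G r) (bcomul B x)) (bcomul B (e l h))"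
      by (rule bsum_e[OF F2 l h, symmetric])
    finally show "tsum KT2 (\<lambda>p q. pr p (bcomul B q)) (bcomul B (e l h)) = \<dots>" .
  qed
  also have "\<dots> = tcls L (via_tgt B RB) BB [(p, cc q a2). (a1, a2) \<leftarrow> tlist (bcomul B b), (p, q) \<leftarrow> tlist (bcomul B a1)]"
  proof -
    have val: "set (map (\<lambda>(p, q). (p, cc q r)) (tlist (bcomul B x))) \<subseteq> carrier (via_tgt B RB) \<times> carrier BB"
      if "x \<in> carrier B" "r \<in> carrier B" for x r
      by (rule tensor_pair.tlist_map_valid[OF tpB _ _ cT[OF that(1)]]) (use that cc_closed in \<open>auto simp: pb.kt_simps\<close>)
    have 1: "tcls L (via_tgt B RB) BB (map (\<lambda>(p, q). (p, cc q r)) (tlist (bcomul B x))) = tsum KT2 (?G r) (bcomul B x)"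
      if "x \<in> carrier B" "r \<in> carrier B" for x r
      unfolding pb.tsum_kt[symmetric]
      by (rule tensor_pair.tcls_map[OF tpB _ _ tp2 cT[OF that(1)]]) (use that cc_closed in \<open>auto simp: pb.kt_simps\<close>)
    have "tcls L (via_tgt B RB) BB (concat (map (\<lambda>(x, r). map (\<lambda>(p, q). (p, cc q r)) (tlist (bcomul B x))) (tlist (bcomul B b)))) =
      tsum KT2 (\<lambda>x r. tcls L (via_tgt B RB) BB (map (\<lambda>(p, q). (p, cc q r)) (tlist (bcomul B x)))) (bcomul B b)"
      unfolding pb.tsum_kt[symmetric]
      by (rule tensor_pair.tcls_concat[OF tpB _ tp2 cT[OF b]]) (use val in simp)
    also have "\<dots> = tsum KT2 (\<lambda>x r. tsum KT2 (?G r) (bcomul B x)) (bcomul B b)"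
      by (intro bsum_cong 1 bcomul_closed b)
    finally show ?thesis by simp
  qed
  finally show ?thesis .
qed

theorem bialgebroid_smash: "bialgebroid K L B"
  unfolding bialgebroid_def Let_def
proof (intro conjI ballI)
  show "k_algebra K L" "k_algebra K B" "k_algebra_hom K L B (src B)" "k_algebra_antihom K L B (tgt B)"
    by (rule alg_L alg_B src_hom tgt_antihom)+
  show "src B l \<star> tgt B m = tgt B m \<star> src B l" if "l \<in> carrier L" "m \<in> carrier L" for l m
    by (rule src_tgt[OF that])
  show "additive_on B BB (bcomul B)"
    using k_linear_additive[OF lin_bcomul] by (simp add: additive_on_def pb.kt_simps)
  show "bcomul B (src B l \<star> a) = bcls L B RB RB [(src B l \<star> a1, a2). (a1, a2) \<leftarrow> tlist (bcomul B a)]"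
    if "l \<in> carrier L" "a \<in> carrier B" for l a
    using that by (simp add: comul_src bcls_list[where f="\<lambda>p q. src B l \<star> p"])
  show "bcomul B (tgt B l \<star> a) = bcls L B RB RB [(a1, tgt B l \<star> a2). (a1, a2) \<leftarrow> tlist (bcomul B a)]"
    if "l \<in> carrier L" "a \<in> carrier B" for l a
    using that by (simp add: comul_tgt bcls_list[where g="\<lambda>p q. tgt B l \<star> q"])
  show "bcls L B RB RB [(a1 \<star> tgt B l, a2). (a1, a2) \<leftarrow> tlist (bcomul B a)] =
    bcls L B RB RB [(a1, a2 \<star> src B l). (a1, a2) \<leftarrow> tlist (bcomul B a)]"
    if "a \<in> carrier B" "l \<in> carrier L" for a l
    using that takeuchi[OF bal2_cc that(2,1)]
    by (simp add: bcls_list[where f="\<lambda>p q. p \<star> tgt B l"] bcls_list[where g="\<lambda>p q. q \<star> src B l"])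
  have "bilinear K H H KT (\<lambda>x y. cc (u x) (u y))" by (auto intro!: linD)
  thus "bcomul B \<one>\<^bsub>B\<^esub> = \<one>\<^bsub>BB\<^esub>"
    using comul_e[of "\<one>\<^bsub>L\<^esub>" "\<one>\<^bsub>H\<^esub>"] sw_one[OF mod_KT, of "\<lambda>x y. cc (u x) (u y)"]
    by (simp add: smash_simps(5) tensor_def bcls_def[symmetric])
  show "bcomul B (a \<star> b) = bcomul B a \<otimes>\<^bsub>BB\<^esub> bcomul B b" if a: "a \<in> carrier B" and b: "b \<in> carrier B" for a b
  proof -
    have cT: "x \<in> carrier B \<Longrightarrow> bcomul B x \<in> carrier (tensor L (via_tgt B RB) (via_src B RB))" for x
      using bcomul_closed[of x] by (simp add: pb.kt_simps)
    let ?h = "\<lambda>p q. map (\<lambda>(p', q'). (p \<star> p', q \<star> q')) (tlist (bcomul B b))"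
    have val: "set (?h p q) \<subseteq> carrier (via_tgt B RB) \<times> carrier (via_src B RB)" if "p \<in> carrier B" "q \<in> carrier B" for p q
      by (rule tensor_pair.tlist_map_valid[OF tpB _ _ cT[OF b]]) (use that in auto)
    have "bcomul B a \<otimes>\<^bsub>BB\<^esub> bcomul B b = bcls L B RB RB (concat (map (\<lambda>(p, q). ?h p q) (tlist (bcomul B a))))"
      by (simp add: tensor_def bcls_def)
    also have "\<dots> = tsum KT (\<lambda>p q. bcls L B RB RB (?h p q)) (bcomul B a)"
      unfolding bcls_def pb.tsum_kt[symmetric]
      by (rule tensor_pair.tcls_concat[OF tpB _ tpB cT[OF a]]) (use val in simp)
    also have "\<dots> = tsum KT (\<lambda>p q. tsum KT (\<lambda>p' q'. cc (p \<star> p') (q \<star> q')) (bcomul B b)) (bcomul B a)"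
      by (intro bsum_cong bcls_list) (use a b in auto)
    finally show ?thesis using comul_mult[OF a b] by simp
  qed
  show "tcls L (via_tgt B RB) BB [(a1, bcomul B a2). (a1, a2) \<leftarrow> tlist (bcomul B a)] =
    tcls L (via_tgt B RB) BB [(p, cc q a2). (a1, a2) \<leftarrow> tlist (bcomul B a), (p, q) \<leftarrow> tlist (bcomul B a1)]"
    if "a \<in> carrier B" for a
    by (rule comul_coassoc[OF that])
  show "additive_on B L \<epsilon>\<^sub>B" by (rule k_linear_additive[OF lin_bcounit])
  show "\<epsilon>\<^sub>B (src B l \<star> a) = l *\<^sub>L \<epsilon>\<^sub>B a" "\<epsilon>\<^sub>B (tgt B l \<star> a) = \<epsilon>\<^sub>B a *\<^sub>L l"
    if "l \<in> carrier L" "a \<in> carrier B" for l a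
    using that by (simp_all add: counit_src_mult counit_tgt_mult)
  show "\<epsilon>\<^sub>B \<one>\<^bsub>B\<^esub> = \<one>\<^bsub>L\<^esub>"
    using counit_e[of "\<one>\<^bsub>L\<^esub>" "\<one>\<^bsub>H\<^esub>"] module.smult_one[OF mod_L] by (simp add: smash_simps(5) counit_one)
  show "\<epsilon>\<^sub>B (a \<star> src B (\<epsilon>\<^sub>B b)) = \<epsilon>\<^sub>B (a \<star> b)" "\<epsilon>\<^sub>B (a \<star> tgt B (\<epsilon>\<^sub>B b)) = \<epsilon>\<^sub>B (a \<star> b)"
    if "a \<in> carrier B" "b \<in> carrier B" for a b
    using that by (simp_all add: counit_mult_src' counit_mult_tgt')
  show "lsum B [src B (\<epsilon>\<^sub>B a1) \<star> a2. (a1, a2) \<leftarrow> tlist (bcomul B a)] = a"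
    "lsum B [tgt B (\<epsilon>\<^sub>B a2) \<star> a1. (a1, a2) \<leftarrow> tlist (bcomul B a)] = a" if "a \<in> carrier B" for a
    using counit_axioms[OF that] by (simp_all add: tsum_def)
qed

lemma bialg: "bialg K L B"
  by (intro bialg.intro prebialg bialg_axioms.intro bialgebroid_smash)

end

sublocale hopf_base \<subseteq> pb: bialg K L "smash K H L"
  by (rule bialg)

context hopf_base
begin

section \<open>Tensor products of modules over the Hopf algebra\<close>

context
  fixes X Y :: "('a univ, 'a univ) module" assumes X: "hmod X" and Y: "hmod Y"
begin

lemmas cl2 = left_module_closed[OF X] left_module_closed[OF Y]

abbreviation (input) "TT \<equiv> tensor K (r X) (r Y)"

lemma mod_TT: "module K TT"
  by (rule module_tensor[OF mod_r[OF X] mod_r[OF Y]])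

lemma pure_TT: "x \<in> carrier X \<Longrightarrow> y \<in> carrier Y \<Longrightarrow> hp X Y x y \<in> carrier TT"
  unfolding hcls_def by (rule tensor_pair.pure_closed[OF pair_r[OF X Y]]) simp_all

lemma lin_TT_left: "lin P (r X) f \<Longrightarrow> y \<in> carrier Y \<Longrightarrow> lin P TT (\<lambda>x. hp X Y (f x) y)"
  unfolding hcls_def by (rule k_linear_pure_left[OF mod_r[OF X] mod_r[OF Y]]) simp_all

lemma lin_TT_right: "lin P (r Y) f \<Longrightarrow> x \<in> carrier X \<Longrightarrow> lin P TT (\<lambda>y. hp X Y x (f y))"
  unfolding hcls_def by (rule k_linear_pure_right[OF mod_r[OF X] mod_r[OF Y]]) simp_all

lemmas lin_TT = lin mod_TT pure_TT lin_TT_left lin_TT_right cl2 X Y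

definition htact where
  "htact h x y = sw TT h (\<lambda>a b. hp X Y (a \<odot>\<^bsub>X\<^esub> x) (b \<odot>\<^bsub>Y\<^esub> y))"

lemma htact_bilinear: "h \<in> carrier H \<Longrightarrow> bilinear K (r X) (r Y) TT (htact h)"
  unfolding htact_def by (auto intro!: lin_TT)

lemma ht_smult:
  assumes h: "h \<in> carrier H" and t: "t \<in> carrier TT"
  shows "h \<odot>\<^bsub>X \<bullet> Y\<^esub> t = tsum TT (htact h) t"
proof -
  let ?h = "\<lambda>a b. map (\<lambda>(x, y). (a \<odot>\<^bsub>X\<^esub> x, b \<odot>\<^bsub>Y\<^esub> y)) (tlist t)"
  note p = pair_r[OF X Y]
  have val: "set (?h a b) \<subseteq> carrier (r X) \<times> carrier (r Y)" if "a \<in> carrier H" "b \<in> carrier H" for a b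
    by (rule tensor_pair.tlist_map_valid[OF p _ _ t]) (use that cl2 in auto)
  have "h \<odot>\<^bsub>X \<bullet> Y\<^esub> t = hcls K H X Y (concat (map (\<lambda>(a, b). ?h a b) (tlist (comul H h))))"
    by (simp add: htensor_def)
  also have "\<dots> = sw TT h (\<lambda>a b. hcls K H X Y (?h a b))"
    unfolding hcls_def by (rule tensor_pair.tcls_concat[OF pair_HH val p comul_closed[OF h]])
  also have "\<dots> = sw TT h (\<lambda>a b. tsum TT (\<lambda>x y. hp X Y (a \<odot>\<^bsub>X\<^esub> x) (b \<odot>\<^bsub>Y\<^esub> y)) t)"
    unfolding hcls_def
    by (intro sw_cong h tensor_pair.tcls_map[OF p _ _ p t]) (auto simp: cl2)
  also have "\<dots> = tsum TT (htact h) t"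
    unfolding htact_def
    by (rule tsum_swap[OF pair_HH p module_group[OF mod_TT] comul_closed[OF h] t])
      (auto intro!: pure_TT simp: cl2)
  finally show ?thesis .
qed

lemma ht_smult_lin: "h \<in> carrier H \<Longrightarrow> lin TT TT (\<lambda>t. h \<odot>\<^bsub>X \<bullet> Y\<^esub> t)"
  by (rule k_linear_cong[OF k_linear_tsum[OF mod_r[OF X] mod_r[OF Y] mod_TT htact_bilinear k_linear_id] _ mod_TT])
    (auto simp: ht_smult)

lemma ht_smult_pure0: "h \<in> carrier H \<Longrightarrow> x \<in> carrier X \<Longrightarrow> y \<in> carrier Y \<Longrightarrow>
    h \<odot>\<^bsub>X \<bullet> Y\<^esub> hp X Y x y = sw TT h (\<lambda>a b. hp X Y (a \<odot>\<^bsub>X\<^esub> x) (b \<odot>\<^bsub>Y\<^esub> y))"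
  using tensor_pair.tsum_pure[OF pair_r[OF X Y] module_group[OF mod_TT] bilinear_balanced[OF htact_bilinear]]
  by (simp add: ht_smult pure_TT) (simp add: htact_def hcls_def)

lemma TT_eqI:
  assumes "module K A" "lin TT A f" "lin TT A g" "t \<in> carrier TT"
    "\<And>x y. x \<in> carrier X \<Longrightarrow> y \<in> carrier Y \<Longrightarrow> f (hp X Y x y) = g (hp X Y x y)"
  shows "f t = g t"
  by (rule tensor_pair.tensor_eqI[OF pair_r[OF X Y] module_group[OF assms(1)] k_linear_additive[OF assms(2)]
        k_linear_additive[OF assms(3)] assms(4)]) (use assms(5) in \<open>simp add: hcls_def\<close>)

lemma lin_ht_smult_left: assumes t: "t \<in> carrier TT" shows "lin H TT (\<lambda>h. h \<odot>\<^bsub>X \<bullet> Y\<^esub> t)"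
proof (rule k_linear_cong[OF _ _ mod_H])
  show "lin H TT (\<lambda>h. tsum TT (htact h) t)"
    unfolding htact_def
    by (rule k_linear_tsum_inner[OF mod_r[OF X] mod_r[OF Y] mod_TT t])
      (auto intro!: lin_TT module.smult_closed[OF mod_H])
qed (simp add: ht_smult t)

lemma hmod_ht: "hmod (X \<bullet> Y)"
proof -
  have G: "abelian_group (X \<bullet> Y)"
    by (rule abelian_group_cong[OF module_group[OF mod_TT]]) (simp_all add: ht_simps)
  have one: "\<one>\<^bsub>H\<^esub> \<odot>\<^bsub>X \<bullet> Y\<^esub> t = t" if t: "t \<in> carrier TT" for t
  proof (rule TT_eqI[OF mod_TT ht_smult_lin k_linear_id t])
    fix x y assume xy: "x \<in> carrier X" "y \<in> carrier Y"
    have "bilinear K H H TT (\<lambda>a b. hp X Y (a \<odot>\<^bsub>X\<^esub> x) (b \<odot>\<^bsub>Y\<^esub> y))" using xy by (auto intro!: lin_TT)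
    from sw_one[OF mod_TT this] show "\<one>\<^bsub>H\<^esub> \<odot>\<^bsub>X \<bullet> Y\<^esub> hp X Y x y = hp X Y x y"
      using xy by (simp add: ht_smult_pure0 left_module_one[OF X] left_module_one[OF Y])
  qed simp
  have mult: "(g \<cdot> h) \<odot>\<^bsub>X \<bullet> Y\<^esub> t = g \<odot>\<^bsub>X \<bullet> Y\<^esub> (h \<odot>\<^bsub>X \<bullet> Y\<^esub> t)"
    if g: "g \<in> carrier H" and h: "h \<in> carrier H" and t: "t \<in> carrier TT" for g h t
  proof (rule TT_eqI[OF mod_TT ht_smult_lin k_linear_comp[OF ht_smult_lin ht_smult_lin] t])
    fix x y assume xy: "x \<in> carrier X" "y \<in> carrier Y"
    have "(g \<cdot> h) \<odot>\<^bsub>X \<bullet> Y\<^esub> hp X Y x y = sw TT g (\<lambda>a b. sw TT h (\<lambda>c d. hp X Y ((a \<cdot> c) \<odot>\<^bsub>X\<^esub> x) ((b \<cdot> d) \<odot>\<^bsub>Y\<^esub> y)))"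
      unfolding ht_smult_pure0[OF H_closed(1)[OF g h] xy]
      by (rule sw_mult[OF mod_TT _ g h]) (use xy in \<open>auto intro!: lin_TT\<close>)
    also have "\<dots> = sw TT h (\<lambda>c d. sw TT g (\<lambda>a b. hp X Y ((a \<cdot> c) \<odot>\<^bsub>X\<^esub> x) ((b \<cdot> d) \<odot>\<^bsub>Y\<^esub> y)))"
      by (rule sw_sw) (use g h xy in \<open>auto intro!: lin_TT\<close>)
    also have "\<dots> = sw TT h (\<lambda>c d. g \<odot>\<^bsub>X \<bullet> Y\<^esub> hp X Y (c \<odot>\<^bsub>X\<^esub> x) (d \<odot>\<^bsub>Y\<^esub> y))"
      using g xy by (intro sw_cong h)
        (simp add: ht_smult_pure0 cl2 left_module_mult[OF X] left_module_mult[OF Y] cong: sw_cong)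
    also have "\<dots> = g \<odot>\<^bsub>X \<bullet> Y\<^esub> (h \<odot>\<^bsub>X \<bullet> Y\<^esub> hp X Y x y)"
      unfolding ht_smult_pure0[OF h xy]
      by (rule sw_hom[OF mod_TT mod_TT ht_smult_lin[OF g], symmetric]) (use h xy in \<open>auto intro!: lin_TT\<close>)
    finally show "(g \<cdot> h) \<odot>\<^bsub>X \<bullet> Y\<^esub> hp X Y x y = g \<odot>\<^bsub>X \<bullet> Y\<^esub> (h \<odot>\<^bsub>X \<bullet> Y\<^esub> hp X Y x y)" .
  qed (use g h in auto)
  show ?thesis
    unfolding left_module_def
    using G ring_H one mult k_linear_additive[OF ht_smult_lin] k_linear_additive[OF lin_ht_smult_left]
    by (auto simp: ht_simps additive_on_def Pi_iff)
qed

text \<open>X \<otimes> Y is a \<open>K\<close>-module as a tensor product and once more through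
  \<open>H\<close>. The two structures agree because the action is \<open>K\<close>-linear in the
  element of \<open>H\<close>; linear maps for one are linear for the other.\<close>

lemma ht_scalar: assumes k: "k \<in> carrier K" and t: "t \<in> carrier TT"
  shows "(k \<odot>\<^bsub>H\<^esub> \<one>\<^bsub>H\<^esub>) \<odot>\<^bsub>X \<bullet> Y\<^esub> t = k \<odot>\<^bsub>TT\<^esub> t"
  using k_linear_smult[OF lin_ht_smult_left[OF t] k, of "\<one>\<^bsub>H\<^esub>"] left_module_one[OF hmod_ht, of t] t
  by (simp add: ht_simps)

lemma lin_to_ht: "lin P (r (X \<bullet> Y)) f = lin P TT f"
  by (auto simp: k_linear_def additive_on_def ht_simps r_smult ht_scalar Pi_iff)

lemma lin_from_ht: "lin (r (X \<bullet> Y)) P f = lin TT P f"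
  by (auto simp: k_linear_def additive_on_def ht_simps r_smult ht_scalar Pi_iff)

lemma hp_closed: "x \<in> carrier X \<Longrightarrow> y \<in> carrier Y \<Longrightarrow> hp X Y x y \<in> carrier (X \<bullet> Y)"
  by (simp add: ht_simps pure_TT)

lemma lin_hp_left: "lin P (r X) f \<Longrightarrow> y \<in> carrier Y \<Longrightarrow> lin P (r (X \<bullet> Y)) (\<lambda>x. hp X Y (f x) y)"
  unfolding lin_to_ht by (rule lin_TT_left)

lemma lin_hp_right: "lin P (r Y) f \<Longrightarrow> x \<in> carrier X \<Longrightarrow> lin P (r (X \<bullet> Y)) (\<lambda>y. hp X Y x (f y))"
  unfolding lin_to_ht by (rule lin_TT_right)

lemma ht_smult_pure: "h \<in> carrier H \<Longrightarrow> x \<in> carrier X \<Longrightarrow> y \<in> carrier Y \<Longrightarrow>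
    h \<odot>\<^bsub>X \<bullet> Y\<^esub> hp X Y x y = sw (r (X \<bullet> Y)) h (\<lambda>a b. hp X Y (a \<odot>\<^bsub>X\<^esub> x) (b \<odot>\<^bsub>Y\<^esub> y))"
  unfolding tsum_ht by (rule ht_smult_pure0)

lemma ht_eqI:
  assumes "module K A" "lin (r (X \<bullet> Y)) A f" "lin (r (X \<bullet> Y)) A g" "t \<in> carrier (X \<bullet> Y)"
    "\<And>x y. x \<in> carrier X \<Longrightarrow> y \<in> carrier Y \<Longrightarrow> f (hp X Y x y) = g (hp X Y x y)"
  shows "f t = g t"
  by (rule TT_eqI[OF assms(1)]) (use assms in \<open>simp_all add: lin_from_ht ht_simps\<close>)

lemma lin_htsum:
  assumes "module K A" "\<And>x. x \<in> carrier X \<Longrightarrow> lin (r Y) A (\<lambda>y. F x y)"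
    "\<And>y. y \<in> carrier Y \<Longrightarrow> lin (r X) A (\<lambda>x. F x y)" "lin P (r (X \<bullet> Y)) f"
  shows "lin P A (\<lambda>x. tsum A F (f x))"
  by (rule k_linear_comp[OF assms(4)[unfolded lin_to_ht] k_linear_tsum[OF mod_r[OF X] mod_r[OF Y] assms(1) _ k_linear_id]])
    (rule bilinearI; use assms in simp)

lemma lin_htsum_inner:
  assumes "module K A" "module K P" "t \<in> carrier (X \<bullet> Y)"
    "\<And>x y. x \<in> carrier X \<Longrightarrow> y \<in> carrier Y \<Longrightarrow> lin P A (\<lambda>z. F z x y)"
  shows "lin P A (\<lambda>z. tsum A (F z) t)"
  by (rule k_linear_tsum_inner[OF mod_r[OF X] mod_r[OF Y] assms(1)])
    (use assms module.smult_closed[OF assms(2)] in \<open>auto simp: ht_simps\<close>)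

lemma htsum_pure:
  assumes "module K A" "\<And>x. x \<in> carrier X \<Longrightarrow> lin (r Y) A (\<lambda>y. F x y)"
    "\<And>y. y \<in> carrier Y \<Longrightarrow> lin (r X) A (\<lambda>x. F x y)" "x \<in> carrier X" "y \<in> carrier Y"
  shows "tsum A F (hp X Y x y) = F x y"
proof -
  have "bilinear K (r X) (r Y) A F" by (rule bilinearI) (use assms in auto)
  from tensor_pair.tsum_pure[OF pair_r[OF X Y] module_group[OF assms(1)] bilinear_balanced[OF this]] show ?thesis
    using assms(4,5) by (simp add: hcls_def)
qed

lemma htsum_cong:
  assumes "\<And>x y. x \<in> carrier X \<Longrightarrow> y \<in> carrier Y \<Longrightarrow> F x y = G x y" "t \<in> carrier (X \<bullet> Y)"
  shows "tsum A F t = tsum A G t"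
  by (rule tensor_pair.tsum_cong[OF pair_r[OF X Y]]) (use assms in \<open>auto simp: ht_simps\<close>)

lemma hcls_map:
  assumes "\<And>x y. x \<in> carrier X \<Longrightarrow> y \<in> carrier Y \<Longrightarrow> f x y \<in> carrier U"
    "\<And>x y. x \<in> carrier X \<Longrightarrow> y \<in> carrier Y \<Longrightarrow> g x y \<in> carrier V"
    "hmod U" "hmod V" "t \<in> carrier (X \<bullet> Y)"
  shows "hcls K H U V (map (\<lambda>(x, y). (f x y, g x y)) (tlist t)) =
    tsum (r (U \<bullet> V)) (\<lambda>x y. hp U V (f x y) (g x y)) t"
  unfolding hcls_def tsum_ht
  by (rule tensor_pair.tcls_map[OF pair_r[OF X Y] _ _ pair_r]) (use assms in \<open>simp_all add: ht_simps\<close>)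

lemma hcls_concat:
  assumes "\<And>x y. x \<in> carrier X \<Longrightarrow> y \<in> carrier Y \<Longrightarrow> set (h x y) \<subseteq> carrier U \<times> carrier V"
    "hmod U" "hmod V" "t \<in> carrier (X \<bullet> Y)"
  shows "hcls K H U V (concat (map (\<lambda>(x, y). h x y) (tlist t))) =
    tsum (r (U \<bullet> V)) (\<lambda>x y. hcls K H U V (h x y)) t"
  unfolding hcls_def tsum_ht
  by (rule tensor_pair.tcls_concat[OF pair_r[OF X Y] _ pair_r]) (use assms in \<open>simp_all add: ht_simps\<close>)

lemma htlist_valid:
  assumes "\<And>x y. x \<in> carrier X \<Longrightarrow> y \<in> carrier Y \<Longrightarrow> f x y \<in> U"
    "\<And>x y. x \<in> carrier X \<Longrightarrow> y \<in> carrier Y \<Longrightarrow> g x y \<in> V" "t \<in> carrier (X \<bullet> Y)"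
  shows "set (map (\<lambda>(x, y). (f x y, g x y)) (tlist t)) \<subseteq> U \<times> V"
  by (rule tensor_pair.tlist_map_valid[OF pair_r[OF X Y]]) (use assms in \<open>simp_all add: ht_simps\<close>)

lemma htlist_concat_valid:
  assumes "\<And>x y. x \<in> carrier X \<Longrightarrow> y \<in> carrier Y \<Longrightarrow> set (h x y) \<subseteq> V" "t \<in> carrier (X \<bullet> Y)"
  shows "set (concat (map (\<lambda>(x, y). h x y) (tlist t))) \<subseteq> V"
  by (rule tensor_pair.tlist_concat_valid[OF pair_r[OF X Y]]) (use assms in \<open>simp_all add: ht_simps\<close>)

end

lemma hcls_comap:
  assumes "\<And>a n. a \<in> carrier H \<Longrightarrow> n \<in> carrier L \<Longrightarrow> f a n \<in> carrier U"
    "\<And>a n. a \<in> carrier H \<Longrightarrow> n \<in> carrier L \<Longrightarrow> g a n \<in> carrier V"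
    "hmod U" "hmod V" "l \<in> carrier L"
  shows "hcls K H U V (map (\<lambda>(a, n). (f a n, g a n)) (tlist (coact L l))) =
    co (r (U \<bullet> V)) l (\<lambda>a n. hp U V (f a n) (g a n))"
  unfolding hcls_def tsum_ht
  by (rule tensor_pair.tcls_map[OF pair_HL _ _ pair_r]) (use assms in \<open>simp_all add: coact_closed\<close>)

lemma hcls_coconcat:
  assumes "\<And>a n. a \<in> carrier H \<Longrightarrow> n \<in> carrier L \<Longrightarrow> set (h a n) \<subseteq> carrier U \<times> carrier V"
    "hmod U" "hmod V" "l \<in> carrier L"
  shows "hcls K H U V (concat (map (\<lambda>(a, n). h a n) (tlist (coact L l)))) =
    co (r (U \<bullet> V)) l (\<lambda>a n. hcls K H U V (h a n))"
  unfolding hcls_def tsum_ht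
  by (rule tensor_pair.tcls_concat[OF pair_HL _ pair_r]) (use assms in \<open>simp_all add: coact_closed\<close>)

lemmas linH = linC hmod_ht hmod_LL hp_closed lin_hp_left lin_hp_right

section \<open>The functor \<open>\<Xi>\<close> on objects\<close>

abbreviation "XL X \<equiv> X \<bullet> LL"
abbreviation lp where "lp X x l \<equiv> hp X LL x l"
abbreviation la where "la X l v \<equiv> Xi_left_act K H L X l v"

text \<open>The right multiplication v m on X \<otimes> L; \<open>Xi_tgt\<close> identifies it with
  the action of t(m).\<close>

definition ra where
  "ra X v m = tsum (r (XL X)) (\<lambda>x l. lp X x (l *\<^sub>L m)) v"

context
  fixes X :: "('a univ, 'a univ) module" assumes X: "hmod X"
begin

lemmas hXL = hmod_ht[OF X hmod_LL]
lemmas modXL = mod_r[OF hXL]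
lemmas linX = linH X hXL modXL left_module_closed[OF X]

lemma lp_closed: "x \<in> carrier X \<Longrightarrow> l \<in> carrier L \<Longrightarrow> lp X x l \<in> carrier (XL X)"
  using hp_closed[OF X hmod_LL] by simp

lemma XL_eqI:
  assumes "module K A" "lin (r (XL X)) A f" "lin (r (XL X)) A g" "v \<in> carrier (XL X)"
    "\<And>x l. x \<in> carrier X \<Longrightarrow> l \<in> carrier L \<Longrightarrow> f (lp X x l) = g (lp X x l)"
  shows "f v = g v"
  by (rule ht_eqI[OF X hmod_LL assms(1-4)]) (use assms(5) in simp)

lemma lin_XLsum:
  assumes "module K A" "\<And>x. x \<in> carrier X \<Longrightarrow> lin L A (\<lambda>y. F x y)"
    "\<And>y. y \<in> carrier L \<Longrightarrow> lin (r X) A (\<lambda>x. F x y)" "lin P (r (XL X)) f"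
  shows "lin P A (\<lambda>x. tsum A F (f x))"
  by (rule lin_htsum[OF X hmod_LL]) (use assms in \<open>simp_all add: lin_from_LL\<close>)

lemma lin_XLsum_inner:
  assumes "module K A" "module K P" "t \<in> carrier (XL X)"
    "\<And>x y. x \<in> carrier X \<Longrightarrow> y \<in> carrier L \<Longrightarrow> lin P A (\<lambda>z. F z x y)"
  shows "lin P A (\<lambda>z. tsum A (F z) t)"
  by (rule lin_htsum_inner[OF X hmod_LL]) (use assms in simp_all)

lemma XLsum_pure:
  assumes "module K A" "\<And>x. x \<in> carrier X \<Longrightarrow> lin L A (\<lambda>y. F x y)"
    "\<And>y. y \<in> carrier L \<Longrightarrow> lin (r X) A (\<lambda>x. F x y)" "x \<in> carrier X" "l \<in> carrier L"
  shows "tsum A F (lp X x l) = F x l"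
  by (rule htsum_pure[OF X hmod_LL]) (use assms in \<open>simp_all add: lin_from_LL\<close>)

lemma la_eq:
  assumes l: "l \<in> carrier L" and v: "v \<in> carrier (XL X)"
  shows "la X l v = co (r (XL X)) l (\<lambda>a n. tsum (r (XL X)) (\<lambda>x m. lp X (a \<odot>\<^bsub>X\<^esub> x) (n *\<^sub>L m)) v)"
proof -
  let ?h = "\<lambda>a n. map (\<lambda>(x, m). (a \<odot>\<^bsub>X\<^esub> x, n *\<^sub>L m)) (tlist v)"
  have "set (?h a n) \<subseteq> carrier X \<times> carrier LL" if "a \<in> carrier H" "n \<in> carrier L" for a n
    by (rule htlist_valid[OF X hmod_LL _ _ v]) (use that in \<open>auto simp: left_module_closed[OF X]\<close>)
  from hcls_coconcat[OF this X hmod_LL l]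
  have "la X l v = co (r (XL X)) l (\<lambda>a n. hcls K H X LL (?h a n))"
    by (simp add: Xi_left_act_def)
  also have "\<dots> = co (r (XL X)) l (\<lambda>a n. tsum (r (XL X)) (\<lambda>x m. lp X (a \<odot>\<^bsub>X\<^esub> x) (n *\<^sub>L m)) v)"
    by (intro co_cong l hcls_map[OF X hmod_LL _ _ X hmod_LL v]) (auto simp: left_module_closed[OF X])
  finally show ?thesis .
qed

lemma lin_la_right0: assumes l: "l \<in> carrier L" shows "lin (r (XL X)) (r (XL X)) (\<lambda>v. la X l v)"
proof (rule k_linear_cong[OF _ _ modXL])
  show "lin (r (XL X)) (r (XL X)) (\<lambda>v. co (r (XL X)) l (\<lambda>a n. tsum (r (XL X)) (\<lambda>x m. lp X (a \<odot>\<^bsub>X\<^esub> x) (n *\<^sub>L m)) v))"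
    by (intro lin_co_inner lin_XLsum k_linear_id) (use l in \<open>auto intro!: linX\<close>)
qed (simp add: la_eq l)

lemma lin_la_left0: assumes v: "v \<in> carrier (XL X)" shows "lin L (r (XL X)) (\<lambda>l. la X l v)"
proof (rule k_linear_cong[OF _ _ mod_L])
  show "lin L (r (XL X)) (\<lambda>l. co (r (XL X)) l (\<lambda>a n. tsum (r (XL X)) (\<lambda>x m. lp X (a \<odot>\<^bsub>X\<^esub> x) (n *\<^sub>L m)) v))"
    by (intro lin_co lin_XLsum_inner k_linear_id) (use v in \<open>auto intro!: linX\<close>)
qed (simp add: la_eq v)

lemma lin_la_right: "lin P (r (XL X)) f \<Longrightarrow> l \<in> carrier L \<Longrightarrow> lin P (r (XL X)) (\<lambda>x. la X l (f x))"
  by (rule k_linear_comp[OF _ lin_la_right0])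

lemma lin_la_left: "lin P L f \<Longrightarrow> v \<in> carrier (XL X) \<Longrightarrow> lin P (r (XL X)) (\<lambda>x. la X (f x) v)"
  by (rule k_linear_comp[OF _ lin_la_left0])

lemma la_pure:
  assumes l: "l \<in> carrier L" and x: "x \<in> carrier X" and m: "m \<in> carrier L"
  shows "la X l (lp X x m) = co (r (XL X)) l (\<lambda>a n. lp X (a \<odot>\<^bsub>X\<^esub> x) (n *\<^sub>L m))"
  unfolding la_eq[OF l lp_closed[OF x m]]
  by (intro co_cong l XLsum_pure x m) (auto intro!: linX)

lemma la_closed: "l \<in> carrier L \<Longrightarrow> v \<in> carrier (XL X) \<Longrightarrow> la X l v \<in> carrier (XL X)"
  using k_linear_closed[OF lin_la_right0] by simp

lemmas linY = linX lp_closed la_closed lin_la_left lin_la_right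

lemma la_one: assumes v: "v \<in> carrier (XL X)" shows "la X \<one>\<^bsub>L\<^esub> v = v"
proof (rule XL_eqI[OF modXL lin_la_right0 k_linear_id v])
  fix x m assume xm: "x \<in> carrier X" "m \<in> carrier L"
  have "bilinear K H L (r (XL X)) (\<lambda>a n. lp X (a \<odot>\<^bsub>X\<^esub> x) (n *\<^sub>L m))" using xm by (auto intro!: linY)
  from co_one[OF modXL this] show "la X \<one>\<^bsub>L\<^esub> (lp X x m) = lp X x m"
    using xm by (simp add: la_pure left_module_one[OF X])
qed simp

text \<open>A consequence of the multiplicativity of the coaction.\<close>

lemma la_la:
  assumes l: "l \<in> carrier L" and m: "m \<in> carrier L" and v: "v \<in> carrier (XL X)"
  shows "la X l (la X m v) = la X (l *\<^sub>L m) v"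
proof (rule XL_eqI[OF modXL k_linear_comp[OF lin_la_right0 lin_la_right0] lin_la_right0 v])
  fix x n assume x: "x \<in> carrier X" and n: "n \<in> carrier L"
  have "la X l (la X m (lp X x n)) = co (r (XL X)) m (\<lambda>c q. la X l (lp X (c \<odot>\<^bsub>X\<^esub> x) (q *\<^sub>L n)))"
    unfolding la_pure[OF m x n]
    by (rule co_hom[OF modXL modXL lin_la_right0]) (use l m x n in \<open>auto intro!: linY\<close>)
  also have "\<dots> = co (r (XL X)) m (\<lambda>c q. co (r (XL X)) l (\<lambda>a p. lp X ((a \<cdot> c) \<odot>\<^bsub>X\<^esub> x) (p *\<^sub>L q *\<^sub>L n)))"
    using l m x n by (intro co_cong)
      (simp_all add: la_pure left_module_closed[OF X] left_module_mult[OF X] L_assoc cong: co_cong)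
  also have "\<dots> = co (r (XL X)) l (\<lambda>a p. co (r (XL X)) m (\<lambda>c q. lp X ((a \<cdot> c) \<odot>\<^bsub>X\<^esub> x) (p *\<^sub>L q *\<^sub>L n)))"
    by (rule co_co) (use l m x n in \<open>auto intro!: linY\<close>)
  also have "\<dots> = co (r (XL X)) (l *\<^sub>L m) (\<lambda>a p. lp X (a \<odot>\<^bsub>X\<^esub> x) (p *\<^sub>L n))"
    by (rule co_mult[symmetric]) (use l m x n in \<open>auto intro!: linY\<close>)
  also have "\<dots> = la X (l *\<^sub>L m) (lp X x n)"
    using l m x n by (simp add: la_pure)
  finally show "la X l (la X m (lp X x n)) = la X (l *\<^sub>L m) (lp X x n)" .
qed (use l m in auto)

end

section \<open>The module structure on X \<otimes> L over the smash product\<close>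

context
  fixes X :: "('a univ, 'a univ) module" assumes X: "hmod X"
begin

lemmas cX = left_module_closed[OF X] and mX = left_module_mult[OF X]
lemmas lX = linY[OF X]

lemma XL_smult_pure:
  assumes "h \<in> carrier H" "x \<in> carrier X" "m \<in> carrier L"
  shows "h \<odot>\<^bsub>XL X\<^esub> lp X x m = sw (r (XL X)) h (\<lambda>a b. lp X (a \<odot>\<^bsub>X\<^esub> x) (b \<rhd> m))"
  using ht_smult_pure[OF X hmod_LL] assms by simp

lemma XL_smult_closed: "h \<in> carrier H \<Longrightarrow> v \<in> carrier (XL X) \<Longrightarrow> h \<odot>\<^bsub>XL X\<^esub> v \<in> carrier (XL X)"
  by (rule left_module_closed[OF hXL[OF X]])

text \<open>The relation that makes the actions of \<open>L\<close> and \<open>H\<close> an action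
  of the smash product. On the left stands h1 l1 x \<otimes> (h2 \<rhd> n) (h3 \<rhd> m). The
  condition \<open>co_act\<close> needs h1 l1 conjugated, that is, followed by an antipode, so a
  cancelling pair of further legs is inserted.\<close>

lemma act_la:
  assumes h: "h \<in> carrier H" and l: "l \<in> carrier L" and v: "v \<in> carrier (XL X)"
  shows "h \<odot>\<^bsub>XL X\<^esub> la X l v = sw (r (XL X)) h (\<lambda>a b. la X (a \<rhd> l) (b \<odot>\<^bsub>XL X\<^esub> v))"
proof (rule XL_eqI[OF X modXL[OF X] _ _ v])
  let ?A = "r (XL X)"
  show "lin ?A ?A (\<lambda>v. h \<odot>\<^bsub>XL X\<^esub> la X l v)" "lin ?A ?A (\<lambda>v. sw ?A h (\<lambda>a b. la X (a \<rhd> l) (b \<odot>\<^bsub>XL X\<^esub> v)))"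
    using h l by (auto intro!: lX)
  fix x m assume x: "x \<in> carrier X" and m: "m \<in> carrier L"
  let ?W = "\<lambda>e p k c d g n. lp X ((e \<cdot> p \<cdot> S k) \<odot>\<^bsub>X\<^esub> (c \<odot>\<^bsub>X\<^esub> x)) ((g \<rhd> n) *\<^sub>L (d \<rhd> m))"
  have "h \<odot>\<^bsub>XL X\<^esub> la X l (lp X x m) = co ?A l (\<lambda>p n. h \<odot>\<^bsub>XL X\<^esub> lp X (p \<odot>\<^bsub>X\<^esub> x) (n *\<^sub>L m))"
    unfolding la_pure[OF X l x m]
    by (rule co_hom[OF modXL[OF X] modXL[OF X]]) (use h l x m in \<open>auto intro!: lX\<close>)
  also have "\<dots> = co ?A l (\<lambda>p n. sw ?A h (\<lambda>e z. sw ?A z (\<lambda>g w. lp X ((e \<cdot> p \<cdot> \<one>\<^bsub>H\<^esub>) \<odot>\<^bsub>X\<^esub> x) ((g \<rhd> n) *\<^sub>L (w \<rhd> m)))))"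
  proof (rule co_cong[OF _ l])
    fix p n assume pn: "p \<in> carrier H" "n \<in> carrier L"
    have "h \<odot>\<^bsub>XL X\<^esub> lp X (p \<odot>\<^bsub>X\<^esub> x) (n *\<^sub>L m) = sw ?A h (\<lambda>e z. lp X (e \<odot>\<^bsub>X\<^esub> (p \<odot>\<^bsub>X\<^esub> x)) (z \<rhd> (n *\<^sub>L m)))"
      using pn h x m by (intro XL_smult_pure) (auto simp: cX)
    also have "\<dots> = sw ?A h (\<lambda>e z. sw ?A z (\<lambda>g w. lp X ((e \<cdot> p \<cdot> \<one>\<^bsub>H\<^esub>) \<odot>\<^bsub>X\<^esub> x) ((g \<rhd> n) *\<^sub>L (w \<rhd> m))))"
    proof (rule sw_cong[OF _ h])
      fix e z assume ez: "e \<in> carrier H" "z \<in> carrier H"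
      have "lp X (e \<odot>\<^bsub>X\<^esub> (p \<odot>\<^bsub>X\<^esub> x)) (sw L z (\<lambda>g w. (g \<rhd> n) *\<^sub>L (w \<rhd> m))) =
        sw ?A z (\<lambda>g w. lp X (e \<odot>\<^bsub>X\<^esub> (p \<odot>\<^bsub>X\<^esub> x)) ((g \<rhd> n) *\<^sub>L (w \<rhd> m)))"
        by (rule sw_hom[OF mod_L modXL[OF X], where f="\<lambda>y. lp X (e \<odot>\<^bsub>X\<^esub> (p \<odot>\<^bsub>X\<^esub> x)) y"])
          (use ez pn x m in \<open>auto intro!: lX\<close>)
      thus "lp X (e \<odot>\<^bsub>X\<^esub> (p \<odot>\<^bsub>X\<^esub> x)) (z \<rhd> (n *\<^sub>L m)) =
        sw ?A z (\<lambda>g w. lp X ((e \<cdot> p \<cdot> \<one>\<^bsub>H\<^esub>) \<odot>\<^bsub>X\<^esub> x) ((g \<rhd> n) *\<^sub>L (w \<rhd> m)))"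
        using ez pn x m by (simp add: act_mult mX)
    qed
    finally show "h \<odot>\<^bsub>XL X\<^esub> lp X (p \<odot>\<^bsub>X\<^esub> x) (n *\<^sub>L m) = \<dots>" .
  qed
  also have "\<dots> = sw ?A h (\<lambda>e z. co ?A l (\<lambda>p n. sw ?A z (\<lambda>g w. lp X ((e \<cdot> p \<cdot> \<one>\<^bsub>H\<^esub>) \<odot>\<^bsub>X\<^esub> x) ((g \<rhd> n) *\<^sub>L (w \<rhd> m)))))"
    by (rule sw_co[symmetric]) (use h l x m in \<open>auto intro!: lX\<close>)
  also have "\<dots> = sw ?A h (\<lambda>e z. sw ?A z (\<lambda>g w. co ?A l (\<lambda>p n. lp X ((e \<cdot> p \<cdot> \<one>\<^bsub>H\<^esub>) \<odot>\<^bsub>X\<^esub> x) ((g \<rhd> n) *\<^sub>L (w \<rhd> m)))))"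
    by (intro sw_cong h sw_co[symmetric]) (use l x m in \<open>auto intro!: lX\<close>)
  \<comment> \<open>\<open>S k \<cdot> c\<close> sums to a counit. With the legs in the order e, g,
    k, c, d, the first three form the coaction of \<open>a \<rhd> l\<close>, and the last two act on
    x \<otimes> m.\<close>
  also have "\<dots> = sw ?A h (\<lambda>e z. sw ?A z (\<lambda>g w. sw ?A w (\<lambda>k b. sw ?A b (\<lambda>c d.
      co ?A l (\<lambda>p n. lp X ((e \<cdot> p \<cdot> (S k \<cdot> c)) \<odot>\<^bsub>X\<^esub> x) ((g \<rhd> n) *\<^sub>L (d \<rhd> m)))))))"
    by (intro sw_cong h, subst collapse_left[OF conv_S(1) modXL[OF X], where
          F="\<lambda>s d. co ?A l (\<lambda>p n. lp X ((_ \<cdot> p \<cdot> s) \<odot>\<^bsub>X\<^esub> x) ((_ \<rhd> n) *\<^sub>L (d \<rhd> m)))"])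
      (use l x m in \<open>auto intro!: lX\<close>)
  also have "\<dots> = sw ?A h (\<lambda>e z. sw ?A z (\<lambda>g w. sw ?A w (\<lambda>k b. sw ?A b (\<lambda>c d. co ?A l (\<lambda>p n. ?W e p k c d g n)))))"
    by (intro sw_cong h co_cong l) (simp_all add: mX x H_assoc cX)
  also have "\<dots> = sw ?A h (\<lambda>e z. sw ?A z (\<lambda>f b. sw ?A f (\<lambda>g k. sw ?A b (\<lambda>c d. co ?A l (\<lambda>p n. ?W e p k c d g n)))))"
    by (intro sw_cong h sw_coassoc[symmetric]) (use l x m in \<open>auto intro!: lX\<close>)
  also have "\<dots> = sw ?A h (\<lambda>a b. sw ?A a (\<lambda>e f. sw ?A f (\<lambda>g k. sw ?A b (\<lambda>c d. co ?A l (\<lambda>p n. ?W e p k c d g n)))))"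
    by (rule sw_coassoc[symmetric]) (use h l x m in \<open>auto intro!: lX\<close>)
  also have "\<dots> = sw ?A h (\<lambda>a b. sw ?A a (\<lambda>e f. sw ?A b (\<lambda>c d. sw ?A f (\<lambda>g k. co ?A l (\<lambda>p n. ?W e p k c d g n)))))"
    by (intro sw_cong h sw_sw) (use l x m in \<open>auto intro!: lX\<close>)
  also have "\<dots> = sw ?A h (\<lambda>a b. sw ?A b (\<lambda>c d. sw ?A a (\<lambda>e f. sw ?A f (\<lambda>g k. co ?A l (\<lambda>p n. ?W e p k c d g n)))))"
    by (intro sw_cong h sw_sw) (use l x m in \<open>auto intro!: lX\<close>)
  also have "\<dots> = sw ?A h (\<lambda>a b. sw ?A b (\<lambda>c d. la X (a \<rhd> l) (lp X (c \<odot>\<^bsub>X\<^esub> x) (d \<rhd> m))))"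
  proof (intro sw_cong h)
    fix a b c d assume hh: "a \<in> carrier H" "b \<in> carrier H" "c \<in> carrier H" "d \<in> carrier H"
    have "la X (a \<rhd> l) (lp X (c \<odot>\<^bsub>X\<^esub> x) (d \<rhd> m)) = co ?A (a \<rhd> l) (\<lambda>q n. lp X (q \<odot>\<^bsub>X\<^esub> (c \<odot>\<^bsub>X\<^esub> x)) (n *\<^sub>L (d \<rhd> m)))"
      using hh l x m by (intro la_pure[OF X]) (auto simp: cX)
    also have "\<dots> = sw ?A a (\<lambda>e f. sw ?A f (\<lambda>g k. co ?A l (\<lambda>p n. ?W e p k c d g n)))"
      by (rule co_act[OF modXL[OF X]]) (use hh l x m in \<open>auto intro!: lX\<close>)
    finally show "sw ?A a (\<lambda>e f. sw ?A f (\<lambda>g k. co ?A l (\<lambda>p n. ?W e p k c d g n))) =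
      la X (a \<rhd> l) (lp X (c \<odot>\<^bsub>X\<^esub> x) (d \<rhd> m))" by simp
  qed
  also have "\<dots> = sw ?A h (\<lambda>a b. la X (a \<rhd> l) (b \<odot>\<^bsub>XL X\<^esub> lp X x m))"
  proof (rule sw_cong[OF _ h])
    fix a b assume hh: "a \<in> carrier H" "b \<in> carrier H"
    show "sw ?A b (\<lambda>c d. la X (a \<rhd> l) (lp X (c \<odot>\<^bsub>X\<^esub> x) (d \<rhd> m))) = la X (a \<rhd> l) (b \<odot>\<^bsub>XL X\<^esub> lp X x m)"
      unfolding XL_smult_pure[OF hh(2) x m]
      by (rule sw_hom[OF modXL[OF X] modXL[OF X], symmetric, where f="\<lambda>v. la X (a \<rhd> l) v"])
        (use hh l x m in \<open>auto intro!: lX\<close>)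
  qed
  finally show "h \<odot>\<^bsub>XL X\<^esub> la X l (lp X x m) = sw ?A h (\<lambda>a b. la X (a \<rhd> l) (b \<odot>\<^bsub>XL X\<^esub> lp X x m))" .
qed

abbreviation (input) "\<Xi>X \<equiv> Xi_obj K H L X"

lemma Xi_simps: "carrier (Xi_obj K H L X) = carrier (XL X)" "add (Xi_obj K H L X) = add (XL X)"
  "zero (Xi_obj K H L X) = zero (XL X)"
  by (simp_all add: Xi_obj_def)

lemma Xi_smult: "b \<odot>\<^bsub>\<Xi>X\<^esub> v = tsum (r (XL X)) (\<lambda>l h. la X l (h \<odot>\<^bsub>XL X\<^esub> v)) b"
  unfolding tsum_r[of "XL X", symmetric] by (simp add: Xi_obj_def tsum_def)

lemma lin_Xi_left: assumes "v \<in> carrier (XL X)" shows "lin B (r (XL X)) (\<lambda>b. b \<odot>\<^bsub>\<Xi>X\<^esub> v)"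
  unfolding Xi_smult by (rule lin_Bsum) (use assms in \<open>auto intro!: lX\<close>)

lemma lin_Xi_right: assumes "b \<in> carrier B" shows "lin (r (XL X)) (r (XL X)) (\<lambda>v. b \<odot>\<^bsub>\<Xi>X\<^esub> v)"
  unfolding Xi_smult by (rule lin_Bsum_inner) (use assms in \<open>auto intro!: lX\<close>)

lemma Xi_e: "l \<in> carrier L \<Longrightarrow> h \<in> carrier H \<Longrightarrow> v \<in> carrier (XL X) \<Longrightarrow> e l h \<odot>\<^bsub>\<Xi>X\<^esub> v = la X l (h \<odot>\<^bsub>XL X\<^esub> v)"
  unfolding Xi_smult by (rule Bsum_pure) (auto intro!: lX)

lemma XL_one: "v \<in> carrier (XL X) \<Longrightarrow> \<one>\<^bsub>H\<^esub> \<odot>\<^bsub>XL X\<^esub> v = v"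
  by (rule left_module_one[OF hXL[OF X]])

lemma Xi_src: "l \<in> carrier L \<Longrightarrow> v \<in> carrier (XL X) \<Longrightarrow> src B l \<odot>\<^bsub>\<Xi>X\<^esub> v = la X l v"
  by (simp add: src_eq Xi_e XL_one)

lemma Xi_u: "h \<in> carrier H \<Longrightarrow> v \<in> carrier (XL X) \<Longrightarrow> u h \<odot>\<^bsub>\<Xi>X\<^esub> v = h \<odot>\<^bsub>XL X\<^esub> v"
  by (simp add: Xi_e XL_smult_closed la_one[OF X])

lemma Xi_closed: "b \<in> carrier B \<Longrightarrow> v \<in> carrier (XL X) \<Longrightarrow> b \<odot>\<^bsub>\<Xi>X\<^esub> v \<in> carrier (XL X)"
  using k_linear_closed[OF lin_Xi_right] by simp

text \<open>The product brings f \<rhd> m into play; \<open>act_la\<close> is the matching rule for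
  moving \<open>f\<close> past the action of \<open>m\<close>, and \<open>la_la\<close> merges the
  two elements of \<open>L\<close>.\<close>

lemma Xi_mult_pure:
  assumes l: "l \<in> carrier L" and f: "f \<in> carrier H" and m: "m \<in> carrier L" and g: "g \<in> carrier H"
    and v: "v \<in> carrier (XL X)"
  shows "(e l f \<star> e m g) \<odot>\<^bsub>\<Xi>X\<^esub> v = e l f \<odot>\<^bsub>\<Xi>X\<^esub> (e m g \<odot>\<^bsub>\<Xi>X\<^esub> v)"
proof -
  let ?A = "r (XL X)"
  have gv: "g \<odot>\<^bsub>XL X\<^esub> v \<in> carrier (XL X)" by (rule XL_smult_closed[OF g v])
  have "(e l f \<star> e m g) \<odot>\<^bsub>\<Xi>X\<^esub> v = sw ?A f (\<lambda>a b. e (l *\<^sub>L (a \<rhd> m)) (b \<cdot> g) \<odot>\<^bsub>\<Xi>X\<^esub> v)"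
    unfolding smash_pure[OF l f m g]
    by (rule sw_hom[OF mod_B modXL[OF X] lin_Xi_left[OF v]]) (use l f m g in \<open>auto intro!: lX\<close>)
  also have "\<dots> = sw ?A f (\<lambda>a b. la X l (la X (a \<rhd> m) (b \<odot>\<^bsub>XL X\<^esub> (g \<odot>\<^bsub>XL X\<^esub> v))))"
    using l m g v gv by (intro sw_cong f)
      (simp add: Xi_e la_la[OF X] XL_smult_closed left_module_mult[OF hXL[OF X]])
  also have "\<dots> = la X l (f \<odot>\<^bsub>XL X\<^esub> la X m (g \<odot>\<^bsub>XL X\<^esub> v))"
    unfolding act_la[OF f m gv]
    by (rule sw_hom[OF modXL[OF X] modXL[OF X], symmetric, where f="\<lambda>v. la X l v"]) (use l f m gv in \<open>auto intro!: lX\<close>)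
  also have "\<dots> = e l f \<odot>\<^bsub>\<Xi>X\<^esub> (e m g \<odot>\<^bsub>\<Xi>X\<^esub> v)"
    using l f m g v gv by (simp add: Xi_e la_closed[OF X])
  finally show ?thesis .
qed

lemma lmod_Xi: "left_module B \<Xi>X"
proof -
  note A = modXL[OF X]
  have one: "\<one>\<^bsub>B\<^esub> \<odot>\<^bsub>\<Xi>X\<^esub> v = v" if "v \<in> carrier (XL X)" for v
    using that by (simp add: smash_simps(5) Xi_u XL_one)
  have mult: "(a \<star> b) \<odot>\<^bsub>\<Xi>X\<^esub> v = a \<odot>\<^bsub>\<Xi>X\<^esub> (b \<odot>\<^bsub>\<Xi>X\<^esub> v)"
    if a: "a \<in> carrier B" and b: "b \<in> carrier B" and v: "v \<in> carrier (XL X)" for a b v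
  proof (rule B_eqI[OF A k_linear_comp[OF lin_smash_left[OF b] lin_Xi_left[OF v]] lin_Xi_left[OF Xi_closed[OF b v]] a])
    fix l f assume lf: "l \<in> carrier L" "f \<in> carrier H"
    hence elf: "e l f \<in> carrier B" by simp
    show "(e l f \<star> b) \<odot>\<^bsub>\<Xi>X\<^esub> v = e l f \<odot>\<^bsub>\<Xi>X\<^esub> (b \<odot>\<^bsub>\<Xi>X\<^esub> v)"
      by (rule B_eqI[OF A k_linear_comp[OF lin_smash_right[OF elf] lin_Xi_left[OF v]]
            k_linear_comp[OF lin_Xi_left[OF v] lin_Xi_right[OF elf]] b])
        (use lf v Xi_mult_pure in auto)
  qed
  have "abelian_group \<Xi>X"
    by (rule abelian_group_cong[OF left_module_group[OF hXL[OF X]]]) (simp_all add: Xi_simps)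
  thus ?thesis
    unfolding left_module_def
    using ring_B one mult k_linear_additive[OF lin_Xi_left] k_linear_additive[OF lin_Xi_right] Xi_closed
    by (auto simp: Xi_simps additive_on_def)
qed

lemma lin_ra_left: "lin P (r (XL X)) f \<Longrightarrow> m \<in> carrier L \<Longrightarrow> lin P (r (XL X)) (\<lambda>x. ra X (f x) m)"
  unfolding ra_def by (rule lin_XLsum[OF X]) (auto intro!: lX)

lemma lin_ra_right: "lin P L f \<Longrightarrow> module K P \<Longrightarrow> v \<in> carrier (XL X) \<Longrightarrow> lin P (r (XL X)) (\<lambda>x. ra X v (f x))"
  unfolding ra_def by (rule lin_XLsum_inner[OF X]) (auto intro!: lX)

lemma ra_pure: "x \<in> carrier X \<Longrightarrow> l \<in> carrier L \<Longrightarrow> m \<in> carrier L \<Longrightarrow> ra X (lp X x l) m = lp X x (l *\<^sub>L m)"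
  unfolding ra_def by (rule XLsum_pure[OF X]) (auto intro!: lX)

lemma ra_closed: "v \<in> carrier (XL X) \<Longrightarrow> m \<in> carrier L \<Longrightarrow> ra X v m \<in> carrier (XL X)"
  using k_linear_closed[OF lin_ra_left[OF k_linear_id]] by simp

text \<open>T(p) acts on x \<otimes> m with its legs reversed, and the coaction of \<open>n\<close>
  supplies a further leg \<open>c\<close> in front of T(b) on \<open>x\<close>. After
  coassociativity \<open>b\<close> and \<open>c\<close> are neighbours and collapse; on
  \<open>L\<close> the sum is the one of \<open>quasi_comm_T\<close> and gives m l.\<close>

lemma Xi_tgt:
  assumes l: "l \<in> carrier L" and v: "v \<in> carrier (XL X)"
  shows "tgt B l \<odot>\<^bsub>\<Xi>X\<^esub> v = ra X v l"
proof (rule XL_eqI[OF X modXL[OF X] lin_Xi_right lin_ra_left[OF k_linear_id] v])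
  let ?A = "r (XL X)"
  fix x m assume x: "x \<in> carrier X" and m: "m \<in> carrier L"
  have v: "lp X x m \<in> carrier (XL X)" by (rule lp_closed[OF X x m])
  have "tgt B l \<odot>\<^bsub>\<Xi>X\<^esub> lp X x m = co ?A l (\<lambda>p n. e n (T p) \<odot>\<^bsub>\<Xi>X\<^esub> lp X x m)"
    unfolding tgt_eq[OF l]
    by (rule co_hom[OF mod_B modXL[OF X] lin_Xi_left[OF v]]) (use l in \<open>auto intro!: lX\<close>)
  also have "\<dots> = co ?A l (\<lambda>p n. sw ?A p (\<lambda>a b. co ?A n (\<lambda>c q. lp X ((c \<cdot> T b) \<odot>\<^bsub>X\<^esub> x) (q *\<^sub>L (T a \<rhd> m)))))"
  proof (rule co_cong[OF _ l])
    fix p n assume pn: "p \<in> carrier H" "n \<in> carrier L"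
    have "e n (T p) \<odot>\<^bsub>\<Xi>X\<^esub> lp X x m = la X n (sw ?A (T p) (\<lambda>a b. lp X (a \<odot>\<^bsub>X\<^esub> x) (b \<rhd> m)))"
      using pn v x m by (simp add: Xi_e XL_smult_pure)
    also have "\<dots> = la X n (sw ?A p (\<lambda>a b. lp X (T b \<odot>\<^bsub>X\<^esub> x) (T a \<rhd> m)))"
      by (subst sw_T[OF modXL[OF X]]) (use pn x m in \<open>auto intro!: lX\<close>)
    also have "\<dots> = sw ?A p (\<lambda>a b. la X n (lp X (T b \<odot>\<^bsub>X\<^esub> x) (T a \<rhd> m)))"
      by (rule sw_hom[OF modXL[OF X] modXL[OF X], where f="\<lambda>v. la X n v"]) (use pn x m in \<open>auto intro!: lX\<close>)
    also have "\<dots> = sw ?A p (\<lambda>a b. co ?A n (\<lambda>c q. lp X ((c \<cdot> T b) \<odot>\<^bsub>X\<^esub> x) (q *\<^sub>L (T a \<rhd> m))))"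
      using pn x m by (intro sw_cong) (simp_all add: la_pure[OF X] cX mX cong: co_cong)
    finally show "e n (T p) \<odot>\<^bsub>\<Xi>X\<^esub> lp X x m = \<dots>" .
  qed
  also have "\<dots> = co ?A l (\<lambda>a z. co ?A z (\<lambda>b n. co ?A n (\<lambda>c q. lp X ((c \<cdot> T b) \<odot>\<^bsub>X\<^esub> x) (q *\<^sub>L (T a \<rhd> m)))))"
    by (rule co_coassoc) (use l x m in \<open>auto intro!: lX\<close>)
  also have "\<dots> = co ?A l (\<lambda>a z. lp X (\<one>\<^bsub>H\<^esub> \<odot>\<^bsub>X\<^esub> x) (z *\<^sub>L (T a \<rhd> m)))"
    by (intro co_cong l, subst collapse_co[OF conv_T(2) modXL[OF X], where G="\<lambda>s q. lp X (s \<odot>\<^bsub>X\<^esub> x) (q *\<^sub>L (T _ \<rhd> m))"])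
      (use x m in \<open>auto intro!: lX\<close>)
  also have "\<dots> = lp X x (co L l (\<lambda>a z. z *\<^sub>L (T a \<rhd> m)))"
    unfolding left_module_one[OF X x]
    by (rule co_hom[OF mod_L modXL[OF X], symmetric, where f="\<lambda>y. lp X x y"]) (use l x m in \<open>auto intro!: lX\<close>)
  also have "\<dots> = ra X (lp X x m) l"
    using l x m by (simp add: quasi_comm_T ra_pure)
  finally show "tgt B l \<odot>\<^bsub>\<Xi>X\<^esub> lp X x m = ra X (lp X x m) l" .
qed (use l in auto)

end

text \<open>The smash product is generated by the images of \<open>L\<close> and \<open>H\<close>.\<close>

lemma B_homI:
  assumes M: "left_module B M" and N: "left_module B N"
    and f: "f \<in> extensional (carrier M)" "additive_on M N f"
    and s: "\<And>l x. l \<in> carrier L \<Longrightarrow> x \<in> carrier M \<Longrightarrow> f (src B l \<odot>\<^bsub>M\<^esub> x) = src B l \<odot>\<^bsub>N\<^esub> f x"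
    and t: "\<And>h x. h \<in> carrier H \<Longrightarrow> x \<in> carrier M \<Longrightarrow> f (u h \<odot>\<^bsub>M\<^esub> x) = u h \<odot>\<^bsub>N\<^esub> f x"
  shows "f \<in> left_module_hom B M N"
proof -
  have "f (b \<odot>\<^bsub>M\<^esub> x) = b \<odot>\<^bsub>N\<^esub> f x" if b: "b \<in> carrier B" and x: "x \<in> carrier M" for b x
  proof (rule tensor_pair.tensor_eqI[OF pair_LH left_module_group[OF N]])
    have id: "additive_on (tensor K L H) B (\<lambda>b. b)" by (auto simp: additive_on_def smash_simps)
    have fx: "f x \<in> carrier N" by (rule additive_on_closed[OF f(2) x])
    show "additive_on (tensor K L H) N (\<lambda>b. f (b \<odot>\<^bsub>M\<^esub> x))"
      by (rule additive_on_comp[OF additive_on_smult_left[OF M id x] f(2)])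
    show "additive_on (tensor K L H) N (\<lambda>b. b \<odot>\<^bsub>N\<^esub> f x)"
      by (rule additive_on_smult_left[OF N id fx])
    show "b \<in> carrier (tensor K L H)" using b by (simp add: smash_simps)
    fix l h assume "l \<in> carrier L" "h \<in> carrier H"
    thus "f (e l h \<odot>\<^bsub>M\<^esub> x) = e l h \<odot>\<^bsub>N\<^esub> f x"
      using x fx by (simp add: e_split[of l h] left_module_mult[OF M] left_module_mult[OF N] left_module_closed[OF M] s t)
  qed
  thus ?thesis using f by (simp add: left_module_hom_iff)
qed

end

text \<open>\<open>inv_mor\<close> is a definite description. Uniqueness of inverses lets it be
  replaced by an inverse given by a formula.\<close>

lemma (in category) inv_mor_eq:
  assumes X: "X \<in> Obj C" and Y: "Y \<in> Obj C" and fg: "inverse_pair C X Y f g"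
  shows "inv_mor C X Y f = g"
  unfolding inv_mor_def
proof (rule the_equality[of "inverse_pair C X Y f", OF fg])
  fix g' assume fg': "inverse_pair C X Y f g'"
  have "g' = Comp C Y X X g' (Comp C X Y X f g)"
    using fg fg' X Y by (simp add: inverse_pair_def comp_ident_right)
  also have "\<dots> = Comp C Y Y X (Comp C Y X Y g' f) g"
    using fg fg' X Y by (intro comp_assoc[symmetric]) (auto simp: inverse_pair_def)
  also have "\<dots> = g"
    using fg fg' X Y by (simp add: inverse_pair_def comp_ident_left)
  finally show "g' = g" .
qed

context bialg
begin

text \<open>The multiple of the unit by \<open>k\<close> is both the source and the target of the
  corresponding element of \<open>L\<close>, so \<open>bt_src\<close> and \<open>bt_tgt\<close> let
  scalars act on either factor.\<close>

lemma bt_scalar: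
  assumes "lmod M" "lmod N" "k \<in> carrier K" "m \<in> carrier M" "n \<in> carrier N"
  shows "(k \<odot>\<^bsub>B\<^esub> \<one>\<^bsub>B\<^esub>) \<odot>\<^bsub>bt M N\<^esub> bp M N m n = bp M N ((k \<odot>\<^bsub>B\<^esub> \<one>\<^bsub>B\<^esub>) \<odot>\<^bsub>M\<^esub> m) n"
    "(k \<odot>\<^bsub>B\<^esub> \<one>\<^bsub>B\<^esub>) \<odot>\<^bsub>bt M N\<^esub> bp M N m n = bp M N m ((k \<odot>\<^bsub>B\<^esub> \<one>\<^bsub>B\<^esub>) \<odot>\<^bsub>N\<^esub> n)"
  using bt_src[OF assms(1,2) scalar_closed(2)[OF assms(3)] assms(4,5)]
    bt_tgt[OF assms(1,2) scalar_closed(2)[OF assms(3)] assms(4,5)]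
  by (simp_all add: scalar_src scalar_tgt assms(3))

lemma k_linear_bp_left:
  assumes "lmod M" "lmod N" "k_linear K P (restrict_scalars B M) f" "n \<in> carrier N"
  shows "k_linear K P (restrict_scalars B (bt M N)) (\<lambda>x. bp M N (f x) n)"
  using assms additive_on_bp_left[OF assms(1,2), of P f n] bt_scalar(1)[OF assms(1,2)]
  by (auto simp: k_linear_def restrict_scalars_def additive_on_def Pi_iff)

lemma k_linear_bp_right:
  assumes "lmod M" "lmod N" "k_linear K P (restrict_scalars B N) f" "m \<in> carrier M"
  shows "k_linear K P (restrict_scalars B (bt M N)) (\<lambda>x. bp M N m (f x))"
  using assms additive_on_bp_right[OF assms(1,2), of P f m] bt_scalar(2)[OF assms(1,2)]
  by (auto simp: k_linear_def restrict_scalars_def additive_on_def Pi_iff)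

end

context hopf_base
begin

section \<open>The canonical identifications\<close>

abbreviation "\<Xi> X \<equiv> Xi_obj K H L X"
abbreviation "bt M N \<equiv> btensor L B M N"
abbreviation bp where "bp M N m n \<equiv> bcls L B M N [(m, n)]"

lemma hcls_btconcat:
  assumes "\<And>m n. m \<in> carrier M \<Longrightarrow> n \<in> carrier N \<Longrightarrow> set (h m n) \<subseteq> carrier U \<times> carrier V"
    "hmod U" "hmod V" "left_module B M" "left_module B N" "t \<in> carrier (bt M N)"
  shows "hcls K H U V (concat (map (\<lambda>(m, n). h m n) (tlist t))) =
    tsum (r (U \<bullet> V)) (\<lambda>m n. hcls K H U V (h m n)) t"
  unfolding hcls_def tsum_ht
  by (rule tensor_pair.tcls_concat[OF pb.pair[OF assms(4,5)] _ pair_r[OF assms(2,3)]])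
    (use assms in \<open>simp_all add: pb.btensor_simps\<close>)

lemma lin_to_Xi:
  assumes X: "hmod X"
  shows "lin P (restrict_scalars B (\<Xi> X)) f = lin P (r (XL X)) f"
proof -
  have "(k \<odot>\<^bsub>B\<^esub> \<one>\<^bsub>B\<^esub>) \<odot>\<^bsub>\<Xi> X\<^esub> v = (k \<odot>\<^bsub>H\<^esub> \<one>\<^bsub>H\<^esub>) \<odot>\<^bsub>XL X\<^esub> v" if "k \<in> carrier K" "v \<in> carrier (XL X)" for k v
  proof -
    have "k \<odot>\<^bsub>B\<^esub> \<one>\<^bsub>B\<^esub> = u (k \<odot>\<^bsub>H\<^esub> \<one>\<^bsub>H\<^esub>)"
      using that k_linear_smult[OF lin_e_right[OF k_linear_id H_closed(4)], of k "\<one>\<^bsub>H\<^esub>"] by (simp add: smash_simps(5))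
    thus ?thesis using that Xi_u[OF X, of "k \<odot>\<^bsub>H\<^esub> \<one>\<^bsub>H\<^esub>" v] by (simp add: module.smult_closed[OF mod_H])
  qed
  thus ?thesis by (auto simp: k_linear_def additive_on_def Xi_simps[OF X] restrict_scalars_def Pi_iff)
qed

context
  fixes X Y :: "('a univ, 'a univ) module" assumes X: "hmod X" and Y: "hmod Y"
begin

abbreviation (input) "ZZ \<equiv> X \<bullet> Y"
abbreviation (input) "BT \<equiv> restrict_scalars B (bt (\<Xi> X) (\<Xi> Y))"

lemmas hZ = hmod_ht[OF X Y]
lemmas bX = lmod_Xi[OF X] and bY = lmod_Xi[OF Y] and bZ = lmod_Xi[OF hZ]
lemmas bXY = pb.lmod_bt[OF bX bY]
lemmas gZ = left_module_group[OF hXL[OF hZ]]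
lemmas c = left_module_closed[OF X] left_module_closed[OF Y] left_module_mult[OF X] left_module_mult[OF Y]
lemmas lZ = linY[OF X] linY[OF Y] linY[OF hZ] hZ hp_closed[OF X Y] lin_hp_left[OF X Y] lin_hp_right[OF X Y]

text \<open>The associativity isomorphism \<open>x \<otimes> (y \<otimes> m) \<mapsto> (x \<otimes> y) \<otimes> m\<close>.\<close>

definition jx where
  "jx x w = tsum (r (XL (X \<bullet> Y))) (\<lambda>y m. lp (X \<bullet> Y) (hp X Y x y) m) w"

lemma lin_jx_right: "lin P (r (XL Y)) f \<Longrightarrow> x \<in> carrier X \<Longrightarrow> lin P (r (XL ZZ)) (\<lambda>w. jx x (f w))"
  unfolding jx_def by (rule lin_XLsum[OF Y]) (auto intro!: lZ)

lemma lin_jx_left: "lin P (r X) f \<Longrightarrow> module K P \<Longrightarrow> w \<in> carrier (XL Y) \<Longrightarrow> lin P (r (XL ZZ)) (\<lambda>x. jx (f x) w)"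
  unfolding jx_def by (rule lin_XLsum_inner[OF Y]) (auto intro!: lZ)

lemma jx_pure: "x \<in> carrier X \<Longrightarrow> y \<in> carrier Y \<Longrightarrow> m \<in> carrier L \<Longrightarrow> jx x (lp Y y m) = lp ZZ (hp X Y x y) m"
  unfolding jx_def by (rule XLsum_pure[OF Y]) (auto intro!: lZ)

lemma jx_closed: "x \<in> carrier X \<Longrightarrow> w \<in> carrier (XL Y) \<Longrightarrow> jx x w \<in> carrier (XL ZZ)"
  using k_linear_closed[OF lin_jx_right[OF k_linear_id]] by simp

lemmas lW = lZ lin_jx_left lin_jx_right jx_closed

text \<open>\<open>L\<close> acts on (x \<otimes> y) \<otimes> m through the coproduct of its first
  leg; coassociativity of the coaction splits this into one leg on \<open>x\<close> and the full
  action of the remainder on y \<otimes> m.\<close>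

lemma jx_la:
  assumes l: "l \<in> carrier L" and x: "x \<in> carrier X" and w: "w \<in> carrier (XL Y)"
  shows "la ZZ l (jx x w) = co (r (XL ZZ)) l (\<lambda>a n. jx (a \<odot>\<^bsub>X\<^esub> x) (la Y n w))"
proof (rule XL_eqI[OF Y modXL[OF hZ] _ _ w])
  let ?A = "r (XL ZZ)"
  show "lin (r (XL Y)) ?A (\<lambda>w. la ZZ l (jx x w))" "lin (r (XL Y)) ?A (\<lambda>w. co ?A l (\<lambda>a n. jx (a \<odot>\<^bsub>X\<^esub> x) (la Y n w)))"
    using l x by (auto intro!: lW)
  fix y m assume y: "y \<in> carrier Y" and m: "m \<in> carrier L"
  have "la ZZ l (jx x (lp Y y m)) = co ?A l (\<lambda>a n. lp ZZ (a \<odot>\<^bsub>ZZ\<^esub> hp X Y x y) (n *\<^sub>L m))"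
    using l x y m by (simp add: jx_pure la_pure[OF hZ] hp_closed[OF X Y])
  also have "\<dots> = co ?A l (\<lambda>a n. sw ?A a (\<lambda>c d. lp ZZ (hp X Y (c \<odot>\<^bsub>X\<^esub> x) (d \<odot>\<^bsub>Y\<^esub> y)) (n *\<^sub>L m)))"
  proof (rule co_cong[OF _ l])
    fix a n assume an: "a \<in> carrier H" "n \<in> carrier L"
    show "lp ZZ (a \<odot>\<^bsub>ZZ\<^esub> hp X Y x y) (n *\<^sub>L m) = sw ?A a (\<lambda>c d. lp ZZ (hp X Y (c \<odot>\<^bsub>X\<^esub> x) (d \<odot>\<^bsub>Y\<^esub> y)) (n *\<^sub>L m))"
      unfolding ht_smult_pure[OF X Y an(1) x y]
      by (rule sw_hom[OF mod_r[OF hZ] modXL[OF hZ], where f="\<lambda>s. lp ZZ s (n *\<^sub>L m)"]) (use an x y m in \<open>auto intro!: lW\<close>)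
  qed
  also have "\<dots> = co ?A l (\<lambda>a z. co ?A z (\<lambda>d n. lp ZZ (hp X Y (a \<odot>\<^bsub>X\<^esub> x) (d \<odot>\<^bsub>Y\<^esub> y)) (n *\<^sub>L m)))"
    by (rule co_coassoc) (use l x y m in \<open>auto intro!: lW\<close>)
  also have "\<dots> = co ?A l (\<lambda>a z. jx (a \<odot>\<^bsub>X\<^esub> x) (la Y z (lp Y y m)))"
  proof (rule co_cong[OF _ l])
    fix a z assume az: "a \<in> carrier H" "z \<in> carrier L"
    have "jx (a \<odot>\<^bsub>X\<^esub> x) (la Y z (lp Y y m)) = co ?A z (\<lambda>d n. jx (a \<odot>\<^bsub>X\<^esub> x) (lp Y (d \<odot>\<^bsub>Y\<^esub> y) (n *\<^sub>L m)))"
      unfolding la_pure[OF Y az(2) y m]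
      by (rule co_hom[OF modXL[OF Y] modXL[OF hZ], where f="\<lambda>w. jx (a \<odot>\<^bsub>X\<^esub> x) w"]) (use az x y m in \<open>auto intro!: lW\<close>)
    thus "co ?A z (\<lambda>d n. lp ZZ (hp X Y (a \<odot>\<^bsub>X\<^esub> x) (d \<odot>\<^bsub>Y\<^esub> y)) (n *\<^sub>L m)) = jx (a \<odot>\<^bsub>X\<^esub> x) (la Y z (lp Y y m))"
      using az x y m by (simp add: jx_pure c cong: co_cong)
  qed
  finally show "la ZZ l (jx x (lp Y y m)) = co ?A l (\<lambda>a n. jx (a \<odot>\<^bsub>X\<^esub> x) (la Y n (lp Y y m)))" .
qed

lemma jx_act:
  assumes h: "h \<in> carrier H" and x: "x \<in> carrier X" and w: "w \<in> carrier (XL Y)"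
  shows "h \<odot>\<^bsub>XL ZZ\<^esub> jx x w = sw (r (XL ZZ)) h (\<lambda>a b. jx (a \<odot>\<^bsub>X\<^esub> x) (b \<odot>\<^bsub>XL Y\<^esub> w))"
proof (rule XL_eqI[OF Y modXL[OF hZ] _ _ w])
  let ?A = "r (XL ZZ)"
  show "lin (r (XL Y)) ?A (\<lambda>w. h \<odot>\<^bsub>XL ZZ\<^esub> jx x w)" "lin (r (XL Y)) ?A (\<lambda>w. sw ?A h (\<lambda>a b. jx (a \<odot>\<^bsub>X\<^esub> x) (b \<odot>\<^bsub>XL Y\<^esub> w)))"
    using h x by (auto intro!: lW)
  fix y m assume y: "y \<in> carrier Y" and m: "m \<in> carrier L"
  have "h \<odot>\<^bsub>XL ZZ\<^esub> jx x (lp Y y m) = sw ?A h (\<lambda>a b. lp ZZ (a \<odot>\<^bsub>ZZ\<^esub> hp X Y x y) (b \<rhd> m))"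
    using h x y m by (simp add: jx_pure XL_smult_pure[OF hZ] hp_closed[OF X Y])
  also have "\<dots> = sw ?A h (\<lambda>a b. sw ?A a (\<lambda>c d. lp ZZ (hp X Y (c \<odot>\<^bsub>X\<^esub> x) (d \<odot>\<^bsub>Y\<^esub> y)) (b \<rhd> m)))"
  proof (rule sw_cong[OF _ h])
    fix a b assume ab: "a \<in> carrier H" "b \<in> carrier H"
    show "lp ZZ (a \<odot>\<^bsub>ZZ\<^esub> hp X Y x y) (b \<rhd> m) = sw ?A a (\<lambda>c d. lp ZZ (hp X Y (c \<odot>\<^bsub>X\<^esub> x) (d \<odot>\<^bsub>Y\<^esub> y)) (b \<rhd> m))"
      unfolding ht_smult_pure[OF X Y ab(1) x y]
      by (rule sw_hom[OF mod_r[OF hZ] modXL[OF hZ], where f="\<lambda>s. lp ZZ s (b \<rhd> m)"]) (use ab x y m in \<open>auto intro!: lW\<close>)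
  qed
  also have "\<dots> = sw ?A h (\<lambda>a z. sw ?A z (\<lambda>d b. lp ZZ (hp X Y (a \<odot>\<^bsub>X\<^esub> x) (d \<odot>\<^bsub>Y\<^esub> y)) (b \<rhd> m)))"
    by (rule sw_coassoc) (use h x y m in \<open>auto intro!: lW\<close>)
  also have "\<dots> = sw ?A h (\<lambda>a z. jx (a \<odot>\<^bsub>X\<^esub> x) (z \<odot>\<^bsub>XL Y\<^esub> lp Y y m))"
  proof (rule sw_cong[OF _ h])
    fix a z assume az: "a \<in> carrier H" "z \<in> carrier H"
    have "jx (a \<odot>\<^bsub>X\<^esub> x) (z \<odot>\<^bsub>XL Y\<^esub> lp Y y m) = sw ?A z (\<lambda>d n. jx (a \<odot>\<^bsub>X\<^esub> x) (lp Y (d \<odot>\<^bsub>Y\<^esub> y) (n \<rhd> m)))"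
      unfolding XL_smult_pure[OF Y az(2) y m]
      by (rule sw_hom[OF modXL[OF Y] modXL[OF hZ], where f="\<lambda>w. jx (a \<odot>\<^bsub>X\<^esub> x) w"]) (use az x y m in \<open>auto intro!: lW\<close>)
    thus "sw ?A z (\<lambda>d n. lp ZZ (hp X Y (a \<odot>\<^bsub>X\<^esub> x) (d \<odot>\<^bsub>Y\<^esub> y)) (n \<rhd> m)) = jx (a \<odot>\<^bsub>X\<^esub> x) (z \<odot>\<^bsub>XL Y\<^esub> lp Y y m)"
      using az x y m by (simp add: jx_pure c cong: sw_cong)
  qed
  finally show "h \<odot>\<^bsub>XL ZZ\<^esub> jx x (lp Y y m) = sw ?A h (\<lambda>a b. jx (a \<odot>\<^bsub>X\<^esub> x) (b \<odot>\<^bsub>XL Y\<^esub> lp Y y m))" .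
qed

text \<open>The identification in the form (x \<otimes> l) \<otimes> w to x \<otimes> l w, with the
  left action of \<open>L\<close> on Y \<otimes> L in place of the explicit coaction. Its properties
  then follow from those of the action.\<close>

definition JF where
  "JF v w = tsum (r (XL (X \<bullet> Y))) (\<lambda>x l. jx x (la Y l w)) v"

lemma lin_JF_left: "lin P (r (XL X)) f \<Longrightarrow> w \<in> carrier (XL Y) \<Longrightarrow> lin P (r (XL ZZ)) (\<lambda>v. JF (f v) w)"
  unfolding JF_def by (rule lin_XLsum[OF X]) (auto intro!: lW)

lemma lin_JF_right: "lin P (r (XL Y)) f \<Longrightarrow> module K P \<Longrightarrow> v \<in> carrier (XL X) \<Longrightarrow> lin P (r (XL ZZ)) (\<lambda>w. JF v (f w))"
  unfolding JF_def by (rule lin_XLsum_inner[OF X]) (auto intro!: lW)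

lemma JF_pure: "x \<in> carrier X \<Longrightarrow> l \<in> carrier L \<Longrightarrow> w \<in> carrier (XL Y) \<Longrightarrow> JF (lp X x l) w = jx x (la Y l w)"
  unfolding JF_def by (rule XLsum_pure[OF X]) (auto intro!: lW)

lemma JF_closed: "v \<in> carrier (XL X) \<Longrightarrow> w \<in> carrier (XL Y) \<Longrightarrow> JF v w \<in> carrier (XL ZZ)"
  using k_linear_closed[OF lin_JF_left[OF k_linear_id]] by simp

lemma JF_balance:
  assumes l: "l \<in> carrier L" and v: "v \<in> carrier (XL X)" and w: "w \<in> carrier (XL Y)"
  shows "JF (ra X v l) w = JF v (la Y l w)"
  by (rule XL_eqI[OF X modXL[OF hZ] lin_JF_left[OF lin_ra_left[OF X k_linear_id]] lin_JF_left[OF k_linear_id] v])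
    (use l w in \<open>auto simp: ra_pure[OF X] JF_pure la_la[OF Y] la_closed[OF Y]\<close>)

lemma bal_JF: "pb.bal (\<Xi> X) (\<Xi> Y) (XL ZZ) JF"
proof (rule pb.balI)
  show "additive_on (\<Xi> Y) (XL ZZ) (JF v)" if "v \<in> carrier (\<Xi> X)" for v
    using k_linear_additive[OF lin_JF_right[OF k_linear_id modXL[OF Y]]] that
    by (simp add: Xi_simps[OF X] Xi_simps[OF Y] additive_on_def)
  show "additive_on (\<Xi> X) (XL ZZ) (\<lambda>v. JF v w)" if "w \<in> carrier (\<Xi> Y)" for w
    using k_linear_additive[OF lin_JF_left[OF k_linear_id]] that
    by (simp add: Xi_simps[OF X] Xi_simps[OF Y] additive_on_def)
  show "JF (tgt B l \<odot>\<^bsub>\<Xi> X\<^esub> v) w = JF v (src B l \<odot>\<^bsub>\<Xi> Y\<^esub> w)"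
    if "l \<in> carrier L" "v \<in> carrier (\<Xi> X)" "w \<in> carrier (\<Xi> Y)" for l v w
    using that by (simp add: Xi_tgt[OF X] Xi_src[OF Y] Xi_simps[OF X] Xi_simps[OF Y] JF_balance)
qed

text \<open>The same comprehension occurs in the definition of the identification and in the tensor
  product of morphisms of the dynamization; it is evaluated here for both.\<close>

lemma JF_list:
  assumes u: "v \<in> carrier (XL X)" and v: "w \<in> carrier (XL Y)"
  shows "lcls K H L ZZ [(hp X Y x (a \<odot>\<^bsub>Y\<^esub> y), n *\<^sub>L m).
      (x, l) \<leftarrow> tlist v, (y, m) \<leftarrow> tlist w, (a, n) \<leftarrow> tlist (coact L l)] = JF v w"
    and JF_list_valid: "set [(hp X Y x (a \<odot>\<^bsub>Y\<^esub> y), n *\<^sub>L m).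
      (x, l) \<leftarrow> tlist v, (y, m) \<leftarrow> tlist w, (a, n) \<leftarrow> tlist (coact L l)] \<subseteq> carrier ZZ \<times> carrier LL"
proof -
  let ?h3 = "\<lambda>x l y m. map (\<lambda>(a, n). (hp X Y x (a \<odot>\<^bsub>Y\<^esub> y), n *\<^sub>L m)) (tlist (coact L l))"
  let ?h2 = "\<lambda>x l v. concat (map (\<lambda>(y, m). ?h3 x l y m) (tlist v))"
  let ?A = "r (XL ZZ)"
  have v3: "set (?h3 x l y m) \<subseteq> carrier ZZ \<times> carrier LL"
    if "x \<in> carrier X" "l \<in> carrier L" "y \<in> carrier Y" "m \<in> carrier L" for x l y m
    by (rule tensor_pair.tlist_map_valid[OF pair_HL _ _ coact_closed]) (use that in \<open>auto simp: hp_closed[OF X Y] c\<close>)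
  have v2: "set (?h2 x l v) \<subseteq> carrier ZZ \<times> carrier LL" if "x \<in> carrier X" "l \<in> carrier L" "v \<in> carrier (XL Y)" for x l v
    by (rule htlist_concat_valid[OF Y hmod_LL _ that(3)]) (use that v3 in simp)
  have e3: "lcls K H L ZZ (?h3 x l y m) = co ?A l (\<lambda>a n. lp ZZ (hp X Y x (a \<odot>\<^bsub>Y\<^esub> y)) (n *\<^sub>L m))"
    if "x \<in> carrier X" "l \<in> carrier L" "y \<in> carrier Y" "m \<in> carrier L" for x l y m
    by (rule hcls_comap[OF _ _ hZ hmod_LL]) (use that in \<open>auto simp: hp_closed[OF X Y] c\<close>)
  have e2: "lcls K H L ZZ (?h2 x l v) = jx x (la Y l v)" if x: "x \<in> carrier X" and l: "l \<in> carrier L" and v: "v \<in> carrier (XL Y)" for x l v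
  proof -
    have "lcls K H L ZZ (?h2 x l v) = tsum ?A (\<lambda>y m. lcls K H L ZZ (?h3 x l y m)) v"
      by (rule hcls_concat[OF Y hmod_LL _ hZ hmod_LL v]) (use v3 x l in simp)
    also have "\<dots> = tsum ?A (\<lambda>y m. co ?A l (\<lambda>a n. lp ZZ (hp X Y x (a \<odot>\<^bsub>Y\<^esub> y)) (n *\<^sub>L m))) v"
      by (rule htsum_cong[OF Y hmod_LL _ v]) (use e3 x l in simp)
    also have "\<dots> = jx x (la Y l v)"
    proof (rule XL_eqI[OF Y modXL[OF hZ] _ _ v])
      have bil: "\<And>y. y \<in> carrier Y \<Longrightarrow> lin L ?A (\<lambda>m. co ?A l (\<lambda>a n. lp ZZ (hp X Y x (a \<odot>\<^bsub>Y\<^esub> y)) (n *\<^sub>L m)))"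
        "\<And>m. m \<in> carrier L \<Longrightarrow> lin (r Y) ?A (\<lambda>y. co ?A l (\<lambda>a n. lp ZZ (hp X Y x (a \<odot>\<^bsub>Y\<^esub> y)) (n *\<^sub>L m)))"
        using x l by (auto intro!: lW)
      show "lin (r (XL Y)) ?A (\<lambda>v. tsum ?A (\<lambda>y m. co ?A l (\<lambda>a n. lp ZZ (hp X Y x (a \<odot>\<^bsub>Y\<^esub> y)) (n *\<^sub>L m))) v)"
        by (rule lin_XLsum[OF Y modXL[OF hZ] bil k_linear_id])
      show "lin (r (XL Y)) ?A (\<lambda>v. jx x (la Y l v))" using x l by (auto intro!: lW)
      fix y m assume y: "y \<in> carrier Y" and m: "m \<in> carrier L"
      have "tsum ?A (\<lambda>y m. co ?A l (\<lambda>a n. lp ZZ (hp X Y x (a \<odot>\<^bsub>Y\<^esub> y)) (n *\<^sub>L m))) (lp Y y m) =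
        co ?A l (\<lambda>a n. lp ZZ (hp X Y x (a \<odot>\<^bsub>Y\<^esub> y)) (n *\<^sub>L m))"
        by (rule XLsum_pure[OF Y modXL[OF hZ] _ _ y m]) (use bil in simp_all)
      also have "\<dots> = co ?A l (\<lambda>a n. jx x (lp Y (a \<odot>\<^bsub>Y\<^esub> y) (n *\<^sub>L m)))"
        using x y m by (intro co_cong l) (simp add: jx_pure c)
      also have "\<dots> = jx x (la Y l (lp Y y m))"
        unfolding la_pure[OF Y l y m]
        by (rule co_hom[OF modXL[OF Y] modXL[OF hZ], symmetric, where f="\<lambda>w. jx x w"]) (use l x y m in \<open>auto intro!: lW\<close>)
      finally show "tsum ?A (\<lambda>y m. co ?A l (\<lambda>a n. lp ZZ (hp X Y x (a \<odot>\<^bsub>Y\<^esub> y)) (n *\<^sub>L m))) (lp Y y m) = jx x (la Y l (lp Y y m))" .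
    qed
    finally show ?thesis .
  qed
  have "lcls K H L ZZ (concat (map (\<lambda>(x, l). ?h2 x l w) (tlist v))) = tsum ?A (\<lambda>x l. lcls K H L ZZ (?h2 x l w)) v"
    by (rule hcls_concat[OF X hmod_LL _ hZ hmod_LL u]) (use v2 v in simp)
  also have "\<dots> = JF v w"
    unfolding JF_def by (rule htsum_cong[OF X hmod_LL _ u]) (use e2 v in simp)
  finally show "lcls K H L ZZ (concat (map (\<lambda>(x, l). ?h2 x l w) (tlist v))) = JF v w" .
  show "set (concat (map (\<lambda>(x, l). ?h2 x l w) (tlist v))) \<subseteq> carrier ZZ \<times> carrier LL"
    by (rule htlist_concat_valid[OF X hmod_LL _ u]) (use v v2 in simp)
qed

lemma Xi_ident_eq: "Xi_ident K H L X Y = (\<lambda>t\<in>carrier (bt (\<Xi> X) (\<Xi> Y)). tsum (XL ZZ) JF t)"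
proof -
  let ?h1 = "\<lambda>v w. [(hp X Y x (a \<odot>\<^bsub>Y\<^esub> y), n *\<^sub>L m).
      (x, l) \<leftarrow> tlist v, (y, m) \<leftarrow> tlist w, (a, n) \<leftarrow> tlist (coact L l)]"
  let ?A = "r (XL ZZ)"
  have "lcls K H L ZZ (concat (map (\<lambda>(u, v). ?h1 u v) (tlist t))) = tsum (XL ZZ) JF t"
    if t: "t \<in> carrier (bt (\<Xi> X) (\<Xi> Y))" for t
  proof -
    have "lcls K H L ZZ (concat (map (\<lambda>(u, v). ?h1 u v) (tlist t))) = tsum ?A (\<lambda>u v. lcls K H L ZZ (?h1 u v)) t"
      by (rule hcls_btconcat[OF JF_list_valid hZ hmod_LL bX bY t]) (simp_all add: Xi_simps[OF X] Xi_simps[OF Y])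
    also have "\<dots> = tsum (XL ZZ) JF t"
      unfolding tsum_r[of "XL ZZ"]
      by (rule pb.btsum_cong[OF bX bY _ t]) (simp add: JF_list Xi_simps[OF X] Xi_simps[OF Y])
    finally show ?thesis .
  qed
  thus ?thesis by (simp add: Xi_ident_def cong: restrict_cong)
qed

lemma J_pure: "v \<in> carrier (XL X) \<Longrightarrow> w \<in> carrier (XL Y) \<Longrightarrow> Xi_ident K H L X Y (bp (\<Xi> X) (\<Xi> Y) v w) = JF v w"
  using pb.btsum_pure[OF bX bY gZ bal_JF] pb.bp_closed[OF bX bY]
  by (simp add: Xi_ident_eq Xi_simps[OF X] Xi_simps[OF Y])

lemma J_additive: "additive_on (bt (\<Xi> X) (\<Xi> Y)) (\<Xi> ZZ) (Xi_ident K H L X Y)"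
proof -
  have "additive_on (bt (\<Xi> X) (\<Xi> Y)) (XL ZZ) (Xi_ident K H L X Y)"
    by (rule additive_on_cong[OF pb.btsum_additive[OF bX bY gZ bal_JF] _ pb.group_bt[OF bX bY]]) (simp add: Xi_ident_eq)
  thus ?thesis by (simp add: additive_on_def Xi_simps[OF hZ])
qed

section \<open>Linearity of the identification over the smash product\<close>

lemma u_bt:
  assumes h: "h \<in> carrier H" and v: "v \<in> carrier (XL X)" and w: "w \<in> carrier (XL Y)"
  shows "u h \<odot>\<^bsub>bt (\<Xi> X) (\<Xi> Y)\<^esub> bp (\<Xi> X) (\<Xi> Y) v w =
    sw BT h (\<lambda>a b. bp (\<Xi> X) (\<Xi> Y) (a \<odot>\<^bsub>XL X\<^esub> v) (b \<odot>\<^bsub>XL Y\<^esub> w))"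
proof -
  let ?F = "\<lambda>p q. bp (\<Xi> X) (\<Xi> Y) (p \<odot>\<^bsub>\<Xi> X\<^esub> v) (q \<odot>\<^bsub>\<Xi> Y\<^esub> w)"
  have v': "v \<in> carrier (\<Xi> X)" and w': "w \<in> carrier (\<Xi> Y)" using v w by (simp_all add: Xi_simps[OF X] Xi_simps[OF Y])
  have F: "bal2 BT ?F"
  proof (rule bal2I)
    show "module K BT" by (rule module_restrict_scalars[OF alg_B bXY])
    show "lin B BT (\<lambda>q. ?F p q)" if "p \<in> carrier B" for p
      by (rule pb.k_linear_bp_right[OF bX bY k_linear_act_left[OF alg_B bY k_linear_id w']]) (use that v' left_module_closed[OF bX] in simp)
    show "lin B BT (\<lambda>p. ?F p q)" if "q \<in> carrier B" for q
      by (rule pb.k_linear_bp_left[OF bX bY k_linear_act_left[OF alg_B bX k_linear_id v']]) (use that w' left_module_closed[OF bY] in simp)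
    show "?F (tgt B l \<star> p) q = ?F p (src B l \<star> q)" if "l \<in> carrier L" "p \<in> carrier B" "q \<in> carrier B" for l p q
      using that v' w' by (simp add: left_module_mult[OF bX] left_module_mult[OF bY] pb.bp_balance[OF bX bY] left_module_closed[OF bX] left_module_closed[OF bY])
  qed
  have "u h \<odot>\<^bsub>bt (\<Xi> X) (\<Xi> Y)\<^esub> bp (\<Xi> X) (\<Xi> Y) v w = tsum BT ?F (bcomul B (u h))"
    using pb.bt_smult_pure[OF bX bY _ v' w', of "u h"] h
    by (simp add: tsum_cong_record[of "bt (\<Xi> X) (\<Xi> Y)" BT])
  also have "\<dots> = sw BT h (\<lambda>a b. ?F (u a) (u b))"
    by (rule bsum_e[OF F]) (use h in auto)
  also have "\<dots> = sw BT h (\<lambda>a b. bp (\<Xi> X) (\<Xi> Y) (a \<odot>\<^bsub>XL X\<^esub> v) (b \<odot>\<^bsub>XL Y\<^esub> w))"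
    using v w by (intro sw_cong h) (simp add: Xi_u[OF X] Xi_u[OF Y])
  finally show ?thesis .
qed

lemma JF_la:
  assumes l: "l \<in> carrier L" and v: "v \<in> carrier (XL X)" and w: "w \<in> carrier (XL Y)"
  shows "JF (la X l v) w = la ZZ l (JF v w)"
proof (rule XL_eqI[OF X modXL[OF hZ] lin_JF_left[OF lin_la_right0[OF X]] lin_la_right[OF hZ lin_JF_left[OF k_linear_id]] v])
  fix x m assume x: "x \<in> carrier X" and m: "m \<in> carrier L"
  have "JF (la X l (lp X x m)) w = co (r (XL ZZ)) l (\<lambda>a n. JF (lp X (a \<odot>\<^bsub>X\<^esub> x) (n *\<^sub>L m)) w)"
    unfolding la_pure[OF X l x m]
    by (rule co_hom[OF modXL[OF X] modXL[OF hZ] lin_JF_left[OF k_linear_id]]) (use l x m w in \<open>auto intro!: lW\<close>)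
  also have "\<dots> = co (r (XL ZZ)) l (\<lambda>a n. jx (a \<odot>\<^bsub>X\<^esub> x) (la Y n (la Y m w)))"
    using x m w by (intro co_cong l) (simp add: JF_pure c la_la[OF Y])
  also have "\<dots> = la ZZ l (JF (lp X x m) w)"
    using l x m w by (simp add: JF_pure jx_la la_closed[OF Y])
  finally show "JF (la X l (lp X x m)) w = la ZZ l (JF (lp X x m) w)" .
qed (use l w in auto)

text \<open>Coassociativity groups the legs that act on \<open>l\<close> and \<open>w\<close>, and
  \<open>act_la\<close> on the second module turns them into the action of one leg on l w.\<close>

lemma JF_act:
  assumes h: "h \<in> carrier H" and v: "v \<in> carrier (XL X)" and w: "w \<in> carrier (XL Y)"
  shows "sw (r (XL ZZ)) h (\<lambda>a b. JF (a \<odot>\<^bsub>XL X\<^esub> v) (b \<odot>\<^bsub>XL Y\<^esub> w)) = h \<odot>\<^bsub>XL ZZ\<^esub> JF v w"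
proof (rule XL_eqI[OF X modXL[OF hZ] _ _ v])
  let ?A = "r (XL ZZ)"
  show "lin (r (XL X)) ?A (\<lambda>v. sw ?A h (\<lambda>a b. JF (a \<odot>\<^bsub>XL X\<^esub> v) (b \<odot>\<^bsub>XL Y\<^esub> w)))" "lin (r (XL X)) ?A (\<lambda>v. h \<odot>\<^bsub>XL ZZ\<^esub> JF v w)"
    using h w by (auto intro!: lW lin_JF_left)
  fix x l assume x: "x \<in> carrier X" and l: "l \<in> carrier L"
  have "sw ?A h (\<lambda>a b. JF (a \<odot>\<^bsub>XL X\<^esub> lp X x l) (b \<odot>\<^bsub>XL Y\<^esub> w)) =
    sw ?A h (\<lambda>a b. sw ?A a (\<lambda>c d. jx (c \<odot>\<^bsub>X\<^esub> x) (la Y (d \<rhd> l) (b \<odot>\<^bsub>XL Y\<^esub> w))))"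
  proof (rule sw_cong[OF _ h])
    fix a b assume ab: "a \<in> carrier H" "b \<in> carrier H"
    have bw: "b \<odot>\<^bsub>XL Y\<^esub> w \<in> carrier (XL Y)" by (rule XL_smult_closed[OF Y ab(2) w])
    have "JF (a \<odot>\<^bsub>XL X\<^esub> lp X x l) (b \<odot>\<^bsub>XL Y\<^esub> w) = sw ?A a (\<lambda>c d. JF (lp X (c \<odot>\<^bsub>X\<^esub> x) (d \<rhd> l)) (b \<odot>\<^bsub>XL Y\<^esub> w))"
      unfolding XL_smult_pure[OF X ab(1) x l]
      by (rule sw_hom[OF modXL[OF X] modXL[OF hZ] lin_JF_left[OF k_linear_id bw]]) (use ab x l in \<open>auto intro!: lW\<close>)
    also have "\<dots> = sw ?A a (\<lambda>c d. jx (c \<odot>\<^bsub>X\<^esub> x) (la Y (d \<rhd> l) (b \<odot>\<^bsub>XL Y\<^esub> w)))"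
      using x l bw by (intro sw_cong ab) (simp add: JF_pure c)
    finally show "JF (a \<odot>\<^bsub>XL X\<^esub> lp X x l) (b \<odot>\<^bsub>XL Y\<^esub> w) = \<dots>" .
  qed
  also have "\<dots> = sw ?A h (\<lambda>c y. sw ?A y (\<lambda>d b. jx (c \<odot>\<^bsub>X\<^esub> x) (la Y (d \<rhd> l) (b \<odot>\<^bsub>XL Y\<^esub> w))))"
    by (rule sw_coassoc) (use h x l w in \<open>auto intro!: lW\<close>)
  also have "\<dots> = sw ?A h (\<lambda>c y. jx (c \<odot>\<^bsub>X\<^esub> x) (y \<odot>\<^bsub>XL Y\<^esub> la Y l w))"
  proof (rule sw_cong[OF _ h])
    fix c y assume cy: "c \<in> carrier H" "y \<in> carrier H"
    show "sw ?A y (\<lambda>d b. jx (c \<odot>\<^bsub>X\<^esub> x) (la Y (d \<rhd> l) (b \<odot>\<^bsub>XL Y\<^esub> w))) = jx (c \<odot>\<^bsub>X\<^esub> x) (y \<odot>\<^bsub>XL Y\<^esub> la Y l w)"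
      unfolding act_la[OF Y cy(2) l w]
      by (rule sw_hom[OF modXL[OF Y] modXL[OF hZ], symmetric, where f="\<lambda>z. jx (c \<odot>\<^bsub>X\<^esub> x) z"]) (use cy x l w in \<open>auto intro!: lW\<close>)
  qed
  also have "\<dots> = h \<odot>\<^bsub>XL ZZ\<^esub> JF (lp X x l) w"
    using h x l w by (simp add: JF_pure jx_act la_closed[OF Y])
  finally show "sw ?A h (\<lambda>a b. JF (a \<odot>\<^bsub>XL X\<^esub> lp X x l) (b \<odot>\<^bsub>XL Y\<^esub> w)) = h \<odot>\<^bsub>XL ZZ\<^esub> JF (lp X x l) w" .
qed

lemma J_hom: "Xi_ident K H L X Y \<in> left_module_hom B (bt (\<Xi> X) (\<Xi> Y)) (\<Xi> ZZ)"
proof (rule B_homI[OF bXY bZ _ J_additive])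
  let ?J = "Xi_ident K H L X Y" and ?T = "bt (\<Xi> X) (\<Xi> Y)"
  note G = left_module_group[OF bZ]
  show "?J \<in> extensional (carrier ?T)" by (simp add: Xi_ident_eq)
  show "?J (src B l \<odot>\<^bsub>?T\<^esub> t) = src B l \<odot>\<^bsub>\<Xi> ZZ\<^esub> ?J t" if l: "l \<in> carrier L" and t: "t \<in> carrier ?T" for l t
    by (rule pb.bt_eqI[OF bX bY G additive_on_comp[OF pb.bt_smult_additive[OF bX bY] J_additive]
          additive_on_smult_right[OF bZ J_additive] t])
      (use l in \<open>auto simp: pb.bt_src[OF bX bY] Xi_simps[OF X] Xi_simps[OF Y] Xi_src[OF X] Xi_src[OF hZ] J_pure la_closed[OF X] JF_la JF_closed\<close>)
  show "?J (u h \<odot>\<^bsub>?T\<^esub> t) = u h \<odot>\<^bsub>\<Xi> ZZ\<^esub> ?J t" if h: "h \<in> carrier H" and t: "t \<in> carrier ?T" for h t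
  proof (rule pb.bt_eqI[OF bX bY G additive_on_comp[OF pb.bt_smult_additive[OF bX bY] J_additive]
          additive_on_smult_right[OF bZ J_additive] t])
    fix v w assume "v \<in> carrier (\<Xi> X)" "w \<in> carrier (\<Xi> Y)"
    hence v: "v \<in> carrier (XL X)" and w: "w \<in> carrier (XL Y)" by (simp_all add: Xi_simps[OF X] Xi_simps[OF Y])
    have cc: "bp (\<Xi> X) (\<Xi> Y) (a \<odot>\<^bsub>XL X\<^esub> v) (b \<odot>\<^bsub>XL Y\<^esub> w) \<in> carrier ?T" if "a \<in> carrier H" "b \<in> carrier H" for a b
      using that v w pb.bp_closed[OF bX bY] XL_smult_closed[OF X] XL_smult_closed[OF Y] by (simp add: Xi_simps[OF X] Xi_simps[OF Y])
    have "?J (u h \<odot>\<^bsub>?T\<^esub> bp (\<Xi> X) (\<Xi> Y) v w) = sw (XL ZZ) h (\<lambda>a b. ?J (bp (\<Xi> X) (\<Xi> Y) (a \<odot>\<^bsub>XL X\<^esub> v) (b \<odot>\<^bsub>XL Y\<^esub> w)))"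
      unfolding u_bt[OF h v w]
      by (rule tensor_pair.tsum_hom[OF pair_HH module_group[OF module_restrict_scalars[OF alg_B bXY]] gZ _ _ comul_closed[OF h]])
        (use J_additive cc in \<open>auto simp: additive_on_def Xi_simps[OF hZ]\<close>)
    also have "\<dots> = sw (r (XL ZZ)) h (\<lambda>a b. JF (a \<odot>\<^bsub>XL X\<^esub> v) (b \<odot>\<^bsub>XL Y\<^esub> w))"
      unfolding tsum_r[of "XL ZZ"] using v w
      by (intro sw_cong h) (simp add: J_pure XL_smult_closed[OF X] XL_smult_closed[OF Y])
    also have "\<dots> = u h \<odot>\<^bsub>\<Xi> ZZ\<^esub> ?J (bp (\<Xi> X) (\<Xi> Y) v w)"
      using h v w by (simp add: JF_act J_pure Xi_u[OF hZ] JF_closed)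
    finally show "?J (u h \<odot>\<^bsub>?T\<^esub> bp (\<Xi> X) (\<Xi> Y) v w) = u h \<odot>\<^bsub>\<Xi> ZZ\<^esub> ?J (bp (\<Xi> X) (\<Xi> Y) v w)" .
  qed (use h in auto)
qed

section \<open>The inverse of the identification\<close>

definition ji where
  "ji = (\<lambda>t\<in>carrier (\<Xi> (X \<bullet> Y)). tsum BT (\<lambda>s m. tsum BT (\<lambda>x y. bp (\<Xi> X) (\<Xi> Y) (lp X x \<one>\<^bsub>L\<^esub>) (lp Y y m)) s) t)"

lemma modBT: "module K BT"
  by (rule module_restrict_scalars[OF alg_B bXY])

lemma lin_bp_left: "lin P (r (XL X)) f \<Longrightarrow> w \<in> carrier (XL Y) \<Longrightarrow> lin P BT (\<lambda>v. bp (\<Xi> X) (\<Xi> Y) (f v) w)"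
  by (rule pb.k_linear_bp_left[OF bX bY]) (simp_all add: lin_to_Xi[OF X] Xi_simps[OF Y])

lemma lin_bp_right: "lin P (r (XL Y)) f \<Longrightarrow> v \<in> carrier (XL X) \<Longrightarrow> lin P BT (\<lambda>w. bp (\<Xi> X) (\<Xi> Y) v (f w))"
  by (rule pb.k_linear_bp_right[OF bX bY]) (simp_all add: lin_to_Xi[OF Y] Xi_simps[OF X])

lemmas lB = lW modBT lin_bp_left lin_bp_right

lemma lin_ji0: "lin (r (XL ZZ)) BT (\<lambda>t. tsum BT (\<lambda>s m. tsum BT (\<lambda>x y. bp (\<Xi> X) (\<Xi> Y) (lp X x \<one>\<^bsub>L\<^esub>) (lp Y y m)) s) t)"
  by (rule lin_XLsum[OF hZ modBT _ _ k_linear_id];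
      (rule lin_htsum_inner[OF X Y modBT mod_L] lin_htsum[OF X Y modBT _ _ k_linear_id])?) (auto intro!: lB)

lemma lin_ji: "lin (r (XL ZZ)) BT ji"
  by (rule k_linear_cong[OF lin_ji0 _ modXL[OF hZ]]) (simp add: ji_def Xi_simps[OF hZ])

lemma ji_pure:
  assumes x: "x \<in> carrier X" and y: "y \<in> carrier Y" and m: "m \<in> carrier L"
  shows "ji (lp ZZ (hp X Y x y) m) = bp (\<Xi> X) (\<Xi> Y) (lp X x \<one>\<^bsub>L\<^esub>) (lp Y y m)"
proof -
  have s: "hp X Y x y \<in> carrier ZZ" by (rule hp_closed[OF X Y x y])
  have "ji (lp ZZ (hp X Y x y) m) = tsum BT (\<lambda>x y. bp (\<Xi> X) (\<Xi> Y) (lp X x \<one>\<^bsub>L\<^esub>) (lp Y y m)) (hp X Y x y)"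
    using s m by (simp add: ji_def Xi_simps[OF hZ] lp_closed[OF hZ])
      (rule XLsum_pure[OF hZ modBT _ _ s m];
        (rule lin_htsum_inner[OF X Y modBT mod_L] lin_htsum[OF X Y modBT _ _ k_linear_id])?; auto intro!: lB)
  also have "\<dots> = bp (\<Xi> X) (\<Xi> Y) (lp X x \<one>\<^bsub>L\<^esub>) (lp Y y m)"
    by (rule htsum_pure[OF X Y modBT _ _ x y]) (use m in \<open>auto intro!: lB\<close>)
  finally show ?thesis .
qed

lemma ji_closed: "t \<in> carrier (XL ZZ) \<Longrightarrow> ji t \<in> carrier (bt (\<Xi> X) (\<Xi> Y))"
  using k_linear_closed[OF lin_ji] by simp

lemma ji_jx:
  assumes x: "x \<in> carrier X" and w: "w \<in> carrier (XL Y)"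
  shows "ji (jx x w) = bp (\<Xi> X) (\<Xi> Y) (lp X x \<one>\<^bsub>L\<^esub>) w"
  by (rule XL_eqI[OF Y modBT k_linear_comp[OF lin_jx_right[OF k_linear_id x] lin_ji] lin_bp_right[OF k_linear_id] w])
    (use x in \<open>auto simp: jx_pure ji_pure lp_closed[OF X]\<close>)

lemma Z_eqI:
  assumes "module K A" "lin (r (XL ZZ)) A f" "lin (r (XL ZZ)) A g" "t \<in> carrier (XL ZZ)"
    "\<And>x y m. x \<in> carrier X \<Longrightarrow> y \<in> carrier Y \<Longrightarrow> m \<in> carrier L \<Longrightarrow>
       f (lp ZZ (hp X Y x y) m) = g (lp ZZ (hp X Y x y) m)"
  shows "f t = g t"
proof (rule XL_eqI[OF hZ assms(1-4)])
  fix s m assume s: "s \<in> carrier ZZ" and m: "m \<in> carrier L"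
  have l: "lin (r ZZ) (r (XL ZZ)) (\<lambda>s. lp ZZ s m)" using m by (auto intro!: lW)
  show "f (lp ZZ s m) = g (lp ZZ s m)"
    by (rule ht_eqI[OF X Y assms(1) k_linear_comp[OF l assms(2)] k_linear_comp[OF l assms(3)] s]) (use m assms(5) in simp)
qed

lemma J_inverse: "inverse_pair (BMod L B) (bt (\<Xi> X) (\<Xi> Y)) (\<Xi> ZZ) (Xi_ident K H L X Y) ji"
proof -
  let ?J = "Xi_ident K H L X Y" and ?T = "bt (\<Xi> X) (\<Xi> Y)"
  have J': "additive_on ?T (r (XL ZZ)) ?J" using J_additive by (simp add: additive_on_def Xi_simps[OF hZ])
  have gf: "ji (?J t) = t" if t: "t \<in> carrier ?T" for t
  proof (rule pb.bt_eqI[OF bX bY left_module_group[OF bXY] _ additive_on_id t])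
    show "additive_on ?T ?T (\<lambda>t. ji (?J t))"
      using additive_on_comp[OF J' k_linear_additive[OF lin_ji]] by (simp add: additive_on_def)
    fix v w assume "v \<in> carrier (\<Xi> X)" "w \<in> carrier (\<Xi> Y)"
    hence v: "v \<in> carrier (XL X)" and w: "w \<in> carrier (XL Y)" by (simp_all add: Xi_simps[OF X] Xi_simps[OF Y])
    show "ji (?J (bp (\<Xi> X) (\<Xi> Y) v w)) = bp (\<Xi> X) (\<Xi> Y) v w"
      unfolding J_pure[OF v w]
    proof (rule XL_eqI[OF X modBT k_linear_comp[OF lin_JF_left[OF k_linear_id w] lin_ji] lin_bp_left[OF k_linear_id w] v])
      fix x l assume x: "x \<in> carrier X" and l: "l \<in> carrier L"
      have "ji (JF (lp X x l) w) = bp (\<Xi> X) (\<Xi> Y) (lp X x \<one>\<^bsub>L\<^esub>) (src B l \<odot>\<^bsub>\<Xi> Y\<^esub> w)"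
        using x l w by (simp add: JF_pure ji_jx la_closed[OF Y] Xi_src[OF Y])
      \<comment> \<open>The element \<open>l\<close>, left on the second factor by
        \<open>JF\<close>, crosses back as a target and multiplies x \<otimes> 1 from the
        right.\<close>
      also have "\<dots> = bp (\<Xi> X) (\<Xi> Y) (tgt B l \<odot>\<^bsub>\<Xi> X\<^esub> lp X x \<one>\<^bsub>L\<^esub>) w"
        using x l w by (intro pb.bp_balance[OF bX bY, symmetric]) (simp_all add: Xi_simps[OF X] Xi_simps[OF Y] lp_closed[OF X])
      also have "\<dots> = bp (\<Xi> X) (\<Xi> Y) (lp X x l) w"
        using x l by (simp add: Xi_tgt[OF X] lp_closed[OF X] ra_pure[OF X])
      finally show "ji (JF (lp X x l) w) = bp (\<Xi> X) (\<Xi> Y) (lp X x l) w" .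
    qed
  qed
  have fg: "?J (ji t) = t" if t: "t \<in> carrier (XL ZZ)" for t
  proof -
    have lJ: "lin BT (r (XL ZZ)) ?J"
      using J' left_module_hom_smult[OF J_hom] module.smult_closed[OF mod_B, of _ "\<one>\<^bsub>B\<^esub>"]
        lin_to_Xi[OF hZ, of "r (XL ZZ)" "\<lambda>x. x"] k_linear_id[of K "r (XL ZZ)"] additive_on_closed[OF J_additive]
      by (auto simp: k_linear_def additive_on_def restrict_scalars_def Xi_simps[OF hZ])
    show ?thesis
      by (rule Z_eqI[OF modXL[OF hZ] k_linear_comp[OF lin_ji lJ] k_linear_id t])
        (auto simp: ji_pure J_pure JF_pure lp_closed[OF X] lp_closed[OF Y] la_one[OF Y] jx_pure)
  qed
  have "inverse_pair (BMod L B) ?T (\<Xi> ZZ) ?J (restrict ji (carrier (\<Xi> ZZ)))"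
    by (rule pb.BMod_inverse_pair[OF J_hom bXY bZ]) (use gf fg ji_closed in \<open>auto simp: Xi_simps[OF hZ]\<close>)
  thus ?thesis by (simp add: ji_def)
qed

end

subsection \<open>The unit object\<close>

abbreviation "hU \<equiv> hunit K H"
abbreviation "BU \<equiv> bunit L B"
abbreviation "J0 \<equiv> Xi_ident_unit K H L"

lemma hU_simps [simp]:
  "carrier hU = carrier K" "add hU = add K" "zero hU = zero K" "smult hU = (\<lambda>h c. \<epsilon> h \<otimes>\<^bsub>K\<^esub> c)"
  by (simp_all add: hunit_def)

lemma hmod_hU: "hmod hU"
proof -
  interpret K: cring K by (rule cring_K)
  have "abelian_group hU" by (rule abelian_group_cong[OF K.is_abelian_group]) simp_all
  thus ?thesis
    using additive_on_add[OF k_linear_additive[OF lin_counit]]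
    by (auto simp: left_module_def ring_H counit_one counit_mult K.l_distr K.r_distr K.m_assoc)
qed

lemma hU_scalar: "k \<in> carrier K \<Longrightarrow> (k \<odot>\<^bsub>H\<^esub> \<one>\<^bsub>H\<^esub>) \<odot>\<^bsub>hU\<^esub> c = k \<otimes>\<^bsub>K\<^esub> c"
proof -
  interpret K: cring K by (rule cring_K)
  show "k \<in> carrier K \<Longrightarrow> (k \<odot>\<^bsub>H\<^esub> \<one>\<^bsub>H\<^esub>) \<odot>\<^bsub>hU\<^esub> c = k \<otimes>\<^bsub>K\<^esub> c"
    using k_linear_smult[OF lin_counit, of k "\<one>\<^bsub>H\<^esub>"] by (simp add: counit_one)
qed

lemma lin_to_hU: "lin P (r hU) f = lin P (regular K) f"
  using hU_scalar by (simp add: k_linear_def additive_on_def r_smult)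

lemma lin_from_hU: "lin (r hU) P f = lin (regular K) P f"
  using hU_scalar by (simp add: k_linear_def additive_on_def r_smult)

lemmas lU = linY[OF hmod_hU] lin_to_hU[THEN iffD2] lin_from_hU[THEN iffD2]

lemma lp_hU_scalar:
  assumes c: "c \<in> carrier K" and l: "l \<in> carrier L"
  shows "lp hU c l = c \<odot>\<^bsub>r (XL hU)\<^esub> lp hU \<one>\<^bsub>K\<^esub> l" "lp hU c l = lp hU \<one>\<^bsub>K\<^esub> (c \<odot>\<^bsub>L\<^esub> l)"
proof -
  interpret K: cring K by (rule cring_K)
  have 1: "lin (regular K) (r (XL hU)) (\<lambda>c. lp hU c l)" and 2: "lin L (r (XL hU)) (\<lambda>l. lp hU \<one>\<^bsub>K\<^esub> l)"
    using l by (auto intro!: lU)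
  show 3: "lp hU c l = c \<odot>\<^bsub>r (XL hU)\<^esub> lp hU \<one>\<^bsub>K\<^esub> l"
    using k_linear_smult[OF 1 c, of "\<one>\<^bsub>K\<^esub>"] c by simp
  show "lp hU c l = lp hU \<one>\<^bsub>K\<^esub> (c \<odot>\<^bsub>L\<^esub> l)"
    using k_linear_smult[OF 2 c l] 3 by simp
qed

lemma J0_apply: "l \<in> carrier L \<Longrightarrow> J0 l = lp hU \<one>\<^bsub>K\<^esub> l"
  by (simp add: Xi_ident_unit_def)

lemma J0_closed: "l \<in> carrier L \<Longrightarrow> J0 l \<in> carrier (XL hU)"
  by (simp add: J0_apply lp_closed[OF hmod_hU])

lemma lin_J0: "lin L (r (XL hU)) J0"
  by (rule k_linear_cong[OF _ _ mod_L, of _ "\<lambda>l. lp hU \<one>\<^bsub>K\<^esub> l"]) (auto simp: J0_apply intro!: lU)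

lemma lmod_BU: "left_module B BU"
  by (rule pb.lmod_BU)

text \<open>\<open>H\<close> acts on the unit object through its counit. Thus the coaction of an
  element of \<open>L\<close> reduces by its counit axiom, and the coproduct of \<open>h\<close> by
  that of \<open>H\<close>; on the other side \<epsilon>(h s(l)) is h \<rhd> l.\<close>

lemma J0_hom: "J0 \<in> left_module_hom B BU (\<Xi> hU)"
proof (rule B_homI[OF lmod_BU lmod_Xi[OF hmod_hU]])
  interpret K: cring K by (rule cring_K)
  note A = modXL[OF hmod_hU]
  have one: "\<one>\<^bsub>K\<^esub> \<in> carrier hU" by simp
  show "J0 \<in> extensional (carrier BU)" by (simp add: Xi_ident_unit_def pb.bunit_simps)
  show "additive_on BU (\<Xi> hU) J0"
    using k_linear_additive[OF lin_J0] by (simp add: additive_on_def Xi_simps[OF hmod_hU])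
  show "J0 (src B m \<odot>\<^bsub>BU\<^esub> l) = src B m \<odot>\<^bsub>\<Xi> hU\<^esub> J0 l" if m: "m \<in> carrier L" and "l \<in> carrier BU" for m l
  proof -
    have l: "l \<in> carrier L" using that by simp
    have "src B m \<odot>\<^bsub>\<Xi> hU\<^esub> J0 l = la hU m (lp hU \<one>\<^bsub>K\<^esub> l)"
      using m l by (simp add: Xi_src[OF hmod_hU] J0_closed) (simp add: J0_apply)
    also have "\<dots> = co (r (XL hU)) m (\<lambda>a n. \<epsilon> a \<odot>\<^bsub>r (XL hU)\<^esub> lp hU \<one>\<^bsub>K\<^esub> (n *\<^sub>L l))"
      unfolding la_pure[OF hmod_hU m one l]
      by (rule co_cong[OF _ m]) (use l lp_hU_scalar(1)[of "\<epsilon> _"] in simp)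
    also have "\<dots> = lp hU \<one>\<^bsub>K\<^esub> (m *\<^sub>L l)"
      by (rule co_counit[OF A _ m]) (use l in \<open>auto intro!: lU\<close>)
    also have "\<dots> = J0 (src B m \<odot>\<^bsub>BU\<^esub> l)"
      using m l by (simp add: J0_apply counit_src_mult)
    finally show ?thesis by simp
  qed
  show "J0 (u h \<odot>\<^bsub>BU\<^esub> l) = u h \<odot>\<^bsub>\<Xi> hU\<^esub> J0 l" if h: "h \<in> carrier H" and "l \<in> carrier BU" for h l
  proof -
    have l: "l \<in> carrier L" using that by simp
    have "\<epsilon>\<^sub>B (u h \<star> src B l) = sw L h (\<lambda>a b. \<epsilon>\<^sub>B (e (a \<rhd> l) (b \<cdot> \<one>\<^bsub>H\<^esub>)))"
      unfolding src_eq u_mult_e[OF h l H_closed(3)]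
      by (rule sw_hom[OF mod_B mod_L lin_bcounit _ h]) (use l in auto)
    also have "\<dots> = sw L h (\<lambda>a b. \<epsilon> b \<odot>\<^bsub>L\<^esub> (a \<rhd> l))"
      using l by (intro sw_cong h) (simp add: counit_e)
    also have "\<dots> = h \<rhd> l" by (rule sw_counit_right) (use l h in \<open>auto intro!: lU\<close>)
    finally have 1: "u h \<odot>\<^bsub>BU\<^esub> l = h \<rhd> l" by simp
    have "u h \<odot>\<^bsub>\<Xi> hU\<^esub> J0 l = h \<odot>\<^bsub>XL hU\<^esub> lp hU \<one>\<^bsub>K\<^esub> l"
      using h l by (simp add: Xi_u[OF hmod_hU] J0_closed) (simp add: J0_apply)
    also have "\<dots> = sw (r (XL hU)) h (\<lambda>a b. \<epsilon> a \<odot>\<^bsub>r (XL hU)\<^esub> lp hU \<one>\<^bsub>K\<^esub> (b \<rhd> l))"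
      unfolding XL_smult_pure[OF hmod_hU h one l]
      by (rule sw_cong[OF _ h]) (use l lp_hU_scalar(1)[of "\<epsilon> _"] in simp)
    also have "\<dots> = lp hU \<one>\<^bsub>K\<^esub> (h \<rhd> l)"
      by (rule sw_counit_left[OF A _ h]) (use l in \<open>auto intro!: lU\<close>)
    finally show ?thesis using h l 1 by (simp add: J0_apply)
  qed
qed

lemma J0_inverse:
  "inverse_pair (BMod L B) BU (\<Xi> hU) J0 (\<lambda>t\<in>carrier (\<Xi> hU). tsum L (\<lambda>c l. c \<odot>\<^bsub>L\<^esub> l) t)"
proof (rule pb.BMod_inverse_pair[OF J0_hom lmod_BU lmod_Xi[OF hmod_hU]])
  interpret K: cring K by (rule cring_K)
  interpret L: module K L by (rule mod_L)
  note A = modXL[OF hmod_hU]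
  have lin: "lin (r (XL hU)) L (\<lambda>t. tsum L (\<lambda>c l. c \<odot>\<^bsub>L\<^esub> l) t)"
    by (rule lin_XLsum[OF hmod_hU]) (auto intro!: lU)
  have pure: "tsum L (\<lambda>c l. c \<odot>\<^bsub>L\<^esub> l) (lp hU c l) = c \<odot>\<^bsub>L\<^esub> l" if "c \<in> carrier K" "l \<in> carrier L" for c l
    by (rule XLsum_pure[OF hmod_hU]) (use that in \<open>auto intro!: lU\<close>)
  show "tsum L (\<lambda>c l. c \<odot>\<^bsub>L\<^esub> l) y \<in> carrier BU" if "y \<in> carrier (\<Xi> hU)" for y
    using k_linear_closed[OF lin] that by (simp add: Xi_simps[OF hmod_hU])
  show "tsum L (\<lambda>c l. c \<odot>\<^bsub>L\<^esub> l) (J0 x) = x" if "x \<in> carrier BU" for x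
    using that by (simp add: J0_apply pure)
  show "J0 (tsum L (\<lambda>c l. c \<odot>\<^bsub>L\<^esub> l) y) = y" if "y \<in> carrier (\<Xi> hU)" for y
    by (rule XL_eqI[OF hmod_hU A k_linear_comp[OF lin lin_J0] k_linear_id])
      (use that in \<open>auto simp: Xi_simps[OF hmod_hU] pure J0_apply lp_hU_scalar(2)[symmetric]\<close>)
qed

theorem identification_Xi:
  "identification (BMod L B) {X. hmod X} (Xi_obj K H L) (htensor K H) hU (Xi_ident K H L) J0"
proof -
  have "iso_mor (BMod L B) (bt (\<Xi> X) (\<Xi> Y)) (\<Xi> (X \<bullet> Y)) (Xi_ident K H L X Y)" if "hmod X" "hmod Y" for X Y
    using J_inverse[OF that] by (auto simp: iso_mor_def)
  moreover have "iso_mor (BMod L B) BU (\<Xi> hU) J0" using J0_inverse by (auto simp: iso_mor_def)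
  ultimately show ?thesis
    by (simp add: identification_def pb.BMod_simps lmod_Xi hmod_hU hmod_ht)
qed

end

section \<open>Isomorphisms in monoidal categories\<close>

context category
begin

lemma inverse_pair_comp:
  assumes obj: "X \<in> Obj C" "Y \<in> Obj C" "Z \<in> Obj C"
    and f: "inverse_pair C X Y f f'" and g: "inverse_pair C Y Z g g'"
  shows "inverse_pair C X Z (Comp C X Y Z f g) (Comp C Z Y X g' f')"
proof -
  have h: "f \<in> Hom C X Y" "f' \<in> Hom C Y X" "g \<in> Hom C Y Z" "g' \<in> Hom C Z Y"
    and e: "Comp C X Y X f f' = Ident C X" "Comp C Y X Y f' f = Ident C Y"
      "Comp C Y Z Y g g' = Ident C Y" "Comp C Z Y Z g' g = Ident C Z"
    using f g by (simp_all add: inverse_pair_def)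
  note c = comp[OF obj h(1,3)] comp[OF obj(3,2,1) h(4,2)]
  have "Comp C X Z X (Comp C X Y Z f g) (Comp C Z Y X g' f') =
    Comp C X Y X f (Comp C Y Z X g (Comp C Z Y X g' f'))"
    by (rule comp_assoc[OF obj(1,2,3,1) h(1,3) c(2)])
  also have "Comp C Y Z X g (Comp C Z Y X g' f') = f'"
    using comp_assoc[OF obj(2,3,2,1) h(3,4,2)] comp_ident_left[OF obj(2,1) h(2)] by (simp add: e)
  finally have 1: "Comp C X Z X (Comp C X Y Z f g) (Comp C Z Y X g' f') = Ident C X" by (simp add: e)
  have "Comp C Z X Z (Comp C Z Y X g' f') (Comp C X Y Z f g) =
    Comp C Z Y Z g' (Comp C Y X Z f' (Comp C X Y Z f g))"
    by (rule comp_assoc[OF obj(3,2,1,3) h(4,2) c(1)])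
  also have "Comp C Y X Z f' (Comp C X Y Z f g) = g"
    using comp_assoc[OF obj(2,1,2,3) h(2,1,3)] comp_ident_left[OF obj(2,3) h(3)] by (simp add: e)
  finally have 2: "Comp C Z X Z (Comp C Z Y X g' f') (Comp C X Y Z f g) = Ident C Z" by (simp add: e)
  show ?thesis using 1 2 c by (simp add: inverse_pair_def)
qed

lemma iso_mor_comp:
  "X \<in> Obj C \<Longrightarrow> Y \<in> Obj C \<Longrightarrow> Z \<in> Obj C \<Longrightarrow> iso_mor C X Y f \<Longrightarrow> iso_mor C Y Z g \<Longrightarrow>
   iso_mor C X Z (Comp C X Y Z f g)"
  using inverse_pair_comp unfolding iso_mor_def by blast

lemma iso_mor_ident: "X \<in> Obj C \<Longrightarrow> iso_mor C X X (Ident C X)"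
  unfolding iso_mor_def inverse_pair_def using ident comp_ident_left by blast

lemma iso_mor_hom: "iso_mor C X Y f \<Longrightarrow> f \<in> Hom C X Y"
  by (auto simp: iso_mor_def inverse_pair_def)

lemma inv_mor_iso:
  assumes "X \<in> Obj C" "Y \<in> Obj C" "iso_mor C X Y f"
  shows "inverse_pair C X Y f (inv_mor C X Y f)" "iso_mor C Y X (inv_mor C X Y f)"
proof -
  obtain g where g: "inverse_pair C X Y f g" using assms(3) by (auto simp: iso_mor_def)
  thus 1: "inverse_pair C X Y f (inv_mor C X Y f)" using inv_mor_eq[OF assms(1,2) g] by simp
  thus "iso_mor C Y X (inv_mor C X Y f)" by (auto simp: iso_mor_def inverse_pair_def)
qed

end

lemma (in monoidal_category) iso_mor_tmor:
  assumes obj: "X \<in> Obj C" "X' \<in> Obj C" "Y \<in> Obj C" "Y' \<in> Obj C"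
    and f: "iso_mor C X X' f" and g: "iso_mor C Y Y' g"
  shows "iso_mor C (tobj C X Y) (tobj C X' Y') (tmor C X X' Y Y' f g)"
proof -
  obtain f' g' where "inverse_pair C X X' f f'" "inverse_pair C Y Y' g g'"
    using f g by (auto simp: iso_mor_def)
  hence h: "f \<in> Hom C X X'" "f' \<in> Hom C X' X" "g \<in> Hom C Y Y'" "g' \<in> Hom C Y' Y"
    and e: "Comp C X X' X f f' = Ident C X" "Comp C X' X X' f' f = Ident C X'"
      "Comp C Y Y' Y g g' = Ident C Y" "Comp C Y' Y Y' g' g = Ident C Y'"
    by (simp_all add: inverse_pair_def)
  have "inverse_pair C (tobj C X Y) (tobj C X' Y') (tmor C X X' Y Y' f g) (tmor C X' X Y' Y f' g')"
    using tmor_comp[OF obj(1,2,1,3,4,3) h] tmor_comp[OF obj(2,1,2,4,3,4) h(2,1,4,3)]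
      tmor[OF obj h(1,3)] tmor[OF obj(2,1,4,3) h(2,4)] tmor_ident[OF obj(1,3)] tmor_ident[OF obj(2,4)]
    by (simp add: inverse_pair_def e)
  thus ?thesis by (auto simp: iso_mor_def)
qed

context hopf_base
begin

section \<open>The full subcategory\<close>

abbreviation "DB \<equiv> BMod L B"
abbreviation "M0 \<equiv> Mod_0 K H L"
abbreviation ob where "ob X \<equiv> (X, Xi_obj K H L X)"
abbreviation J where "J X Y \<equiv> Xi_ident K H L X Y"
abbreviation bhom where "bhom M N \<equiv> left_module_hom B M N"

lemma moncat_DB: "monoidal_category DB"
  by (rule pb.monoidal_category_BMod)

interpretation D: monoidal_category DB by (rule moncat_DB)

lemma M0_simps:
  "Obj M0 = ob ` {X. hmod X}" "Hom M0 (X, M) (Y, N) = bhom M N" "Ident M0 (X, M) = Ident DB M"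
  "Comp M0 (X, M) (Y, N) (Z, P) f g = Comp DB M N P f g" "tobj M0 (X, M) (Y, N) = ob (X \<bullet> Y)"
  "tunit M0 = ob hU"
  by (simp_all add: Mod_0_def full_subcategory_on_def BMod_def)

lemma iso_mor_M0: "iso_mor M0 (X, M) (Y, N) f = iso_mor DB M N f"
  by (simp add: iso_mor_def inverse_pair_def M0_simps pb.BMod_simps)

lemma inv_J: "hmod X \<Longrightarrow> hmod Y \<Longrightarrow> inv_mor DB (bt (\<Xi> X) (\<Xi> Y)) (\<Xi> (X \<bullet> Y)) (J X Y) = ji X Y"
  by (rule D.inv_mor_eq[OF _ _ J_inverse]) (simp_all add: pb.BMod_simps lmod_Xi hmod_ht pb.lmod_bt)

lemma iso_J: "hmod X \<Longrightarrow> hmod Y \<Longrightarrow> iso_mor DB (bt (\<Xi> X) (\<Xi> Y)) (\<Xi> (X \<bullet> Y)) (J X Y)"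
  and iso_ji: "hmod X \<Longrightarrow> hmod Y \<Longrightarrow> iso_mor DB (\<Xi> (X \<bullet> Y)) (bt (\<Xi> X) (\<Xi> Y)) (ji X Y)"
  using J_inverse by (auto simp: iso_mor_def inverse_pair_def)

lemma ji_hom: "hmod X \<Longrightarrow> hmod Y \<Longrightarrow> ji X Y \<in> bhom (\<Xi> (X \<bullet> Y)) (bt (\<Xi> X) (\<Xi> Y))"
  using D.iso_mor_hom[OF iso_ji] by (simp add: pb.BMod_simps)

lemma bp_XL_closed: "hmod X \<Longrightarrow> hmod Y \<Longrightarrow> v \<in> carrier (XL X) \<Longrightarrow> w \<in> carrier (XL Y) \<Longrightarrow>
    bp (\<Xi> X) (\<Xi> Y) v w \<in> carrier (bt (\<Xi> X) (\<Xi> Y))"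
  by (rule pb.bp_closed[OF lmod_Xi lmod_Xi]) (simp_all add: Xi_simps)

lemma ji_JF:
  assumes X: "hmod X" and Y: "hmod Y" and v: "v \<in> carrier (XL X)" and w: "w \<in> carrier (XL Y)"
  shows "ji X Y (JF X Y v w) = bp (\<Xi> X) (\<Xi> Y) v w"
proof -
  have "Comp DB (bt (\<Xi> X) (\<Xi> Y)) (\<Xi> (X \<bullet> Y)) (bt (\<Xi> X) (\<Xi> Y)) (J X Y) (ji X Y) (bp (\<Xi> X) (\<Xi> Y) v w) =
    Ident DB (bt (\<Xi> X) (\<Xi> Y)) (bp (\<Xi> X) (\<Xi> Y) v w)"
    using J_inverse[OF X Y] by (simp add: inverse_pair_def)
  thus ?thesis
    using bp_XL_closed[OF assms] by (simp add: pb.comp_apply J_pure[OF X Y v w] pb.BMod_simps(3))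
qed

lemma J_ji: assumes X: "hmod X" and Y: "hmod Y" and s: "s \<in> carrier (XL (X \<bullet> Y))" shows "J X Y (ji X Y s) = s"
proof -
  have s': "s \<in> carrier (\<Xi> (X \<bullet> Y))" using s by (simp add: Xi_simps hmod_ht X Y)
  have "Comp DB (\<Xi> (X \<bullet> Y)) (bt (\<Xi> X) (\<Xi> Y)) (\<Xi> (X \<bullet> Y)) (ji X Y) (J X Y) s = Ident DB (\<Xi> (X \<bullet> Y)) s"
    using J_inverse[OF X Y] by (simp add: inverse_pair_def)
  thus ?thesis using s' by (simp add: pb.comp_apply pb.BMod_simps(3))
qed

text \<open>\<open>X \<otimes> Y \<otimes> L\<close> is generated by the elements \<^term>\<open>JF X Y v w\<close>, which play the role of
  the pure tensors in the full subcategory.\<close>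

lemma JF_gen:
  assumes X: "hmod X" and Y: "hmod Y" and A: "abelian_group A"
    and f: "additive_on (XL (X \<bullet> Y)) A f" and g: "additive_on (XL (X \<bullet> Y)) A g"
    and s: "s \<in> carrier (XL (X \<bullet> Y))"
    and eq: "\<And>v w. v \<in> carrier (XL X) \<Longrightarrow> w \<in> carrier (XL Y) \<Longrightarrow> f (JF X Y v w) = g (JF X Y v w)"
  shows "f s = g s"
proof -
  have J: "additive_on (bt (\<Xi> X) (\<Xi> Y)) (XL (X \<bullet> Y)) (J X Y)"
    using J_additive[OF X Y] by (simp add: additive_on_def Xi_simps hmod_ht X Y)
  have "f (J X Y (ji X Y s)) = g (J X Y (ji X Y s))"
    by (rule pb.bt_eqI[OF lmod_Xi[OF X] lmod_Xi[OF Y] A additive_on_comp[OF J f] additive_on_comp[OF J g] ji_closed[OF X Y s]])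
      (use eq in \<open>auto simp: J_pure[OF X Y] Xi_simps X Y\<close>)
  thus ?thesis using J_ji[OF X Y s] by simp
qed

lemma Xi_hom_additive: "hmod X \<Longrightarrow> f \<in> bhom (\<Xi> X) N \<Longrightarrow> additive_on (XL X) N f"
  using left_module_hom_additive[of f B "\<Xi> X" N] by (simp add: additive_on_def Xi_simps)

lemma JF_hom_eqI:
  assumes X: "hmod X" and Y: "hmod Y" and N: "left_module B N"
    and f: "f \<in> bhom (\<Xi> (X \<bullet> Y)) N" and g: "g \<in> bhom (\<Xi> (X \<bullet> Y)) N"
    and eq: "\<And>v w. v \<in> carrier (XL X) \<Longrightarrow> w \<in> carrier (XL Y) \<Longrightarrow> f (JF X Y v w) = g (JF X Y v w)"
  shows "f = g"
  by (rule left_module_hom_eqI[OF f g], rule JF_gen[OF X Y left_module_group[OF N]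
      Xi_hom_additive[OF hmod_ht[OF X Y] f] Xi_hom_additive[OF hmod_ht[OF X Y] g]])
    (use eq in \<open>simp_all add: Xi_simps hmod_ht X Y\<close>)

lemma JF_additive_left: "hmod X \<Longrightarrow> hmod Y \<Longrightarrow> w \<in> carrier (XL Y) \<Longrightarrow> additive_on (XL X) (XL (X \<bullet> Y)) (\<lambda>v. JF X Y v w)"
  using k_linear_additive[OF lin_JF_left[OF _ _ k_linear_id]] by (simp add: additive_on_def)

lemma JF_hom_eqI3:
  assumes X: "hmod X" and Y: "hmod Y" and Z: "hmod Z" and N: "left_module B N"
    and f: "f \<in> bhom (\<Xi> ((X \<bullet> Y) \<bullet> Z)) N" and g: "g \<in> bhom (\<Xi> ((X \<bullet> Y) \<bullet> Z)) N"
    and eq: "\<And>x v w. x \<in> carrier (XL X) \<Longrightarrow> v \<in> carrier (XL Y) \<Longrightarrow> w \<in> carrier (XL Z) \<Longrightarrow>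
      f (JF (X \<bullet> Y) Z (JF X Y x v) w) = g (JF (X \<bullet> Y) Z (JF X Y x v) w)"
  shows "f = g"
proof (rule JF_hom_eqI[OF hmod_ht[OF X Y] Z N f g])
  note XY = hmod_ht[OF X Y] and h = hmod_ht[OF hmod_ht[OF X Y] Z]
  fix s w assume s: "s \<in> carrier (XL (X \<bullet> Y))" and w: "w \<in> carrier (XL Z)"
  note a = JF_additive_left[OF XY Z w]
  show "f (JF (X \<bullet> Y) Z s w) = g (JF (X \<bullet> Y) Z s w)"
    by (rule JF_gen[OF X Y left_module_group[OF N] additive_on_comp[OF a Xi_hom_additive[OF h f]]
          additive_on_comp[OF a Xi_hom_additive[OF h g]] s eq[OF _ _ w]])
qed

lemma JF_hom_eqI4:
  assumes W: "hmod W" and X: "hmod X" and Y: "hmod Y" and Z: "hmod Z" and N: "left_module B N"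
    and f: "f \<in> bhom (\<Xi> (((W \<bullet> X) \<bullet> Y) \<bullet> Z)) N" and g: "g \<in> bhom (\<Xi> (((W \<bullet> X) \<bullet> Y) \<bullet> Z)) N"
    and eq: "\<And>t x v w. t \<in> carrier (XL W) \<Longrightarrow> x \<in> carrier (XL X) \<Longrightarrow> v \<in> carrier (XL Y) \<Longrightarrow> w \<in> carrier (XL Z) \<Longrightarrow>
      f (JF ((W \<bullet> X) \<bullet> Y) Z (JF (W \<bullet> X) Y (JF W X t x) v) w) = g (JF ((W \<bullet> X) \<bullet> Y) Z (JF (W \<bullet> X) Y (JF W X t x) v) w)"
  shows "f = g"
proof (rule JF_hom_eqI3[OF hmod_ht[OF W X] Y Z N f g])
  note WX = hmod_ht[OF W X]
  note WXY = hmod_ht[OF WX Y]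
  note h = hmod_ht[OF WXY Z]
  fix s v w assume s: "s \<in> carrier (XL (W \<bullet> X))" and v: "v \<in> carrier (XL Y)" and w: "w \<in> carrier (XL Z)"
  note a = additive_on_comp[OF JF_additive_left[OF WX Y v] JF_additive_left[OF WXY Z w]]
  show "f (JF ((W \<bullet> X) \<bullet> Y) Z (JF (W \<bullet> X) Y s v) w) = g (JF ((W \<bullet> X) \<bullet> Y) Z (JF (W \<bullet> X) Y s v) w)"
    by (rule JF_gen[OF W X left_module_group[OF N] additive_on_comp[OF a Xi_hom_additive[OF h f]]
          additive_on_comp[OF a Xi_hom_additive[OF h g]] s eq[OF _ _ v w]])
qed

lemma bhom_XL_closed: "hmod X \<Longrightarrow> hmod Y \<Longrightarrow> f \<in> bhom (\<Xi> X) (\<Xi> Y) \<Longrightarrow> v \<in> carrier (XL X) \<Longrightarrow> f v \<in> carrier (XL Y)"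
  using left_module_hom_closed[of f B "\<Xi> X" "\<Xi> Y" v] by (simp add: Xi_simps)

lemma objD: "hmod X \<Longrightarrow> \<Xi> X \<in> Obj DB" "hmod X \<Longrightarrow> hmod Y \<Longrightarrow> bt (\<Xi> X) (\<Xi> Y) \<in> Obj DB"
  "M \<in> Obj DB \<Longrightarrow> N \<in> Obj DB \<Longrightarrow> bt M N \<in> Obj DB" "BU \<in> Obj DB"
  by (simp_all add: pb.BMod_simps lmod_Xi pb.lmod_bt lmod_BU)

section \<open>The tensor product of morphisms in the full subcategory\<close>

lemma M0_tmor:
  "tmor M0 (ob X) (ob X') (ob Y) (ob Y') f g =
     Comp DB (\<Xi> (X \<bullet> Y)) (bt (\<Xi> X) (\<Xi> Y)) (\<Xi> (X' \<bullet> Y'))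
       (inv_mor DB (bt (\<Xi> X) (\<Xi> Y)) (\<Xi> (X \<bullet> Y)) (J X Y))
       (Comp DB (bt (\<Xi> X) (\<Xi> Y)) (bt (\<Xi> X') (\<Xi> Y')) (\<Xi> (X' \<bullet> Y')) (tmor DB (\<Xi> X) (\<Xi> X') (\<Xi> Y) (\<Xi> Y') f g) (J X' Y'))"
  by (simp add: Mod_0_def full_subcategory_on_def pb.BMod_simps)

context
  fixes X X' Y Y' f g
  assumes h: "hmod X" "hmod X'" "hmod Y" "hmod Y'"
    and f: "f \<in> bhom (\<Xi> X) (\<Xi> X')" and g: "g \<in> bhom (\<Xi> Y) (\<Xi> Y')"
begin

lemma M0_tmor_hom: "tmor M0 (ob X) (ob X') (ob Y) (ob Y') f g \<in> bhom (\<Xi> (X \<bullet> Y)) (\<Xi> (X' \<bullet> Y'))"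
proof -
  note t = pb.tmor_hom[OF lmod_Xi[OF h(1)] lmod_Xi[OF h(2)] lmod_Xi[OF h(3)] lmod_Xi[OF h(4)] f g]
  show ?thesis
    unfolding M0_tmor inv_J[OF h(1,3)] pb.BMod_simps
    by (rule left_module_hom_compose[OF ji_hom[OF h(1,3)] left_module_hom_compose[OF t J_hom[OF h(2,4)]]])
      (simp_all add: h lmod_Xi hmod_ht pb.lmod_bt)
qed

text \<open>The conjugating identifications cancel against \<open>JF\<close>, so the formula is that
  of a tensor product of maps on pure tensors.\<close>

lemma M0_tmor_JF:
  assumes v: "v \<in> carrier (XL X)" and w: "w \<in> carrier (XL Y)"
  shows "tmor M0 (ob X) (ob X') (ob Y) (ob Y') f g (JF X Y v w) = JF X' Y' (f v) (g w)"
proof -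
  have 1: "JF X Y v w \<in> carrier (\<Xi> (X \<bullet> Y))" using JF_closed[OF h(1,3) v w] by (simp add: Xi_simps hmod_ht h)
  have v': "v \<in> carrier (\<Xi> X)" "w \<in> carrier (\<Xi> Y)" using v w by (simp_all add: Xi_simps h)
  show ?thesis
    unfolding M0_tmor inv_J[OF h(1,3)]
    by (simp add: pb.comp_apply[OF 1] ji_JF[OF h(1,3) v w] pb.comp_apply bp_XL_closed[OF h(1,3) v w]
        pb.tmor_pure[OF lmod_Xi[OF h(1)] lmod_Xi[OF h(2)] lmod_Xi[OF h(3)] lmod_Xi[OF h(4)] f g v']
        J_pure[OF h(2,4)] bhom_XL_closed[OF h(1,2) f v] bhom_XL_closed[OF h(3,4) g w])
qed

end

lemma id_hom: "hmod X \<Longrightarrow> (\<lambda>x\<in>carrier (\<Xi> X). x) \<in> bhom (\<Xi> X) (\<Xi> X)"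
  by (rule left_module_hom_ident[OF lmod_Xi])

section \<open>The associativity constraint in the full subcategory\<close>

context
  fixes X Y Z :: "('a univ, 'a univ) module"
  assumes X: "hmod X" and Y: "hmod Y" and Z: "hmod Z"
begin

lemma M0_assoc:
  "assoc M0 (ob X) (ob Y) (ob Z) =
    Comp DB (\<Xi> ((X \<bullet> Y) \<bullet> Z)) (bt (\<Xi> (X \<bullet> Y)) (\<Xi> Z)) (\<Xi> (X \<bullet> (Y \<bullet> Z))) (ji (X \<bullet> Y) Z)
      (Comp DB (bt (\<Xi> (X \<bullet> Y)) (\<Xi> Z)) (bt (bt (\<Xi> X) (\<Xi> Y)) (\<Xi> Z)) (\<Xi> (X \<bullet> (Y \<bullet> Z)))
        (tmor DB (\<Xi> (X \<bullet> Y)) (bt (\<Xi> X) (\<Xi> Y)) (\<Xi> Z) (\<Xi> Z) (ji X Y) (Ident DB (\<Xi> Z)))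
        (Comp DB (bt (bt (\<Xi> X) (\<Xi> Y)) (\<Xi> Z)) (bt (\<Xi> X) (bt (\<Xi> Y) (\<Xi> Z))) (\<Xi> (X \<bullet> (Y \<bullet> Z)))
          (assoc DB (\<Xi> X) (\<Xi> Y) (\<Xi> Z))
          (Comp DB (bt (\<Xi> X) (bt (\<Xi> Y) (\<Xi> Z))) (bt (\<Xi> X) (\<Xi> (Y \<bullet> Z))) (\<Xi> (X \<bullet> (Y \<bullet> Z)))
            (tmor DB (\<Xi> X) (\<Xi> X) (bt (\<Xi> Y) (\<Xi> Z)) (\<Xi> (Y \<bullet> Z)) (Ident DB (\<Xi> X)) (J Y Z))
            (J X (Y \<bullet> Z)))))"
  unfolding inv_J[OF X Y, symmetric] inv_J[OF hmod_ht[OF X Y] Z, symmetric]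
  by (simp add: Mod_0_def full_subcategory_on_def pb.BMod_simps(5))

text \<open>The constraint is a composite of five isomorphisms; its membership in the hom set is
  read off from this too.\<close>

lemma M0_assoc_iso: "iso_mor DB (\<Xi> ((X \<bullet> Y) \<bullet> Z)) (\<Xi> (X \<bullet> (Y \<bullet> Z))) (assoc M0 (ob X) (ob Y) (ob Z))"
proof -
  note XY = hmod_ht[OF X Y] and YZ = hmod_ht[OF Y Z]
  have o: "\<Xi> X \<in> Obj DB" "\<Xi> Y \<in> Obj DB" "\<Xi> Z \<in> Obj DB" "\<Xi> (X \<bullet> Y) \<in> Obj DB" "\<Xi> (Y \<bullet> Z) \<in> Obj DB"
    "\<Xi> ((X \<bullet> Y) \<bullet> Z) \<in> Obj DB" "\<Xi> (X \<bullet> (Y \<bullet> Z)) \<in> Obj DB"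
    by (intro objD hmod_ht X Y Z)+
  note oo = objD(3)[OF o(1,2)] objD(3)[OF o(2,3)]
  note t = D.iso_mor_tmor[unfolded pb.BMod_simps(5)]
  show ?thesis
    unfolding M0_assoc
    by (intro D.iso_mor_comp iso_J iso_ji t D.iso_mor_ident D.assoc_iso[unfolded pb.BMod_simps(5)] o oo objD(3) X Y Z XY YZ)
qed

lemma M0_assoc_hom: "assoc M0 (ob X) (ob Y) (ob Z) \<in> bhom (\<Xi> ((X \<bullet> Y) \<bullet> Z)) (\<Xi> (X \<bullet> (Y \<bullet> Z)))"
  using D.iso_mor_hom[OF M0_assoc_iso] by (simp add: pb.BMod_simps)

lemma M0_assoc_JF:
  assumes x: "x \<in> carrier (XL X)" and v: "v \<in> carrier (XL Y)" and w: "w \<in> carrier (XL Z)"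
  shows "assoc M0 (ob X) (ob Y) (ob Z) (JF (X \<bullet> Y) Z (JF X Y x v) w) = JF X (Y \<bullet> Z) x (JF Y Z v w)"
proof -
  note XY = hmod_ht[OF X Y] and YZ = hmod_ht[OF Y Z]
  note b = lmod_Xi[OF X] lmod_Xi[OF Y] lmod_Xi[OF Z] and bXY = lmod_Xi[OF XY] and bYZ = lmod_Xi[OF YZ]
  note tXY = pb.lmod_bt[OF b(1,2)] and tYZ = pb.lmod_bt[OF b(2,3)]
  have c: "x \<in> carrier (\<Xi> X)" "v \<in> carrier (\<Xi> Y)" "w \<in> carrier (\<Xi> Z)" using x v w by (simp_all add: Xi_simps X Y Z)
  note uv = JF_closed[OF X Y x v] and vw = JF_closed[OF Y Z v w]
  have uv': "JF X Y x v \<in> carrier (\<Xi> (X \<bullet> Y))" using uv by (simp add: Xi_simps XY)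
  have 1: "JF (X \<bullet> Y) Z (JF X Y x v) w \<in> carrier (\<Xi> ((X \<bullet> Y) \<bullet> Z))"
    using JF_closed[OF XY Z uv w] by (simp add: Xi_simps hmod_ht XY Z)
  note p2 = pb.bp_closed[OF tXY b(3) pb.bp_closed[OF b(1,2) c(1,2)] c(3)]
  note p3 = pb.bp_closed[OF b(1) tYZ c(1) pb.bp_closed[OF b(2,3) c(2,3)]]
  show ?thesis
    unfolding M0_assoc pb.comp_apply[OF 1] ji_JF[OF XY Z uv w] pb.comp_apply[OF bp_XL_closed[OF XY Z uv w]]
      pb.BMod_simps(3) pb.tmor_pure[OF bXY tXY b(3) b(3) ji_hom[OF X Y] id_hom[OF Z] uv' c(3)]
      ji_JF[OF X Y x v] restrict_apply'[OF c(3)]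
      pb.comp_apply[OF p2] pb.assoc_pure[OF b c] pb.comp_apply[OF p3]
      pb.tmor_pure[OF b(1) b(1) tYZ bYZ id_hom[OF X] J_hom[OF Y Z] c(1) pb.bp_closed[OF b(2,3) c(2,3)]]
      restrict_apply'[OF c(1)] J_pure[OF Y Z v w] J_pure[OF X YZ x vw] ..
qed

end

section \<open>The unit constraints in the full subcategory\<close>

lemma inv_J0_apply: "l \<in> carrier L \<Longrightarrow> inv_mor DB BU (\<Xi> hU) J0 (J0 l) = l"
proof -
  assume l: "l \<in> carrier L"
  note o = objD(4) objD(1)[OF hmod_hU]
  have "iso_mor DB BU (\<Xi> hU) J0" using J0_inverse by (auto simp: iso_mor_def)
  from D.inv_mor_iso(1)[OF o this]
  have "Comp DB BU (\<Xi> hU) BU J0 (inv_mor DB BU (\<Xi> hU) J0) l = Ident DB BU l" by (simp add: inverse_pair_def)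
  thus ?thesis using l by (simp add: pb.comp_apply pb.BMod_simps(3))
qed

lemma iso_inv_J0: "iso_mor DB (\<Xi> hU) BU (inv_mor DB BU (\<Xi> hU) J0)"
  using J0_inverse by (intro D.inv_mor_iso(2) objD hmod_hU) (auto simp: iso_mor_def)

text \<open>Morphisms out of a tensor product with the unit object need to be compared only at
  elements of the form \<open>J0 l\<close>, where the unit constraints are explicit.\<close>

lemma J0_surj: "v \<in> carrier (XL hU) \<Longrightarrow> \<exists>l\<in>carrier L. v = J0 l"
proof -
  assume v: "v \<in> carrier (XL hU)"
  let ?g = "(\<lambda>t\<in>carrier (\<Xi> hU). tsum L (\<lambda>c l. c \<odot>\<^bsub>L\<^esub> l) t)"
  have v': "v \<in> carrier (\<Xi> hU)" using v by (simp add: Xi_simps hmod_hU)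
  have "Comp DB (\<Xi> hU) BU (\<Xi> hU) ?g J0 v = Ident DB (\<Xi> hU) v" "?g \<in> bhom (\<Xi> hU) BU"
    using J0_inverse by (simp_all add: inverse_pair_def pb.BMod_simps)
  thus ?thesis using left_module_hom_closed[of ?g B "\<Xi> hU" BU v, OF _ v']
    unfolding pb.comp_apply[OF v'] pb.BMod_simps(3) restrict_apply'[OF v'] pb.bunit_simps by metis
qed

context
  fixes X :: "('a univ, 'a univ) module" assumes X: "hmod X"
begin

lemma M0_lunit:
  "lunit M0 (ob X) = Comp DB (\<Xi> (hU \<bullet> X)) (bt (\<Xi> hU) (\<Xi> X)) (\<Xi> X) (ji hU X)
     (Comp DB (bt (\<Xi> hU) (\<Xi> X)) (bt BU (\<Xi> X)) (\<Xi> X)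
       (tmor DB (\<Xi> hU) BU (\<Xi> X) (\<Xi> X) (inv_mor DB BU (\<Xi> hU) J0) (Ident DB (\<Xi> X))) (lunit DB (\<Xi> X)))"
  unfolding inv_J[OF hmod_hU X, symmetric]
  by (simp add: Mod_0_def full_subcategory_on_def pb.BMod_simps(5,6))

lemma M0_runit:
  "runit M0 (ob X) = Comp DB (\<Xi> (X \<bullet> hU)) (bt (\<Xi> X) (\<Xi> hU)) (\<Xi> X) (ji X hU)
     (Comp DB (bt (\<Xi> X) (\<Xi> hU)) (bt (\<Xi> X) BU) (\<Xi> X)
       (tmor DB (\<Xi> X) (\<Xi> X) (\<Xi> hU) BU (Ident DB (\<Xi> X)) (inv_mor DB BU (\<Xi> hU) J0)) (runit DB (\<Xi> X)))"
  unfolding inv_J[OF X hmod_hU, symmetric]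
  by (simp add: Mod_0_def full_subcategory_on_def pb.BMod_simps(5,6))

lemma M0_lunit_iso: "iso_mor DB (\<Xi> (hU \<bullet> X)) (\<Xi> X) (lunit M0 (ob X))"
  unfolding M0_lunit
  by (intro D.iso_mor_comp iso_ji D.iso_mor_tmor[unfolded pb.BMod_simps(5)] D.iso_mor_ident
      D.lunit_iso[unfolded pb.BMod_simps(5,6)] objD iso_inv_J0 hmod_ht hmod_hU X)

lemma M0_runit_iso: "iso_mor DB (\<Xi> (X \<bullet> hU)) (\<Xi> X) (runit M0 (ob X))"
  unfolding M0_runit
  by (intro D.iso_mor_comp iso_ji D.iso_mor_tmor[unfolded pb.BMod_simps(5)] D.iso_mor_ident
      D.runit_iso[unfolded pb.BMod_simps(5,6)] objD iso_inv_J0 hmod_ht hmod_hU X)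

lemma M0_lunit_hom: "lunit M0 (ob X) \<in> bhom (\<Xi> (hU \<bullet> X)) (\<Xi> X)"
  using D.iso_mor_hom[OF M0_lunit_iso] by (simp add: pb.BMod_simps)

lemma M0_runit_hom: "runit M0 (ob X) \<in> bhom (\<Xi> (X \<bullet> hU)) (\<Xi> X)"
  using D.iso_mor_hom[OF M0_runit_iso] by (simp add: pb.BMod_simps)

lemma inv_J0_hom: "inv_mor DB BU (\<Xi> hU) J0 \<in> bhom (\<Xi> hU) BU"
  using D.iso_mor_hom[OF iso_inv_J0] by (simp add: pb.BMod_simps)

lemma M0_lunit_JF:
  assumes l: "l \<in> carrier L" and v: "v \<in> carrier (XL X)"
  shows "lunit M0 (ob X) (JF hU X (J0 l) v) = la X l v"
proof -
  note b = lmod_Xi[OF hmod_hU] lmod_Xi[OF X]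
  have c: "J0 l \<in> carrier (\<Xi> hU)" "v \<in> carrier (\<Xi> X)" using J0_closed[OF l] v by (simp_all add: Xi_simps hmod_hU X)
  have 1: "JF hU X (J0 l) v \<in> carrier (\<Xi> (hU \<bullet> X))"
    using JF_closed[OF hmod_hU X J0_closed[OF l] v] by (simp add: Xi_simps hmod_ht hmod_hU X)
  have "lunit M0 (ob X) (JF hU X (J0 l) v) = src B l \<odot>\<^bsub>\<Xi> X\<^esub> v"
    unfolding M0_lunit pb.comp_apply[OF 1] ji_JF[OF hmod_hU X J0_closed[OF l] v]
      pb.comp_apply[OF bp_XL_closed[OF hmod_hU X J0_closed[OF l] v]] pb.BMod_simps(3)
      pb.tmor_pure[OF b(1) lmod_BU b(2) b(2) inv_J0_hom id_hom[OF X] c] inv_J0_apply[OF l] restrict_apply'[OF c(2)]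
    by (rule pb.lunit_pure[OF b(2) l c(2)])
  thus ?thesis by (simp add: Xi_src[OF X l v])
qed

lemma M0_runit_JF:
  assumes l: "l \<in> carrier L" and v: "v \<in> carrier (XL X)"
  shows "runit M0 (ob X) (JF X hU v (J0 l)) = ra X v l"
proof -
  note b = lmod_Xi[OF X] lmod_Xi[OF hmod_hU]
  have c: "v \<in> carrier (\<Xi> X)" "J0 l \<in> carrier (\<Xi> hU)" using J0_closed[OF l] v by (simp_all add: Xi_simps hmod_hU X)
  have 1: "JF X hU v (J0 l) \<in> carrier (\<Xi> (X \<bullet> hU))"
    using JF_closed[OF X hmod_hU v J0_closed[OF l]] by (simp add: Xi_simps hmod_ht hmod_hU X)
  have "runit M0 (ob X) (JF X hU v (J0 l)) = tgt B l \<odot>\<^bsub>\<Xi> X\<^esub> v"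
    unfolding M0_runit pb.comp_apply[OF 1] ji_JF[OF X hmod_hU v J0_closed[OF l]]
      pb.comp_apply[OF bp_XL_closed[OF X hmod_hU v J0_closed[OF l]]] pb.BMod_simps(3)
      pb.tmor_pure[OF b(1) b(1) b(2) lmod_BU id_hom[OF X] inv_J0_hom c] inv_J0_apply[OF l] restrict_apply'[OF c(1)]
    by (rule pb.runit_pure[OF b(1) l c(1)])
  thus ?thesis by (simp add: Xi_tgt[OF X l v])
qed

end

lemma bhom_la: "hmod X \<Longrightarrow> hmod Y \<Longrightarrow> f \<in> bhom (\<Xi> X) (\<Xi> Y) \<Longrightarrow> l \<in> carrier L \<Longrightarrow> v \<in> carrier (XL X) \<Longrightarrow>
    f (la X l v) = la Y l (f v)"
  using left_module_hom_smult[of f B "\<Xi> X" "\<Xi> Y" "src B l" v] bhom_XL_closed[of X Y f v]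
  by (simp add: Xi_src Xi_simps)

lemma bhom_ra: "hmod X \<Longrightarrow> hmod Y \<Longrightarrow> f \<in> bhom (\<Xi> X) (\<Xi> Y) \<Longrightarrow> l \<in> carrier L \<Longrightarrow> v \<in> carrier (XL X) \<Longrightarrow>
    f (ra X v l) = ra Y (f v) l"
  using left_module_hom_smult[of f B "\<Xi> X" "\<Xi> Y" "tgt B l" v] bhom_XL_closed[of X Y f v]
  by (simp add: Xi_tgt Xi_simps)

section \<open>The monoidal axioms of the full subcategory\<close>

lemma category_M0: "category M0"
proof (rule category.intro, goal_cases)
  case (1 X) thus ?case using D.ident objD(1) by (auto simp: M0_simps pb.BMod_simps(2))
next
  case (2 X Y Z f g) thus ?case using D.comp objD(1) by (auto simp: M0_simps pb.BMod_simps(2))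
next
  case (3 X Y f) thus ?case using D.comp_ident_left objD(1) by (auto simp: M0_simps pb.BMod_simps(2))
next
  case (4 X Y f) thus ?case using D.comp_ident_right objD(1) by (auto simp: M0_simps pb.BMod_simps(2))
next
  case (5 W X Y Z f g h)
  then obtain W' X' Y' Z' where o: "W = ob W'" "X = ob X'" "Y = ob Y'" "Z = ob Z'"
    and h: "hmod W'" "hmod X'" "hmod Y'" "hmod Z'" by (auto simp: M0_simps)
  show ?case using D.comp_assoc[OF objD(1)[OF h(1)] objD(1)[OF h(2)] objD(1)[OF h(3)] objD(1)[OF h(4)]] 5(5-7)
    by (simp add: o M0_simps pb.BMod_simps(2))
qed

lemma M0_ident: "hmod X \<Longrightarrow> s \<in> carrier (XL X) \<Longrightarrow> Ident M0 (ob X) s = s"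
  by (simp add: M0_simps(3) pb.BMod_simps(3) Xi_simps)

lemma M0_ident_hom: "hmod X \<Longrightarrow> Ident M0 (ob X) \<in> bhom (\<Xi> X) (\<Xi> X)"
  by (simp add: M0_simps(3) pb.BMod_simps(3) id_hom)

lemma M0_comp: "hmod X \<Longrightarrow> s \<in> carrier (XL X) \<Longrightarrow> Comp M0 (ob X) (ob Y) (ob Z) f g s = g (f s)"
  by (simp add: M0_simps(4) pb.comp_apply Xi_simps)

lemma M0_comp_hom: "hmod X \<Longrightarrow> hmod Y \<Longrightarrow> hmod Z \<Longrightarrow> f \<in> bhom (\<Xi> X) (\<Xi> Y) \<Longrightarrow> g \<in> bhom (\<Xi> Y) (\<Xi> Z) \<Longrightarrow>
    Comp M0 (ob X) (ob Y) (ob Z) f g \<in> bhom (\<Xi> X) (\<Xi> Z)"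
  using category.comp[OF category_M0, of "ob X" "ob Y" "ob Z" f g] by (simp add: M0_simps(1,2))

lemmas M0s = M0_comp_hom M0_ident_hom M0_tmor_hom M0_assoc_hom M0_lunit_hom M0_runit_hom hmod_ht hmod_hU lmod_Xi
  M0_comp M0_ident M0_tmor_JF M0_assoc_JF M0_lunit_JF M0_runit_JF JF_closed la_closed ra_closed

lemma M0_tmor_ident:
  assumes h: "hmod X" "hmod Y"
  shows "tmor M0 (ob X) (ob X) (ob Y) (ob Y) (Ident M0 (ob X)) (Ident M0 (ob Y)) = Ident M0 (ob (X \<bullet> Y))"
  by (rule JF_hom_eqI[OF h lmod_Xi[OF hmod_ht[OF h]]]) (simp_all add: h M0s)

lemma M0_tmor_comp:
  assumes h: "hmod X" "hmod X'" "hmod X''" "hmod Y" "hmod Y'" "hmod Y''"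
    and f: "f \<in> bhom (\<Xi> X) (\<Xi> X')" "f' \<in> bhom (\<Xi> X') (\<Xi> X'')"
    and g: "g \<in> bhom (\<Xi> Y) (\<Xi> Y')" "g' \<in> bhom (\<Xi> Y') (\<Xi> Y'')"
  shows "tmor M0 (ob X) (ob X'') (ob Y) (ob Y'') (Comp M0 (ob X) (ob X') (ob X'') f f') (Comp M0 (ob Y) (ob Y') (ob Y'') g g') =
    Comp M0 (ob (X \<bullet> Y)) (ob (X' \<bullet> Y')) (ob (X'' \<bullet> Y'')) (tmor M0 (ob X) (ob X') (ob Y) (ob Y') f g)
      (tmor M0 (ob X') (ob X'') (ob Y') (ob Y'') f' g')"
  by (rule JF_hom_eqI[OF h(1,4) lmod_Xi[OF hmod_ht[OF h(3,6)]]])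
    (simp_all add: h f g M0s bhom_XL_closed[OF h(1,2) f(1)] bhom_XL_closed[OF h(4,5) g(1)])

lemma M0_assoc_natural:
  assumes h: "hmod X" "hmod X'" "hmod Y" "hmod Y'" "hmod Z" "hmod Z'"
    and f: "f \<in> bhom (\<Xi> X) (\<Xi> X')" and g: "g \<in> bhom (\<Xi> Y) (\<Xi> Y')" and k: "k \<in> bhom (\<Xi> Z) (\<Xi> Z')"
  shows "Comp M0 (ob ((X \<bullet> Y) \<bullet> Z)) (ob ((X' \<bullet> Y') \<bullet> Z')) (ob (X' \<bullet> (Y' \<bullet> Z')))
      (tmor M0 (ob (X \<bullet> Y)) (ob (X' \<bullet> Y')) (ob Z) (ob Z') (tmor M0 (ob X) (ob X') (ob Y) (ob Y') f g) k)
      (assoc M0 (ob X') (ob Y') (ob Z')) =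
    Comp M0 (ob ((X \<bullet> Y) \<bullet> Z)) (ob (X \<bullet> (Y \<bullet> Z))) (ob (X' \<bullet> (Y' \<bullet> Z'))) (assoc M0 (ob X) (ob Y) (ob Z))
      (tmor M0 (ob X) (ob X') (ob (Y \<bullet> Z)) (ob (Y' \<bullet> Z')) f (tmor M0 (ob Y) (ob Y') (ob Z) (ob Z') g k))"
  by (rule JF_hom_eqI3[OF h(1,3,5) lmod_Xi[OF hmod_ht[OF h(2) hmod_ht[OF h(4,6)]]]])
    (simp_all add: h f g k M0s bhom_XL_closed[OF h(1,2) f] bhom_XL_closed[OF h(3,4) g] bhom_XL_closed[OF h(5,6) k])

lemma M0_pentagon:
  assumes h: "hmod W" "hmod X" "hmod Y" "hmod Z"
  shows "Comp M0 (ob (((W \<bullet> X) \<bullet> Y) \<bullet> Z)) (ob ((W \<bullet> X) \<bullet> (Y \<bullet> Z))) (ob (W \<bullet> (X \<bullet> (Y \<bullet> Z))))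
      (assoc M0 (ob (W \<bullet> X)) (ob Y) (ob Z)) (assoc M0 (ob W) (ob X) (ob (Y \<bullet> Z))) =
    Comp M0 (ob (((W \<bullet> X) \<bullet> Y) \<bullet> Z)) (ob ((W \<bullet> (X \<bullet> Y)) \<bullet> Z)) (ob (W \<bullet> (X \<bullet> (Y \<bullet> Z))))
      (tmor M0 (ob ((W \<bullet> X) \<bullet> Y)) (ob (W \<bullet> (X \<bullet> Y))) (ob Z) (ob Z) (assoc M0 (ob W) (ob X) (ob Y)) (Ident M0 (ob Z)))
      (Comp M0 (ob ((W \<bullet> (X \<bullet> Y)) \<bullet> Z)) (ob (W \<bullet> ((X \<bullet> Y) \<bullet> Z))) (ob (W \<bullet> (X \<bullet> (Y \<bullet> Z))))
        (assoc M0 (ob W) (ob (X \<bullet> Y)) (ob Z))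
        (tmor M0 (ob W) (ob W) (ob ((X \<bullet> Y) \<bullet> Z)) (ob (X \<bullet> (Y \<bullet> Z))) (Ident M0 (ob W)) (assoc M0 (ob X) (ob Y) (ob Z))))"
  by (rule JF_hom_eqI4[OF h lmod_Xi[OF hmod_ht[OF h(1) hmod_ht[OF h(2) hmod_ht[OF h(3,4)]]]]])
    (simp_all add: h M0s)

lemma M0_lunit_natural:
  assumes h: "hmod X" "hmod Y" and f: "f \<in> bhom (\<Xi> X) (\<Xi> Y)"
  shows "Comp M0 (ob (hU \<bullet> X)) (ob (hU \<bullet> Y)) (ob Y) (tmor M0 (ob hU) (ob hU) (ob X) (ob Y) (Ident M0 (ob hU)) f) (lunit M0 (ob Y)) =
    Comp M0 (ob (hU \<bullet> X)) (ob X) (ob Y) (lunit M0 (ob X)) f"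
  by (rule JF_hom_eqI[OF hmod_hU h(1) lmod_Xi[OF h(2)]])
    (auto simp: h f M0s bhom_la[OF h f] bhom_XL_closed[OF h f] dest!: J0_surj)

lemma M0_runit_natural:
  assumes h: "hmod X" "hmod Y" and f: "f \<in> bhom (\<Xi> X) (\<Xi> Y)"
  shows "Comp M0 (ob (X \<bullet> hU)) (ob (Y \<bullet> hU)) (ob Y) (tmor M0 (ob X) (ob Y) (ob hU) (ob hU) f (Ident M0 (ob hU))) (runit M0 (ob Y)) =
    Comp M0 (ob (X \<bullet> hU)) (ob X) (ob Y) (runit M0 (ob X)) f"
  by (rule JF_hom_eqI[OF h(1) hmod_hU lmod_Xi[OF h(2)]])
    (auto simp: h f M0s bhom_ra[OF h f] bhom_XL_closed[OF h f] dest!: J0_surj)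

text \<open>The unit constraints give x \<otimes> (l y) on one side and (x l) \<otimes> y on the
  other; these agree by \<open>JF_balance\<close>.\<close>

lemma M0_triangle:
  assumes h: "hmod X" "hmod Y"
  shows "Comp M0 (ob ((X \<bullet> hU) \<bullet> Y)) (ob (X \<bullet> (hU \<bullet> Y))) (ob (X \<bullet> Y)) (assoc M0 (ob X) (ob hU) (ob Y))
      (tmor M0 (ob X) (ob X) (ob (hU \<bullet> Y)) (ob Y) (Ident M0 (ob X)) (lunit M0 (ob Y))) =
    tmor M0 (ob (X \<bullet> hU)) (ob X) (ob Y) (ob Y) (runit M0 (ob X)) (Ident M0 (ob Y))"
  by (rule JF_hom_eqI3[OF h(1) hmod_hU h(2) lmod_Xi[OF hmod_ht[OF h]]])
    (auto simp: h M0s JF_balance[OF h] dest!: J0_surj)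

theorem monoidal_category_M0: "monoidal_category M0"
proof (intro monoidal_category.intro monoidal_category_axioms.intro category_M0, goal_cases)
  case (1 X Y) thus ?case by (auto simp: M0_simps(1,5) hmod_ht)
next
  case 2 show ?case by (simp add: M0_simps(1,6) hmod_hU)
next
  case (3 X X' Y Y' f g) thus ?case by (auto simp: M0_simps(1,2,5) intro: M0_tmor_hom)
next
  case (4 X Y) thus ?case by (auto simp: M0_simps(1,5) M0_tmor_ident)
next
  case (5 X X' X'' Y Y' Y'' f f' g g') thus ?case by (auto simp: M0_simps(1,2,5) intro: M0_tmor_comp)
next
  case (6 X Y Z) thus ?case by (auto simp: M0_simps(1,5) iso_mor_M0 intro: M0_assoc_iso)
next
  case (7 X X' Y Y' Z Z' f g h) thus ?case by (auto simp: M0_simps(1,2,5) intro: M0_assoc_natural)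
next
  case (8 X) thus ?case by (auto simp: M0_simps(1,5,6) iso_mor_M0 intro: M0_lunit_iso)
next
  case (9 X Y f) thus ?case by (auto simp: M0_simps(1,2,5,6) intro: M0_lunit_natural)
next
  case (10 X) thus ?case by (auto simp: M0_simps(1,5,6) iso_mor_M0 intro: M0_runit_iso)
next
  case (11 X Y f) thus ?case by (auto simp: M0_simps(1,2,5,6) intro: M0_runit_natural)
next
  case (12 W X Y Z) thus ?case by (auto simp: M0_simps(1,2,5) intro: M0_pentagon)
next
  case (13 X Y) thus ?case by (auto simp: M0_simps(1,2,5,6) intro: M0_triangle)
qed

section \<open>The functor on morphisms\<close>

lemma H_hom_lin: "hmod X \<Longrightarrow> f \<in> left_module_hom H X N \<Longrightarrow> lin (r X) (r N) f"
  using module.smult_closed[OF mod_H _ H_closed(3)]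
  by (auto simp: left_module_hom_def k_linear_def additive_on_def restrict_scalars_def)

text \<open>Quasi-commutativity extended from \<open>L\<close> to X \<otimes> L. On x \<otimes> p
  one leg acts on \<open>x\<close> and the next one on \<open>p\<close>; the axiom applied to the
  rest of the coaction turns the product in \<open>L\<close> into left multiplication of
  \<open>p\<close>. Left linearity of the extension of an equivariant map reduces to this.\<close>

lemma co_ra:
  assumes X: "hmod X" and l: "l \<in> carrier L" and m: "m \<in> carrier L" and v: "v \<in> carrier (XL X)"
  shows "co (r (XL X)) l (\<lambda>a n. ra X (a \<odot>\<^bsub>XL X\<^esub> v) (n *\<^sub>L m)) = la X l (ra X v m)"
proof (rule XL_eqI[OF X modXL[OF X] _ _ v])
  let ?A = "r (XL X)"
  note c = linY[OF X] lin_ra_left[OF X] lin_ra_right[OF X] ra_closed[OF X]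
  show "lin ?A ?A (\<lambda>v. co ?A l (\<lambda>a n. ra X (a \<odot>\<^bsub>XL X\<^esub> v) (n *\<^sub>L m)))" "lin ?A ?A (\<lambda>v. la X l (ra X v m))"
    using l m by (auto intro!: c)
  fix x p assume x: "x \<in> carrier X" and p: "p \<in> carrier L"
  have "co ?A l (\<lambda>a n. ra X (a \<odot>\<^bsub>XL X\<^esub> lp X x p) (n *\<^sub>L m)) =
    co ?A l (\<lambda>a n. sw ?A a (\<lambda>c d. lp X (c \<odot>\<^bsub>X\<^esub> x) ((d \<rhd> p) *\<^sub>L (n *\<^sub>L m))))"
  proof (rule co_cong[OF _ l])
    fix a n assume an: "a \<in> carrier H" "n \<in> carrier L"
    have "ra X (a \<odot>\<^bsub>XL X\<^esub> lp X x p) (n *\<^sub>L m) = sw ?A a (\<lambda>c d. ra X (lp X (c \<odot>\<^bsub>X\<^esub> x) (d \<rhd> p)) (n *\<^sub>L m))"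
      unfolding XL_smult_pure[OF X an(1) x p]
      by (rule sw_hom[OF modXL[OF X] modXL[OF X], where f="\<lambda>s. ra X s (n *\<^sub>L m)"]) (use an x p m in \<open>auto intro!: c\<close>)
    thus "ra X (a \<odot>\<^bsub>XL X\<^esub> lp X x p) (n *\<^sub>L m) = sw ?A a (\<lambda>c d. lp X (c \<odot>\<^bsub>X\<^esub> x) ((d \<rhd> p) *\<^sub>L (n *\<^sub>L m)))"
      using an x p m by (simp add: ra_pure[OF X] left_module_closed[OF X] cong: sw_cong)
  qed
  also have "\<dots> = co ?A l (\<lambda>c z. co ?A z (\<lambda>d n. lp X (c \<odot>\<^bsub>X\<^esub> x) ((d \<rhd> p) *\<^sub>L (n *\<^sub>L m))))"
    by (rule co_coassoc) (use l x p m in \<open>auto intro!: c\<close>)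
  also have "\<dots> = co ?A l (\<lambda>c z. lp X (c \<odot>\<^bsub>X\<^esub> x) (z *\<^sub>L (p *\<^sub>L m)))"
  proof (rule co_cong[OF _ l])
    fix a z assume az: "a \<in> carrier H" "z \<in> carrier L"
    have "lp X (a \<odot>\<^bsub>X\<^esub> x) (co L z (\<lambda>d n. (d \<rhd> p) *\<^sub>L n) *\<^sub>L m) =
      co ?A z (\<lambda>d n. lp X (a \<odot>\<^bsub>X\<^esub> x) ((d \<rhd> p) *\<^sub>L n *\<^sub>L m))"
      by (rule co_hom[OF mod_L modXL[OF X], where f="\<lambda>s. lp X (a \<odot>\<^bsub>X\<^esub> x) (s *\<^sub>L m)"]) (use az x p m in \<open>auto intro!: c\<close>)
    thus "co ?A z (\<lambda>d n. lp X (a \<odot>\<^bsub>X\<^esub> x) ((d \<rhd> p) *\<^sub>L (n *\<^sub>L m))) = lp X (a \<odot>\<^bsub>X\<^esub> x) (z *\<^sub>L (p *\<^sub>L m))"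
      using az p m by (simp add: quasi_comm L_assoc cong: co_cong)
  qed
  also have "\<dots> = la X l (ra X (lp X x p) m)"
    using l x p m by (simp add: ra_pure[OF X] la_pure[OF X])
  finally show "co ?A l (\<lambda>a n. ra X (a \<odot>\<^bsub>XL X\<^esub> lp X x p) (n *\<^sub>L m)) = la X l (ra X (lp X x p) m)" .
qed

text \<open>The counterpart for \<open>H\<close>: the right multiplication is equivariant because
  \<open>L\<close> is a module algebra.\<close>

lemma sw_ra:
  assumes X: "hmod X" and h: "h \<in> carrier H" and m: "m \<in> carrier L" and v: "v \<in> carrier (XL X)"
  shows "sw (r (XL X)) h (\<lambda>a b. ra X (a \<odot>\<^bsub>XL X\<^esub> v) (b \<rhd> m)) = h \<odot>\<^bsub>XL X\<^esub> ra X v m"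
proof (rule XL_eqI[OF X modXL[OF X] _ _ v])
  let ?A = "r (XL X)"
  note c = linY[OF X] lin_ra_left[OF X] lin_ra_right[OF X] ra_closed[OF X]
  show "lin ?A ?A (\<lambda>v. sw ?A h (\<lambda>a b. ra X (a \<odot>\<^bsub>XL X\<^esub> v) (b \<rhd> m)))" "lin ?A ?A (\<lambda>v. h \<odot>\<^bsub>XL X\<^esub> ra X v m)"
    using h m by (auto intro!: c)
  fix x p assume x: "x \<in> carrier X" and p: "p \<in> carrier L"
  have "sw ?A h (\<lambda>a b. ra X (a \<odot>\<^bsub>XL X\<^esub> lp X x p) (b \<rhd> m)) =
    sw ?A h (\<lambda>a b. sw ?A a (\<lambda>c d. lp X (c \<odot>\<^bsub>X\<^esub> x) ((d \<rhd> p) *\<^sub>L (b \<rhd> m))))"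
  proof (rule sw_cong[OF _ h])
    fix a b assume ab: "a \<in> carrier H" "b \<in> carrier H"
    have "ra X (a \<odot>\<^bsub>XL X\<^esub> lp X x p) (b \<rhd> m) = sw ?A a (\<lambda>c d. ra X (lp X (c \<odot>\<^bsub>X\<^esub> x) (d \<rhd> p)) (b \<rhd> m))"
      unfolding XL_smult_pure[OF X ab(1) x p]
      by (rule sw_hom[OF modXL[OF X] modXL[OF X], where f="\<lambda>s. ra X s (b \<rhd> m)"]) (use ab x p m in \<open>auto intro!: c\<close>)
    thus "ra X (a \<odot>\<^bsub>XL X\<^esub> lp X x p) (b \<rhd> m) = sw ?A a (\<lambda>c d. lp X (c \<odot>\<^bsub>X\<^esub> x) ((d \<rhd> p) *\<^sub>L (b \<rhd> m)))"
      using ab x p m by (simp add: ra_pure[OF X] left_module_closed[OF X] cong: sw_cong)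
  qed
  also have "\<dots> = sw ?A h (\<lambda>c z. sw ?A z (\<lambda>d b. lp X (c \<odot>\<^bsub>X\<^esub> x) ((d \<rhd> p) *\<^sub>L (b \<rhd> m))))"
    by (rule sw_coassoc) (use h x p m in \<open>auto intro!: c\<close>)
  also have "\<dots> = sw ?A h (\<lambda>c z. lp X (c \<odot>\<^bsub>X\<^esub> x) (z \<rhd> (p *\<^sub>L m)))"
  proof (rule sw_cong[OF _ h])
    fix a z assume az: "a \<in> carrier H" "z \<in> carrier H"
    show "sw ?A z (\<lambda>d b. lp X (a \<odot>\<^bsub>X\<^esub> x) ((d \<rhd> p) *\<^sub>L (b \<rhd> m))) = lp X (a \<odot>\<^bsub>X\<^esub> x) (z \<rhd> (p *\<^sub>L m))"
      unfolding act_mult[OF az(2) p m]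
      by (rule sw_hom[OF mod_L modXL[OF X], symmetric, where f="\<lambda>s. lp X (a \<odot>\<^bsub>X\<^esub> x) s"]) (use az x p m in \<open>auto intro!: c\<close>)
  qed
  also have "\<dots> = h \<odot>\<^bsub>XL X\<^esub> ra X (lp X x p) m"
    using h x p m by (simp add: ra_pure[OF X] XL_smult_pure[OF X])
  finally show "sw ?A h (\<lambda>a b. ra X (a \<odot>\<^bsub>XL X\<^esub> lp X x p) (b \<rhd> m)) = h \<odot>\<^bsub>XL X\<^esub> ra X (lp X x p) m" .
qed

lemma ra_one: "hmod X \<Longrightarrow> v \<in> carrier (XL X) \<Longrightarrow> ra X v \<one>\<^bsub>L\<^esub> = v"
  by (rule XL_eqI[OF _ modXL, of X X]) (auto simp: ra_pure intro: lin_ra_left k_linear_id)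

text \<open>The leg that reaches the unit of \<open>L\<close> acts by its counit and is
  absorbed.\<close>

lemma act_lp_one:
  assumes X: "hmod X" and h: "h \<in> carrier H" and x: "x \<in> carrier X"
  shows "h \<odot>\<^bsub>XL X\<^esub> lp X x \<one>\<^bsub>L\<^esub> = lp X (h \<odot>\<^bsub>X\<^esub> x) \<one>\<^bsub>L\<^esub>"
proof -
  let ?A = "r (XL X)"
  have "h \<odot>\<^bsub>XL X\<^esub> lp X x \<one>\<^bsub>L\<^esub> = sw ?A h (\<lambda>a b. \<epsilon> b \<odot>\<^bsub>?A\<^esub> lp X (a \<odot>\<^bsub>X\<^esub> x) \<one>\<^bsub>L\<^esub>)"
  proof (subst XL_smult_pure[OF X h x], simp, rule sw_cong[OF _ h])
    fix a b assume ab: "a \<in> carrier H" "b \<in> carrier H"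
    have "lin L ?A (\<lambda>l. lp X (a \<odot>\<^bsub>X\<^esub> x) l)" using ab x by (auto intro!: linY[OF X])
    from k_linear_smult[OF this, of "\<epsilon> b" "\<one>\<^bsub>L\<^esub>"]
    show "lp X (a \<odot>\<^bsub>X\<^esub> x) (b \<rhd> \<one>\<^bsub>L\<^esub>) = \<epsilon> b \<odot>\<^bsub>?A\<^esub> lp X (a \<odot>\<^bsub>X\<^esub> x) \<one>\<^bsub>L\<^esub>" using ab by (simp add: act_unit)
  qed
  also have "\<dots> = lp X (h \<odot>\<^bsub>X\<^esub> x) \<one>\<^bsub>L\<^esub>"
    by (rule sw_counit_right[OF modXL[OF X] _ h]) (use x in \<open>auto intro!: linY[OF X]\<close>)
  finally show ?thesis .
qed

abbreviation "DY \<equiv> dynamization K H L"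
abbreviation Fm where "Fm X Y f \<equiv> Xi_mor K H L X Y f"
abbreviation dhom where "dhom X Y \<equiv> left_module_hom H X (XL Y)"

lemma DY_simps:
  "Obj DY = {X. hmod X}" "Hom DY X Y = dhom X Y" "tobj DY X Y = X \<bullet> Y" "tunit DY = hU"
  by (simp_all add: dynamization_def)

text \<open>A \<open>B\<close>-linear map on \<open>X \<otimes> L\<close> is determined by its restriction to \<open>X \<otimes> 1\<close>.\<close>

definition gen_res where "gen_res X \<phi> = (\<lambda>x\<in>carrier X. \<phi> (lp X x \<one>\<^bsub>L\<^esub>))"

section \<open>The extension of equivariant maps to module homomorphisms\<close>

context
  fixes X Y :: "('a univ, 'a univ) module" and f assumes X: "hmod X" and Y: "hmod Y" and f: "f \<in> dhom X Y"
begin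

lemma dhom_closed: "x \<in> carrier X \<Longrightarrow> f x \<in> carrier (XL Y)"
  by (rule left_module_hom_closed[OF f])

lemmas lF = linY[OF X] linY[OF Y] lin_ra_left[OF Y] lin_ra_right[OF Y] ra_closed[OF Y] k_linear_comp[OF _ H_hom_lin[OF X f]]
  H_hom_lin[OF X f] dhom_closed

lemma Fm_eq:
  assumes v: "v \<in> carrier (XL X)"
  shows "Fm X Y f v = tsum (r (XL Y)) (\<lambda>x m. ra Y (f x) m) v"
proof -
  let ?h = "\<lambda>x m. map (\<lambda>(y, l). (y, l *\<^sub>L m)) (tlist (f x))"
  have "lcls K H L Y (concat (map (\<lambda>(x, m). ?h x m) (tlist v))) = tsum (r (XL Y)) (\<lambda>x m. lcls K H L Y (?h x m)) v"
    by (rule hcls_concat[OF X hmod_LL htlist_valid[OF Y hmod_LL] Y hmod_LL v]) (auto simp: dhom_closed)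
  also have "\<dots> = tsum (r (XL Y)) (\<lambda>x m. ra Y (f x) m) v"
    unfolding ra_def
    by (rule htsum_cong[OF X hmod_LL _ v], rule hcls_map[OF Y hmod_LL _ _ Y hmod_LL]) (auto simp: dhom_closed)
  finally show ?thesis using v by (simp add: Xi_mor_def)
qed

lemma lin_Fm: "lin (r (XL X)) (r (XL Y)) (Fm X Y f)"
proof (rule k_linear_cong[OF _ _ modXL[OF X]])
  show "lin (r (XL X)) (r (XL Y)) (\<lambda>v. tsum (r (XL Y)) (\<lambda>x m. ra Y (f x) m) v)"
    by (rule lin_XLsum[OF X modXL[OF Y]]) (auto intro!: lF)
qed (simp add: Fm_eq)

lemma Fm_lp: "x \<in> carrier X \<Longrightarrow> m \<in> carrier L \<Longrightarrow> Fm X Y f (lp X x m) = ra Y (f x) m"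
  unfolding Fm_eq[OF lp_closed[OF X]] by (rule XLsum_pure[OF X modXL[OF Y]]) (auto intro!: lF)

lemma Fm_lp_one: "x \<in> carrier X \<Longrightarrow> Fm X Y f (lp X x \<one>\<^bsub>L\<^esub>) = f x"
  by (simp add: Fm_lp ra_one[OF Y] dhom_closed)

lemma Fm_la:
  assumes l: "l \<in> carrier L" and v: "v \<in> carrier (XL X)"
  shows "Fm X Y f (la X l v) = la Y l (Fm X Y f v)"
proof (rule XL_eqI[OF X modXL[OF Y] k_linear_comp[OF lin_la_right0[OF X l] lin_Fm]
      k_linear_comp[OF lin_Fm lin_la_right0[OF Y l]] v])
  fix x m assume x: "x \<in> carrier X" and m: "m \<in> carrier L"
  have "Fm X Y f (la X l (lp X x m)) = co (r (XL Y)) l (\<lambda>a n. Fm X Y f (lp X (a \<odot>\<^bsub>X\<^esub> x) (n *\<^sub>L m)))"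
    unfolding la_pure[OF X l x m]
    by (rule co_hom[OF modXL[OF X] modXL[OF Y] lin_Fm]) (use l x m in \<open>auto intro!: lF\<close>)
  also have "\<dots> = co (r (XL Y)) l (\<lambda>a n. ra Y (a \<odot>\<^bsub>XL Y\<^esub> f x) (n *\<^sub>L m))"
    using x m by (intro co_cong l) (simp add: Fm_lp left_module_closed[OF X] left_module_hom_smult[OF f])
  finally show "Fm X Y f (la X l (lp X x m)) = la Y l (Fm X Y f (lp X x m))"
    using l x m by (simp add: co_ra[OF Y] dhom_closed Fm_lp)
qed

lemma Fm_act:
  assumes h: "h \<in> carrier H" and v: "v \<in> carrier (XL X)"
  shows "Fm X Y f (h \<odot>\<^bsub>XL X\<^esub> v) = h \<odot>\<^bsub>XL Y\<^esub> Fm X Y f v"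
proof (rule XL_eqI[OF X modXL[OF Y] _ _ v])
  show "lin (r (XL X)) (r (XL Y)) (\<lambda>v. Fm X Y f (h \<odot>\<^bsub>XL X\<^esub> v))" "lin (r (XL X)) (r (XL Y)) (\<lambda>v. h \<odot>\<^bsub>XL Y\<^esub> Fm X Y f v)"
    using h by (auto intro!: lF k_linear_comp[OF _ lin_Fm] lin_Fm)
  fix x m assume x: "x \<in> carrier X" and m: "m \<in> carrier L"
  have "Fm X Y f (h \<odot>\<^bsub>XL X\<^esub> lp X x m) = sw (r (XL Y)) h (\<lambda>a b. Fm X Y f (lp X (a \<odot>\<^bsub>X\<^esub> x) (b \<rhd> m)))"
    unfolding XL_smult_pure[OF X h x m]
    by (rule sw_hom[OF modXL[OF X] modXL[OF Y] lin_Fm]) (use h x m in \<open>auto intro!: lF\<close>)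
  also have "\<dots> = sw (r (XL Y)) h (\<lambda>a b. ra Y (a \<odot>\<^bsub>XL Y\<^esub> f x) (b \<rhd> m))"
    using x m by (intro sw_cong h) (simp add: Fm_lp left_module_closed[OF X] left_module_hom_smult[OF f])
  finally show "Fm X Y f (h \<odot>\<^bsub>XL X\<^esub> lp X x m) = h \<odot>\<^bsub>XL Y\<^esub> Fm X Y f (lp X x m)"
    using h x m by (simp add: sw_ra[OF Y] dhom_closed Fm_lp)
qed

lemma Fm_closed: "v \<in> carrier (XL X) \<Longrightarrow> Fm X Y f v \<in> carrier (XL Y)"
  using k_linear_closed[OF lin_Fm] by simp

lemma Fm_hom: "Fm X Y f \<in> bhom (\<Xi> X) (\<Xi> Y)"
proof (rule B_homI[OF lmod_Xi[OF X] lmod_Xi[OF Y]])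
  show "Fm X Y f \<in> extensional (carrier (\<Xi> X))" by (simp add: Xi_mor_def Xi_simps[OF X])
  show "additive_on (\<Xi> X) (\<Xi> Y) (Fm X Y f)"
    using k_linear_additive[OF lin_Fm] by (simp add: additive_on_def Xi_simps[OF X] Xi_simps[OF Y])
qed (simp_all add: Xi_simps[OF X] Xi_src[OF X] Xi_src[OF Y] Xi_u[OF X] Xi_u[OF Y] Fm_closed Fm_la Fm_act)

lemma gen_res_Fm: "gen_res X (Fm X Y f) = f"
  by (rule extensionalityI[of _ "carrier X"]) (use f in \<open>auto simp: gen_res_def Fm_lp_one left_module_hom_def PiE_def\<close>)

end

section \<open>The restriction of module homomorphisms to equivariant maps\<close>

context
  fixes X Y \<phi> assumes X: "hmod X" and Y: "hmod Y" and \<phi>: "\<phi> \<in> bhom (\<Xi> X) (\<Xi> Y)"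
begin

lemma lin_bhom: "lin (r (XL X)) (r (XL Y)) \<phi>"
proof -
  have "lin (r (XL X)) (restrict_scalars B (\<Xi> X)) (\<lambda>x. x)" by (simp add: lin_to_Xi[OF X] k_linear_id)
  moreover have "lin (restrict_scalars B (\<Xi> X)) (restrict_scalars B (\<Xi> Y)) \<phi>"
    using \<phi> module.smult_closed[OF mod_B, of _ "\<one>\<^bsub>B\<^esub>"]
    by (auto simp: left_module_hom_def k_linear_def additive_on_def restrict_scalars_def)
  ultimately have "lin (r (XL X)) (restrict_scalars B (\<Xi> Y)) \<phi>" by (rule k_linear_comp)
  thus ?thesis by (simp add: lin_to_Xi[OF Y])
qed

lemma gen_res_hom: "gen_res X \<phi> \<in> dhom X Y"
proof -
  have a: "additive_on X (XL Y) (\<lambda>x. \<phi> (lp X x \<one>\<^bsub>L\<^esub>))"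
  proof -
    have "lin (r X) (r (XL X)) (\<lambda>x. lp X x \<one>\<^bsub>L\<^esub>)" by (auto intro!: linY[OF X])
    from k_linear_additive[OF k_linear_comp[OF this lin_bhom]] show ?thesis by (simp add: additive_on_def)
  qed
  moreover have "\<phi> (lp X (h \<odot>\<^bsub>X\<^esub> x) \<one>\<^bsub>L\<^esub>) = h \<odot>\<^bsub>XL Y\<^esub> \<phi> (lp X x \<one>\<^bsub>L\<^esub>)" if "h \<in> carrier H" "x \<in> carrier X" for h x
    using left_module_hom_smult[OF \<phi>, of "u h" "lp X x \<one>\<^bsub>L\<^esub>"] that bhom_XL_closed[OF X Y \<phi>]
    by (simp add: Xi_u[OF X] Xi_u[OF Y] Xi_simps[OF X] act_lp_one[OF X] lp_closed[OF X])
  ultimately show ?thesis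
    using X by (auto simp: gen_res_def left_module_hom_def additive_on_def left_module_closed[OF X] left_module_def
        abelian_group_def abelian_monoid.a_closed)
qed

lemma Fm_gen_res: "Fm X Y (gen_res X \<phi>) = \<phi>"
proof (rule left_module_hom_eqI[OF Fm_hom[OF X Y gen_res_hom] \<phi>])
  fix v assume "v \<in> carrier (\<Xi> X)"
  hence v: "v \<in> carrier (XL X)" by (simp add: Xi_simps[OF X])
  show "Fm X Y (gen_res X \<phi>) v = \<phi> v"
  proof (rule XL_eqI[OF X modXL[OF Y] lin_Fm[OF X Y gen_res_hom] lin_bhom v])
    fix x l assume x: "x \<in> carrier X" and l: "l \<in> carrier L"
    have "Fm X Y (gen_res X \<phi>) (lp X x l) = \<phi> (ra X (lp X x \<one>\<^bsub>L\<^esub>) l)"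
      using x l by (simp add: Fm_lp[OF X Y gen_res_hom] bhom_ra[OF X Y \<phi>] lp_closed[OF X]) (simp add: gen_res_def)
    thus "Fm X Y (gen_res X \<phi>) (lp X x l) = \<phi> (lp X x l)" using x l by (simp add: ra_pure[OF X])
  qed
qed

end

lemma Fm_bij:
  assumes "hmod X" "hmod Y"
  shows "bij_betw (Fm X Y) (dhom X Y) (bhom (\<Xi> X) (\<Xi> Y))"
  by (rule bij_betw_byWitness[of _ "gen_res X"])
    (use assms in \<open>auto simp: gen_res_Fm Fm_gen_res Fm_hom gen_res_hom\<close>)

end

section \<open>Transport of a monoidal structure\<close>

text \<open>Of \<open>C\<close> only the typing of its structure maps is assumed, together with
  bijections that carry them to those of \<open>D\<close>. Each equation in \<open>C\<close> then
  follows from its image in \<open>D\<close> by injectivity on hom sets, so the axioms of the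
  dynamization are not computed with its own formulas.\<close>

locale monoidal_transport = D: monoidal_category D
  for C :: "('o, 'm, 'y) moncat_scheme" and D :: "('p, 'n, 'z) moncat_scheme"
    and F0 :: "'o \<Rightarrow> 'p" and F1 :: "'o \<Rightarrow> 'o \<Rightarrow> 'm \<Rightarrow> 'n" +
  assumes F0_bij: "bij_betw F0 (Obj C) (Obj D)"
    and F1_bij: "\<lbrakk> X \<in> Obj C; Y \<in> Obj C \<rbrakk> \<Longrightarrow> bij_betw (F1 X Y) (Hom C X Y) (Hom D (F0 X) (F0 Y))"
    and C_ident: "X \<in> Obj C \<Longrightarrow> Ident C X \<in> Hom C X X"
    and F1_ident: "X \<in> Obj C \<Longrightarrow> F1 X X (Ident C X) = Ident D (F0 X)"
    and C_comp: "\<lbrakk> X \<in> Obj C; Y \<in> Obj C; Z \<in> Obj C; f \<in> Hom C X Y; g \<in> Hom C Y Z \<rbrakk> \<Longrightarrow>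
      Comp C X Y Z f g \<in> Hom C X Z"
    and F1_comp: "\<lbrakk> X \<in> Obj C; Y \<in> Obj C; Z \<in> Obj C; f \<in> Hom C X Y; g \<in> Hom C Y Z \<rbrakk> \<Longrightarrow>
      F1 X Z (Comp C X Y Z f g) = Comp D (F0 X) (F0 Y) (F0 Z) (F1 X Y f) (F1 Y Z g)"
    and C_tobj: "\<lbrakk> X \<in> Obj C; Y \<in> Obj C \<rbrakk> \<Longrightarrow> tobj C X Y \<in> Obj C"
    and F0_tobj: "\<lbrakk> X \<in> Obj C; Y \<in> Obj C \<rbrakk> \<Longrightarrow> F0 (tobj C X Y) = tobj D (F0 X) (F0 Y)"
    and C_tunit: "tunit C \<in> Obj C"
    and F0_tunit: "F0 (tunit C) = tunit D"
    and C_tmor: "\<lbrakk> X \<in> Obj C; X' \<in> Obj C; Y \<in> Obj C; Y' \<in> Obj C; f \<in> Hom C X X'; g \<in> Hom C Y Y' \<rbrakk> \<Longrightarrow>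
      tmor C X X' Y Y' f g \<in> Hom C (tobj C X Y) (tobj C X' Y')"
    and F1_tmor: "\<lbrakk> X \<in> Obj C; X' \<in> Obj C; Y \<in> Obj C; Y' \<in> Obj C; f \<in> Hom C X X'; g \<in> Hom C Y Y' \<rbrakk> \<Longrightarrow>
      F1 (tobj C X Y) (tobj C X' Y') (tmor C X X' Y Y' f g) =
      tmor D (F0 X) (F0 X') (F0 Y) (F0 Y') (F1 X X' f) (F1 Y Y' g)"
    and C_assoc: "\<lbrakk> X \<in> Obj C; Y \<in> Obj C; Z \<in> Obj C \<rbrakk> \<Longrightarrow>
      assoc C X Y Z \<in> Hom C (tobj C (tobj C X Y) Z) (tobj C X (tobj C Y Z))"
    and F1_assoc: "\<lbrakk> X \<in> Obj C; Y \<in> Obj C; Z \<in> Obj C \<rbrakk> \<Longrightarrow>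
      F1 (tobj C (tobj C X Y) Z) (tobj C X (tobj C Y Z)) (assoc C X Y Z) = assoc D (F0 X) (F0 Y) (F0 Z)"
    and C_lunit: "X \<in> Obj C \<Longrightarrow> lunit C X \<in> Hom C (tobj C (tunit C) X) X"
    and F1_lunit: "X \<in> Obj C \<Longrightarrow> F1 (tobj C (tunit C) X) X (lunit C X) = lunit D (F0 X)"
    and C_runit: "X \<in> Obj C \<Longrightarrow> runit C X \<in> Hom C (tobj C X (tunit C)) X"
    and F1_runit: "X \<in> Obj C \<Longrightarrow> F1 (tobj C X (tunit C)) X (runit C X) = runit D (F0 X)"
begin

lemma F0: "X \<in> Obj C \<Longrightarrow> F0 X \<in> Obj D"
  using bij_betwE[OF F0_bij] by blast

lemma F1: "X \<in> Obj C \<Longrightarrow> Y \<in> Obj C \<Longrightarrow> f \<in> Hom C X Y \<Longrightarrow> F1 X Y f \<in> Hom D (F0 X) (F0 Y)"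
  using bij_betwE[OF F1_bij] by blast

lemma F1_eqI: "F1 X Y f = F1 X Y g \<Longrightarrow> X \<in> Obj C \<Longrightarrow> Y \<in> Obj C \<Longrightarrow> f \<in> Hom C X Y \<Longrightarrow> g \<in> Hom C X Y \<Longrightarrow> f = g"
  using bij_betw_imp_inj_on[OF F1_bij] by (auto dest: inj_onD)

lemma F1_iso:
  assumes X: "X \<in> Obj C" and Y: "Y \<in> Obj C" and f: "f \<in> Hom C X Y" and iso: "iso_mor D (F0 X) (F0 Y) (F1 X Y f)"
  shows "iso_mor C X Y f"
proof -
  obtain g where g: "inverse_pair D (F0 X) (F0 Y) (F1 X Y f) g" using iso by (auto simp: iso_mor_def)
  \<comment> \<open>Surjectivity on hom sets provides the preimage of the inverse morphism.\<close>
  then obtain g' where g': "g' \<in> Hom C Y X" "g = F1 Y X g'"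
    using bij_betw_imp_surj_on[OF F1_bij[OF Y X]] by (auto simp: inverse_pair_def)
  have "Comp C X Y X f g' = Ident C X"
    by (rule F1_eqI[of X X]) (use g g' X Y f in \<open>simp_all add: inverse_pair_def C_comp C_ident F1_comp F1_ident\<close>)
  moreover have "Comp C Y X Y g' f = Ident C Y"
    by (rule F1_eqI[of Y Y]) (use g g' X Y f in \<open>simp_all add: inverse_pair_def C_comp C_ident F1_comp F1_ident\<close>)
  ultimately have "inverse_pair C X Y f g'" using f g' by (simp add: inverse_pair_def)
  thus ?thesis by (auto simp: iso_mor_def)
qed

lemmas tr = C_ident C_comp C_tobj C_tunit C_tmor C_assoc C_lunit C_runit F0 F1
  F1_ident F1_comp F1_tmor F1_assoc F1_lunit F1_runit F0_tobj F0_tunit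

sublocale C: monoidal_category C
proof (intro monoidal_category.intro category.intro monoidal_category_axioms.intro, goal_cases)
  case (3 X Y f) thus ?case by (intro F1_eqI[of X Y]) (simp_all add: tr D.comp_ident_left)
next
  case (4 X Y f) thus ?case by (intro F1_eqI[of X Y]) (simp_all add: tr D.comp_ident_right)
next
  case (5 W X Y Z f g h)
  thus ?case by (intro F1_eqI[of W Z]) (simp_all add: tr D.comp_assoc[of "F0 W" "F0 X" "F0 Y" "F0 Z"])
next
  case (9 X Y) thus ?case by (intro F1_eqI[of "tobj C X Y" "tobj C X Y"]) (simp_all add: tr D.tmor_ident)
next
  case (10 X X' X'' Y Y' Y'' f f' g g')
  thus ?case by (intro F1_eqI[of "tobj C X Y" "tobj C X'' Y''"])
    (simp_all add: tr D.tmor_comp[of "F0 X" "F0 X'" "F0 X''" "F0 Y" "F0 Y'" "F0 Y''"])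
next
  case (11 X Y Z) thus ?case by (intro F1_iso) (simp_all add: tr D.assoc_iso)
next
  case (12 X X' Y Y' Z Z' f g h)
  thus ?case by (intro F1_eqI[of "tobj C (tobj C X Y) Z" "tobj C X' (tobj C Y' Z')"]) (simp_all add: tr D.assoc_natural)
next
  case (13 X) thus ?case by (intro F1_iso) (simp_all add: tr D.lunit_iso)
next
  case (14 X Y f) thus ?case by (intro F1_eqI[of "tobj C (tunit C) X" Y]) (simp_all add: tr D.lunit_natural)
next
  case (15 X) thus ?case by (intro F1_iso) (simp_all add: tr D.runit_iso)
next
  case (16 X Y f) thus ?case by (intro F1_eqI[of "tobj C X (tunit C)" Y]) (simp_all add: tr D.runit_natural)
next
  case (17 W X Y Z)
  thus ?case by (intro F1_eqI[of "tobj C (tobj C (tobj C W X) Y) Z" "tobj C W (tobj C X (tobj C Y Z))"])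
    (simp_all add: tr D.pentagon)
next
  case (18 X Y)
  thus ?case by (intro F1_eqI[of "tobj C (tobj C X (tunit C)) Y" "tobj C X Y"]) (simp_all add: tr D.triangle)
qed (simp_all add: tr)

sublocale monoidal_isomorphism C D F0 F1
  by unfold_locales (simp_all add: F0_bij F1_bij tr)

end

context hopf_base
begin

section \<open>The dynamization\<close>

text \<open>Pure elements of (X \<otimes> Y) \<otimes> L are values of \<open>JF\<close>, so the
  formulas for the structure maps of the full subcategory apply to them.\<close>

lemma lp_hp:
  assumes "hmod X" "hmod Y" "x \<in> carrier X" "y \<in> carrier Y" "m \<in> carrier L"
  shows "lp (X \<bullet> Y) (hp X Y x y) m = JF X Y (lp X x \<one>\<^bsub>L\<^esub>) (lp Y y m)"
  using assms by (simp add: JF_pure lp_closed la_one jx_pure)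

lemma lin_gen: "hmod X \<Longrightarrow> hmod Y \<Longrightarrow> \<phi> \<in> bhom (\<Xi> X) (\<Xi> Y) \<Longrightarrow> lin (r X) (r (XL Y)) (\<lambda>x. \<phi> (lp X x \<one>\<^bsub>L\<^esub>))"
  by (rule k_linear_comp[OF _ lin_bhom, of _ X]) (auto intro!: linY[of X])

text \<open>Criterion for a structure map of the dynamization to be the restriction of a morphism of
  the full subcategory: by linearity in the tensor, the comparison is only needed on x \<otimes> 1
  and y \<otimes> 1.\<close>

lemma gen_resI:
  assumes X: "hmod X" and Y: "hmod Y" and Z: "hmod Z" and \<phi>: "\<phi> \<in> bhom (\<Xi> (X \<bullet> Y)) (\<Xi> Z)"
    and F: "lin (r (X \<bullet> Y)) (r (XL Z)) F"
    and eq: "\<And>x y. x \<in> carrier X \<Longrightarrow> y \<in> carrier Y \<Longrightarrow>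
      \<phi> (JF X Y (lp X x \<one>\<^bsub>L\<^esub>) (lp Y y \<one>\<^bsub>L\<^esub>)) = F (hp X Y x y)"
  shows "(\<lambda>t\<in>carrier (X \<bullet> Y). F t) = gen_res (X \<bullet> Y) \<phi>"
proof -
  have "\<phi> (lp (X \<bullet> Y) t \<one>\<^bsub>L\<^esub>) = F t" if "t \<in> carrier (X \<bullet> Y)" for t
    by (rule ht_eqI[OF X Y modXL[OF Z] lin_gen[OF hmod_ht[OF X Y] Z \<phi>] F that])
      (simp add: lp_hp[OF X Y] eq)
  thus ?thesis by (auto simp: gen_res_def cong: restrict_cong)
qed

lemma DY_ident: "hmod X \<Longrightarrow> Ident DY X = gen_res X (Ident M0 (ob X))"
  by (auto simp: dynamization_def gen_res_def M0_ident lp_closed cong: restrict_cong)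

lemma DY_comp:
  assumes h: "hmod X" "hmod Y" "hmod Z" and f: "f \<in> dhom X Y" and g: "g \<in> dhom Y Z"
  shows "Comp DY X Y Z f g = gen_res X (Comp M0 (ob X) (ob Y) (ob Z) (Fm X Y f) (Fm Y Z g))"
proof -
  \<comment> \<open>The comprehension that defines composition in the dynamization is the one in
    \<open>Xi_mor\<close> for \<open>g\<close>, evaluated at \<open>f x\<close>.\<close>
  have "Fm Y Z g (f x) = lcls K H L Z [(z, m *\<^sub>L l). (y, l) \<leftarrow> tlist (f x), (z, m) \<leftarrow> tlist (g y)]"
    if "x \<in> carrier X" for x
    using dhom_closed[OF h(1,2) f that] by (simp add: Xi_mor_def)
  thus ?thesis
    by (auto simp: dynamization_def gen_res_def M0_comp h lp_closed Fm_lp_one f cong: restrict_cong)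
qed

text \<open>By \<open>JF_list\<close> the defining comprehension is a sum of \<open>JF\<close> at
  \<open>f x\<close> and \<open>g y\<close>, which is also the value of the tensor product in the
  full subcategory, since the extension of \<open>f\<close> takes x \<otimes> 1 to
  \<open>f x\<close>.\<close>

lemma DY_tmor:
  assumes h: "hmod X" "hmod X'" "hmod Y" "hmod Y'" and f: "f \<in> dhom X X'" and g: "g \<in> dhom Y Y'"
  shows "tmor DY X X' Y Y' f g = gen_res (X \<bullet> Y) (tmor M0 (ob X) (ob X') (ob Y) (ob Y') (Fm X X' f) (Fm Y Y' g))"
proof -
  note hZ = hmod_ht[OF h(2,4)]
  note c = dhom_closed[OF h(1,2) f] dhom_closed[OF h(3,4) g]
  let ?A = "r (XL (X' \<bullet> Y'))" and ?F = "\<lambda>x y. JF X' Y' (f x) (g y)"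
  let ?h = "\<lambda>v w. [(hp X' Y' x (a \<odot>\<^bsub>Y'\<^esub> y), n *\<^sub>L m).
    (x, l) \<leftarrow> tlist v, (y, m) \<leftarrow> tlist w, (a, n) \<leftarrow> tlist (coact L l)]"
  have "lcls K H L (X' \<bullet> Y') (concat (map (\<lambda>(x, y). ?h (f x) (g y)) (tlist t))) = tsum ?A ?F t"
    if t: "t \<in> carrier (X \<bullet> Y)" for t
  proof -
    have "lcls K H L (X' \<bullet> Y') (concat (map (\<lambda>(x, y). ?h (f x) (g y)) (tlist t))) =
        tsum ?A (\<lambda>x y. lcls K H L (X' \<bullet> Y') (?h (f x) (g y))) t"
      by (rule hcls_concat[OF h(1,3) JF_list_valid[OF h(2,4) c] hZ hmod_LL t])
    also have "\<dots> = tsum ?A ?F t"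
      by (rule htsum_cong[OF h(1,3) JF_list(1)[OF h(2,4) c] t])
    finally show ?thesis .
  qed
  hence "tmor DY X X' Y Y' f g = (\<lambda>t\<in>carrier (X \<bullet> Y). tsum ?A ?F t)"
    by (simp add: dynamization_def cong: restrict_cong)
  also have "\<dots> = gen_res (X \<bullet> Y) (tmor M0 (ob X) (ob X') (ob Y) (ob Y') (Fm X X' f) (Fm Y Y' g))"
  proof (rule gen_resI[OF h(1,3) hZ M0_tmor_hom[OF h Fm_hom[OF h(1,2) f] Fm_hom[OF h(3,4) g]]])
    have l: "lin (r Y) ?A (?F x)" if "x \<in> carrier X" for x
      by (rule lin_JF_right[OF h(2,4) H_hom_lin[OF h(3) g] mod_r[OF h(3)] c(1)[OF that]])
    have l': "lin (r X) ?A (\<lambda>x. ?F x y)" if "y \<in> carrier Y" for y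
      by (rule lin_JF_left[OF h(2,4) H_hom_lin[OF h(1) f] c(2)[OF that]])
    show "lin (r (X \<bullet> Y)) ?A (tsum ?A ?F)"
      by (rule lin_htsum[OF h(1,3) modXL[OF hZ] l l' k_linear_id])
    fix x y assume xy: "x \<in> carrier X" "y \<in> carrier Y"
    show "tmor M0 (ob X) (ob X') (ob Y) (ob Y') (Fm X X' f) (Fm Y Y' g) (JF X Y (lp X x \<one>\<^bsub>L\<^esub>) (lp Y y \<one>\<^bsub>L\<^esub>)) =
      tsum ?A ?F (hp X Y x y)"
      using xy h by (simp add: htsum_pure[OF h(1,3) modXL[OF hZ] l l'] M0_tmor_JF Fm_hom f g lp_closed Fm_lp_one)
  qed
  finally show ?thesis .
qed

text \<open>\<open>gen_resI\<close> leads to s \<otimes> z with \<open>s\<close> in X \<otimes> Y.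
  For fixed \<open>z\<close> both sides are linear in \<open>s\<close>, so a second reduction
  reaches x, y and z, where \<open>M0_assoc_JF\<close> gives the value.\<close>

lemma DY_assoc:
  assumes X: "hmod X" and Y: "hmod Y" and Z: "hmod Z"
  shows "assoc DY X Y Z = gen_res ((X \<bullet> Y) \<bullet> Z) (assoc M0 (ob X) (ob Y) (ob Z))"
proof -
  note XY = hmod_ht[OF X Y] and YZ = hmod_ht[OF Y Z]
  note XYZ = hmod_ht[OF X YZ]
  let ?W = "X \<bullet> (Y \<bullet> Z)" and ?A = "r (XL (X \<bullet> (Y \<bullet> Z)))"
  let ?F = "\<lambda>z x y. lp ?W (hp X (Y \<bullet> Z) x (hp Y Z y z)) \<one>\<^bsub>L\<^esub>"
  let ?h = "\<lambda>s z. map (\<lambda>(x, y). (hp X (Y \<bullet> Z) x (hp Y Z y z), \<one>\<^bsub>L\<^esub>)) (tlist s)"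
  note l = linY[OF X] linY[OF Y] linY[OF Z] linY[OF XYZ] hp_closed[OF X YZ] hp_closed[OF Y Z]
    lin_hp_left[OF X YZ] lin_hp_right[OF X YZ] lin_hp_left[OF Y Z] lin_hp_right[OF Y Z]
  have "lcls K H L ?W (concat (map (\<lambda>(s, z). ?h s z) (tlist t))) = tsum ?A (\<lambda>s z. tsum ?A (?F z) s) t"
    if t: "t \<in> carrier ((X \<bullet> Y) \<bullet> Z)" for t
  proof -
    have "lcls K H L ?W (concat (map (\<lambda>(s, z). ?h s z) (tlist t))) = tsum ?A (\<lambda>s z. lcls K H L ?W (?h s z)) t"
      by (rule hcls_concat[OF XY Z htlist_valid[OF X Y] XYZ hmod_LL t]) (auto intro!: l)
    also have "\<dots> = tsum ?A (\<lambda>s z. tsum ?A (?F z) s) t"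
      by (rule htsum_cong[OF XY Z hcls_map[OF X Y _ _ XYZ hmod_LL] t]) (auto intro!: l)
    finally show ?thesis .
  qed
  hence "assoc DY X Y Z = (\<lambda>t\<in>carrier ((X \<bullet> Y) \<bullet> Z). tsum ?A (\<lambda>s z. tsum ?A (?F z) s) t)"
    by (simp add: dynamization_def cong: restrict_cong)
  also have "\<dots> = gen_res ((X \<bullet> Y) \<bullet> Z) (assoc M0 (ob X) (ob Y) (ob Z))"
  proof (rule gen_resI[OF XY Z XYZ M0_assoc_hom[OF X Y Z]])
    have l1: "lin (r (X \<bullet> Y)) ?A (\<lambda>s. tsum ?A (?F z) s)" if "z \<in> carrier Z" for z
      by (rule lin_htsum[OF X Y modXL[OF XYZ] _ _ k_linear_id]) (use that in \<open>auto intro!: l\<close>)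
    have l2: "lin (r Z) ?A (\<lambda>z. tsum ?A (?F z) s)" if "s \<in> carrier (X \<bullet> Y)" for s
      by (rule lin_htsum_inner[OF X Y modXL[OF XYZ] mod_r[OF Z] that]) (auto intro!: l)
    show "lin (r ((X \<bullet> Y) \<bullet> Z)) ?A (\<lambda>t. tsum ?A (\<lambda>s z. tsum ?A (?F z) s) t)"
      by (rule lin_htsum[OF XY Z modXL[OF XYZ] l2 l1 k_linear_id])
    fix s z assume s: "s \<in> carrier (X \<bullet> Y)" and z: "z \<in> carrier Z"
    have "assoc M0 (ob X) (ob Y) (ob Z) (JF (X \<bullet> Y) Z (lp (X \<bullet> Y) s \<one>\<^bsub>L\<^esub>) (lp Z z \<one>\<^bsub>L\<^esub>)) = tsum ?A (?F z) s"
    proof (rule ht_eqI[OF X Y modXL[OF XYZ] _ l1[OF z] s])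
      note j = lin_JF_left[OF XY Z _ lp_closed[OF Z z], of "r (X \<bullet> Y)" "\<lambda>s. lp (X \<bullet> Y) s \<one>\<^bsub>L\<^esub>" "\<one>\<^bsub>L\<^esub>"]
      show "lin (r (X \<bullet> Y)) ?A (\<lambda>s. assoc M0 (ob X) (ob Y) (ob Z) (JF (X \<bullet> Y) Z (lp (X \<bullet> Y) s \<one>\<^bsub>L\<^esub>) (lp Z z \<one>\<^bsub>L\<^esub>)))"
        by (rule k_linear_comp[OF j lin_bhom[OF hmod_ht[OF XY Z] XYZ M0_assoc_hom[OF X Y Z]]]) (auto intro!: linY[OF XY])
      fix x y assume xy: "x \<in> carrier X" "y \<in> carrier Y"
      have "tsum ?A (?F z) (hp X Y x y) = ?F z x y"
        by (rule htsum_pure[OF X Y modXL[OF XYZ]]) (use z xy in \<open>auto intro!: l\<close>)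
      thus "assoc M0 (ob X) (ob Y) (ob Z) (JF (X \<bullet> Y) Z (lp (X \<bullet> Y) (hp X Y x y) \<one>\<^bsub>L\<^esub>) (lp Z z \<one>\<^bsub>L\<^esub>)) = tsum ?A (?F z) (hp X Y x y)"
        using xy z by (simp add: lp_hp[OF X Y] lp_hp[OF X YZ] lp_hp[OF Y Z] hp_closed[OF Y Z] M0_assoc_JF[OF X Y Z]
            lp_closed[OF X] lp_closed[OF Y] lp_closed[OF Z])
    qed
    thus "assoc M0 (ob X) (ob Y) (ob Z) (JF (X \<bullet> Y) Z (lp (X \<bullet> Y) s \<one>\<^bsub>L\<^esub>) (lp Z z \<one>\<^bsub>L\<^esub>)) =
        tsum ?A (\<lambda>s z. tsum ?A (?F z) s) (hp (X \<bullet> Y) Z s z)"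
      using s z by (simp add: htsum_pure[OF XY Z modXL[OF XYZ] l2 l1])
  qed
  finally show ?thesis .
qed

lemma lp_hU_J0: "c \<in> carrier K \<Longrightarrow> l \<in> carrier L \<Longrightarrow> lp hU c l = J0 (c \<odot>\<^bsub>L\<^esub> l)"
  by (simp add: lp_hU_scalar(2)[of c l] J0_apply module.smult_closed[OF mod_L])

text \<open>On X \<otimes> L, multiples of the unit of \<open>L\<close> act from the left and from
  the right as scalars. Both unit constraints therefore restrict to scalar multiplication on
  X.\<close>

lemma lp_scalar:
  assumes X: "hmod X" and c: "c \<in> carrier K" and x: "x \<in> carrier X"
  shows "la X (c \<odot>\<^bsub>L\<^esub> \<one>\<^bsub>L\<^esub>) (lp X x \<one>\<^bsub>L\<^esub>) = lp X ((c \<odot>\<^bsub>H\<^esub> \<one>\<^bsub>H\<^esub>) \<odot>\<^bsub>X\<^esub> x) \<one>\<^bsub>L\<^esub>"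
    "ra X (lp X x \<one>\<^bsub>L\<^esub>) (c \<odot>\<^bsub>L\<^esub> \<one>\<^bsub>L\<^esub>) = lp X ((c \<odot>\<^bsub>H\<^esub> \<one>\<^bsub>H\<^esub>) \<odot>\<^bsub>X\<^esub> x) \<one>\<^bsub>L\<^esub>"
proof -
  have v: "lp X x \<one>\<^bsub>L\<^esub> \<in> carrier (XL X)" using x by (simp add: lp_closed[OF X])
  have "lin (r X) (r (XL X)) (\<lambda>x. lp X x \<one>\<^bsub>L\<^esub>)" by (auto intro!: linY[OF X])
  from k_linear_smult[OF this c, of x] x
  have 1: "lp X ((c \<odot>\<^bsub>H\<^esub> \<one>\<^bsub>H\<^esub>) \<odot>\<^bsub>X\<^esub> x) \<one>\<^bsub>L\<^esub> = c \<odot>\<^bsub>r (XL X)\<^esub> lp X x \<one>\<^bsub>L\<^esub>" by (simp add: r_smult)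
  show "la X (c \<odot>\<^bsub>L\<^esub> \<one>\<^bsub>L\<^esub>) (lp X x \<one>\<^bsub>L\<^esub>) = lp X ((c \<odot>\<^bsub>H\<^esub> \<one>\<^bsub>H\<^esub>) \<odot>\<^bsub>X\<^esub> x) \<one>\<^bsub>L\<^esub>"
    using k_linear_smult[OF lin_la_left[OF X k_linear_id v] c, of "\<one>\<^bsub>L\<^esub>"] by (simp add: 1 la_one[OF X v])
  show "ra X (lp X x \<one>\<^bsub>L\<^esub>) (c \<odot>\<^bsub>L\<^esub> \<one>\<^bsub>L\<^esub>) = lp X ((c \<odot>\<^bsub>H\<^esub> \<one>\<^bsub>H\<^esub>) \<odot>\<^bsub>X\<^esub> x) \<one>\<^bsub>L\<^esub>"
    using k_linear_smult[OF lin_ra_right[OF X k_linear_id mod_L v] c, of "\<one>\<^bsub>L\<^esub>"] by (simp add: 1 ra_one[OF X v])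
qed

lemma lin_scalar:
  assumes X: "hmod X"
  shows "c \<in> carrier K \<Longrightarrow> lin (r X) (r (XL X)) (\<lambda>x. lp X ((c \<odot>\<^bsub>H\<^esub> \<one>\<^bsub>H\<^esub>) \<odot>\<^bsub>X\<^esub> x) \<one>\<^bsub>L\<^esub>)"
    "x \<in> carrier X \<Longrightarrow> lin (r hU) (r (XL X)) (\<lambda>c. lp X ((c \<odot>\<^bsub>H\<^esub> \<one>\<^bsub>H\<^esub>) \<odot>\<^bsub>X\<^esub> x) \<one>\<^bsub>L\<^esub>)"
  by (auto intro!: linY[OF X] lin_from_hU[THEN iffD2] module.smult_closed[OF mod_H])

lemma DY_lunit:
  assumes X: "hmod X"
  shows "lunit DY X = gen_res (hU \<bullet> X) (lunit M0 (ob X))"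
proof -
  let ?A = "r (XL X)" and ?F = "\<lambda>c x. lp X ((c \<odot>\<^bsub>H\<^esub> \<one>\<^bsub>H\<^esub>) \<odot>\<^bsub>X\<^esub> x) \<one>\<^bsub>L\<^esub>"
  have "lcls K H L X (map (\<lambda>(c, x). ((c \<odot>\<^bsub>H\<^esub> \<one>\<^bsub>H\<^esub>) \<odot>\<^bsub>X\<^esub> x, \<one>\<^bsub>L\<^esub>)) (tlist t)) = tsum ?A ?F t"
    if "t \<in> carrier (hU \<bullet> X)" for t
    by (rule hcls_map[OF hmod_hU X _ _ X hmod_LL that])
      (auto intro!: left_module_closed[OF X] module.smult_closed[OF mod_H])
  hence "lunit DY X = (\<lambda>t\<in>carrier (hU \<bullet> X). tsum ?A ?F t)"
    by (simp add: dynamization_def cong: restrict_cong)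
  also have "\<dots> = gen_res (hU \<bullet> X) (lunit M0 (ob X))"
  proof (rule gen_resI[OF hmod_hU X X M0_lunit_hom[OF X]])
    show "lin (r (hU \<bullet> X)) ?A (tsum ?A ?F)"
      by (rule lin_htsum[OF hmod_hU X modXL[OF X] _ _ k_linear_id]) (simp_all add: lin_scalar[OF X])
    fix c x assume "c \<in> carrier hU" and x: "x \<in> carrier X"
    hence c: "c \<in> carrier K" by simp
    have "lunit M0 (ob X) (JF hU X (lp hU c \<one>\<^bsub>L\<^esub>) (lp X x \<one>\<^bsub>L\<^esub>)) = ?F c x"
      using c x by (simp add: lp_hU_J0 M0_lunit_JF[OF X] lp_scalar[OF X] module.smult_closed[OF mod_L] lp_closed[OF X])
    moreover have "tsum ?A ?F (hp hU X c x) = ?F c x"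
      by (rule htsum_pure[OF hmod_hU X modXL[OF X]]) (use c x in \<open>simp_all add: lin_scalar[OF X]\<close>)
    ultimately show "lunit M0 (ob X) (JF hU X (lp hU c \<one>\<^bsub>L\<^esub>) (lp X x \<one>\<^bsub>L\<^esub>)) = tsum ?A ?F (hp hU X c x)" by simp
  qed
  finally show ?thesis .
qed

lemma DY_runit:
  assumes X: "hmod X"
  shows "runit DY X = gen_res (X \<bullet> hU) (runit M0 (ob X))"
proof -
  let ?A = "r (XL X)" and ?F = "\<lambda>x c. lp X ((c \<odot>\<^bsub>H\<^esub> \<one>\<^bsub>H\<^esub>) \<odot>\<^bsub>X\<^esub> x) \<one>\<^bsub>L\<^esub>"
  have "lcls K H L X (map (\<lambda>(x, c). ((c \<odot>\<^bsub>H\<^esub> \<one>\<^bsub>H\<^esub>) \<odot>\<^bsub>X\<^esub> x, \<one>\<^bsub>L\<^esub>)) (tlist t)) = tsum ?A ?F t"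
    if "t \<in> carrier (X \<bullet> hU)" for t
    by (rule hcls_map[OF X hmod_hU _ _ X hmod_LL that])
      (auto intro!: left_module_closed[OF X] module.smult_closed[OF mod_H])
  hence "runit DY X = (\<lambda>t\<in>carrier (X \<bullet> hU). tsum ?A ?F t)"
    by (simp add: dynamization_def cong: restrict_cong)
  also have "\<dots> = gen_res (X \<bullet> hU) (runit M0 (ob X))"
  proof (rule gen_resI[OF X hmod_hU X M0_runit_hom[OF X]])
    show "lin (r (X \<bullet> hU)) ?A (tsum ?A ?F)"
      by (rule lin_htsum[OF X hmod_hU modXL[OF X] _ _ k_linear_id]) (simp_all add: lin_scalar[OF X])
    fix x c assume x: "x \<in> carrier X" and "c \<in> carrier hU"
    hence c: "c \<in> carrier K" by simp
    have "runit M0 (ob X) (JF X hU (lp X x \<one>\<^bsub>L\<^esub>) (lp hU c \<one>\<^bsub>L\<^esub>)) = ?F x c"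
      using c x by (simp add: lp_hU_J0 M0_runit_JF[OF X] lp_scalar[OF X] module.smult_closed[OF mod_L] lp_closed[OF X])
    moreover have "tsum ?A ?F (hp X hU x c) = ?F x c"
      by (rule htsum_pure[OF X hmod_hU modXL[OF X]]) (use c x in \<open>simp_all add: lin_scalar[OF X]\<close>)
    ultimately show "runit M0 (ob X) (JF X hU (lp X x \<one>\<^bsub>L\<^esub>) (lp hU c \<one>\<^bsub>L\<^esub>)) = tsum ?A ?F (hp X hU x c)" by simp
  qed
  finally show ?thesis .
qed

text \<open>Injectivity on objects is immediate because an object of the full subcategory is a pair
  that records X. Every structure map of the dynamization is given as a \<open>gen_res\<close>, so
  \<open>gen_res_hom\<close> yields its typing and \<open>Fm_gen_res\<close> its image.\<close>

lemma transport_M0: "monoidal_transport DY M0 (\<lambda>X. ob X) (Xi_mor K H L)"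
proof (intro monoidal_transport.intro monoidal_category_M0 monoidal_transport_axioms.intro, goal_cases)
  case 1 show ?case by (auto simp: bij_betw_def inj_on_def DY_simps M0_simps(1))
qed (auto simp: DY_simps M0_simps(1,2,5,6) Fm_bij DY_ident DY_comp DY_tmor DY_assoc DY_lunit DY_runit
    hmod_ht hmod_hU M0_ident_hom M0_comp_hom M0_tmor_hom M0_assoc_hom M0_lunit_hom M0_runit_hom
    Fm_hom Fm_gen_res gen_res_hom)

end

theorem theorem7p2:
  fixes K :: "'a univ ring" and H :: "'a univ hopf" and L :: "'a univ base_alg"
  assumes "ground_ring K"
    and "hopf_algebra K H" and "invertible_antipode H"
    and "base_algebra K H L"
  shows "bialgebroid K L (smash K H L) \<and>
    monoidal_category (BMod L (smash K H L)) \<and>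
    identification (BMod L (smash K H L)) {X. left_module H X}
      (Xi_obj K H L) (htensor K H) (hunit K H) (Xi_ident K H L) (Xi_ident_unit K H L) \<and>
    monoidal_isomorphism (dynamization K H L) (Mod_0 K H L)
      (\<lambda>X. (X, Xi_obj K H L X)) (Xi_mor K H L)"
proof -
  interpret hopf_base K H L
    using assms by (intro hopf_base.intro) (simp_all add: ground_ring_def)
  interpret monoidal_transport "dynamization K H L" "Mod_0 K H L" "\<lambda>X. (X, Xi_obj K H L X)" "Xi_mor K H L"
    by (rule transport_M0)
  show ?thesis
    using bialgebroid_smash pb.monoidal_category_BMod identification_Xi monoidal_isomorphism_axioms by blast
qed

end
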